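(* Let $(X,\sigma)\in\mathsf{LHomeo}$, let $(F,D)$ be an $l$-diagram for $(X,\sigma)$, and let $\{(X_n,\sigma_n),\psi_{n,m}\}$ be the associated inverse system of generalized finite shifts, so that $(X,\sigma)\cong\varprojlim(X_n,\sigma_n)$. Then, for every field with involution $(K,* )$, $$A_K(\mathcal G(X,\sigma))\cong\varinjlim A_K(\mathcal G(X_n,\sigma_n))$$ as $*$-algebras, where the colimit is taken along the connecting $*$-homomorphisms $\psi_{n,n+1}^*$. At the level of $C^*$-algebras, also $$C^*(\mathcal G(X,\sigma))\cong\varinjlim C^*(\mathcal G(X_n,\sigma_n)),$$ the colimit being taken in the category of $C^*$-algebras along the $*$-homomorphisms induced by $\psi_{n,n+1}$.
   Context: $\mathsf{LHomeo}$: pairs $(X,\sigma)$ with $X$ a nonempty totally disconnected compact metrizable space and $\sigma:X\to X$ a surjective local homeomorphism. **Groupoid algebras.** The Deaconu-Renault groupoid is $\mathcal G(X,\sigma)=\bigcup_{m,n\ge0}\{(x,m-n,y)\mid x,y\in X,\ \sigma^m(x)=\sigma^n(y)\}$, with $(x,p,y)(y,q,z)=(x,p+q,z)$, $(x,p,y)^{-1}=(y,-p,x)$, $r(x,p,y)=x$, $s(x,p,y)=y$, and topology with basis the sets $Z(U,m,n,V)=\{(x,m-n,y)\mid x\in U,y\in V,\sigma^m(x)=\sigma^n(y)\}$, $U,V\subseteq X$ open. It is an ample Hausdorff second countable groupoid. For such a groupoid $\mathcal G$, the Steinberg algebra $A_K(\mathcal G)$ is the $*$-algebra of locally constant compactly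 supported functions $\mathcal G\to K$ with convolution $(f*g)(\gamma)=\sum_{s(\alpha)=s(\gamma)}f(\gamma\alpha^{-1})g(\alpha)$ and involution $f^*(\gamma)=f(\gamma^{-1})^*$; $C^*(\mathcal G)$ is the full groupoid $C^*$-algebra, i.e. the enveloping $C^*$-algebra of $A_{\mathbb C}(\mathcal G)$. **Separated graphs and $l$-diagrams.** A separated graph $(E,C)$ is a directed graph $E=(E^0,E^1,r,s)$ with $C=\bigsqcup_vC_v$, $C_v$ a partition of $r^{-1}(v)$ into nonempty subsets. A separated Bratteli diagram is a separated graph $(F,D)$ with $F^0=\bigsqcup_{j\ge0}F^{0,j}$, $F^1=\bigsqcup_{j\ge0}F^{1,j}$, all these sets finite nonempty, $r(F^{1,j})=F^{0,j}$, $s(F^{1,j})=F^{0,j+1}$. It is an $l$-diagram if: (a) For $v\in F^{0,2j}$, $j\ge0$: $D_v=\{B_v,R_v\}$, nonempty sets of blue, resp. red, edges. (b) For $v\in F^{0,2j-1}$, $j\ge1$: $D_v=\{B_v\}\cup\{R(f)\mid f\in R_{r(f)},s(f)=v\}$, with $B_v,R(f)\subseteq r^{-1}(v)$ nonempty; elements of $B_v$ are blue, elements of $R_v:=\bigcup_fR(f)$ are red. (c) For $j\ge1$: $F^{0,2j}=\bigsqcup_{v\in F^{0,2j-1}}s(B_v)=\bigsqcup_{v\in F^{0,2j-1}}s(R_v)$, and for $v\in F^{0,2j-1}$ distinct edges of $B_v$ (resp. of $R_v$) have distinct sources. (d) $F^{0,1}=\bigsqcup_{v\in F^{0,0}}s(B_v)=\bigcup_{v\in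 F^{0,0}}s(R_v)$; and distinct blue edges with ranges in $F^{0,2j}$ have distinct sources ($j\ge0$). (e) For $v\in F^{0,2j}$: $\bigsqcup_{e\in B_v}s(B_{s(e)})=\bigsqcup_{f\in R_v}s(R(f))$. (f) For $j\ge1$, $v\in F^{0,2j-1}$ and red $(f_0,f_1)$ with $r(f_0)=v$, $s(f_0)=r(f_1)$ there is a (unique) blue pair $(e_0,e_1)$ with $r(e_0)=v$, $s(e_0)=r(e_1)$, $s(e_1)=s(f_1)$. (g) For $j\ge1$, $v\in F^{0,2j-1}$, red $g$ with $s(g)=v$, and blue $(e_0,e_1)$ with $r(e_0)=v$, $s(e_0)=r(e_1)$ there is a unique red pair $(f_0,f_1)$ with $f_0\in R(g)$, $r(f_0)=v$, $s(f_0)=r(f_1)$, $s(f_1)=s(e_1)$. **System of an $l$-diagram.** For an $l$-diagram $(F,D)$ let $X_F$ be the space of sequences $(e_0,e_1,\dots)$ of blue edges $e_i\in F^{1,i}$ with $r(e_{i+1})=s(e_i)$, with topology generated by the cylinder sets $Z(e_0,\dots,e_n)$. For blue $e_0\in F^{1,2j}$, $e_1$ with $r(e_1)=s(e_0)$ there is a unique red pair $(f_0,f_1)$ with $r(f_0)=r(e_0)$, $r(f_1)=s(f_0)$, $s(f_1)=s(e_1)$, $f_1\in R(f_0)$. Given $(e_i)\in X_F$, let $(f_{2j},f_{2j+1})$ be the red pair so associated to $(e_{2j},e_{2j+1})$ ($j\ge0$), $(e'_{2j-1},e'_{2j})$ the blue pair associated by (f) to $(f_{2j-1},f_{2j})$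 ($j\ge1$), $e'_0$ the unique blue edge with $s(e_0')=r(e_1')$, and $\sigma_F(e_0,e_1,\dots)=(e'_0,e'_1,\dots)$. Then $(X_F,\sigma_F)\in\mathsf{LHomeo}$. "$(F,D)$ is an $l$-diagram for $(X,\sigma)$" means that $(X_F,\sigma_F)$ is topologically conjugate to $(X,\sigma)$ (such an $l$-diagram always exists). **Generalized finite shifts.** A generalized finite shift graph is a finite separated graph $(E,C)$ with $E^0=E^{0,0}\sqcup E^{0,1}$, $s(E^1)=E^{0,1}$, $r(E^1)=E^{0,0}$, $C_v=\{B_v,R_v\}$ (nonempty sets of blue, red edges) for $v\in E^{0,0}$, $E^{0,1}=\bigsqcup_vs(B_v)=\bigcup_vs(R_v)$, and distinct edges of $B_v$ have distinct sources. The 1-step resolution of a finite bipartite separated graph $(E,C)$ with $C_u=\{X_1^u,\dots,X^u_{k_u}\}$ has $E_1^{0,0}=E^{0,1}$, $E_1^{0,1}=\{v(x_1,\dots,x_{k_u})\mid u\in E^{0,0},x_j\in X_j^u\}$, edges $\alpha^{x_i}(x_1,\dots,\widehat{x_i},\dots,x_{k_u})$ with range $s(x_i)$ and source $v(x_1,\dots,x_{k_u})$, and $C^1_v=\{X(x)\mid x\in s^{-1}(v)\}$, $X(x_i)=\{\alpha^{x_i}(x_1,\dots,\widehat{x_i},\dots,x_{k_u})\mid x_j\in X^u_j,j\ne i\}$. Iterating from $(E_0,C^0)=(E,C)$, the canonical resolution is $\bigcup_n(E_n,C^n)$ with $n$-th vertex level $E_n^{0,0}$ and $n$-th edge level $E_n^1$;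 edges of $X(x)$ get the colour of $x$, and $R(f)=X(f)$ for red $f$ at even levels. It is an $l$-diagram, and its system is the generalized finite shift of $(E,C)$. **$(E,C)$-structures.** An $(E,C)$-structure on $(Y,\rho)\in\mathsf{LHomeo}$ consists of nonempty compact open sets $Z_e$ ($e$ blue) and $W_f$ ($f$ red) with $Y=\bigsqcup_eZ_e$, $\bigsqcup_{e\in B_v}Z_e=\bigsqcup_{f\in R_v}W_f$ for all $v\in E^{0,0}$, $\rho|_{W_f}$ injective and $\rho(W_f)=Z_e$, where $e$ is the unique blue edge with $s(e)=s(f)$. The system of any $l$-diagram with first layer $(E,C)$ has the natural structure: $Z_e$ = sequences starting with $e$; $W_f$ = sequences $(e_0,e_1,\dots)$ such that the red pair $(f_0,f_1)$ associated to $(e_0,e_1)$ has $f_0=f$. For each $(E,C)$-structure on $(Y,\rho)$ there is a unique continuous equivariant map from $Y$ to the generalized finite shift of $(E,C)$ that maps each $Z_e$, $W_f$ into the corresponding natural set. **The inverse system.** Let $(E(n),C(n))$ be the layer $(F^{0,2n}\cup F^{0,2n+1},F^{1,2n})$ of $(F,D)$ with the inherited separation; it is a generalized finite shift graph. Let $(F(n),D(n))$ be its canonical resolution and $(X_n,\sigma_n)$ its generalized finite shift. The $l$-diagram $G$ whose first two layers are layers $2n$ and $2n+1$ of $(F,D)$ and whose layer $k\ge2$ is layer $k-2$ of $(F(n+1),D(n+1))$ has system conjugate to $(X_{n+1},\sigma_{n+1})$ by deleting the first two edges of sequences, so $X_{n+1}$ carries an $(E(n),C(n))$-structure; $\psi_{n,n+1}:X_{n+1}\to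 X_n$ is the resulting unique equivariant map, and $\psi_{n,m}$ are the compositions. **Connecting maps.** $\psi_{n,n+1}^*(f)=f\circ(\psi_{n,n+1})_*$, with $(\psi_{n,n+1})_*(x,k,y)=(\psi_{n,n+1}(x),k,\psi_{n,n+1}(y))$; this is a $*$-homomorphism $A_K(\mathcal G(X_n,\sigma_n))\to A_K(\mathcal G(X_{n+1},\sigma_{n+1}))$ and, for $K=\mathbb C$, it induces a $*$-homomorphism $C^*(\mathcal G(X_n,\sigma_n))\to C^*(\mathcal G(X_{n+1},\sigma_{n+1}))$. *)

theory Defs
  imports "HOL-Analysis.Analysis" "HOL-Library.Disjoint_Sets" "HOL-Library.FSet"
begin

section \<open>Dynamical systems\<close>

definition totally_disconnected_space :: "'a topology \<Rightarrow> bool" where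
  "totally_disconnected_space X \<longleftrightarrow> (\<forall>S. connectedin X S \<longrightarrow> (\<exists>a. S \<subseteq> {a}))"

definition local_homeo :: "'a topology \<Rightarrow> 'b topology \<Rightarrow> ('a \<Rightarrow> 'b) \<Rightarrow> bool" where
  "local_homeo X Y f \<longleftrightarrow>
     (\<forall>x\<in>topspace X. \<exists>U. openin X U \<and> x \<in> U \<and> openin Y (f ` U) \<and>
        homeomorphic_map (subtopology X U) (subtopology Y (f ` U)) f)"

definition lhomeo :: "'a topology \<Rightarrow> ('a \<Rightarrow> 'a) \<Rightarrow> bool" where
  "lhomeo X \<sigma> \<longleftrightarrow>
     topspace X \<noteq> {} \<and> totally_disconnected_space X \<and> compact_space X \<and> metrizable_space X \<and>
     local_homeo X X \<sigma> \<and> \<sigma> ` topspace X = topspace X"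

definition conjugate ::
    "'a topology \<Rightarrow> ('a \<Rightarrow> 'a) \<Rightarrow> 'b topology \<Rightarrow> ('b \<Rightarrow> 'b) \<Rightarrow> bool" where
  "conjugate X \<sigma> Y \<rho> \<longleftrightarrow>
     (\<exists>h. homeomorphic_map X Y h \<and> (\<forall>x\<in>topspace X. h (\<sigma> x) = \<rho> (h x)))"


section \<open>Star-algebras and their sequential direct limits\<close>

record ('k, 'a) star_alg =
  scarrier :: "'a set"
  szero :: 'a
  sadd :: "'a \<Rightarrow> 'a \<Rightarrow> 'a"
  sscale :: "'k \<Rightarrow> 'a \<Rightarrow> 'a"
  smul :: "'a \<Rightarrow> 'a \<Rightarrow> 'a"
  sstar :: "'a \<Rightarrow> 'a"

definition star_isomorphism ::
    "('k, 'a, 'm) star_alg_scheme \<Rightarrow> ('k, 'b, 'n) star_alg_scheme \<Rightarrow> ('a \<Rightarrow> 'b) \<Rightarrow> bool" where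
  "star_isomorphism A B h \<longleftrightarrow>
     bij_betw h (scarrier A) (scarrier B) \<and>
     (\<forall>a\<in>scarrier A. \<forall>b\<in>scarrier A. h (sadd A a b) = sadd B (h a) (h b)) \<and>
     (\<forall>c. \<forall>a\<in>scarrier A. h (sscale A c a) = sscale B c (h a)) \<and>
     (\<forall>a\<in>scarrier A. \<forall>b\<in>scarrier A. h (smul A a b) = smul B (h a) (h b)) \<and>
     (\<forall>a\<in>scarrier A. h (sstar A a) = sstar B (h a))"

definition star_isomorphic ::
    "('k, 'a, 'm) star_alg_scheme \<Rightarrow> ('k, 'b, 'n) star_alg_scheme \<Rightarrow> bool" where
  "star_isomorphic A B \<longleftrightarrow> (\<exists>h. star_isomorphism A B h)"

text \<open>\<open>stage_map \<phi> n k\<close> is the composite connecting map from stage \<open>n\<close> to stage \<open>n + k\<close>.\<close>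

primrec stage_map :: "(nat \<Rightarrow> 'a \<Rightarrow> 'a) \<Rightarrow> nat \<Rightarrow> nat \<Rightarrow> 'a \<Rightarrow> 'a" where
  "stage_map \<phi> n 0 = id"
| "stage_map \<phi> n (Suc k) = \<phi> (n + k) \<circ> stage_map \<phi> n k"

text \<open>The colimit of a sequence of star-algebras, in its standard model: the disjoint union of the carriers, modulo
  eventual equality. The operations are computed on representatives moved to a common stage.\<close>

definition dl_class ::
    "(nat \<Rightarrow> ('k, 'a, 'm) star_alg_scheme) \<Rightarrow> (nat \<Rightarrow> 'a \<Rightarrow> 'a) \<Rightarrow> nat \<Rightarrow> 'a \<Rightarrow> (nat \<times> 'a) set" where
  "dl_class A \<phi> n a =
     {(m, b). b \<in> scarrier (A m) \<and> (\<exists>k l. n + k = m + l \<and> stage_map \<phi> n k a = stage_map \<phi> m l b)}"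

definition star_colimit ::
    "(nat \<Rightarrow> ('k, 'a, 'm) star_alg_scheme) \<Rightarrow> (nat \<Rightarrow> 'a \<Rightarrow> 'a) \<Rightarrow> ('k, (nat \<times> 'a) set) star_alg" where
  "star_colimit A \<phi> =
     \<lparr> scarrier = {dl_class A \<phi> n a | n a. a \<in> scarrier (A n)},
       szero = dl_class A \<phi> 0 (szero (A 0)),
       sadd = (\<lambda>P Q. \<Union>(n, a)\<in>P. \<Union>(m, b)\<in>Q.
                 dl_class A \<phi> (n + m) (sadd (A (n + m)) (stage_map \<phi> n m a) (stage_map \<phi> m n b))),
       sscale = (\<lambda>c P. \<Union>(n, a)\<in>P. dl_class A \<phi> n (sscale (A n) c a)),
       smul = (\<lambda>P Q. \<Union>(n, a)\<in>P. \<Union>(m, b)\<in>Q.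
                 dl_class A \<phi> (n + m) (smul (A (n + m)) (stage_map \<phi> n m a) (stage_map \<phi> m n b))),
       sstar = (\<lambda>P. \<Union>(n, a)\<in>P. dl_class A \<phi> n (sstar (A n) a)) \<rparr>"


section \<open>Completions, enveloping C*-algebras and their sequential direct limits\<close>

record 'a cstar_alg = "(complex, 'a) star_alg" +
  snorm :: "'a \<Rightarrow> real"

text \<open>The isometry requirement is no restriction: a star-isomorphism between C*-algebras is
  automatically isometric.\<close>

definition cstar_isomorphic :: "'a cstar_alg \<Rightarrow> 'b cstar_alg \<Rightarrow> bool" where
  "cstar_isomorphic A B \<longleftrightarrow>
     (\<exists>h. star_isomorphism A B h \<and> (\<forall>a\<in>scarrier A. snorm B (h a) = snorm A a))"

definition sdiff :: "(complex, 'a, 'm) star_alg_scheme \<Rightarrow> 'a \<Rightarrow> 'a \<Rightarrow> 'a" where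
  "sdiff A a b = sadd A a (sscale A (-1) b)"

text \<open>The (Hausdorff) completion of a complex star-algebra in a seminorm \<open>p\<close>: Cauchy sequences
  modulo null sequences.\<close>

definition cauchy_seqs ::
    "(complex, 'a, 'm) star_alg_scheme \<Rightarrow> ('a \<Rightarrow> real) \<Rightarrow> (nat \<Rightarrow> 'a) set" where
  "cauchy_seqs A p = {s. (\<forall>n. s n \<in> scarrier A) \<and>
     (\<forall>\<epsilon>>0. \<exists>N. \<forall>m\<ge>N. \<forall>n\<ge>N. p (sdiff A (s m) (s n)) < \<epsilon>)}"

definition completion_class ::
    "(complex, 'a, 'm) star_alg_scheme \<Rightarrow> ('a \<Rightarrow> real) \<Rightarrow> (nat \<Rightarrow> 'a) \<Rightarrow> (nat \<Rightarrow> 'a) set" where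
  "completion_class A p s = {t \<in> cauchy_seqs A p. (\<lambda>n. p (sdiff A (s n) (t n))) \<longlonglongrightarrow> 0}"

definition completion ::
    "(complex, 'a, 'm) star_alg_scheme \<Rightarrow> ('a \<Rightarrow> real) \<Rightarrow> (nat \<Rightarrow> 'a) set cstar_alg" where
  "completion A p =
     \<lparr> scarrier = completion_class A p ` cauchy_seqs A p,
       szero = completion_class A p (\<lambda>_. szero A),
       sadd = (\<lambda>P Q. \<Union>s\<in>P. \<Union>t\<in>Q. completion_class A p (\<lambda>n. sadd A (s n) (t n))),
       sscale = (\<lambda>c P. \<Union>s\<in>P. completion_class A p (\<lambda>n. sscale A c (s n))),
       smul = (\<lambda>P Q. \<Union>s\<in>P. \<Union>t\<in>Q. completion_class A p (\<lambda>n. smul A (s n) (t n))),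
       sstar = (\<lambda>P. \<Union>s\<in>P. completion_class A p (\<lambda>n. sstar A (s n))),
       snorm = (\<lambda>P. THE c. \<forall>s\<in>P. (\<lambda>n. p (s n)) \<longlonglongrightarrow> c) \<rparr>"

text \<open>C*-seminorms are exactly the functions \<open>a \<mapsto> \<parallel>\<pi> a\<parallel>\<close> for star-homomorphisms \<open>\<pi>\<close> into
  C*-algebras (equivalently, star-representations on Hilbert spaces), so the largest one is the
  norm defining the enveloping C*-algebra.\<close>

definition cstar_seminorm :: "(complex, 'a, 'm) star_alg_scheme \<Rightarrow> ('a \<Rightarrow> real) \<Rightarrow> bool" where
  "cstar_seminorm A p \<longleftrightarrow>
     (\<forall>a\<in>scarrier A. 0 \<le> p a) \<and>
     (\<forall>c. \<forall>a\<in>scarrier A. p (sscale A c a) = cmod c * p a) \<and>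
     (\<forall>a\<in>scarrier A. \<forall>b\<in>scarrier A. p (sadd A a b) \<le> p a + p b) \<and>
     (\<forall>a\<in>scarrier A. \<forall>b\<in>scarrier A. p (smul A a b) \<le> p a * p b) \<and>
     (\<forall>a\<in>scarrier A. p (smul A (sstar A a) a) = (p a)\<^sup>2)"

text \<open>For Steinberg algebras of ample groupoids the supremum is over a bounded set.\<close>

definition env_norm :: "(complex, 'a, 'm) star_alg_scheme \<Rightarrow> 'a \<Rightarrow> real" where
  "env_norm A a = (SUP p\<in>{p. cstar_seminorm A p}. p a)"

definition env_cstar :: "(complex, 'a, 'm) star_alg_scheme \<Rightarrow> (nat \<Rightarrow> 'a) set cstar_alg" where
  "env_cstar A = completion A (env_norm A)"

text \<open>The star-homomorphism between enveloping C*-algebras induced by a star-homomorphism \<open>\<phi>\<close> into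
  \<open>B\<close>.\<close>

definition env_map ::
    "(complex, 'b, 'm) star_alg_scheme \<Rightarrow> ('a \<Rightarrow> 'b) \<Rightarrow> (nat \<Rightarrow> 'a) set \<Rightarrow> (nat \<Rightarrow> 'b) set" where
  "env_map B \<phi> P = (\<Union>s\<in>P. completion_class B (env_norm B) (\<lambda>n. \<phi> (s n)))"

text \<open>The colimit in the category of C*-algebras, in its standard model: the completion of the algebraic colimit in the
  C*-seminorm which sends the class of \<open>a\<close> at stage \<open>n\<close> to the limit of the (decreasing) norms of
  the images of \<open>a\<close> at the later stages.\<close>

definition colimit_norm ::
    "(nat \<Rightarrow> 'a cstar_alg) \<Rightarrow> (nat \<Rightarrow> 'a \<Rightarrow> 'a) \<Rightarrow> (nat \<times> 'a) set \<Rightarrow> real" where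
  "colimit_norm A \<phi> P =
     (THE c. \<forall>(n, a)\<in>P. (\<lambda>k. snorm (A (n + k)) (stage_map \<phi> n k a)) \<longlonglongrightarrow> c)"

definition cstar_colimit ::
    "(nat \<Rightarrow> 'a cstar_alg) \<Rightarrow> (nat \<Rightarrow> 'a \<Rightarrow> 'a) \<Rightarrow> (nat \<Rightarrow> (nat \<times> 'a) set) set cstar_alg" where
  "cstar_colimit A \<phi> = completion (star_colimit A \<phi>) (colimit_norm A \<phi>)"


section \<open>Groupoids and Steinberg algebras\<close>

text \<open>The set of arrows is the underlying set of the topology; \<open>'x\<close> is the type of units.\<close>

record ('g, 'x) top_groupoid =
  gtop :: "'g topology"
  grange :: "'g \<Rightarrow> 'x"
  gsource :: "'g \<Rightarrow> 'x"
  gmult :: "'g \<Rightarrow> 'g \<Rightarrow> 'g"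
  ginv :: "'g \<Rightarrow> 'g"

definition dr_basic ::
    "'a topology \<Rightarrow> ('a \<Rightarrow> 'a) \<Rightarrow> 'a set \<Rightarrow> nat \<Rightarrow> nat \<Rightarrow> 'a set \<Rightarrow> ('a \<times> int \<times> 'a) set" where
  "dr_basic X \<sigma> U m n V =
     {(x, int m - int n, y) | x y. x \<in> U \<and> y \<in> V \<and> (\<sigma> ^^ m) x = (\<sigma> ^^ n) y}"

definition dr_groupoid ::
    "'a topology \<Rightarrow> ('a \<Rightarrow> 'a) \<Rightarrow> ('a \<times> int \<times> 'a, 'a) top_groupoid" where
  "dr_groupoid X \<sigma> =
     \<lparr> gtop = topology_generated_by {dr_basic X \<sigma> U m n V | U m n V. openin X U \<and> openin X V},
       grange = (\<lambda>(x, p, y). x),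
       gsource = (\<lambda>(x, p, y). y),
       gmult = (\<lambda>(x, p, y) (y', q, z). (x, p + q, z)),
       ginv = (\<lambda>(x, p, y). (y, - p, x)) \<rparr>"

definition field_involution :: "('k::field \<Rightarrow> 'k) \<Rightarrow> bool" where
  "field_involution j \<longleftrightarrow>
     (\<forall>a b. j (a + b) = j a + j b) \<and> (\<forall>a b. j (a * b) = j a * j b) \<and> (\<forall>a. j (j a) = a)"

text \<open>Functions on the groupoid are represented by functions on the ambient type which vanish off
  the set of arrows.\<close>

definition steinberg_carrier :: "('g, 'x) top_groupoid \<Rightarrow> ('g \<Rightarrow> 'k::field) set" where
  "steinberg_carrier G =
     {f. (\<forall>\<gamma>. \<gamma> \<notin> topspace (gtop G) \<longrightarrow> f \<gamma> = 0) \<and>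
         (\<forall>\<gamma>\<in>topspace (gtop G). \<exists>U. openin (gtop G) U \<and> \<gamma> \<in> U \<and> (\<forall>\<delta>\<in>U. f \<delta> = f \<gamma>)) \<and>
         compactin (gtop G) (gtop G closure_of {\<gamma> \<in> topspace (gtop G). f \<gamma> \<noteq> 0})}"

text \<open>The convolution sum ranges over the nonzero terms only, of which there are finitely many.\<close>

definition convolution ::
    "('g, 'x) top_groupoid \<Rightarrow> ('g \<Rightarrow> 'k::field) \<Rightarrow> ('g \<Rightarrow> 'k) \<Rightarrow> 'g \<Rightarrow> 'k" where
  "convolution G f g \<gamma> =
     (if \<gamma> \<in> topspace (gtop G)
      then \<Sum>\<alpha> | \<alpha> \<in> topspace (gtop G) \<and> gsource G \<alpha> = gsource G \<gamma> \<and>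
                 f (gmult G \<gamma> (ginv G \<alpha>)) * g \<alpha> \<noteq> 0.
             f (gmult G \<gamma> (ginv G \<alpha>)) * g \<alpha>
      else 0)"

definition steinberg ::
    "('k \<Rightarrow> 'k) \<Rightarrow> ('g, 'x) top_groupoid \<Rightarrow> ('k::field, 'g \<Rightarrow> 'k) star_alg" where
  "steinberg j G =
     \<lparr> scarrier = steinberg_carrier G,
       szero = (\<lambda>_. 0),
       sadd = (\<lambda>f g \<gamma>. f \<gamma> + g \<gamma>),
       sscale = (\<lambda>c f \<gamma>. c * f \<gamma>),
       smul = convolution G,
       sstar = (\<lambda>f \<gamma>. if \<gamma> \<in> topspace (gtop G) then j (f (ginv G \<gamma>)) else 0) \<rparr>"

definition groupoid_cstar ::
    "('g, 'x) top_groupoid \<Rightarrow> (nat \<Rightarrow> 'g \<Rightarrow> complex) set cstar_alg" where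
  "groupoid_cstar G = env_cstar (steinberg cnj G)"


section \<open>Separated Bratteli diagrams and l-diagrams\<close>

text \<open>A separated Bratteli diagram together with a colouring of the edges (edges which are not blue
  are red) and, for red edges \<open>f\<close> of even layers, the set \<open>R(f)\<close> (the field \<open>dR\<close>).\<close>

record ('v, 'e) diagram =
  dvert :: "nat \<Rightarrow> 'v set"
  dedge :: "nat \<Rightarrow> 'e set"
  dsrc :: "'e \<Rightarrow> 'v"
  drng :: "'e \<Rightarrow> 'v"
  dsep :: "'v \<Rightarrow> 'e set set"
  dblue :: "'e set"
  dR :: "'e \<Rightarrow> 'e set"

definition dedges :: "('v, 'e) diagram \<Rightarrow> 'e set" where
  "dedges F = (\<Union>j. dedge F j)"

definition B_at :: "('v, 'e) diagram \<Rightarrow> 'v \<Rightarrow> 'e set" where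
  "B_at F v = {e \<in> dedges F. drng F e = v \<and> e \<in> dblue F}"

definition R_at :: "('v, 'e) diagram \<Rightarrow> 'v \<Rightarrow> 'e set" where
  "R_at F v = {e \<in> dedges F. drng F e = v \<and> e \<notin> dblue F}"

definition separated_bratteli :: "('v, 'e) diagram \<Rightarrow> bool" where
  "separated_bratteli F \<longleftrightarrow>
     disjoint_family (dvert F) \<and> disjoint_family (dedge F) \<and>
     (\<forall>j. finite (dvert F j) \<and> dvert F j \<noteq> {} \<and> finite (dedge F j) \<and> dedge F j \<noteq> {} \<and>
          drng F ` dedge F j = dvert F j \<and> dsrc F ` dedge F j = dvert F (Suc j)) \<and>
     (\<forall>j. \<forall>v\<in>dvert F j. partition_on {e \<in> dedges F. drng F e = v} (dsep F v))"

text \<open>Nonemptiness of \<open>B_v\<close>, \<open>R_v\<close> and \<open>R(f)\<close> in (a) and (b) is part of \<^const>\<open>partition_on\<close>. Odd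
  levels \<open>2j - 1\<close>, \<open>j \<ge> 1\<close>, are written \<open>2j + 1\<close>, \<open>j \<ge> 0\<close>.\<close>

definition l_cond_a :: "('v, 'e) diagram \<Rightarrow> bool" where
  "l_cond_a F \<longleftrightarrow> (\<forall>j. \<forall>v\<in>dvert F (2*j). dsep F v = {B_at F v, R_at F v})"

definition l_cond_b :: "('v, 'e) diagram \<Rightarrow> bool" where
  "l_cond_b F \<longleftrightarrow> (\<forall>j. \<forall>v\<in>dvert F (2*j+1).
     dsep F v = {B_at F v} \<union> dR F ` {f \<in> dedge F (2*j) - dblue F. dsrc F f = v} \<and>
     R_at F v = \<Union> (dR F ` {f \<in> dedge F (2*j) - dblue F. dsrc F f = v}))"

definition l_cond_c :: "('v, 'e) diagram \<Rightarrow> bool" where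
  "l_cond_c F \<longleftrightarrow> (\<forall>j.
     disjoint_family_on (\<lambda>v. dsrc F ` B_at F v) (dvert F (2*j+1)) \<and>
     dvert F (2*j+2) = (\<Union>v\<in>dvert F (2*j+1). dsrc F ` B_at F v) \<and>
     disjoint_family_on (\<lambda>v. dsrc F ` R_at F v) (dvert F (2*j+1)) \<and>
     dvert F (2*j+2) = (\<Union>v\<in>dvert F (2*j+1). dsrc F ` R_at F v) \<and>
     (\<forall>v\<in>dvert F (2*j+1). inj_on (dsrc F) (B_at F v) \<and> inj_on (dsrc F) (R_at F v)))"

definition l_cond_d :: "('v, 'e) diagram \<Rightarrow> bool" where
  "l_cond_d F \<longleftrightarrow>
     disjoint_family_on (\<lambda>v. dsrc F ` B_at F v) (dvert F 0) \<and>
     dvert F 1 = (\<Union>v\<in>dvert F 0. dsrc F ` B_at F v) \<and>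
     dvert F 1 = (\<Union>v\<in>dvert F 0. dsrc F ` R_at F v) \<and>
     (\<forall>j. inj_on (dsrc F) (dedge F (2*j) \<inter> dblue F))"

definition l_cond_e :: "('v, 'e) diagram \<Rightarrow> bool" where
  "l_cond_e F \<longleftrightarrow> (\<forall>j. \<forall>v\<in>dvert F (2*j).
     disjoint_family_on (\<lambda>e. dsrc F ` B_at F (dsrc F e)) (B_at F v) \<and>
     disjoint_family_on (\<lambda>f. dsrc F ` dR F f) (R_at F v) \<and>
     (\<Union>e\<in>B_at F v. dsrc F ` B_at F (dsrc F e)) = (\<Union>f\<in>R_at F v. dsrc F ` dR F f))"

definition l_cond_f :: "('v, 'e) diagram \<Rightarrow> bool" where
  "l_cond_f F \<longleftrightarrow> (\<forall>j. \<forall>v\<in>dvert F (2*j+1). \<forall>f0\<in>R_at F v. \<forall>f1\<in>R_at F (dsrc F f0).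
     \<exists>!(e0, e1). e0 \<in> B_at F v \<and> e1 \<in> B_at F (dsrc F e0) \<and> dsrc F e1 = dsrc F f1)"

definition l_cond_g :: "('v, 'e) diagram \<Rightarrow> bool" where
  "l_cond_g F \<longleftrightarrow> (\<forall>j. \<forall>v\<in>dvert F (2*j+1). \<forall>g\<in>dedge F (2*j) - dblue F. dsrc F g = v \<longrightarrow>
     (\<forall>e0\<in>B_at F v. \<forall>e1\<in>B_at F (dsrc F e0).
        \<exists>!(f0, f1). f0 \<in> dR F g \<and> f0 \<in> R_at F v \<and> f1 \<in> R_at F (dsrc F f0) \<and>
                    dsrc F f1 = dsrc F e1))"

definition l_diagram :: "('v, 'e) diagram \<Rightarrow> bool" where
  "l_diagram F \<longleftrightarrow> separated_bratteli F \<and> l_cond_a F \<and> l_cond_b F \<and> l_cond_c F \<and> l_cond_d F \<and>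
     l_cond_e F \<and> l_cond_f F \<and> l_cond_g F"


section \<open>The system of an l-diagram\<close>

definition paths :: "('v, 'e) diagram \<Rightarrow> (nat \<Rightarrow> 'e) set" where
  "paths F = {x. \<forall>i. x i \<in> dedge F i \<and> x i \<in> dblue F \<and> drng F (x (Suc i)) = dsrc F (x i)}"

definition path_space :: "('v, 'e) diagram \<Rightarrow> (nat \<Rightarrow> 'e) topology" where
  "path_space F = topology_generated_by {{x \<in> paths F. \<forall>i\<le>n. x i = e i} | e n. True}"

definition red_pair :: "('v, 'e) diagram \<Rightarrow> 'e \<Rightarrow> 'e \<Rightarrow> 'e \<times> 'e" where
  "red_pair F e0 e1 =
     (THE (f0, f1). f0 \<in> R_at F (drng F e0) \<and> f1 \<in> R_at F (dsrc F f0) \<and>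
                    dsrc F f1 = dsrc F e1 \<and> f1 \<in> dR F f0)"

definition blue_pair :: "('v, 'e) diagram \<Rightarrow> 'e \<Rightarrow> 'e \<Rightarrow> 'e \<times> 'e" where
  "blue_pair F f0 f1 =
     (THE (e0, e1). e0 \<in> B_at F (drng F f0) \<and> e1 \<in> B_at F (dsrc F e0) \<and> dsrc F e1 = dsrc F f1)"

text \<open>The sequence \<open>f_0, f_1, \<dots>\<close> of red edges associated to a path.\<close>

definition red_seq :: "('v, 'e) diagram \<Rightarrow> (nat \<Rightarrow> 'e) \<Rightarrow> nat \<Rightarrow> 'e" where
  "red_seq F x i =
     (if even i then fst (red_pair F (x i) (x (i + 1))) else snd (red_pair F (x (i - 1)) (x i)))"

definition path_shift :: "('v, 'e) diagram \<Rightarrow> (nat \<Rightarrow> 'e) \<Rightarrow> nat \<Rightarrow> 'e" where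
  "path_shift F x i =
     (if i = 0 then
        (THE e. e \<in> dedge F 0 \<and> e \<in> dblue F \<and>
                dsrc F e = drng F (fst (blue_pair F (red_seq F x 1) (red_seq F x 2))))
      else if odd i then fst (blue_pair F (red_seq F x i) (red_seq F x (i + 1)))
      else snd (blue_pair F (red_seq F x (i - 1)) (red_seq F x i)))"

definition l_diagram_for :: "('v, 'e) diagram \<Rightarrow> 'a topology \<Rightarrow> ('a \<Rightarrow> 'a) \<Rightarrow> bool" where
  "l_diagram_for F X \<sigma> \<longleftrightarrow> l_diagram F \<and> conjugate (path_space F) (path_shift F) X \<sigma>"

text \<open>The sets of the natural structure of the system over the first layer of the diagram.\<close>

definition natural_Z :: "('v, 'e) diagram \<Rightarrow> 'e \<Rightarrow> (nat \<Rightarrow> 'e) set" where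
  "natural_Z F e = {x \<in> paths F. x 0 = e}"

definition natural_W :: "('v, 'e) diagram \<Rightarrow> 'e \<Rightarrow> (nat \<Rightarrow> 'e) set" where
  "natural_W F f = {x \<in> paths F. fst (red_pair F (x 0) (x 1)) = f}"


section \<open>Canonical resolutions\<close>

text \<open>Edges and vertices of all the graphs \<open>(E_n, C^n)\<close> of a canonical resolution. A family
  \<open>(x_1, \<dots>, x_k)\<close> with \<open>x_j \<in> X_j\<^sup>u\<close> is encoded as the finite set \<open>S = {x_1, \<dots>, x_k}\<close>, which loses
  nothing since the \<open>X_j\<^sup>u\<close> are pairwise disjoint. \<open>Fam S\<close> is the vertex \<open>v(x_1, \<dots>, x_k)\<close>, and
  \<open>Alpha x_i S\<close> is the edge \<open>\<alpha>\<close> with superscript \<open>x_i\<close> and arguments the remaining \<open>x_j\<close>.\<close>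

datatype 'e redge = Init 'e | Alpha "'e redge" "'e redge fset"

datatype ('v, 'e) rvert = Base 'v | Fam "'e redge fset"

record ('v, 'e) bip_graph =
  bvert0 :: "'v set"
  bvert1 :: "'v set"
  bedge :: "'e set"
  bsrc :: "'e \<Rightarrow> 'v"
  brng :: "'e \<Rightarrow> 'v"
  bsep :: "'v \<Rightarrow> 'e set set"
  bblue :: "'e set"

type_synonym ('v, 'e) res_graph = "(('v, 'e) rvert, 'e redge) bip_graph"
type_synonym ('v, 'e) res_diagram = "(('v, 'e) rvert, 'e redge) diagram"

definition family :: "('v, 'e) res_graph \<Rightarrow> 'e redge fset \<Rightarrow> bool" where
  "family G S \<longleftrightarrow> (\<exists>u\<in>bvert0 G. fset S \<subseteq> {x \<in> bedge G. brng G x = u} \<and>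
                              (\<forall>Y\<in>bsep G u. \<exists>!x. x \<in> Y \<and> x |\<in>| S))"

definition block :: "('v, 'e) res_graph \<Rightarrow> 'e redge \<Rightarrow> 'e redge set" where
  "block G x = {Alpha x S | S. family G S \<and> x |\<in>| S}"

definition resolve :: "('v, 'e) res_graph \<Rightarrow> ('v, 'e) res_graph" where
  "resolve G =
     \<lparr> bvert0 = bvert1 G,
       bvert1 = {Fam S | S. family G S},
       bedge = (\<Union>x\<in>bedge G. block G x),
       bsrc = (\<lambda>a. case a of Alpha x S \<Rightarrow> Fam S | Init _ \<Rightarrow> undefined),
       brng = (\<lambda>a. case a of Alpha x S \<Rightarrow> bsrc G x | Init _ \<Rightarrow> undefined),
       bsep = (\<lambda>v. block G ` {x \<in> bedge G. bsrc G x = v}),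
       bblue = (\<Union>x\<in>bedge G \<inter> bblue G. block G x) \<rparr>"

definition edge_level :: "('v, 'e) res_graph \<Rightarrow> 'e redge \<Rightarrow> nat" where
  "edge_level G a = (THE n. a \<in> bedge ((resolve ^^ n) G))"

definition vert_level :: "('v, 'e) res_graph \<Rightarrow> ('v, 'e) rvert \<Rightarrow> nat" where
  "vert_level G v = (THE n. v \<in> bvert0 ((resolve ^^ n) G))"

definition resolution :: "('v, 'e) res_graph \<Rightarrow> ('v, 'e) res_diagram" where
  "resolution G =
     \<lparr> dvert = (\<lambda>n. bvert0 ((resolve ^^ n) G)),
       dedge = (\<lambda>n. bedge ((resolve ^^ n) G)),
       dsrc = (\<lambda>a. bsrc ((resolve ^^ edge_level G a) G) a),
       drng = (\<lambda>a. brng ((resolve ^^ edge_level G a) G) a),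
       dsep = (\<lambda>v. bsep ((resolve ^^ vert_level G v) G) v),
       dblue = (\<Union>n. bedge ((resolve ^^ n) G) \<inter> bblue ((resolve ^^ n) G)),
       dR = (\<lambda>f. block ((resolve ^^ edge_level G f) G) f) \<rparr>"


section \<open>The inverse system of generalized finite shifts of an l-diagram\<close>

text \<open>\<open>E(n)\<close> with the separation \<open>C(n)\<close>: layer \<open>2n\<close> of the diagram, as the start of a resolution.\<close>

definition layer_graph :: "('v, 'e) diagram \<Rightarrow> nat \<Rightarrow> ('v, 'e) res_graph" where
  "layer_graph F n =
     \<lparr> bvert0 = Base ` dvert F (2*n),
       bvert1 = Base ` dvert F (2*n+1),
       bedge = Init ` dedge F (2*n),
       bsrc = (\<lambda>a. case a of Init e \<Rightarrow> Base (dsrc F e) | Alpha _ _ \<Rightarrow> undefined),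
       brng = (\<lambda>a. case a of Init e \<Rightarrow> Base (drng F e) | Alpha _ _ \<Rightarrow> undefined),
       bsep = (\<lambda>v. case v of Base w \<Rightarrow> if w \<in> dvert F (2*n) then (`) Init ` dsep F w else {}
                           | Fam _ \<Rightarrow> {}),
       bblue = Init ` (dedge F (2*n) \<inter> dblue F) \<rparr>"

text \<open>\<open>F(n)\<close> with the separation \<open>D(n)\<close>, and its system.\<close>

definition layer_res :: "('v, 'e) diagram \<Rightarrow> nat \<Rightarrow> ('v, 'e) res_diagram" where
  "layer_res F n = resolution (layer_graph F n)"

definition gfs_space :: "('v, 'e) diagram \<Rightarrow> nat \<Rightarrow> (nat \<Rightarrow> 'e redge) topology" where
  "gfs_space F n = path_space (layer_res F n)"

definition gfs_shift :: "('v, 'e) diagram \<Rightarrow> nat \<Rightarrow> (nat \<Rightarrow> 'e redge) \<Rightarrow> nat \<Rightarrow> 'e redge" where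
  "gfs_shift F n = path_shift (layer_res F n)"

text \<open>The l-diagram \<open>G\<close> consisting of layers \<open>2n\<close> and \<open>2n + 1\<close> of \<open>F\<close> followed by \<open>F(n + 1)\<close>.
  The edges \<open>Init e\<close> of its layer 2 come from layer \<open>2n + 2\<close> of \<open>F\<close> and have their source and range
  there.\<close>

definition glued :: "('v, 'e) diagram \<Rightarrow> nat \<Rightarrow> ('v, 'e) res_diagram" where
  "glued F n = (let H = layer_res F (Suc n) in
     \<lparr> dvert = (\<lambda>k. if k < 2 then Base ` dvert F (2*n + k) else dvert H (k - 2)),
       dedge = (\<lambda>k. if k < 2 then Init ` dedge F (2*n + k) else dedge H (k - 2)),
       dsrc = (\<lambda>a. case a of Init e \<Rightarrow> Base (dsrc F e) | Alpha _ _ \<Rightarrow> dsrc H a),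
       drng = (\<lambda>a. case a of Init e \<Rightarrow> Base (drng F e) | Alpha _ _ \<Rightarrow> drng H a),
       dsep = (\<lambda>v. case v of
                 Base w \<Rightarrow> if w \<in> dvert F (2*n) \<union> dvert F (2*n+1) then (`) Init ` dsep F w
                           else dsep H v
               | Fam _ \<Rightarrow> dsep H v),
       dblue = Init ` ((dedge F (2*n) \<union> dedge F (2*n+1)) \<inter> dblue F) \<union> dblue H,
       dR = (\<lambda>f. case f of
               Init e \<Rightarrow> if e \<in> dedge F (2*n) then Init ` dR F e else dR H f
             | Alpha _ _ \<Rightarrow> dR H f) \<rparr>)"

definition delete2 :: "(nat \<Rightarrow> 'a) \<Rightarrow> nat \<Rightarrow> 'a" where
  "delete2 x = (\<lambda>k. x (k + 2))"

text \<open>\<open>\<psi>\<close> from stage \<open>n + 1\<close> to stage \<open>n\<close>: the unique continuous equivariant map compatible with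
  the structures over layer \<open>2n\<close>, that on the domain being transported from \<^const>\<open>glued\<close>.\<close>

definition connecting :: "('v, 'e) diagram \<Rightarrow> nat \<Rightarrow> (nat \<Rightarrow> 'e redge) \<Rightarrow> nat \<Rightarrow> 'e redge" where
  "connecting F n = (THE \<psi>.
     \<psi> \<in> extensional (topspace (gfs_space F (Suc n))) \<and>
     continuous_map (gfs_space F (Suc n)) (gfs_space F n) \<psi> \<and>
     (\<forall>x\<in>topspace (gfs_space F (Suc n)). \<psi> (gfs_shift F (Suc n) x) = gfs_shift F n (\<psi> x)) \<and>
     (\<forall>e\<in>Init ` (dedge F (2*n) \<inter> dblue F).
        \<psi> ` delete2 ` natural_Z (glued F n) e \<subseteq> natural_Z (layer_res F n) e) \<and>
     (\<forall>f\<in>Init ` (dedge F (2*n) - dblue F).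
        \<psi> ` delete2 ` natural_W (glued F n) f \<subseteq> natural_W (layer_res F n) f))"

definition limit_space :: "('v, 'e) diagram \<Rightarrow> (nat \<Rightarrow> nat \<Rightarrow> 'e redge) topology" where
  "limit_space F = subtopology (product_topology (gfs_space F) UNIV)
                     {x. \<forall>n. connecting F n (x (Suc n)) = x n}"

definition limit_shift ::
    "('v, 'e) diagram \<Rightarrow> (nat \<Rightarrow> nat \<Rightarrow> 'e redge) \<Rightarrow> nat \<Rightarrow> nat \<Rightarrow> 'e redge" where
  "limit_shift F x = (\<lambda>n. gfs_shift F n (x n))"

definition gfs_groupoid ::
    "('v, 'e) diagram \<Rightarrow> nat \<Rightarrow>
     ((nat \<Rightarrow> 'e redge) \<times> int \<times> (nat \<Rightarrow> 'e redge), nat \<Rightarrow> 'e redge) top_groupoid" where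
  "gfs_groupoid F n = dr_groupoid (gfs_space F n) (gfs_shift F n)"

definition connecting_star ::
    "('v, 'e) diagram \<Rightarrow> nat \<Rightarrow>
     ((nat \<Rightarrow> 'e redge) \<times> int \<times> (nat \<Rightarrow> 'e redge) \<Rightarrow> 'k::field) \<Rightarrow>
     (nat \<Rightarrow> 'e redge) \<times> int \<times> (nat \<Rightarrow> 'e redge) \<Rightarrow> 'k" where
  "connecting_star F n f =
     (\<lambda>(x, k, y). if (x, k, y) \<in> topspace (gtop (gfs_groupoid F (Suc n)))
                  then f (connecting F n x, k, connecting F n y) else 0)"

definition connecting_cstar ::
    "('v, 'e) diagram \<Rightarrow> nat \<Rightarrow>
     (nat \<Rightarrow> (nat \<Rightarrow> 'e redge) \<times> int \<times> (nat \<Rightarrow> 'e redge) \<Rightarrow> complex) set \<Rightarrow>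
     (nat \<Rightarrow> (nat \<Rightarrow> 'e redge) \<times> int \<times> (nat \<Rightarrow> 'e redge) \<Rightarrow> complex) set" where
  "connecting_cstar F n =
     env_map (steinberg cnj (gfs_groupoid F (Suc n))) (connecting_star F n)"

end

theory Submission
  imports Defs
begin

text \<open>
  Why the theorem holds. Both colimit statements are instances of one principle about a sequence of systems
  \<open>(Y n, \<rho> n)\<close> and equivariant maps \<open>\<psi> n : Y (n + 1) \<rightarrow> Y n\<close> that are bijective on fibres: over \<open>\<psi> n x\<close> every
  \<open>\<rho> n\<close>-preimage has exactly one lift to a preimage of \<open>x\<close> (\<open>fibre_map\<close>). Such a map lifts arrows of the
  Deaconu-Renault groupoid uniquely once the source is lifted, so the intermediate points in a convolution sum
  correspond to each other and pulling back functions is a star-homomorphism (\<open>pullback_hom\<close>). Suppose that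
  \<open>X\<close> is the inverse limit of the \<open>Y n\<close> (\<open>fibred_limit\<close>). By compactness every clopen subset of \<open>X\<close> comes from a
  stage, and the Steinberg algebra is spanned by the indicators of the sets \<open>Z(U, m, n, V)\<close> with \<open>U\<close>, \<open>V\<close> clopen; hence
  every function on the groupoid of \<open>X\<close> is pulled back from a stage (\<open>functions_from_stage\<close>). If a function of
  stage \<open>n\<close> pulls back to zero, then the compact set of ranges of its support misses the image of \<open>X\<close>, and, again by
  compactness, the image of a later stage (\<open>pullback_eventually_zero\<close>). These two facts characterise the algebraic
  colimit (\<open>star_cocone\<close>).

  The statement on C*-algebras follows formally. C*-seminorms on a Steinberg algebra are uniformly bounded at
  each function, because the algebra is spanned by partial isometries (\<open>steinberg_bounded\<close>). The colimit of the
  enveloping norms, pulled back to the Steinberg algebra of \<open>X\<close>, is a C*-seminorm, hence at most the enveloping norm;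
  conversely the enveloping norm of the limit pulls back to a C*-seminorm on each stage. So the two agree
  (\<open>into_colimit_isometric\<close>), and dense isometric subalgebras have isomorphic completions (\<open>completion_isomorphic\<close>).

  It remains to see that an l-diagram yields such an inverse limit. In an l-diagram a path is determined by the
  sources of its edges of even layers, the shift replaces these sources by those of the associated red
  edges, and a red edge lifts uniquely along a path (\<open>red_lift\<close>, which is condition (g)); so the preimages of a path
  \<open>x\<close> correspond to the red edges with the source of a given edge of \<open>x\<close> (\<open>lift_path\<close>, \<open>shift_inj\<close>). This
  is exactly what is recorded by a marking of a system by the edges of layer \<open>2n\<close> (\<open>marked_system\<close>). A marked
  system has a unique equivariant map to the generalized finite shift of the layer that respects the marks, and this
  map is bijective on fibres (\<open>itinerary_fibre_map\<close>, \<open>itinerary_unique\<close>). Condition (g) also makes a marking by layer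
  \<open>2n + 2\<close> into one by layer \<open>2n\<close> (\<open>coarsen_marked\<close>), which identifies the connecting maps (\<open>connecting_eq\<close>) and
  gives compatible projections from the path space. Finally a thread of the system spells out a path of the
  diagram, one even layer at each stage; the threads form a marked system themselves, and uniqueness shows that
  the projections of that path are the given thread (\<open>projection_thread_path\<close>).
\<close>

section \<open>Sequential colimits of star-algebras\<close>

definition star_closed :: "('k, 'a, 'm) star_alg_scheme \<Rightarrow> bool" where
  "star_closed A \<longleftrightarrow>
     (\<forall>a\<in>scarrier A. \<forall>b\<in>scarrier A. sadd A a b \<in> scarrier A \<and> smul A a b \<in> scarrier A) \<and>
     (\<forall>c. \<forall>a\<in>scarrier A. sscale A c a \<in> scarrier A) \<and> (\<forall>a\<in>scarrier A. sstar A a \<in> scarrier A)"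

definition star_hom ::
    "('k, 'a, 'm) star_alg_scheme \<Rightarrow> ('k, 'b, 'n) star_alg_scheme \<Rightarrow> ('a \<Rightarrow> 'b) \<Rightarrow> bool" where
  "star_hom A B \<phi> \<longleftrightarrow> (\<forall>a\<in>scarrier A. \<phi> a \<in> scarrier B) \<and>
     (\<forall>a\<in>scarrier A. \<forall>b\<in>scarrier A. \<phi> (sadd A a b) = sadd B (\<phi> a) (\<phi> b)) \<and>
     (\<forall>c. \<forall>a\<in>scarrier A. \<phi> (sscale A c a) = sscale B c (\<phi> a)) \<and>
     (\<forall>a\<in>scarrier A. \<forall>b\<in>scarrier A. \<phi> (smul A a b) = smul B (\<phi> a) (\<phi> b)) \<and>
     (\<forall>a\<in>scarrier A. \<phi> (sstar A a) = sstar B (\<phi> a))"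

lemma stage_map_add: "stage_map \<phi> (n + k) l (stage_map \<phi> n k a) = stage_map \<phi> n (k + l) a"
  by (induction l) (simp_all add: add.assoc)

locale star_sequence =
  fixes A :: "nat \<Rightarrow> ('k, 'a, 'm) star_alg_scheme" and \<phi> :: "nat \<Rightarrow> 'a \<Rightarrow> 'a"
  assumes closed: "star_closed (A n)" and hom: "star_hom (A n) (A (Suc n)) (\<phi> n)"
begin

lemma closed_ops [simp]:
  "a \<in> scarrier (A n) \<Longrightarrow> b \<in> scarrier (A n) \<Longrightarrow> sadd (A n) a b \<in> scarrier (A n)"
  "a \<in> scarrier (A n) \<Longrightarrow> b \<in> scarrier (A n) \<Longrightarrow> smul (A n) a b \<in> scarrier (A n)"
  "a \<in> scarrier (A n) \<Longrightarrow> sscale (A n) c a \<in> scarrier (A n)"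
  "a \<in> scarrier (A n) \<Longrightarrow> sstar (A n) a \<in> scarrier (A n)"
  using closed[of n] unfolding star_closed_def by auto

lemma stage_map_closed [simp]:
  "a \<in> scarrier (A n) \<Longrightarrow> stage_map \<phi> n k a \<in> scarrier (A (n + k))"
proof (induction k)
  case (Suc k)
  then show ?case using hom[of "n + k"] unfolding star_hom_def by simp
qed simp

lemma stage_map_hom: "star_hom (A n) (A (n + k)) (stage_map \<phi> n k)"
proof (induction k)
  case 0
  then show ?case by (simp add: star_hom_def)
next
  case (Suc k)
  then show ?case using hom[of "n + k"] unfolding star_hom_def by simp
qed

lemma stage_map_ops:
  assumes "a \<in> scarrier (A n)"
  shows "b \<in> scarrier (A n) \<Longrightarrow> stage_map \<phi> n k (sadd (A n) a b) =
      sadd (A (n + k)) (stage_map \<phi> n k a) (stage_map \<phi> n k b)"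
    and "b \<in> scarrier (A n) \<Longrightarrow> stage_map \<phi> n k (smul (A n) a b) =
      smul (A (n + k)) (stage_map \<phi> n k a) (stage_map \<phi> n k b)"
    and "stage_map \<phi> n k (sscale (A n) c a) = sscale (A (n + k)) c (stage_map \<phi> n k a)"
    and "stage_map \<phi> n k (sstar (A n) a) = sstar (A (n + k)) (stage_map \<phi> n k a)"
  using stage_map_hom[of n k] assms unfolding star_hom_def by auto

lemma stage_map_eq_later:
  assumes "n + k = m + l" and "stage_map \<phi> n k a = stage_map \<phi> m l b"
  shows "stage_map \<phi> n (k + i) a = stage_map \<phi> m (l + i) b"
  using assms by (metis stage_map_add)

lemma dl_class_self: "a \<in> scarrier (A n) \<Longrightarrow> (n, a) \<in> dl_class A \<phi> n a"
  unfolding dl_class_def by auto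

lemma dl_class_eq_iff:
  assumes "a \<in> scarrier (A n)" and "b \<in> scarrier (A m)"
  shows "dl_class A \<phi> n a = dl_class A \<phi> m b \<longleftrightarrow>
    (\<exists>k l. n + k = m + l \<and> stage_map \<phi> n k a = stage_map \<phi> m l b)" (is "?L \<longleftrightarrow> ?R")
proof
  assume ?L
  then have "(m, b) \<in> dl_class A \<phi> n a" using dl_class_self[OF assms(2)] by simp
  then show ?R unfolding dl_class_def by auto
next
  have sub: "dl_class A \<phi> n' a' \<subseteq> dl_class A \<phi> m' b'"
    if "n' + k = m' + l" "stage_map \<phi> n' k a' = stage_map \<phi> m' l b'" for n' m' k l a' b'
  proof
    fix z assume "z \<in> dl_class A \<phi> n' a'"
    then obtain r c k' l' where z: "z = (r, c)" "c \<in> scarrier (A r)" "n' + k' = r + l'"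
      "stage_map \<phi> n' k' a' = stage_map \<phi> r l' c" unfolding dl_class_def by auto
    have "stage_map \<phi> m' (l + k') b' = stage_map \<phi> n' (k + k') a'"
      using stage_map_eq_later[OF that] by simp
    also have "\<dots> = stage_map \<phi> r (l' + k) c"
      using stage_map_eq_later[OF z(3,4), of k] by (simp add: add.commute)
    finally have "stage_map \<phi> m' (l + k') b' = stage_map \<phi> r (l' + k) c" .
    moreover have "m' + (l + k') = r + (l' + k)" using z(3) that(1) by simp
    ultimately show "z \<in> dl_class A \<phi> m' b'" unfolding dl_class_def z(1) using z(2) by blast
  qed
  assume ?R
  then obtain k l where "n + k = m + l" "stage_map \<phi> n k a = stage_map \<phi> m l b" by auto
  then show ?L using sub[of n k m l a b] sub[of m l n k b a] by auto
qed

lemma dl_class_stage: "a \<in> scarrier (A n) \<Longrightarrow> dl_class A \<phi> (n + k) (stage_map \<phi> n k a) = dl_class A \<phi> n a"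
  by (subst dl_class_eq_iff) (simp_all, metis add_0_right stage_map.simps(1) id_apply)

lemma dl_class_cases:
  assumes "P \<in> scarrier (star_colimit A \<phi>)"
  obtains n a where "a \<in> scarrier (A n)" "P = dl_class A \<phi> n a"
  using assms unfolding star_colimit_def by auto

lemma dl_class_closed [simp]: "a \<in> scarrier (A n) \<Longrightarrow> dl_class A \<phi> n a \<in> scarrier (star_colimit A \<phi>)"
  unfolding star_colimit_def by auto

lemma dl_class_cases2:
  assumes "P \<in> scarrier (star_colimit A \<phi>)" "Q \<in> scarrier (star_colimit A \<phi>)"
  obtains n a b where "a \<in> scarrier (A n)" "b \<in> scarrier (A n)" "P = dl_class A \<phi> n a" "Q = dl_class A \<phi> n b"
proof -
  obtain n a where 1: "a \<in> scarrier (A n)" "P = dl_class A \<phi> n a" using assms(1) by (rule dl_class_cases)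
  obtain m b where 2: "b \<in> scarrier (A m)" "Q = dl_class A \<phi> m b" using assms(2) by (rule dl_class_cases)
  show ?thesis
    using that[of "stage_map \<phi> n m a" "n + m" "stage_map \<phi> m n b"]
      stage_map_closed[OF 1(1), of m] stage_map_closed[OF 2(1), of n]
      dl_class_stage[OF 1(1), of m] dl_class_stage[OF 2(1), of n] 1(2) 2(2)
    by (simp add: add.commute)
qed

lemma dl_class_cases3:
  assumes "P \<in> scarrier (star_colimit A \<phi>)" "Q \<in> scarrier (star_colimit A \<phi>)"
    "R \<in> scarrier (star_colimit A \<phi>)"
  obtains n a b c where "a \<in> scarrier (A n)" "b \<in> scarrier (A n)" "c \<in> scarrier (A n)"
    "P = dl_class A \<phi> n a" "Q = dl_class A \<phi> n b" "R = dl_class A \<phi> n c"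
proof -
  obtain n a b where 1: "a \<in> scarrier (A n)" "b \<in> scarrier (A n)"
     "P = dl_class A \<phi> n a" "Q = dl_class A \<phi> n b" using assms(1,2) by (rule dl_class_cases2)
  obtain m c where 2: "c \<in> scarrier (A m)" "R = dl_class A \<phi> m c" using assms(3) by (rule dl_class_cases)
  show ?thesis
    using that[of "stage_map \<phi> n m a" "n + m" "stage_map \<phi> n m b" "stage_map \<phi> m n c"]
      stage_map_closed[OF 1(1), of m] stage_map_closed[OF 1(2), of m] stage_map_closed[OF 2(1), of n]
      dl_class_stage[OF 1(1), of m] dl_class_stage[OF 1(2), of m] dl_class_stage[OF 2(1), of n] 1(3,4) 2(2)
    by (simp add: add.commute)
qed

text \<open>Both binary operations of the colimit are unions of the values on all pairs of representatives;
  the values agree because every two representatives agree at some later stage.\<close>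

lemma colimit_binary_op:
  assumes a: "a \<in> scarrier (A n)" and b: "b \<in> scarrier (A n)"
    and cl: "\<And>i x y. x \<in> scarrier (A i) \<Longrightarrow> y \<in> scarrier (A i) \<Longrightarrow> g i x y \<in> scarrier (A i)"
    and st: "\<And>i k x y. x \<in> scarrier (A i) \<Longrightarrow> y \<in> scarrier (A i) \<Longrightarrow>
      stage_map \<phi> i k (g i x y) = g (i + k) (stage_map \<phi> i k x) (stage_map \<phi> i k y)"
  shows "(\<Union>(p, x)\<in>dl_class A \<phi> n a. \<Union>(q, y)\<in>dl_class A \<phi> n b.
      dl_class A \<phi> (p + q) (g (p + q) (stage_map \<phi> p q x) (stage_map \<phi> q p y))) = dl_class A \<phi> n (g n a b)"
proof -
  have eq: "dl_class A \<phi> (p + q) (g (p + q) (stage_map \<phi> p q x) (stage_map \<phi> q p y)) = dl_class A \<phi> n (g n a b)"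
    if px: "(p, x) \<in> dl_class A \<phi> n a" and qy: "(q, y) \<in> dl_class A \<phi> n b" for p q x y
  proof -
    obtain k l where 1: "x \<in> scarrier (A p)" "n + k = p + l" "stage_map \<phi> n k a = stage_map \<phi> p l x"
      using px unfolding dl_class_def by auto
    obtain k' l' where 2: "y \<in> scarrier (A q)" "n + k' = q + l'" "stage_map \<phi> n k' b = stage_map \<phi> q l' y"
      using qy unfolding dl_class_def by auto
    have x: "stage_map \<phi> p q x \<in> scarrier (A (p + q))" and y: "stage_map \<phi> q p y \<in> scarrier (A (p + q))"
      using stage_map_closed[OF 1(1), of q] stage_map_closed[OF 2(1), of p] by (simp_all add: add.commute)
    let ?K = "k + k' + p + q" and ?L = "n + k + k'"
    have N: "n + ?K = p + q + ?L" by simp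
    have e1: "stage_map \<phi> (p + q) ?L (stage_map \<phi> p q x) = stage_map \<phi> n ?K a"
    proof -
      have "q + ?L = l + (k' + p + q)" using 1(2) by simp
      then show ?thesis using stage_map_eq_later[OF 1(2,3), of "k' + p + q"] by (simp add: stage_map_add ac_simps)
    qed
    have e2: "stage_map \<phi> (p + q) ?L (stage_map \<phi> q p y) = stage_map \<phi> n ?K b"
    proof -
      have "p + ?L = l' + (k + p + q)" using 2(2) by simp
      then have "stage_map \<phi> (q + p) ?L (stage_map \<phi> q p y) = stage_map \<phi> q (l' + (k + p + q)) y"
        by (simp only: stage_map_add)
      also have "\<dots> = stage_map \<phi> n (k' + (k + p + q)) b"
        using stage_map_eq_later[OF 2(2,3)] by simp
      finally show ?thesis by (simp add: ac_simps)
    qed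
    show ?thesis
    proof (subst dl_class_eq_iff)
      show "\<exists>i j. p + q + i = n + j \<and>
        stage_map \<phi> (p + q) i (g (p + q) (stage_map \<phi> p q x) (stage_map \<phi> q p y)) = stage_map \<phi> n j (g n a b)"
        by (rule exI[of _ ?L], rule exI[of _ ?K]) (simp only: N[symmetric] e1 e2 st[OF x y] st[OF a b] simp_thms)
    qed (use a b x y cl in auto)
  qed
  show ?thesis using dl_class_self[OF a] dl_class_self[OF b] eq by fast
qed

lemma colimit_unary_op:
  assumes a: "a \<in> scarrier (A n)"
    and cl: "\<And>i x. x \<in> scarrier (A i) \<Longrightarrow> g i x \<in> scarrier (A i)"
    and st: "\<And>i k x. x \<in> scarrier (A i) \<Longrightarrow> stage_map \<phi> i k (g i x) = g (i + k) (stage_map \<phi> i k x)"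
  shows "(\<Union>(p, x)\<in>dl_class A \<phi> n a. dl_class A \<phi> p (g p x)) = dl_class A \<phi> n (g n a)"
proof -
  have eq: "dl_class A \<phi> p (g p x) = dl_class A \<phi> n (g n a)" if px: "(p, x) \<in> dl_class A \<phi> n a" for p x
  proof -
    obtain k l where 1: "x \<in> scarrier (A p)" "n + k = p + l" "stage_map \<phi> n k a = stage_map \<phi> p l x"
      using px unfolding dl_class_def by auto
    show ?thesis
      by (subst dl_class_eq_iff) (use a 1 cl st in \<open>simp_all, metis\<close>)
  qed
  show ?thesis using dl_class_self[OF a] eq by fast
qed

lemma colimit_ops:
  assumes "a \<in> scarrier (A n)"
  shows "b \<in> scarrier (A n) \<Longrightarrow>
      sadd (star_colimit A \<phi>) (dl_class A \<phi> n a) (dl_class A \<phi> n b) = dl_class A \<phi> n (sadd (A n) a b)"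
    and "b \<in> scarrier (A n) \<Longrightarrow>
      smul (star_colimit A \<phi>) (dl_class A \<phi> n a) (dl_class A \<phi> n b) = dl_class A \<phi> n (smul (A n) a b)"
    and "sscale (star_colimit A \<phi>) c (dl_class A \<phi> n a) = dl_class A \<phi> n (sscale (A n) c a)"
    and "sstar (star_colimit A \<phi>) (dl_class A \<phi> n a) = dl_class A \<phi> n (sstar (A n) a)"
proof -
  note defs = star_colimit_def star_alg.simps
  show "b \<in> scarrier (A n) \<Longrightarrow>
      sadd (star_colimit A \<phi>) (dl_class A \<phi> n a) (dl_class A \<phi> n b) = dl_class A \<phi> n (sadd (A n) a b)"
    unfolding defs by (rule colimit_binary_op[where g="\<lambda>i. sadd (A i)"]) (simp_all add: assms stage_map_ops)
  show "b \<in> scarrier (A n) \<Longrightarrow>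
      smul (star_colimit A \<phi>) (dl_class A \<phi> n a) (dl_class A \<phi> n b) = dl_class A \<phi> n (smul (A n) a b)"
    unfolding defs by (rule colimit_binary_op[where g="\<lambda>i. smul (A i)"]) (simp_all add: assms stage_map_ops)
  show "sscale (star_colimit A \<phi>) c (dl_class A \<phi> n a) = dl_class A \<phi> n (sscale (A n) c a)"
    unfolding defs by (rule colimit_unary_op[where g="\<lambda>i. sscale (A i) c"]) (simp_all add: assms stage_map_ops)
  show "sstar (star_colimit A \<phi>) (dl_class A \<phi> n a) = dl_class A \<phi> n (sstar (A n) a)"
    unfolding defs by (rule colimit_unary_op[where g="\<lambda>i. sstar (A i)"]) (simp_all add: assms stage_map_ops)
qed

lemma colimit_closed: "star_closed (star_colimit A \<phi>)"
  unfolding star_closed_def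
proof (intro conjI ballI allI)
  fix P Q assume "P \<in> scarrier (star_colimit A \<phi>)" "Q \<in> scarrier (star_colimit A \<phi>)"
  then show "sadd (star_colimit A \<phi>) P Q \<in> scarrier (star_colimit A \<phi>)"
    and "smul (star_colimit A \<phi>) P Q \<in> scarrier (star_colimit A \<phi>)"
    by (rule dl_class_cases2; simp add: colimit_ops)+
qed (auto elim!: dl_class_cases simp: colimit_ops)

end

text \<open>A jointly surjective cocone whose legs identify only what becomes equal at a later stage is a
  colimit.\<close>

locale star_cocone = star_sequence A \<phi>
  for A :: "nat \<Rightarrow> ('k, 'a, 'm) star_alg_scheme" and \<phi> :: "nat \<Rightarrow> 'a \<Rightarrow> 'a" +
  fixes B :: "('k, 'b, 'n) star_alg_scheme" and \<mu> :: "nat \<Rightarrow> 'a \<Rightarrow> 'b"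
  assumes leg_hom: "star_hom (A n) B (\<mu> n)"
    and leg_compat: "a \<in> scarrier (A n) \<Longrightarrow> \<mu> (Suc n) (\<phi> n a) = \<mu> n a"
    and legs_surj: "b \<in> scarrier B \<Longrightarrow> \<exists>n. \<exists>a\<in>scarrier (A n). \<mu> n a = b"
    and legs_inj: "a \<in> scarrier (A n) \<Longrightarrow> a' \<in> scarrier (A n) \<Longrightarrow> \<mu> n a = \<mu> n a' \<Longrightarrow>
      \<exists>k. stage_map \<phi> n k a = stage_map \<phi> n k a'"
begin

lemma leg_ops:
  assumes "a \<in> scarrier (A n)"
  shows "\<mu> n a \<in> scarrier B"
    and "b \<in> scarrier (A n) \<Longrightarrow> \<mu> n (sadd (A n) a b) = sadd B (\<mu> n a) (\<mu> n b)"
    and "b \<in> scarrier (A n) \<Longrightarrow> \<mu> n (smul (A n) a b) = smul B (\<mu> n a) (\<mu> n b)"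
    and "\<mu> n (sscale (A n) c a) = sscale B c (\<mu> n a)"
    and "\<mu> n (sstar (A n) a) = sstar B (\<mu> n a)"
  using leg_hom[of n] assms unfolding star_hom_def by auto

lemma leg_stage: "a \<in> scarrier (A n) \<Longrightarrow> \<mu> (n + k) (stage_map \<phi> n k a) = \<mu> n a"
  by (induction k) (simp_all add: leg_compat)

lemma legs_eq_iff:
  assumes "a \<in> scarrier (A n)" and "b \<in> scarrier (A m)"
  shows "\<mu> n a = \<mu> m b \<longleftrightarrow> dl_class A \<phi> n a = dl_class A \<phi> m b"
proof
  assume "\<mu> n a = \<mu> m b"
  then have "\<mu> (n + m) (stage_map \<phi> n m a) = \<mu> (n + m) (stage_map \<phi> m n b)"
    using leg_stage[OF assms(1), of m] leg_stage[OF assms(2), of n] by (simp add: add.commute)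
  then obtain k where "stage_map \<phi> (n + m) k (stage_map \<phi> n m a) = stage_map \<phi> (n + m) k (stage_map \<phi> m n b)"
    using legs_inj stage_map_closed[OF assms(1), of m] stage_map_closed[OF assms(2), of n]
    by (metis add.commute)
  then have "stage_map \<phi> n (m + k) a = stage_map \<phi> m (n + k) b"
    by (metis stage_map_add add.commute)
  then show "dl_class A \<phi> n a = dl_class A \<phi> m b"
    unfolding dl_class_eq_iff[OF assms] by (intro exI[of _ "m + k"] exI[of _ "n + k"]) simp
next
  assume "dl_class A \<phi> n a = dl_class A \<phi> m b"
  then show "\<mu> n a = \<mu> m b"
    unfolding dl_class_eq_iff[OF assms] using leg_stage[OF assms(1)] leg_stage[OF assms(2)] by metis
qed

definition to_colimit :: "'b \<Rightarrow> (nat \<times> 'a) set" where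
  "to_colimit b = {(n, a). a \<in> scarrier (A n) \<and> \<mu> n a = b}"

lemma to_colimit_leg: "a \<in> scarrier (A n) \<Longrightarrow> to_colimit (\<mu> n a) = dl_class A \<phi> n a"
  unfolding to_colimit_def using legs_eq_iff dl_class_eq_iff
  by (auto simp: dl_class_def; metis)

lemma leg_cases2:
  assumes "b \<in> scarrier B" "c \<in> scarrier B"
  obtains n x y where "x \<in> scarrier (A n)" "y \<in> scarrier (A n)" "b = \<mu> n x" "c = \<mu> n y"
proof -
  obtain n x where 1: "x \<in> scarrier (A n)" "b = \<mu> n x" using legs_surj[OF assms(1)] by auto
  obtain m y where 2: "y \<in> scarrier (A m)" "c = \<mu> m y" using legs_surj[OF assms(2)] by auto
  show ?thesis
    using that[of "stage_map \<phi> n m x" "n + m" "stage_map \<phi> m n y"] 1 2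
      stage_map_closed[OF 1(1), of m] stage_map_closed[OF 2(1), of n] leg_stage[OF 1(1), of m] leg_stage[OF 2(1), of n]
    by (simp add: add.commute)
qed

lemma star_isomorphism_to_colimit: "star_isomorphism B (star_colimit A \<phi>) to_colimit"
  unfolding star_isomorphism_def
proof (intro conjI ballI allI)
  show "bij_betw to_colimit (scarrier B) (scarrier (star_colimit A \<phi>))"
  proof (rule bij_betw_imageI)
    show "inj_on to_colimit (scarrier B)"
    proof (rule inj_onI)
      fix b c assume "b \<in> scarrier B" "c \<in> scarrier B" and eq: "to_colimit b = to_colimit c"
      then obtain n x y where "x \<in> scarrier (A n)" "y \<in> scarrier (A n)" "b = \<mu> n x" "c = \<mu> n y"
        by (rule_tac leg_cases2)
      then show "b = c" using eq by (simp add: to_colimit_leg legs_eq_iff)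
    qed
    show "to_colimit ` scarrier B = scarrier (star_colimit A \<phi>)"
      by (auto simp: image_iff to_colimit_leg leg_ops dest!: legs_surj elim!: dl_class_cases)
         (metis to_colimit_leg leg_ops(1))
  qed
next
  fix a b assume "a \<in> scarrier B" "b \<in> scarrier B"
  then obtain n x y where "x \<in> scarrier (A n)" "y \<in> scarrier (A n)" "a = \<mu> n x" "b = \<mu> n y"
    by (rule leg_cases2)
  then show "to_colimit (sadd B a b) = sadd (star_colimit A \<phi>) (to_colimit a) (to_colimit b)"
    and "to_colimit (smul B a b) = smul (star_colimit A \<phi>) (to_colimit a) (to_colimit b)"
    by (simp_all add: leg_ops(2-)[symmetric] to_colimit_leg colimit_ops)
next
  fix a c assume "a \<in> scarrier B"
  then obtain n x where "x \<in> scarrier (A n)" "a = \<mu> n x" using legs_surj by metis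
  then show "to_colimit (sscale B c a) = sscale (star_colimit A \<phi>) c (to_colimit a)"
    and "to_colimit (sstar B a) = sstar (star_colimit A \<phi>) (to_colimit a)"
    by (simp_all add: leg_ops(2-)[symmetric] to_colimit_leg colimit_ops)
qed

theorem star_isomorphic_colimit: "star_isomorphic B (star_colimit A \<phi>)"
  unfolding star_isomorphic_def using star_isomorphism_to_colimit by auto

end

section \<open>Completions in C*-seminorms\<close>

text \<open>A completion is controlled by the linear structure, the bilinearity of the product and the
  conjugate linearity of the involution.\<close>

locale complex_star_algebra =
  fixes A :: "(complex, 'a, 'm) star_alg_scheme"
  assumes closed: "star_closed A"
    and zero_closed [simp]: "szero A \<in> scarrier A"
    and add_assoc: "\<lbrakk>a \<in> scarrier A; b \<in> scarrier A; c \<in> scarrier A\<rbrakk> \<Longrightarrow>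
      sadd A (sadd A a b) c = sadd A a (sadd A b c)"
    and add_commute: "\<lbrakk>a \<in> scarrier A; b \<in> scarrier A\<rbrakk> \<Longrightarrow> sadd A a b = sadd A b a"
    and add_zero: "a \<in> scarrier A \<Longrightarrow> sadd A a (szero A) = a"
    and scale_zero: "a \<in> scarrier A \<Longrightarrow> sscale A 0 a = szero A"
    and scale_one: "a \<in> scarrier A \<Longrightarrow> sscale A 1 a = a"
    and scale_scale: "a \<in> scarrier A \<Longrightarrow> sscale A r (sscale A t a) = sscale A (r * t) a"
    and scale_add_left: "a \<in> scarrier A \<Longrightarrow> sscale A (r + t) a = sadd A (sscale A r a) (sscale A t a)"
    and scale_add_right: "\<lbrakk>a \<in> scarrier A; b \<in> scarrier A\<rbrakk> \<Longrightarrow>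
      sscale A r (sadd A a b) = sadd A (sscale A r a) (sscale A r b)"
    and mul_add_left: "\<lbrakk>a \<in> scarrier A; b \<in> scarrier A; c \<in> scarrier A\<rbrakk> \<Longrightarrow>
      smul A (sadd A a b) c = sadd A (smul A a c) (smul A b c)"
    and mul_add_right: "\<lbrakk>a \<in> scarrier A; b \<in> scarrier A; c \<in> scarrier A\<rbrakk> \<Longrightarrow>
      smul A a (sadd A b c) = sadd A (smul A a b) (smul A a c)"
    and mul_scale_left: "\<lbrakk>a \<in> scarrier A; b \<in> scarrier A\<rbrakk> \<Longrightarrow>
      smul A (sscale A r a) b = sscale A r (smul A a b)"
    and mul_scale_right: "\<lbrakk>a \<in> scarrier A; b \<in> scarrier A\<rbrakk> \<Longrightarrow>
      smul A a (sscale A r b) = sscale A r (smul A a b)"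
    and star_add: "\<lbrakk>a \<in> scarrier A; b \<in> scarrier A\<rbrakk> \<Longrightarrow> sstar A (sadd A a b) = sadd A (sstar A a) (sstar A b)"
    and star_scale: "a \<in> scarrier A \<Longrightarrow> sstar A (sscale A r a) = sscale A (cnj r) (sstar A a)"
    and star_star: "a \<in> scarrier A \<Longrightarrow> sstar A (sstar A a) = a"
begin

lemma closed_ops [simp]:
  "a \<in> scarrier A \<Longrightarrow> b \<in> scarrier A \<Longrightarrow> sadd A a b \<in> scarrier A"
  "a \<in> scarrier A \<Longrightarrow> b \<in> scarrier A \<Longrightarrow> smul A a b \<in> scarrier A"
  "a \<in> scarrier A \<Longrightarrow> sscale A c a \<in> scarrier A"
  "a \<in> scarrier A \<Longrightarrow> sstar A a \<in> scarrier A"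
  "a \<in> scarrier A \<Longrightarrow> b \<in> scarrier A \<Longrightarrow> sdiff A a b \<in> scarrier A"
  using closed unfolding star_closed_def sdiff_def by auto

lemma add_left_commute:
  "\<lbrakk>a \<in> scarrier A; b \<in> scarrier A; c \<in> scarrier A\<rbrakk> \<Longrightarrow> sadd A a (sadd A b c) = sadd A b (sadd A a c)"
  by (metis add_assoc add_commute)

lemmas add_ac = add_assoc add_commute add_left_commute

lemma add_neg: "a \<in> scarrier A \<Longrightarrow> sadd A a (sscale A (-1) a) = szero A"
  using scale_add_left[of a 1 "-1"] by (simp add: scale_one scale_zero)

lemma add_zero_left: "a \<in> scarrier A \<Longrightarrow> sadd A (szero A) a = a"
  by (simp add: add_commute[of "szero A"] add_zero)

lemma diff_self: "a \<in> scarrier A \<Longrightarrow> sdiff A a a = szero A"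
  by (simp add: sdiff_def add_neg)

lemma add_neg_cancel:
  "\<lbrakk>a \<in> scarrier A; b \<in> scarrier A\<rbrakk> \<Longrightarrow> sadd A (sscale A (-1) a) (sadd A a b) = b"
  by (simp add: add_assoc[symmetric] add_commute[of "sscale A (-1) a"] add_neg add_zero_left)

lemma diff_add_diff:
  assumes "a \<in> scarrier A" "b \<in> scarrier A" "c \<in> scarrier A"
  shows "sadd A (sdiff A a b) (sdiff A b c) = sdiff A a c"
  using assms by (simp add: sdiff_def add_assoc add_neg_cancel)

lemma diff_add: "\<lbrakk>a \<in> scarrier A; b \<in> scarrier A\<rbrakk> \<Longrightarrow> sadd A (sdiff A a b) b = a"
  unfolding sdiff_def by (simp add: add_assoc) (simp add: add_commute[of _ b] add_neg add_zero)

lemma diff_swap: "\<lbrakk>a \<in> scarrier A; b \<in> scarrier A\<rbrakk> \<Longrightarrow> sdiff A b a = sscale A (-1) (sdiff A a b)"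
  by (simp add: sdiff_def scale_add_right scale_scale scale_one add_commute)

lemma diff_sadd:
  "\<lbrakk>a \<in> scarrier A; b \<in> scarrier A; c \<in> scarrier A; d \<in> scarrier A\<rbrakk> \<Longrightarrow>
    sdiff A (sadd A a b) (sadd A c d) = sadd A (sdiff A a c) (sdiff A b d)"
  by (simp add: sdiff_def scale_add_right add_ac)

lemma diff_scale:
  "\<lbrakk>a \<in> scarrier A; b \<in> scarrier A\<rbrakk> \<Longrightarrow> sdiff A (sscale A c a) (sscale A c b) = sscale A c (sdiff A a b)"
  by (simp add: sdiff_def scale_add_right scale_scale)

lemma diff_star:
  "\<lbrakk>a \<in> scarrier A; b \<in> scarrier A\<rbrakk> \<Longrightarrow> sdiff A (sstar A a) (sstar A b) = sstar A (sdiff A a b)"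
  by (simp add: sdiff_def star_add star_scale)

lemma diff_mul:
  assumes "a \<in> scarrier A" "b \<in> scarrier A" "c \<in> scarrier A" "d \<in> scarrier A"
  shows "sdiff A (smul A a b) (smul A c d) = sadd A (smul A a (sdiff A b d)) (smul A (sdiff A a c) d)"
proof -
  have 1: "smul A a (sdiff A b d) = sdiff A (smul A a b) (smul A a d)"
    using assms by (simp add: sdiff_def mul_add_right mul_scale_right)
  have 2: "smul A (sdiff A a c) d = sdiff A (smul A a d) (smul A c d)"
    using assms by (simp add: sdiff_def mul_add_left mul_scale_left)
  show ?thesis unfolding 1 2 by (rule diff_add_diff[symmetric]) (use assms in auto)
qed

end

lemma star_hom_diff:
  assumes "star_hom A B h" "complex_star_algebra A" "a \<in> scarrier A" "b \<in> scarrier A"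
  shows "h (sdiff A a b) = sdiff B (h a) (h b)"
proof -
  interpret complex_star_algebra A by fact
  show ?thesis using assms(1,3,4) unfolding star_hom_def sdiff_def by simp
qed

locale seminormed_star_algebra = complex_star_algebra A
  for A :: "(complex, 'a, 'm) star_alg_scheme" +
  fixes p :: "'a \<Rightarrow> real"
  assumes seminorm: "cstar_seminorm A p"
begin

lemma p_nonneg [simp]: "a \<in> scarrier A \<Longrightarrow> 0 \<le> p a"
  and p_scale: "a \<in> scarrier A \<Longrightarrow> p (sscale A c a) = cmod c * p a"
  and p_add: "a \<in> scarrier A \<Longrightarrow> b \<in> scarrier A \<Longrightarrow> p (sadd A a b) \<le> p a + p b"
  and p_mul: "a \<in> scarrier A \<Longrightarrow> b \<in> scarrier A \<Longrightarrow> p (smul A a b) \<le> p a * p b"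
  and p_cstar: "a \<in> scarrier A \<Longrightarrow> p (smul A (sstar A a) a) = (p a)\<^sup>2"
  using seminorm unfolding cstar_seminorm_def by auto

lemma p_zero [simp]: "p (szero A) = 0"
  using p_scale[of "szero A" 0] scale_zero[of "szero A"] by simp

text \<open>The C*-identity gives \<open>p a ^ 2 \<le> p (a\<^sup>*) * p a\<close>, hence \<open>p a \<le> p (a\<^sup>*)\<close>; the involution exchanges the two sides.\<close>

lemma p_star: assumes "a \<in> scarrier A" shows "p (sstar A a) = p a"
proof -
  have le: "p x \<le> p (sstar A x)" if x: "x \<in> scarrier A" for x
  proof (cases "p x = 0")
    case False
    have "p x * p x \<le> p (sstar A x) * p x"
      using p_cstar[OF x] p_mul[of "sstar A x" x] x by (simp add: power2_eq_square)
    then show ?thesis using False p_nonneg[OF x] by (simp add: mult_le_cancel_right)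
  qed (use x in simp)
  show ?thesis using le[OF assms] le[of "sstar A a"] assms by (simp add: star_star)
qed

lemma p_diff_swap: "a \<in> scarrier A \<Longrightarrow> b \<in> scarrier A \<Longrightarrow> p (sdiff A b a) = p (sdiff A a b)"
  by (subst diff_swap) (simp_all add: p_scale)

lemma p_diff_triangle:
  "\<lbrakk>a \<in> scarrier A; b \<in> scarrier A; c \<in> scarrier A\<rbrakk> \<Longrightarrow> p (sdiff A a c) \<le> p (sdiff A a b) + p (sdiff A b c)"
  using p_add[of "sdiff A a b" "sdiff A b c"] by (simp add: diff_add_diff)

lemma p_diff_ge: "\<lbrakk>a \<in> scarrier A; b \<in> scarrier A\<rbrakk> \<Longrightarrow> \<bar>p a - p b\<bar> \<le> p (sdiff A a b)"
  using p_add[of "sdiff A a b" b] p_add[of "sdiff A b a" a] by (simp add: diff_add p_diff_swap[of a b])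

abbreviation "Cau \<equiv> cauchy_seqs A p"
abbreviation "cls \<equiv> completion_class A p"

lemma cauchy_in [simp]: "s \<in> Cau \<Longrightarrow> s n \<in> scarrier A"
  unfolding cauchy_seqs_def by auto

lemma cauchy_imp_Cauchy: assumes "s \<in> Cau" shows "Cauchy (\<lambda>n. p (s n))"
proof (rule metric_CauchyI)
  fix e :: real assume "e > 0"
  then obtain N where N: "\<forall>m\<ge>N. \<forall>n\<ge>N. p (sdiff A (s m) (s n)) < e"
    using assms unfolding cauchy_seqs_def by auto
  have "dist (p (s m)) (p (s n)) < e" if "m \<ge> N" "n \<ge> N" for m n
    using le_less_trans[OF p_diff_ge[of "s m" "s n"]] N that assms by (auto simp: dist_real_def)
  then show "\<exists>M. \<forall>m\<ge>M. \<forall>n\<ge>M. dist (p (s m)) (p (s n)) < e" by blast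
qed

lemma cauchy_convergent: "s \<in> Cau \<Longrightarrow> convergent (\<lambda>n. p (s n))"
  using cauchy_imp_Cauchy Cauchy_convergent_iff by blast

lemma cauchy_bounded: assumes "s \<in> Cau" obtains M where "M > 0" "\<And>n. p (s n) \<le> M"
proof -
  have "Bseq (\<lambda>n. p (s n))" using assms cauchy_imp_Cauchy Cauchy_Bseq by blast
  then show ?thesis using that unfolding Bseq_def by (metis abs_le_D1 real_norm_def)
qed

lemma cauchy_const: "a \<in> scarrier A \<Longrightarrow> (\<lambda>_. a) \<in> Cau"
  unfolding cauchy_seqs_def by (simp add: diff_self)

text \<open>This serves all operations: each of them changes by at most a multiple of the changes of its arguments.\<close>

lemma cauchy_dominated:
  assumes "s \<in> Cau" "t \<in> Cau" "\<And>n. u n \<in> scarrier A"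
    and dom: "\<And>m n. p (sdiff A (u m) (u n)) \<le> M * p (sdiff A (s m) (s n)) + M * p (sdiff A (t m) (t n))"
  shows "u \<in> Cau"
  unfolding cauchy_seqs_def
proof (intro CollectI conjI allI impI)
  fix e :: real assume "e > 0"
  define M' where "M' = max M 1"
  have M': "M' > 0" "M \<le> M'" by (auto simp: M'_def)
  then have pos: "e / (2 * M') > 0" using \<open>e > 0\<close> by simp
  obtain N1 where N1: "\<forall>m\<ge>N1. \<forall>n\<ge>N1. p (sdiff A (s m) (s n)) < e / (2 * M')"
    using assms(1) pos unfolding cauchy_seqs_def by blast
  obtain N2 where N2: "\<forall>m\<ge>N2. \<forall>n\<ge>N2. p (sdiff A (t m) (t n)) < e / (2 * M')"
    using assms(2) pos unfolding cauchy_seqs_def by blast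
  have "p (sdiff A (u m) (u n)) < e" if "m \<ge> max N1 N2" "n \<ge> max N1 N2" for m n
  proof -
    have "M * p (sdiff A (s m) (s n)) \<le> M' * p (sdiff A (s m) (s n))"
      and "M * p (sdiff A (t m) (t n)) \<le> M' * p (sdiff A (t m) (t n))"
      using assms(1,2) M' by (auto intro!: mult_right_mono)
    moreover have "M' * p (sdiff A (s m) (s n)) < M' * (e / (2 * M'))"
      and "M' * p (sdiff A (t m) (t n)) < M' * (e / (2 * M'))"
      using N1 N2 that M' by (simp_all only: mult_less_cancel_left_pos max.bounded_iff)
    ultimately show ?thesis using dom[of m n] M' by (simp add: field_simps)
  qed
  then show "\<exists>N. \<forall>m\<ge>N. \<forall>n\<ge>N. p (sdiff A (u m) (u n)) < e" by blast
qed (use assms(3) in auto)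

lemma mul_diff_le:
  assumes "a \<in> scarrier A" "b \<in> scarrier A" "c \<in> scarrier A" "d \<in> scarrier A" "p a \<le> M" "p d \<le> M"
  shows "p (sdiff A (smul A a b) (smul A c d)) \<le> M * p (sdiff A a c) + M * p (sdiff A b d)"
proof -
  have "p (sdiff A (smul A a b) (smul A c d)) \<le> p (smul A a (sdiff A b d)) + p (smul A (sdiff A a c) d)"
    using assms by (simp add: diff_mul p_add)
  also have "\<dots> \<le> p a * p (sdiff A b d) + p (sdiff A a c) * p d"
    using assms by (intro add_mono p_mul) auto
  also have "\<dots> \<le> M * p (sdiff A b d) + p (sdiff A a c) * M"
    using assms by (intro add_mono mult_right_mono mult_left_mono) auto
  finally show ?thesis by (simp add: algebra_simps)
qed

lemma cauchy_ops:
  assumes s: "s \<in> Cau"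
  shows "t \<in> Cau \<Longrightarrow> (\<lambda>n. sadd A (s n) (t n)) \<in> Cau" "t \<in> Cau \<Longrightarrow> (\<lambda>n. smul A (s n) (t n)) \<in> Cau"
    "(\<lambda>n. sscale A c (s n)) \<in> Cau" "(\<lambda>n. sstar A (s n)) \<in> Cau"
proof -
  show "(\<lambda>n. sscale A c (s n)) \<in> Cau"
    by (rule cauchy_dominated[OF s s, where M = "cmod c"]) (use s in \<open>auto simp: diff_scale p_scale\<close>)
  show "(\<lambda>n. sstar A (s n)) \<in> Cau"
    by (rule cauchy_dominated[OF s s, where M = 1]) (use s in \<open>auto simp: diff_star p_star\<close>)
  assume t: "t \<in> Cau"
  show "(\<lambda>n. sadd A (s n) (t n)) \<in> Cau"
    by (rule cauchy_dominated[OF s t, where M = 1]) (use s t in \<open>auto simp: diff_sadd p_add\<close>)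
  obtain M1 where M1: "\<And>n. p (s n) \<le> M1" using cauchy_bounded[OF s] by metis
  obtain M2 where M2: "\<And>n. p (t n) \<le> M2" using cauchy_bounded[OF t] by metis
  show "(\<lambda>n. smul A (s n) (t n)) \<in> Cau"
    by (rule cauchy_dominated[OF s t, where M = "max M1 M2"])
       (use s t M1 M2 in \<open>auto intro!: mul_diff_le simp: le_max_iff_disj\<close>)
qed

lemma class_self: "s \<in> Cau \<Longrightarrow> s \<in> cls s"
  unfolding completion_class_def by (simp add: diff_self)

lemma class_memD: assumes "t \<in> cls s" shows "t \<in> Cau" "(\<lambda>n. p (sdiff A (s n) (t n))) \<longlonglongrightarrow> 0"
  using assms unfolding completion_class_def by auto

lemma class_eq_iff:
  assumes "s \<in> Cau" "t \<in> Cau"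
  shows "cls s = cls t \<longleftrightarrow> (\<lambda>n. p (sdiff A (s n) (t n))) \<longlonglongrightarrow> 0"
proof
  assume "cls s = cls t"
  then show "(\<lambda>n. p (sdiff A (s n) (t n))) \<longlonglongrightarrow> 0"
    using class_self[OF assms(2)] class_memD by auto
next
  have sub: "cls s \<subseteq> cls t"
    if st: "s \<in> Cau" "t \<in> Cau" and lim: "(\<lambda>n. p (sdiff A (s n) (t n))) \<longlonglongrightarrow> 0" for s t
  proof
    fix u assume u: "u \<in> cls s"
    have "(\<lambda>n. p (sdiff A (t n) (u n))) \<longlonglongrightarrow> 0"
    proof (rule real_tendsto_sandwich[OF _ _ tendsto_const])
      show "(\<lambda>n. p (sdiff A (s n) (t n)) + p (sdiff A (s n) (u n))) \<longlonglongrightarrow> 0"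
        using tendsto_add[OF lim class_memD(2)[OF u]] by simp
      show "\<forall>\<^sub>F n in sequentially. p (sdiff A (t n) (u n)) \<le> p (sdiff A (s n) (t n)) + p (sdiff A (s n) (u n))"
        using st class_memD(1)[OF u] p_diff_triangle[of "t _" "s _" "u _"]
        by (intro always_eventually allI) (simp add: p_diff_swap[of "s _" "t _"])
    qed (use st class_memD(1)[OF u] in auto)
    then show "u \<in> cls t" unfolding completion_class_def using class_memD(1)[OF u] by auto
  qed
  assume "(\<lambda>n. p (sdiff A (s n) (t n))) \<longlonglongrightarrow> 0"
  moreover from this have "(\<lambda>n. p (sdiff A (t n) (s n))) \<longlonglongrightarrow> 0"
    using assms by (simp add: p_diff_swap[of "s _" "t _"])
  ultimately show "cls s = cls t" using sub assms by blast
qed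

text \<open>How all operations on classes are shown to be independent of the representatives: it suffices to dominate the change of the
  value by the changes of the arguments.\<close>

lemma class_eqI:
  assumes "s \<in> Cau" "t \<in> Cau" "s' \<in> cls s" "t' \<in> cls t" "u \<in> Cau" "u' \<in> Cau"
    and "\<And>n. p (sdiff A (u n) (u' n)) \<le> M * p (sdiff A (s n) (s' n)) + M * p (sdiff A (t n) (t' n))"
  shows "cls u' = cls u"
proof -
  have "(\<lambda>n. p (sdiff A (u n) (u' n))) \<longlonglongrightarrow> 0"
  proof (rule real_tendsto_sandwich[OF _ _ tendsto_const])
    show "(\<lambda>n. M * p (sdiff A (s n) (s' n)) + M * p (sdiff A (t n) (t' n))) \<longlonglongrightarrow> 0"
      using tendsto_add[OF tendsto_mult[OF tendsto_const class_memD(2)[OF assms(3)], of M]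
          tendsto_mult[OF tendsto_const class_memD(2)[OF assms(4)], of M]] by simp
  qed (use assms in auto)
  then show ?thesis using class_eq_iff[OF assms(5,6)] by simp
qed

lemma completion_ops:
  assumes s: "s \<in> Cau"
  shows "t \<in> Cau \<Longrightarrow> sadd (completion A p) (cls s) (cls t) = cls (\<lambda>n. sadd A (s n) (t n))"
    and "t \<in> Cau \<Longrightarrow> smul (completion A p) (cls s) (cls t) = cls (\<lambda>n. smul A (s n) (t n))"
    and "sscale (completion A p) c (cls s) = cls (\<lambda>n. sscale A c (s n))"
    and "sstar (completion A p) (cls s) = cls (\<lambda>n. sstar A (s n))"
proof -
  note defs = completion_def star_alg.simps cstar_alg.simps
  have "cls (\<lambda>n. sscale A c (s' n)) = cls (\<lambda>n. sscale A c (s n))" if s': "s' \<in> cls s" for s'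
    by (rule class_eqI[OF s s s' s', where M = "cmod c"])
       (use s class_memD(1)[OF s'] in \<open>auto intro: cauchy_ops simp: diff_scale p_scale\<close>)
  then show "sscale (completion A p) c (cls s) = cls (\<lambda>n. sscale A c (s n))"
    unfolding defs using class_self[OF s] by blast
  have "cls (\<lambda>n. sstar A (s' n)) = cls (\<lambda>n. sstar A (s n))" if s': "s' \<in> cls s" for s'
    by (rule class_eqI[OF s s s' s', where M = 1])
       (use s class_memD(1)[OF s'] in \<open>auto intro: cauchy_ops simp: diff_star p_star\<close>)
  then show "sstar (completion A p) (cls s) = cls (\<lambda>n. sstar A (s n))"
    unfolding defs using class_self[OF s] by blast
  assume t: "t \<in> Cau"
  have "cls (\<lambda>n. sadd A (s' n) (t' n)) = cls (\<lambda>n. sadd A (s n) (t n))" if s': "s' \<in> cls s" and t': "t' \<in> cls t" for s' t'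
    by (rule class_eqI[OF s t s' t', where M = 1])
       (use s t class_memD(1)[OF s'] class_memD(1)[OF t'] in \<open>auto intro: cauchy_ops simp: diff_sadd p_add\<close>)
  then show "sadd (completion A p) (cls s) (cls t) = cls (\<lambda>n. sadd A (s n) (t n))"
    unfolding defs using class_self[OF s] class_self[OF t] by blast
  have "cls (\<lambda>n. smul A (s' n) (t' n)) = cls (\<lambda>n. smul A (s n) (t n))" if s': "s' \<in> cls s" and t': "t' \<in> cls t" for s' t'
  proof -
    obtain M1 where M1: "\<And>n. p (s n) \<le> M1" using cauchy_bounded[OF s] by metis
    obtain M2 where M2: "\<And>n. p (t' n) \<le> M2" using cauchy_bounded[OF class_memD(1)[OF t']] by metis
    show ?thesis
      by (rule class_eqI[OF s t s' t', where M = "max M1 M2"])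
         (use s t M1 M2 class_memD(1)[OF s'] class_memD(1)[OF t']
          in \<open>auto intro!: cauchy_ops mul_diff_le simp: le_max_iff_disj\<close>)
  qed
  then show "smul (completion A p) (cls s) (cls t) = cls (\<lambda>n. smul A (s n) (t n))"
    unfolding defs using class_self[OF s] class_self[OF t] by blast
qed

lemma completion_carrier: "scarrier (completion A p) = cls ` Cau"
  and completion_zero: "szero (completion A p) = cls (\<lambda>_. szero A)"
  unfolding completion_def by simp_all

lemma completion_norm: assumes "s \<in> Cau" and lim: "(\<lambda>n. p (s n)) \<longlonglongrightarrow> c" shows "snorm (completion A p) (cls s) = c"
proof -
  have lim': "(\<lambda>n. p (t n)) \<longlonglongrightarrow> c" if t: "t \<in> cls s" for t
  proof (rule Lim_transform[OF lim], rule Lim_null_comparison[OF _ class_memD(2)[OF t]])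
    show "\<forall>\<^sub>F n in sequentially. norm (p (t n) - p (s n)) \<le> p (sdiff A (s n) (t n))"
      using assms(1) class_memD(1)[OF t] p_diff_ge
      by (intro always_eventually) (simp add: abs_minus_commute[of "p (t _)"])
  qed
  show ?thesis unfolding completion_def cstar_alg.simps
  proof (rule the_equality)
    fix c' assume "\<forall>t\<in>cls s. (\<lambda>n. p (t n)) \<longlonglongrightarrow> c'"
    then show "c' = c" using class_self[OF assms(1)] LIMSEQ_unique[OF _ lim] by blast
  qed (use lim' in blast)
qed

lemma completion_norm_tendsto: "s \<in> Cau \<Longrightarrow> (\<lambda>n. p (s n)) \<longlonglongrightarrow> snorm (completion A p) (cls s)"
  using cauchy_convergent completion_norm unfolding convergent_def by metis

lemma completion_norm_const: "a \<in> scarrier A \<Longrightarrow> snorm (completion A p) (cls (\<lambda>_. a)) = p a"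
  by (rule completion_norm) (auto intro: cauchy_const)

lemma completion_algebra: "complex_star_algebra (completion A p)"
proof -
  have ex: "\<exists>s\<in>Cau. P = cls s" if "P \<in> scarrier (completion A p)" for P
    using that by (auto simp: completion_carrier)
  have cl [simp]: "cls s \<in> scarrier (completion A p)" if "s \<in> Cau" for s
    using that by (auto simp: completion_carrier)
  note [simp] = completion_ops cauchy_ops completion_zero cauchy_const
  show ?thesis
  proof unfold_locales
    show "star_closed (completion A p)"
      unfolding star_closed_def completion_carrier by auto
    show "szero (completion A p) \<in> scarrier (completion A p)" by simp
  qed (((drule ex)+, elim bexE, (simp add: add_assoc add_zero scale_zero scale_one scale_scale
       scale_add_left scale_add_right mul_add_left mul_add_right mul_scale_left mul_scale_right star_add star_scale
       star_star; fail | simp add: add_commute)))+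
qed

lemma completion_seminorm: "cstar_seminorm (completion A p) (snorm (completion A p))"
  unfolding cstar_seminorm_def completion_carrier
proof (intro conjI allI ballI; elim imageE)
  fix P s assume [simp]: "P = cls s" "s \<in> Cau"
  note lim = completion_norm_tendsto[OF \<open>s \<in> Cau\<close>]
  show "0 \<le> snorm (completion A p) P" using lim by (auto intro: LIMSEQ_le_const)
  show "snorm (completion A p) (sscale (completion A p) c P) = cmod c * snorm (completion A p) P" for c
    using tendsto_mult[OF tendsto_const lim] by (auto intro!: completion_norm simp: completion_ops cauchy_ops p_scale)
  show "snorm (completion A p) (smul (completion A p) (sstar (completion A p) P) P) = (snorm (completion A p) P)\<^sup>2"
    using tendsto_power[OF lim] by (auto intro!: completion_norm simp: completion_ops cauchy_ops p_cstar)
  fix Q t assume [simp]: "Q = cls t" "t \<in> Cau"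
  note lim' = completion_norm_tendsto[OF \<open>t \<in> Cau\<close>]
  show "snorm (completion A p) (sadd (completion A p) P Q) \<le> snorm (completion A p) P + snorm (completion A p) Q"
    using LIMSEQ_le[OF completion_norm_tendsto tendsto_add[OF lim lim'], of "\<lambda>n. sadd A (s n) (t n)"]
    by (auto simp: completion_ops cauchy_ops p_add)
  show "snorm (completion A p) (smul (completion A p) P Q) \<le> snorm (completion A p) P * snorm (completion A p) Q"
    using LIMSEQ_le[OF completion_norm_tendsto tendsto_mult[OF lim lim'], of "\<lambda>n. smul A (s n) (t n)"]
    by (auto simp: completion_ops cauchy_ops p_mul)
qed

lemma completion_const_dense:
  assumes "P \<in> scarrier (completion A p)" "e > 0"
  obtains a where "a \<in> scarrier A" "snorm (completion A p) (sdiff (completion A p) P (cls (\<lambda>_. a))) < e"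
proof -
  obtain s where s: "s \<in> Cau" "P = cls s" using assms(1) by (auto simp: completion_carrier)
  obtain N where N: "\<forall>m\<ge>N. \<forall>n\<ge>N. p (sdiff A (s m) (s n)) < e / 2"
    using s(1) assms(2) unfolding cauchy_seqs_def by (auto dest!: spec[of _ "e / 2"])
  have C: "(\<lambda>n. sdiff A (s n) (s N)) \<in> Cau"
    unfolding sdiff_def using s by (intro cauchy_ops cauchy_const) auto
  have eq: "sdiff (completion A p) P (cls (\<lambda>_. s N)) = cls (\<lambda>n. sdiff A (s n) (s N))"
    unfolding s(2) sdiff_def using s by (simp add: completion_ops cauchy_const cauchy_ops)
  have "snorm (completion A p) (cls (\<lambda>n. sdiff A (s n) (s N))) \<le> e / 2"
    by (rule LIMSEQ_le_const2[OF completion_norm_tendsto[OF C]]) (use N in \<open>auto intro!: exI[of _ N] less_imp_le\<close>)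
  then show ?thesis using that[of "s N"] eq s assms(2) by simp
qed

end

text \<open>A homomorphism that preserves the seminorms acts termwise on Cauchy sequences, and if its range is dense, then every
  Cauchy sequence of the target is equivalent to one of approximants from the range.\<close>

lemma completion_isomorphic:
  assumes A: "seminormed_star_algebra A p" and B: "seminormed_star_algebra B q" and h: "star_hom A B h"
    and iso: "\<And>a. a \<in> scarrier A \<Longrightarrow> q (h a) = p a"
    and dense: "\<And>b e. b \<in> scarrier B \<Longrightarrow> e > 0 \<Longrightarrow> \<exists>a\<in>scarrier A. q (sdiff B b (h a)) < e"
  shows "cstar_isomorphic (completion A p) (completion B q)"
proof -
  interpret A: seminormed_star_algebra A p by fact
  interpret B: seminormed_star_algebra B q by fact
  define H where "H P = (\<Union>s\<in>P. B.cls (\<lambda>n. h (s n)))" for P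
  have hB [simp]: "h a \<in> scarrier B" if "a \<in> scarrier A" for a
    using h that unfolding star_hom_def by auto
  have qd: "q (sdiff B (h a) (h b)) = p (sdiff A a b)" if "a \<in> scarrier A" "b \<in> scarrier A" for a b
    using star_hom_diff[OF h A.complex_star_algebra_axioms that] iso[of "sdiff A a b"] that by simp
  have cau: "(\<lambda>n. h (s n)) \<in> B.Cau" if "s \<in> A.Cau" for s
    using that unfolding cauchy_seqs_def by (auto simp: qd)
  have H: "H (A.cls s) = B.cls (\<lambda>n. h (s n))" if s: "s \<in> A.Cau" for s
  proof -
    have "B.cls (\<lambda>n. h (t n)) = B.cls (\<lambda>n. h (s n))" if t: "t \<in> A.cls s" for t
      using A.class_memD[OF t] s by (subst eq_commute) (simp add: B.class_eq_iff cau qd)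
    then show ?thesis unfolding H_def using A.class_self[OF s] by blast
  qed
  have "star_isomorphism (completion A p) (completion B q) H"
    unfolding star_isomorphism_def
  proof (intro conjI ballI allI)
    show "bij_betw H (scarrier (completion A p)) (scarrier (completion B q))"
    proof (rule bij_betw_imageI)
      show "inj_on H (scarrier (completion A p))"
      proof (rule inj_onI)
        fix P Q assume "P \<in> scarrier (completion A p)" "Q \<in> scarrier (completion A p)" and eq: "H P = H Q"
        then obtain s t where st: "s \<in> A.Cau" "t \<in> A.Cau" "P = A.cls s" "Q = A.cls t"
          by (auto simp: A.completion_carrier)
        then have "(\<lambda>n. q (sdiff B (h (s n)) (h (t n)))) \<longlonglongrightarrow> 0"
          using eq H B.class_eq_iff cau by simp
        then show "P = Q" using st by (simp add: A.class_eq_iff qd)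
      qed
      show "H ` scarrier (completion A p) = scarrier (completion B q)"
      proof (intro equalityI subsetI)
        fix Q assume "Q \<in> H ` scarrier (completion A p)"
        then show "Q \<in> scarrier (completion B q)"
          by (auto simp: A.completion_carrier B.completion_carrier H cau)
      next
        fix Q assume "Q \<in> scarrier (completion B q)"
        then obtain t where t: "t \<in> B.Cau" "Q = B.cls t" by (auto simp: B.completion_carrier)
        have "\<exists>a\<in>scarrier A. q (sdiff B (t n) (h a)) < inverse (real (Suc n))" for n
          using dense t(1) by simp
        then obtain s where s: "\<And>n. s n \<in> scarrier A" "\<And>n. q (sdiff B (t n) (h (s n))) < inverse (real (Suc n))"
          by metis
        have lim: "(\<lambda>n. q (sdiff B (t n) (h (s n)))) \<longlonglongrightarrow> 0"
          by (rule real_tendsto_sandwich[OF _ _ tendsto_const LIMSEQ_inverse_real_of_nat])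
             (use s t in \<open>auto intro!: always_eventually less_imp_le\<close>)
        have "s \<in> A.Cau" unfolding cauchy_seqs_def
        proof (intro CollectI conjI allI impI)
          fix e :: real assume "e > 0"
          then have e3: "e / 3 > 0" by simp
          obtain N1 where N1: "\<forall>m\<ge>N1. \<forall>n\<ge>N1. q (sdiff B (t m) (t n)) < e / 3"
            using t(1) e3 unfolding cauchy_seqs_def by blast
          obtain N2 where N2: "\<forall>n\<ge>N2. q (sdiff B (t n) (h (s n))) < e / 3"
            using order_tendstoD(2)[OF lim e3] unfolding eventually_sequentially by blast
          have "p (sdiff A (s m) (s n)) < e" if "m \<ge> max N1 N2" "n \<ge> max N1 N2" for m n
          proof -
            have "p (sdiff A (s m) (s n)) = q (sdiff B (h (s m)) (h (s n)))" using s by (simp add: qd)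
            also have "\<dots> \<le> q (sdiff B (h (s m)) (t m)) + q (sdiff B (t m) (h (s n)))"
              using s t by (intro B.p_diff_triangle) auto
            also have "q (sdiff B (t m) (h (s n))) \<le> q (sdiff B (t m) (t n)) + q (sdiff B (t n) (h (s n)))"
              using s t by (intro B.p_diff_triangle) auto
            also have "q (sdiff B (h (s m)) (t m)) = q (sdiff B (t m) (h (s m)))"
              using s t by (intro B.p_diff_swap) auto
            finally have le: "p (sdiff A (s m) (s n)) \<le>
                q (sdiff B (t m) (h (s m))) + (q (sdiff B (t m) (t n)) + q (sdiff B (t n) (h (s n))))" by simp
            have "q (sdiff B (t m) (h (s m))) < e / 3" "q (sdiff B (t m) (t n)) < e / 3"
              "q (sdiff B (t n) (h (s n))) < e / 3"
              using N1 N2 that by auto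
            then show ?thesis using le by linarith
          qed
          then show "\<exists>N. \<forall>m\<ge>N. \<forall>n\<ge>N. p (sdiff A (s m) (s n)) < e" by blast
        qed (use s in auto)
        moreover from this have "Q = H (A.cls s)"
          using lim t by (simp add: H B.class_eq_iff cau)
        ultimately show "Q \<in> H ` scarrier (completion A p)" by (auto simp: A.completion_carrier)
      qed
    qed
  qed (use h in \<open>auto simp: A.completion_carrier A.completion_ops B.completion_ops A.cauchy_ops B.cauchy_ops H cau star_hom_def\<close>)
  moreover have "snorm (completion B q) (H P) = snorm (completion A p) P" if P: "P \<in> scarrier (completion A p)" for P
  proof -
    obtain s where s: "s \<in> A.Cau" "P = A.cls s" using P by (auto simp: A.completion_carrier)
    then show ?thesis
      using A.completion_norm_tendsto[OF s(1)] by (auto simp: H iso intro!: B.completion_norm cau)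
  qed
  ultimately show ?thesis unfolding cstar_isomorphic_def by blast
qed


section \<open>Enveloping C*-algebras and colimits\<close>

definition env_bounded :: "(complex, 'a, 'm) star_alg_scheme \<Rightarrow> bool" where
  "env_bounded A \<longleftrightarrow> (\<forall>a\<in>scarrier A. bdd_above ((\<lambda>p. p a) ` {p. cstar_seminorm A p}))"

lemma env_norm_upper: "\<lbrakk>env_bounded A; a \<in> scarrier A; cstar_seminorm A p\<rbrakk> \<Longrightarrow> p a \<le> env_norm A a"
  unfolding env_norm_def env_bounded_def by (rule cSUP_upper) auto

lemma zero_seminorm: "cstar_seminorm A (\<lambda>_. 0)"
  unfolding cstar_seminorm_def by simp

lemma env_norm_least: "(\<And>p. cstar_seminorm A p \<Longrightarrow> p a \<le> c) \<Longrightarrow> env_norm A a \<le> c"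
  unfolding env_norm_def using zero_seminorm[of A] by (intro cSUP_least) auto

text \<open>All conditions but the C*-identity are inherited by suprema directly; that one is, too, since squaring
  is monotone on nonnegative reals.\<close>

lemma env_norm_seminorm:
  assumes A: "star_closed A" and b: "env_bounded A"
  shows "cstar_seminorm A (env_norm A)"
proof -
  note up = env_norm_upper[OF b]
  have [simp]: "sadd A a b \<in> scarrier A" "smul A a b \<in> scarrier A" if "a \<in> scarrier A" "b \<in> scarrier A" for a b
    using A that unfolding star_closed_def by auto
  have [simp]: "sscale A c a \<in> scarrier A" "sstar A a \<in> scarrier A" if "a \<in> scarrier A" for a c
    using A that unfolding star_closed_def by auto
  have nonneg: "0 \<le> env_norm A a" if "a \<in> scarrier A" for a
    using up[OF that zero_seminorm] .
  show ?thesis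
    unfolding cstar_seminorm_def
  proof (intro conjI ballI allI)
    fix a c assume a: "a \<in> scarrier A"
    show "0 \<le> env_norm A a" using nonneg[OF a] .
    show "env_norm A (sscale A c a) = cmod c * env_norm A a"
    proof (rule antisym)
      show "env_norm A (sscale A c a) \<le> cmod c * env_norm A a"
        by (rule env_norm_least) (use a up in \<open>auto simp: cstar_seminorm_def intro!: mult_left_mono\<close>)
      show "cmod c * env_norm A a \<le> env_norm A (sscale A c a)"
      proof (cases "c = 0")
        case False
        have "env_norm A a \<le> env_norm A (sscale A c a) / cmod c"
        proof (rule env_norm_least)
          fix p assume p: "cstar_seminorm A p"
          have "cmod c * p a \<le> env_norm A (sscale A c a)"
            using up[OF _ p, of "sscale A c a"] p a by (simp add: cstar_seminorm_def)
          then show "p a \<le> env_norm A (sscale A c a) / cmod c" using False by (simp add: field_simps)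
        qed
        then show ?thesis using False by (simp add: field_simps)
      qed (use a nonneg in simp)
    qed
    show "env_norm A (smul A (sstar A a) a) = (env_norm A a)\<^sup>2"
    proof (rule antisym)
      show "env_norm A (smul A (sstar A a) a) \<le> (env_norm A a)\<^sup>2"
        by (rule env_norm_least) (use a up in \<open>auto simp: cstar_seminorm_def intro!: power_mono\<close>)
      have "env_norm A a \<le> sqrt (env_norm A (smul A (sstar A a) a))"
      proof (rule env_norm_least)
        fix p assume p: "cstar_seminorm A p"
        have "(p a)\<^sup>2 \<le> env_norm A (smul A (sstar A a) a)"
          using up[OF _ p, of "smul A (sstar A a) a"] p a by (simp add: cstar_seminorm_def)
        then show "p a \<le> sqrt (env_norm A (smul A (sstar A a) a))" by (rule real_le_rsqrt)
      qed
      then show "(env_norm A a)\<^sup>2 \<le> env_norm A (smul A (sstar A a) a)"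
        using power_mono[OF _ nonneg[OF a], of _ 2] nonneg[of "smul A (sstar A a) a"] a by fastforce
    qed
    fix b assume b: "b \<in> scarrier A"
    show "env_norm A (sadd A a b) \<le> env_norm A a + env_norm A b"
    proof (rule env_norm_least)
      fix p assume p: "cstar_seminorm A p"
      have "p (sadd A a b) \<le> p a + p b" using p a b by (simp add: cstar_seminorm_def)
      then show "p (sadd A a b) \<le> env_norm A a + env_norm A b" using up[OF a p] up[OF b p] by simp
    qed
    show "env_norm A (smul A a b) \<le> env_norm A a * env_norm A b"
    proof (rule env_norm_least)
      fix p assume p: "cstar_seminorm A p"
      have "p (smul A a b) \<le> p a * p b" "0 \<le> p b" using p a b by (simp_all add: cstar_seminorm_def)
      then show "p (smul A a b) \<le> env_norm A a * env_norm A b"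
        using mult_mono[OF up[OF a p] up[OF b p] nonneg[OF a]] by simp
    qed
  qed
qed

lemma seminorm_comp_hom:
  "star_closed A \<Longrightarrow> star_hom A B h \<Longrightarrow> cstar_seminorm B p \<Longrightarrow> cstar_seminorm A (\<lambda>a. p (h a))"
  unfolding star_hom_def cstar_seminorm_def star_closed_def by auto

text \<open>A C*-seminorm of the target, composed with the homomorphism, is one of those whose supremum is the norm of the source.\<close>

lemma env_norm_hom_le:
  assumes "star_hom A B h" "star_closed A" "star_closed B" "env_bounded A" "env_bounded B" "a \<in> scarrier A"
  shows "env_norm B (h a) \<le> env_norm A a"
  by (rule env_norm_upper[OF assms(4,6)]) (intro seminorm_comp_hom[OF assms(2,1)] env_norm_seminorm assms)

text \<open>Along contractions the norms of the images of an element decrease, so they have a limit. This limit is a C*-seminorm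
  on the algebraic colimit.\<close>

locale cstar_sequence = star_sequence C \<Phi>
  for C :: "nat \<Rightarrow> 'a cstar_alg" and \<Phi> :: "nat \<Rightarrow> 'a \<Rightarrow> 'a" +
  assumes stage: "seminormed_star_algebra (C n) (snorm (C n))"
    and contractive: "a \<in> scarrier (C n) \<Longrightarrow> snorm (C (Suc n)) (\<Phi> n a) \<le> snorm (C n) a"
begin

lemma stage_algebra: "complex_star_algebra (C n)"
  using stage seminormed_star_algebra_def by auto

abbreviation "D \<equiv> star_colimit C \<Phi>"
abbreviation "q \<equiv> colimit_norm C \<Phi>"
abbreviation "dl \<equiv> dl_class C \<Phi>"

lemma colimit_zero: "dl n (szero (C n)) = szero D"
proof -
  have z: "szero (C n) \<in> scarrier (C n)" for n
    using stage_algebra by (simp add: complex_star_algebra.zero_closed)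
  have s0: "stage_map \<Phi> 0 n (szero (C 0)) = szero (C n)"
  proof -
    have "stage_map \<Phi> 0 n (sscale (C 0) 0 (szero (C 0))) = sscale (C n) 0 (stage_map \<Phi> 0 n (szero (C 0)))"
      using stage_map_ops(3)[OF z[of 0], of n 0] by simp
    then show ?thesis
      using complex_star_algebra.scale_zero[OF stage_algebra] z stage_map_closed[OF z[of 0], of n] by simp
  qed
  have "dl n (szero (C n)) = dl 0 (szero (C 0))"
    using dl_class_stage[OF z[of 0], of n] s0 by simp
  then show ?thesis by (simp add: star_colimit_def)
qed

lemma colimit_algebra: "complex_star_algebra D"
proof -
  note ax = complex_star_algebra.add_assoc[OF stage_algebra] complex_star_algebra.add_zero[OF stage_algebra]
    complex_star_algebra.scale_zero[OF stage_algebra] complex_star_algebra.scale_one[OF stage_algebra]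
    complex_star_algebra.scale_scale[OF stage_algebra] complex_star_algebra.scale_add_left[OF stage_algebra]
    complex_star_algebra.scale_add_right[OF stage_algebra] complex_star_algebra.mul_add_left[OF stage_algebra]
    complex_star_algebra.mul_add_right[OF stage_algebra] complex_star_algebra.mul_scale_left[OF stage_algebra]
    complex_star_algebra.mul_scale_right[OF stage_algebra] complex_star_algebra.star_add[OF stage_algebra]
    complex_star_algebra.star_scale[OF stage_algebra] complex_star_algebra.star_star[OF stage_algebra]
  have z [simp]: "szero (C n) \<in> scarrier (C n)" for n
    using stage_algebra by (simp add: complex_star_algebra.zero_closed)
  have zD: "szero D \<in> scarrier D" using dl_class_closed[OF z, of 0] by (simp add: colimit_zero)
  show ?thesis
  proof (unfold_locales, goal_cases)
    case 1
    then show ?case by (rule colimit_closed)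
  next
    case 2
    then show ?case by (rule zD)
  next
    case 3
    then show ?case by (rule_tac dl_class_cases3) (assumption+, simp add: colimit_ops ax)
  next
    case 4
    then show ?case by (rule_tac dl_class_cases2) (assumption+, simp add: colimit_ops complex_star_algebra.add_commute[OF stage_algebra])
  next
    case (5 a)
    then obtain n x where x: "x \<in> scarrier (C n)" and a: "a = dl n x" by (rule dl_class_cases)
    show ?case unfolding a colimit_zero[of n, symmetric] using x by (simp add: colimit_ops ax)
  next
    case 6
    then show ?case by (rule_tac dl_class_cases) (assumption+, simp add: colimit_ops ax colimit_zero)
  next
    case 7
    then show ?case by (rule_tac dl_class_cases) (assumption+, simp add: colimit_ops ax)
  next
    case 8
    then show ?case by (rule_tac dl_class_cases) (assumption+, simp add: colimit_ops ax)
  next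
    case 9
    then show ?case by (rule_tac dl_class_cases) (assumption+, simp add: colimit_ops ax)
  next
    case 10
    then show ?case by (rule_tac dl_class_cases2) (assumption+, simp add: colimit_ops ax)
  next
    case 11
    then show ?case by (rule_tac dl_class_cases3) (assumption+, simp add: colimit_ops ax)
  next
    case 12
    then show ?case by (rule_tac dl_class_cases3) (assumption+, simp add: colimit_ops ax)
  next
    case 13
    then show ?case by (rule_tac dl_class_cases2) (assumption+, simp add: colimit_ops ax)
  next
    case 14
    then show ?case by (rule_tac dl_class_cases2) (assumption+, simp add: colimit_ops ax)
  next
    case 15
    then show ?case by (rule_tac dl_class_cases2) (assumption+, simp add: colimit_ops ax)
  next
    case 16
    then show ?case by (rule_tac dl_class_cases) (assumption+, simp add: colimit_ops ax)
  next
    case 17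
    then show ?case by (rule_tac dl_class_cases) (assumption+, simp add: colimit_ops ax)
  qed
qed

lemma stage_norm_decreasing:
  assumes "a \<in> scarrier (C n)"
  shows "decseq (\<lambda>k. snorm (C (n + k)) (stage_map \<Phi> n k a))"
  using contractive[OF stage_map_closed[OF assms]] by (intro decseq_SucI) simp

lemma stage_norm_nonneg: "a \<in> scarrier (C n) \<Longrightarrow> 0 \<le> snorm (C n) a"
  using stage[of n] by (rule seminormed_star_algebra.p_nonneg)

lemma stage_norm_convergent:
  assumes "a \<in> scarrier (C n)"
  shows "convergent (\<lambda>k. snorm (C (n + k)) (stage_map \<Phi> n k a))"
  using decseq_convergent[OF stage_norm_decreasing[OF assms], of 0] stage_norm_nonneg[OF stage_map_closed[OF assms]]
  unfolding convergent_def by blast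

lemma colimit_norm_eq:
  assumes a: "a \<in> scarrier (C n)" and lim: "(\<lambda>k. snorm (C (n + k)) (stage_map \<Phi> n k a)) \<longlonglongrightarrow> c"
  shows "q (dl n a) = c"
proof -
  have lim': "(\<lambda>k. snorm (C (m + k)) (stage_map \<Phi> m k b)) \<longlonglongrightarrow> c" if mb: "(m, b) \<in> dl n a" for m b
  proof -
    obtain k l where kl: "b \<in> scarrier (C m)" "n + k = m + l" "stage_map \<Phi> n k a = stage_map \<Phi> m l b"
      using mb unfolding dl_class_def by auto
    have "snorm (C (n + (i + k))) (stage_map \<Phi> n (i + k) a) = snorm (C (m + (i + l))) (stage_map \<Phi> m (i + l) b)" for i
    proof -
      have "n + (i + k) = m + (i + l)" using kl(2) by simp
      moreover have "stage_map \<Phi> n (k + i) a = stage_map \<Phi> m (l + i) b" by (rule stage_map_eq_later[OF kl(2,3)])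
      ultimately show ?thesis by (simp only: add.commute[of i])
    qed
    then have "(\<lambda>i. snorm (C (m + (i + l))) (stage_map \<Phi> m (i + l) b)) \<longlonglongrightarrow> c"
      using LIMSEQ_ignore_initial_segment[OF lim, of k] by simp
    then show ?thesis by (rule LIMSEQ_offset)
  qed
  show ?thesis
    unfolding colimit_norm_def
  proof (rule the_equality)
    fix c' assume "\<forall>(m, b)\<in>dl n a. (\<lambda>k. snorm (C (m + k)) (stage_map \<Phi> m k b)) \<longlonglongrightarrow> c'"
    then show "c' = c" using dl_class_self[OF a] LIMSEQ_unique[OF _ lim] by blast
  qed (use lim' in blast)
qed

lemma colimit_norm_tendsto:
  "a \<in> scarrier (C n) \<Longrightarrow> (\<lambda>k. snorm (C (n + k)) (stage_map \<Phi> n k a)) \<longlonglongrightarrow> q (dl n a)"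
  using stage_norm_convergent colimit_norm_eq unfolding convergent_def by blast

lemma colimit_norm_le: "a \<in> scarrier (C n) \<Longrightarrow> q (dl n a) \<le> snorm (C n) a"
  using decseq_ge[OF stage_norm_decreasing colimit_norm_tendsto, of a n 0] by simp

lemma colimit_seminorm: "cstar_seminorm D q"
  unfolding cstar_seminorm_def
proof (intro conjI allI ballI)
  note [simp] = seminormed_star_algebra.p_scale[OF stage] seminormed_star_algebra.p_cstar[OF stage]
  fix P assume "P \<in> scarrier D"
  then obtain n a where a: "a \<in> scarrier (C n)" and P: "P = dl n a" by (rule dl_class_cases)
  note cl = stage_map_closed[OF a]
  note lim = colimit_norm_tendsto[OF a]
  show "0 \<le> q P" unfolding P
    by (rule LIMSEQ_le_const[OF lim]) (use stage_norm_nonneg[OF cl] in auto)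
  show "q (sscale D c P) = cmod c * q P" for c
    unfolding P colimit_ops(3)[OF a]
    by (rule colimit_norm_eq) (use tendsto_mult[OF tendsto_const lim] a in \<open>auto simp: stage_map_ops\<close>)
  show "q (smul D (sstar D P) P) = (q P)\<^sup>2"
    unfolding P colimit_ops(4)[OF a] colimit_ops(2)[OF closed_ops(4)[OF a] a]
    by (rule colimit_norm_eq) (use tendsto_power[OF lim] a in \<open>auto simp: stage_map_ops\<close>)
next
  fix P Q assume "P \<in> scarrier D" "Q \<in> scarrier D"
  then obtain n a b where a: "a \<in> scarrier (C n)" and b: "b \<in> scarrier (C n)"
    and P: "P = dl n a" and Q: "Q = dl n b" by (rule dl_class_cases2)
  note lim = colimit_norm_tendsto[OF a] colimit_norm_tendsto[OF b]
  show "q (sadd D P Q) \<le> q P + q Q"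
    unfolding P Q colimit_ops(1)[OF a b]
    by (rule LIMSEQ_le[OF colimit_norm_tendsto tendsto_add[OF lim]])
       (use a b in \<open>auto simp: stage_map_ops seminormed_star_algebra.p_add[OF stage]\<close>)
  show "q (smul D P Q) \<le> q P * q Q"
    unfolding P Q colimit_ops(2)[OF a b]
    by (rule LIMSEQ_le[OF colimit_norm_tendsto tendsto_mult[OF lim]])
       (use a b in \<open>auto simp: stage_map_ops seminormed_star_algebra.p_mul[OF stage]\<close>)
qed

end

text \<open>Homomorphisms are contractions for enveloping norms, so the enveloping C*-algebras of an algebraic colimit form a sequence of
  contractions.\<close>

locale env_cocone = star_cocone A \<phi> B \<mu>
  for A :: "nat \<Rightarrow> (complex, 'a, 'm) star_alg_scheme" and \<phi> :: "nat \<Rightarrow> 'a \<Rightarrow> 'a"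
    and B :: "(complex, 'b, 'n) star_alg_scheme" and \<mu> :: "nat \<Rightarrow> 'a \<Rightarrow> 'b" +
  assumes alg: "complex_star_algebra (A n)" and bounded: "env_bounded (A n)"
    and alg_B: "complex_star_algebra B" and bounded_B: "env_bounded B"
begin

lemma seminormed: "seminormed_star_algebra (A n) (env_norm (A n))"
  using alg bounded by (simp add: seminormed_star_algebra_def seminormed_star_algebra_axioms_def
      env_norm_seminorm complex_star_algebra.closed)

lemma seminormed_B: "seminormed_star_algebra B (env_norm B)"
  using alg_B bounded_B by (simp add: seminormed_star_algebra_def seminormed_star_algebra_axioms_def
      env_norm_seminorm complex_star_algebra.closed)

abbreviation "C n \<equiv> env_cstar (A n)"
abbreviation "\<Phi> n \<equiv> env_map (A (Suc n)) (\<phi> n)"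
abbreviation "Cau n \<equiv> cauchy_seqs (A n) (env_norm (A n))"
abbreviation "cls n \<equiv> completion_class (A n) (env_norm (A n))"

lemma norm_step_le: "a \<in> scarrier (A n) \<Longrightarrow> env_norm (A (Suc n)) (\<phi> n a) \<le> env_norm (A n) a"
  by (rule env_norm_hom_le[OF hom closed closed bounded bounded])

lemma norm_diff_step_le:
  assumes "a \<in> scarrier (A n)" "b \<in> scarrier (A n)"
  shows "env_norm (A (Suc n)) (sdiff (A (Suc n)) (\<phi> n a) (\<phi> n b)) \<le> env_norm (A n) (sdiff (A n) a b)"
  using norm_step_le[of "sdiff (A n) a b" n] star_hom_diff[OF hom alg assms] assms
  by (simp add: sdiff_def)

lemma step_cauchy: assumes "s \<in> Cau n" shows "(\<lambda>i. \<phi> n (s i)) \<in> Cau (Suc n)"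
proof -
  have s: "s i \<in> scarrier (A n)" for i using assms unfolding cauchy_seqs_def by auto
  then show ?thesis
    using assms hom[of n] le_less_trans[OF norm_diff_step_le[OF s s]]
    unfolding cauchy_seqs_def star_hom_def by (auto, metis)
qed

lemma step_class: assumes s: "s \<in> Cau n" shows "\<Phi> n (cls n s) = cls (Suc n) (\<lambda>i. \<phi> n (s i))"
proof -
  interpret N: seminormed_star_algebra "A n" "env_norm (A n)" by (rule seminormed)
  interpret S: seminormed_star_algebra "A (Suc n)" "env_norm (A (Suc n))" by (rule seminormed)
  have "cls (Suc n) (\<lambda>i. \<phi> n (t i)) = cls (Suc n) (\<lambda>i. \<phi> n (s i))" if t: "t \<in> cls n s" for t
  proof -
    note t = N.class_memD[OF t]
    note st = S.cauchy_in[OF step_cauchy[OF s]] S.cauchy_in[OF step_cauchy[OF t(1)]]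
    have "(\<lambda>i. env_norm (A (Suc n)) (sdiff (A (Suc n)) (\<phi> n (s i)) (\<phi> n (t i)))) \<longlonglongrightarrow> 0"
      by (rule real_tendsto_sandwich[OF _ _ tendsto_const t(2)])
         (use st norm_diff_step_le s t(1) in \<open>auto intro!: always_eventually\<close>)
    then show ?thesis using S.class_eq_iff[OF step_cauchy[OF s] step_cauchy[OF t(1)]] by simp
  qed
  then show ?thesis unfolding env_map_def using N.class_self[OF s] by blast
qed


lemma step_hom: "star_hom (C n) (C (Suc n)) (\<Phi> n)"
proof -
  interpret N: seminormed_star_algebra "A n" "env_norm (A n)" by (rule seminormed)
  interpret S: seminormed_star_algebra "A (Suc n)" "env_norm (A (Suc n))" by (rule seminormed)
  have ex: "\<exists>s\<in>Cau n. P = cls n s" if "P \<in> scarrier (C n)" for P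
    using that by (auto simp: env_cstar_def N.completion_carrier)
  note [simp] = N.completion_ops S.completion_ops N.cauchy_ops S.cauchy_ops step_class step_cauchy env_cstar_def
  show ?thesis
    unfolding star_hom_def
    by (intro conjI ballI allI; (drule ex)+; elim bexE)
       (use hom[of n] in \<open>simp_all add: S.completion_carrier star_hom_def\<close>)
qed

lemma stage_seminormed: "seminormed_star_algebra (C n) (snorm (C n))"
proof -
  interpret N: seminormed_star_algebra "A n" "env_norm (A n)" by (rule seminormed)
  show ?thesis
    using N.completion_algebra N.completion_seminorm
    by (simp add: env_cstar_def seminormed_star_algebra_def seminormed_star_algebra_axioms_def)
qed

lemma step_contractive:
  assumes "P \<in> scarrier (C n)"
  shows "snorm (C (Suc n)) (\<Phi> n P) \<le> snorm (C n) P"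
proof -
  interpret N: seminormed_star_algebra "A n" "env_norm (A n)" by (rule seminormed)
  interpret S: seminormed_star_algebra "A (Suc n)" "env_norm (A (Suc n))" by (rule seminormed)
  obtain s where s: "s \<in> Cau n" "P = cls n s" using assms by (auto simp: env_cstar_def N.completion_carrier)
  show ?thesis unfolding s(2) env_cstar_def step_class[OF s(1)]
    by (rule LIMSEQ_le[OF S.completion_norm_tendsto[OF step_cauchy[OF s(1)]] N.completion_norm_tendsto[OF s(1)]])
       (use s(1) norm_step_le in auto)
qed

sublocale colim: cstar_sequence C \<Phi>
proof (intro cstar_sequence.intro star_sequence.intro cstar_sequence_axioms.intro)
  show "star_closed (C n)" for n
    using stage_seminormed[of n] unfolding seminormed_star_algebra_def by (simp add: complex_star_algebra.closed)
qed (fact step_hom stage_seminormed step_contractive)+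

lemma const_cauchy: "a \<in> scarrier (A n) \<Longrightarrow> (\<lambda>_. a) \<in> Cau n"
  using seminormed by (rule seminormed_star_algebra.cauchy_const)

lemma const_class_closed: "a \<in> scarrier (A n) \<Longrightarrow> cls n (\<lambda>_. a) \<in> scarrier (C n)"
  using seminormed_star_algebra.completion_carrier[OF seminormed] const_cauchy by (auto simp: env_cstar_def)

lemma stage_const_class:
  "a \<in> scarrier (A n) \<Longrightarrow> stage_map \<Phi> n k (cls n (\<lambda>_. a)) = cls (n + k) (\<lambda>_. stage_map \<phi> n k a)"
  by (induction k) (simp_all add: step_class const_cauchy)

definition into_colimit :: "'b \<Rightarrow> (nat \<times> (nat \<Rightarrow> 'a) set) set" where
  "into_colimit b = \<Union> {colim.dl n (cls n (\<lambda>_. a)) | n a. a \<in> scarrier (A n) \<and> \<mu> n a = b}"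

lemma into_colimit_leg:
  assumes a: "a \<in> scarrier (A n)"
  shows "into_colimit (\<mu> n a) = colim.dl n (cls n (\<lambda>_. a))"
proof -
  have "colim.dl m (cls m (\<lambda>_. b)) = colim.dl n (cls n (\<lambda>_. a))"
    if b: "b \<in> scarrier (A m)" and eq: "\<mu> m b = \<mu> n a" for m b
  proof -
    obtain k l where kl: "m + k = n + l" "stage_map \<phi> m k b = stage_map \<phi> n l a"
      using eq legs_eq_iff[OF b a] dl_class_eq_iff[OF b a] by auto
    have "stage_map \<Phi> m k (cls m (\<lambda>_. b)) = stage_map \<Phi> n l (cls n (\<lambda>_. a))"
      unfolding stage_const_class[OF b] stage_const_class[OF a] kl ..
    then show ?thesis
      unfolding colim.dl_class_eq_iff[OF const_class_closed[OF b] const_class_closed[OF a]] using kl(1) by blast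
  qed
  then show ?thesis unfolding into_colimit_def using a by blast
qed

lemma const_class_ops:
  assumes "a \<in> scarrier (A n)"
  shows "b \<in> scarrier (A n) \<Longrightarrow> cls n (\<lambda>_. sadd (A n) a b) = sadd (C n) (cls n (\<lambda>_. a)) (cls n (\<lambda>_. b))"
    and "b \<in> scarrier (A n) \<Longrightarrow> cls n (\<lambda>_. smul (A n) a b) = smul (C n) (cls n (\<lambda>_. a)) (cls n (\<lambda>_. b))"
    and "cls n (\<lambda>_. sscale (A n) c a) = sscale (C n) c (cls n (\<lambda>_. a))"
    and "cls n (\<lambda>_. sstar (A n) a) = sstar (C n) (cls n (\<lambda>_. a))"
  using assms by (simp_all add: env_cstar_def seminormed_star_algebra.completion_ops[OF seminormed] const_cauchy)

lemma into_colimit_hom: "star_hom B colim.D into_colimit"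
  unfolding star_hom_def
proof (intro conjI ballI allI)
  fix b assume "b \<in> scarrier B"
  then obtain n x where x: "x \<in> scarrier (A n)" "b = \<mu> n x" using legs_surj by metis
  then show "into_colimit b \<in> scarrier colim.D"
    and "into_colimit (sscale B c b) = sscale colim.D c (into_colimit b)"
    and "into_colimit (sstar B b) = sstar colim.D (into_colimit b)" for c
    by (simp_all add: leg_ops(2-)[symmetric] into_colimit_leg const_class_closed colim.colimit_ops const_class_ops)
next
  fix a b assume "a \<in> scarrier B" "b \<in> scarrier B"
  then obtain n x y where "x \<in> scarrier (A n)" "y \<in> scarrier (A n)" "a = \<mu> n x" "b = \<mu> n y"
    by (rule leg_cases2)
  then show "into_colimit (sadd B a b) = sadd colim.D (into_colimit a) (into_colimit b)"
    and "into_colimit (smul B a b) = smul colim.D (into_colimit a) (into_colimit b)"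
    by (simp_all add: leg_ops(2-)[symmetric] into_colimit_leg const_class_closed colim.colimit_ops const_class_ops)
qed

text \<open>The colimit seminorm pulls back to a C*-seminorm on \<open>B\<close>, hence is at most the enveloping norm
  of \<open>B\<close>; conversely the enveloping norm of \<open>B\<close> pulls back to a C*-seminorm on every stage, hence is
  at most each term of the sequence whose limit is the colimit seminorm.\<close>

lemma into_colimit_isometric:
  assumes b: "b \<in> scarrier B"
  shows "colim.q (into_colimit b) = env_norm B b"
proof (rule antisym)
  show "colim.q (into_colimit b) \<le> env_norm B b"
    by (rule env_norm_upper[OF bounded_B b])
       (rule seminorm_comp_hom[OF complex_star_algebra.closed[OF alg_B] into_colimit_hom colim.colimit_seminorm])
  obtain n a where a: "a \<in> scarrier (A n)" "b = \<mu> n a" using legs_surj[OF b] by metis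
  have "env_norm B b \<le> snorm (C (n + k)) (stage_map \<Phi> n k (cls n (\<lambda>_. a)))" for k
  proof -
    have "env_norm B b \<le> env_norm (A (n + k)) (stage_map \<phi> n k a)"
      using env_norm_hom_le[OF leg_hom closed complex_star_algebra.closed[OF alg_B] bounded bounded_B
          stage_map_closed[OF a(1)], of k] leg_stage[OF a(1), of k] a(2) by simp
    then show ?thesis
      unfolding stage_const_class[OF a(1)]
      using seminormed_star_algebra.completion_norm_const[OF seminormed stage_map_closed[OF a(1)]]
      by (simp add: env_cstar_def)
  qed
  then show "env_norm B b \<le> colim.q (into_colimit b)"
    unfolding a(2) into_colimit_leg[OF a(1)]
    by (intro LIMSEQ_le_const[OF colim.colimit_norm_tendsto[OF const_class_closed[OF a(1)]]]) auto
qed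

text \<open>An element of the colimit lives at some stage, where it is approximated by constant classes.\<close>

lemma into_colimit_dense:
  assumes "P \<in> scarrier colim.D" "e > 0"
  shows "\<exists>b\<in>scarrier B. colim.q (sdiff colim.D P (into_colimit b)) < e"
proof -
  obtain n c where c: "c \<in> scarrier (C n)" and P: "P = colim.dl n c" using assms(1) by (rule colim.dl_class_cases)
  obtain a where a: "a \<in> scarrier (A n)" and lt: "snorm (C n) (sdiff (C n) c (cls n (\<lambda>_. a))) < e"
    using seminormed_star_algebra.completion_const_dense[OF seminormed, of c n e] c assms(2)
    unfolding env_cstar_def by blast
  have "sdiff colim.D P (into_colimit (\<mu> n a)) = colim.dl n (sdiff (C n) c (cls n (\<lambda>_. a)))"
    unfolding P into_colimit_leg[OF a] sdiff_def
    using c const_class_closed[OF a] by (simp add: colim.colimit_ops)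
  moreover have "sdiff (C n) c (cls n (\<lambda>_. a)) \<in> scarrier (C n)"
    unfolding sdiff_def using c const_class_closed[OF a] by simp
  ultimately have "colim.q (sdiff colim.D P (into_colimit (\<mu> n a))) < e"
    using le_less_trans[OF colim.colimit_norm_le lt] by simp
  then show ?thesis using leg_ops(1)[OF a] by blast
qed

theorem cstar_isomorphic_colimit: "cstar_isomorphic (env_cstar B) (cstar_colimit C \<Phi>)"
  unfolding env_cstar_def[of B] cstar_colimit_def
proof (rule completion_isomorphic[OF seminormed_B _ into_colimit_hom into_colimit_isometric into_colimit_dense])
  show "seminormed_star_algebra colim.D colim.q"
    by (intro seminormed_star_algebra.intro seminormed_star_algebra_axioms.intro
        colim.colimit_algebra colim.colimit_seminorm)
qed

end

section \<open>Deaconu-Renault groupoids of zero-dimensional systems\<close>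

definition clopenin :: "'a topology \<Rightarrow> 'a set \<Rightarrow> bool" where
  "clopenin X U \<longleftrightarrow> openin X U \<and> closedin X U"

lemma clopenin_subset: "clopenin X U \<Longrightarrow> U \<subseteq> topspace X"
  unfolding clopenin_def by (simp add: openin_subset)

lemma clopenin_topspace [simp]: "clopenin X (topspace X)"
  unfolding clopenin_def by simp

lemma clopenin_Int [intro]: "clopenin X U \<Longrightarrow> clopenin X V \<Longrightarrow> clopenin X (U \<inter> V)"
  unfolding clopenin_def by auto

lemma clopenin_diff [intro]: "clopenin X U \<Longrightarrow> clopenin X V \<Longrightarrow> clopenin X (U - V)"
  unfolding clopenin_def by auto

lemma clopenin_Union: "finite \<U> \<Longrightarrow> (\<And>U. U \<in> \<U> \<Longrightarrow> clopenin X U) \<Longrightarrow> clopenin X (\<Union>\<U>)"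
  unfolding clopenin_def by (auto intro: closedin_Union)

lemma clopenin_preimage:
  "continuous_map X Y f \<Longrightarrow> clopenin Y V \<Longrightarrow> clopenin X {x \<in> topspace X. f x \<in> V}"
  unfolding clopenin_def using openin_continuous_map_preimage closedin_continuous_map_preimage by blast

text \<open>Differences of clopen sets are clopen, so the members of a finite family can be removed from each other in turn.\<close>

lemma disjoint_clopen_refinement:
  assumes "finite \<V>" and "\<And>V. V \<in> \<V> \<Longrightarrow> clopenin X V \<and> P V" and mono: "\<And>V W. P V \<Longrightarrow> W \<subseteq> V \<Longrightarrow> P W"
  shows "\<exists>\<W>. finite \<W> \<and> disjoint \<W> \<and> \<Union>\<W> = \<Union>\<V> \<and> (\<forall>W\<in>\<W>. clopenin X W \<and> P W)"
  using assms(1,2)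
proof (induction \<V> rule: finite_induct)
  case empty
  then show ?case by (intro exI[of _ "{}"]) simp
next
  case (insert V \<V>)
  then obtain \<W> where W: "finite \<W>" "disjoint \<W>" "\<Union>\<W> = \<Union>\<V>" "\<forall>W\<in>\<W>. clopenin X W \<and> P W" by auto
  have "clopenin X (V - \<Union>\<W>)" using insert.prems W by (intro clopenin_diff clopenin_Union) auto
  moreover have "P (V - \<Union>\<W>)" using mono[of V] insert.prems by auto
  moreover have "disjoint (insert (V - \<Union>\<W>) \<W>)"
    using W(2) unfolding disjoint_def by blast
  moreover have "\<Union>(insert (V - \<Union>\<W>) \<W>) = \<Union>(insert V \<V>)" using W(3) by auto
  ultimately show ?case using W by (intro exI[of _ "insert (V - \<Union>\<W>) \<W>"]) simp
qed

text \<open>A local homeomorphism of a zero-dimensional compact Hausdorff space, given as an open and locally injective map.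
  Total disconnectedness enters as a base of clopen sets.\<close>

locale ample_system =
  fixes X :: "'a topology" and \<sigma> :: "'a \<Rightarrow> 'a"
  assumes compact: "compact_space X" and hausdorff: "Hausdorff_space X"
    and clopen_base: "\<lbrakk>openin X U; x \<in> U\<rbrakk> \<Longrightarrow> \<exists>V. clopenin X V \<and> x \<in> V \<and> V \<subseteq> U"
    and continuous: "continuous_map X X \<sigma>" and open_map: "open_map X X \<sigma>"
    and locally_inj: "x \<in> topspace X \<Longrightarrow> \<exists>U. openin X U \<and> x \<in> U \<and> inj_on \<sigma> U"
begin

lemma iterate_continuous: "continuous_map X X (\<sigma> ^^ n)"
proof (induction n)
  case (Suc n)
  show ?case using continuous_map_compose[OF Suc continuous] by (simp add: comp_def)
qed (simp add: id_def[symmetric])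

lemma iterate_closed [simp]: "x \<in> topspace X \<Longrightarrow> (\<sigma> ^^ n) x \<in> topspace X"
  using iterate_continuous[of n] by (simp add: continuous_map_def Pi_iff)

lemma iterate_open_map: "open_map X X (\<sigma> ^^ n)"
proof (induction n)
  case (Suc n)
  show ?case using open_map_compose[OF Suc open_map] by (simp add: comp_def)
qed (simp add: open_map_def)

lemma iterate_locally_inj:
  assumes "x \<in> topspace X" shows "\<exists>U. openin X U \<and> x \<in> U \<and> inj_on (\<sigma> ^^ n) U"
proof (induction n)
  case 0
  then show ?case using assms by (intro exI[of _ "topspace X"]) simp
next
  case (Suc n)
  then obtain U where U: "openin X U" "x \<in> U" "inj_on (\<sigma> ^^ n) U" by auto
  obtain V where V: "openin X V" "(\<sigma> ^^ n) x \<in> V" "inj_on \<sigma> V"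
    using locally_inj[OF iterate_closed[OF assms]] by metis
  have "openin X (U \<inter> {y \<in> topspace X. (\<sigma> ^^ n) y \<in> V})"
    using U(1) openin_continuous_map_preimage[OF iterate_continuous V(1)] by auto
  moreover have "inj_on (\<sigma> ^^ Suc n) (U \<inter> {y \<in> topspace X. (\<sigma> ^^ n) y \<in> V})"
    using U(3) V(3) unfolding inj_on_def by simp
  ultimately show ?case using U(2) V(2) assms by blast
qed

lemma clopen_image: "clopenin X U \<Longrightarrow> clopenin X ((\<sigma> ^^ n) ` U)"
  unfolding clopenin_def
  by (meson iterate_open_map open_map_def iterate_continuous image_compactin closedin_compact_space compact
      compactin_imp_closedin hausdorff)

lemma clopen_preimage: "clopenin X V \<Longrightarrow> clopenin X {x \<in> topspace X. (\<sigma> ^^ n) x \<in> V}"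
  by (rule clopenin_preimage[OF iterate_continuous])

lemma clopen_inj_partition:
  assumes "clopenin X W"
  obtains \<W> where "finite \<W>" "disjoint \<W>" "\<Union>\<W> = W" "\<And>V. V \<in> \<W> \<Longrightarrow> clopenin X V" "\<And>V. V \<in> \<W> \<Longrightarrow> inj_on (\<sigma> ^^ n) V"
proof -
  have "\<exists>V. clopenin X V \<and> x \<in> V \<and> V \<subseteq> W \<and> inj_on (\<sigma> ^^ n) V" if x: "x \<in> W" for x
  proof -
    obtain U where U: "openin X U" "x \<in> U" "inj_on (\<sigma> ^^ n) U"
      using iterate_locally_inj clopenin_subset[OF assms] x by blast
    have "openin X (U \<inter> W)" using U assms by (auto simp: clopenin_def)
    then obtain V where "clopenin X V" "x \<in> V" "V \<subseteq> U \<inter> W" using clopen_base[of "U \<inter> W" x] U x by auto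
    then show ?thesis using U(3) by (auto intro: inj_on_subset)
  qed
  then obtain \<U> where \<U>: "\<And>x. x \<in> W \<Longrightarrow> clopenin X (\<U> x) \<and> x \<in> \<U> x \<and> \<U> x \<subseteq> W \<and> inj_on (\<sigma> ^^ n) (\<U> x)" by metis
  have "compactin X W" using assms compact closedin_compact_space unfolding clopenin_def by blast
  then have "\<exists>\<F>. finite \<F> \<and> \<F> \<subseteq> \<U> ` W \<and> W \<subseteq> \<Union>\<F>"
    using \<U> unfolding compactin_def clopenin_def by (elim conjE allE[of _ "\<U> ` W"]) blast
  then obtain \<F> where \<F>: "finite \<F>" "\<F> \<subseteq> \<U> ` W" "W \<subseteq> \<Union>\<F>" by auto
  have "\<exists>\<W>. finite \<W> \<and> disjoint \<W> \<and> \<Union>\<W> = \<Union>\<F> \<and> (\<forall>V\<in>\<W>. clopenin X V \<and> inj_on (\<sigma> ^^ n) V)"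
  proof -
    have "clopenin X V \<and> inj_on (\<sigma> ^^ n) V" if "V \<in> \<F>" for V using that \<U> \<F>(2) by blast
    then show ?thesis
      using disjoint_clopen_refinement[OF \<F>(1), of X "inj_on (\<sigma> ^^ n)"] by (auto intro: inj_on_subset)
  qed
  then obtain \<W> where "finite \<W>" "disjoint \<W>" "\<Union>\<W> = \<Union>\<F>" "\<forall>V\<in>\<W>. clopenin X V \<and> inj_on (\<sigma> ^^ n) V"
    by blast
  moreover have "\<Union>\<F> = W" using \<F> \<U> by blast
  ultimately show ?thesis using that by auto
qed

lemma finite_fibre: "finite {y \<in> topspace X. (\<sigma> ^^ n) y = w}"
proof -
  obtain \<W> where W: "finite \<W>" "\<Union>\<W> = topspace X" "\<And>V. V \<in> \<W> \<Longrightarrow> inj_on (\<sigma> ^^ n) V"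
    using clopen_inj_partition[OF clopenin_topspace] by metis
  have "finite {y \<in> V. (\<sigma> ^^ n) y = w}" if "V \<in> \<W>" for V
  proof (rule finite_imageD)
    show "finite ((\<sigma> ^^ n) ` {y \<in> V. (\<sigma> ^^ n) y = w})" by (rule finite_subset[of _ "{w}"]) auto
    show "inj_on (\<sigma> ^^ n) {y \<in> V. (\<sigma> ^^ n) y = w}" by (rule inj_on_subset[OF W(3)[OF that]]) auto
  qed
  moreover have "{y \<in> topspace X. (\<sigma> ^^ n) y = w} = (\<Union>V\<in>\<W>. {y \<in> V. (\<sigma> ^^ n) y = w})" using W(2) by auto
  ultimately show ?thesis using W(1) by simp
qed

end

lemma iterate_eq_later:
  fixes \<sigma> :: "'a \<Rightarrow> 'a"
  assumes "(\<sigma> ^^ m) x = (\<sigma> ^^ n) y" shows "(\<sigma> ^^ (m + l)) x = (\<sigma> ^^ (n + l)) y"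
  using assms by (simp only: add.commute[of _ l] funpow_add comp_apply)

lemma dr_basic_iff:
  "(x, k, y) \<in> dr_basic X \<sigma> U m n V \<longleftrightarrow>
    k = int m - int n \<and> x \<in> U \<and> y \<in> V \<and> (\<sigma> ^^ m) x = (\<sigma> ^^ n) y"
  unfolding dr_basic_def by auto

definition arrows :: "'a topology \<Rightarrow> ('a \<Rightarrow> 'a) \<Rightarrow> ('a \<times> int \<times> 'a) set" where
  "arrows X \<sigma> = (\<Union>m n. dr_basic X \<sigma> (topspace X) m n (topspace X))"

lemma arrows_iff:
  "(x, k, y) \<in> arrows X \<sigma> \<longleftrightarrow> x \<in> topspace X \<and> y \<in> topspace X \<and>
    (\<exists>m n. k = int m - int n \<and> (\<sigma> ^^ m) x = (\<sigma> ^^ n) y)"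
  unfolding arrows_def by (auto simp: dr_basic_iff)

lemma dr_basic_subset_arrows:
  "U \<subseteq> topspace X \<Longrightarrow> V \<subseteq> topspace X \<Longrightarrow> dr_basic X \<sigma> U m n V \<subseteq> arrows X \<sigma>"
proof
  fix \<gamma> assume "U \<subseteq> topspace X" "V \<subseteq> topspace X" "\<gamma> \<in> dr_basic X \<sigma> U m n V"
  then have "\<gamma> \<in> dr_basic X \<sigma> (topspace X) m n (topspace X)" by (auto simp: dr_basic_def)
  then show "\<gamma> \<in> arrows X \<sigma>" by (auto simp: arrows_def)
qed

lemma topspace_dr: "topspace (gtop (dr_groupoid X \<sigma>)) = arrows X \<sigma>"
proof -
  have "\<Union>{dr_basic X \<sigma> U m n V | U m n V. openin X U \<and> openin X V} = arrows X \<sigma>"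
  proof (intro equalityI subsetI)
    fix g assume "g \<in> \<Union>{dr_basic X \<sigma> U m n V | U m n V. openin X U \<and> openin X V}"
    then obtain U m n V where g: "g \<in> dr_basic X \<sigma> U m n V" "openin X U" "openin X V" by blast
    then have "g \<in> dr_basic X \<sigma> (topspace X) m n (topspace X)"
      using openin_subset[OF g(2)] openin_subset[OF g(3)] by (auto simp: dr_basic_def)
    then show "g \<in> arrows X \<sigma>" by (auto simp: arrows_def)
  next
    fix g assume "g \<in> arrows X \<sigma>"
    then obtain m n where "g \<in> dr_basic X \<sigma> (topspace X) m n (topspace X)" by (auto simp: arrows_def)
    then show "g \<in> \<Union>{dr_basic X \<sigma> U m n V | U m n V. openin X U \<and> openin X V}"
      using openin_topspace[of X] by blast
  qed
  then show ?thesis by (simp add: dr_groupoid_def topology_generated_by_topspace)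
qed

lemma arrow_late:
  assumes "(x, k, y) \<in> arrows X \<sigma>"
  obtains m n where "m \<ge> M" "n \<ge> M" "k = int m - int n" "(\<sigma> ^^ m) x = (\<sigma> ^^ n) y"
proof -
  obtain m n where "k = int m - int n" "(\<sigma> ^^ m) x = (\<sigma> ^^ n) y" using assms by (auto simp: arrows_iff)
  then show ?thesis using that[of "m + M" "n + M"] iterate_eq_later[of m \<sigma> x n y M] by simp
qed

lemma arrow_inverse: "(x, k, y) \<in> arrows X \<sigma> \<Longrightarrow> (y, - k, x) \<in> arrows X \<sigma>"
  by (auto simp: arrows_iff) (metis minus_diff_eq)

lemma arrow_compose:
  assumes "(x, p, y) \<in> arrows X \<sigma>" "(y, q, z) \<in> arrows X \<sigma>" shows "(x, p + q, z) \<in> arrows X \<sigma>"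
proof -
  obtain m n where 1: "p = int m - int n" "(\<sigma> ^^ m) x = (\<sigma> ^^ n) y" using assms(1) by (auto simp: arrows_iff)
  obtain m' n' where 2: "q = int m' - int n'" "(\<sigma> ^^ m') y = (\<sigma> ^^ n') z" using assms(2) by (auto simp: arrows_iff)
  have "(\<sigma> ^^ (m + m')) x = (\<sigma> ^^ (n' + n)) z"
    using iterate_eq_later[OF 1(2), of m'] iterate_eq_later[OF 2(2), of n] by (simp add: add.commute)
  moreover have "p + q = int (m + m') - int (n' + n)" using 1(1) 2(1) by simp
  ultimately show ?thesis using assms by (auto simp: arrows_iff simp del: of_nat_add)
qed

subsection \<open>The Steinberg algebra is spanned by indicators of basic compact open sets\<close>

definition dr_ind :: "'a topology \<Rightarrow> ('a \<Rightarrow> 'a) \<Rightarrow> 'k::field \<Rightarrow> 'a set \<Rightarrow> nat \<Rightarrow> nat \<Rightarrow> 'a set \<Rightarrow> 'a \<times> int \<times> 'a \<Rightarrow> 'k" where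
  "dr_ind X \<sigma> c U m n V = (\<lambda>\<gamma>. if \<gamma> \<in> dr_basic X \<sigma> U m n V then c else 0)"

text \<open>The linear span of the indicators of the sets \<open>Z(U, m, n, V)\<close> with \<open>U\<close>, \<open>V\<close> clopen. As an inductive set it reduces linear
  statements about functions on the groupoid to indicators.\<close>

inductive_set dr_span :: "'a topology \<Rightarrow> ('a \<Rightarrow> 'a) \<Rightarrow> ('a \<times> int \<times> 'a \<Rightarrow> 'k::field) set"
  for X \<sigma> where
  zero: "(\<lambda>_. 0) \<in> dr_span X \<sigma>"
| ind_add: "\<lbrakk>f \<in> dr_span X \<sigma>; clopenin X U; clopenin X V\<rbrakk> \<Longrightarrow>
    (\<lambda>\<gamma>. dr_ind X \<sigma> c U m n V \<gamma> + f \<gamma>) \<in> dr_span X \<sigma>"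

lemma dr_ind_span: "\<lbrakk>clopenin X U; clopenin X V\<rbrakk> \<Longrightarrow> dr_ind X \<sigma> c U m n V \<in> dr_span X \<sigma>"
  using dr_span.ind_add[OF dr_span.zero, of X U V \<sigma> c m n] by simp

lemma dr_span_add: "\<lbrakk>f \<in> dr_span X \<sigma>; g \<in> dr_span X \<sigma>\<rbrakk> \<Longrightarrow> (\<lambda>\<gamma>. f \<gamma> + g \<gamma>) \<in> dr_span X \<sigma>"
  by (induction rule: dr_span.induct) (auto simp: add.assoc intro: dr_span.ind_add)

lemma dr_span_sum: "(\<And>i. i \<in> I \<Longrightarrow> f i \<in> dr_span X \<sigma>) \<Longrightarrow> (\<lambda>\<gamma>. \<Sum>i\<in>I. f i \<gamma>) \<in> dr_span X \<sigma>"
  by (induction I rule: infinite_finite_induct) (auto intro: dr_span.zero dr_span_add)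

lemma dr_span_scale: "f \<in> dr_span X \<sigma> \<Longrightarrow> (\<lambda>\<gamma>. c * f \<gamma>) \<in> dr_span X \<sigma>"
proof (induction rule: dr_span.induct)
  case (ind_add f U V d m n)
  have "(\<lambda>\<gamma>. c * (dr_ind X \<sigma> d U m n V \<gamma> + f \<gamma>)) = (\<lambda>\<gamma>. dr_ind X \<sigma> (c * d) U m n V \<gamma> + c * f \<gamma>)"
    by (auto simp: dr_ind_def algebra_simps)
  then show ?case using ind_add dr_span.ind_add by metis
qed (simp add: dr_span.zero)

lemma dr_span_diff: "\<lbrakk>f \<in> dr_span X \<sigma>; g \<in> dr_span X \<sigma>\<rbrakk> \<Longrightarrow> (\<lambda>\<gamma>. f \<gamma> - g \<gamma>) \<in> dr_span X \<sigma>"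
  using dr_span_add[OF _ dr_span_scale[of g X \<sigma> "-1"]] by simp

lemma dr_span_induct [consumes 1, case_names zero ind add]:
  assumes "f \<in> dr_span X \<sigma>" "P (\<lambda>_. 0)"
    and "\<And>c U m n V. \<lbrakk>clopenin X U; clopenin X V\<rbrakk> \<Longrightarrow> P (dr_ind X \<sigma> c U m n V)"
    and "\<And>f g. \<lbrakk>f \<in> dr_span X \<sigma>; g \<in> dr_span X \<sigma>; P f; P g\<rbrakk> \<Longrightarrow> P (\<lambda>\<gamma>. f \<gamma> + g \<gamma>)"
  shows "P f"
  using assms(1) by (induction rule: dr_span.induct) (auto intro: assms dr_ind_span)

lemma dr_basic_Int:
  assumes "m \<le> m'" "int m - int n = int m' - int n'"
  shows "dr_basic X \<sigma> U m n V \<inter> dr_basic X \<sigma> U' m' n' V' = dr_basic X \<sigma> (U \<inter> U') m n (V \<inter> V')"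
proof -
  obtain l where l: "m' = m + l" using assms(1) le_iff_add by blast
  then have l': "n' = n + l" using assms(2) by simp
  show ?thesis
    by (rule set_eqI, case_tac x) (auto simp: dr_basic_iff l l' intro: iterate_eq_later)
qed

text \<open>Two basic sets of different degrees are disjoint, and for equal degrees the relation with the smaller exponents implies the other;
  this makes the span closed under pointwise products.\<close>

lemma dr_basic_Int_cases:
  assumes "clopenin X U" "clopenin X V" "clopenin X U'" "clopenin X V'"
  shows "dr_basic X \<sigma> U m n V \<inter> dr_basic X \<sigma> U' m' n' V' = {} \<or>
    (\<exists>A p q B. clopenin X A \<and> clopenin X B \<and>
       dr_basic X \<sigma> U m n V \<inter> dr_basic X \<sigma> U' m' n' V' = dr_basic X \<sigma> A p q B)"
proof (cases "int m - int n = int m' - int n'")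
  case eq: True
  show ?thesis
  proof (cases "m \<le> m'")
    case True
    then show ?thesis using dr_basic_Int[OF True eq] assms by (metis clopenin_Int)
  next
    case False
    then have "m' \<le> m" by simp
    then show ?thesis using dr_basic_Int[OF _ eq[symmetric], of X \<sigma> U' V' U V] assms
      by (metis clopenin_Int Int_commute)
  qed
qed (auto simp: dr_basic_def)

lemma dr_span_mult:
  assumes "f \<in> dr_span X \<sigma>" "g \<in> dr_span X \<sigma>" shows "(\<lambda>\<gamma>. f \<gamma> * g \<gamma>) \<in> dr_span X \<sigma>"
  using assms(1)
proof (induction rule: dr_span_induct)
  case (ind c U m n V)
  show ?case using assms(2)
  proof (induction rule: dr_span_induct)
    case (ind d U' m' n' V')
    have eq: "(\<lambda>\<gamma>. dr_ind X \<sigma> c U m n V \<gamma> * dr_ind X \<sigma> d U' m' n' V' \<gamma>) =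
      (\<lambda>\<gamma>. if \<gamma> \<in> dr_basic X \<sigma> U m n V \<inter> dr_basic X \<sigma> U' m' n' V' then c * d else 0)"
      by (auto simp: dr_ind_def)
    show ?case
      using dr_basic_Int_cases[OF \<open>clopenin X U\<close> \<open>clopenin X V\<close> ind, of \<sigma> m n m' n']
    proof (elim disjE exE conjE)
      fix A p q B assume "clopenin X A" "clopenin X B"
        and "dr_basic X \<sigma> U m n V \<inter> dr_basic X \<sigma> U' m' n' V' = dr_basic X \<sigma> A p q B"
      then show ?thesis unfolding eq using dr_ind_span[of X A B \<sigma> "c * d" p q] by (simp add: dr_ind_def)
    qed (simp add: eq dr_span.zero)
  next
    case (add f g)
    then show ?case using dr_span_add by (simp add: distrib_left)
  qed (simp add: dr_span.zero)
next
  case (add f g)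
  then show ?case using dr_span_add by (simp add: distrib_right)
qed (simp add: dr_span.zero)

context ample_system
begin

abbreviation "G \<equiv> dr_groupoid X \<sigma>"

lemma openin_dr_basic: "openin X U \<Longrightarrow> openin X V \<Longrightarrow> openin (gtop G) (dr_basic X \<sigma> U m n V)"
  unfolding dr_groupoid_def by (auto intro!: topology_generated_by_Basis)

lemma dr_basis:
  assumes "openin (gtop G) S" "\<gamma> \<in> S"
  shows "\<exists>U m n V. clopenin X U \<and> clopenin X V \<and> \<gamma> \<in> dr_basic X \<sigma> U m n V \<and> dr_basic X \<sigma> U m n V \<subseteq> S"
proof -
  have "generate_topology_on {dr_basic X \<sigma> U m n V | U m n V. openin X U \<and> openin X V} S"
    using assms(1) unfolding dr_groupoid_def by (simp add: openin_topology_generated_by_iff)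
  then show ?thesis using assms(2)
  proof (induction S)
    case (Int a b)
    obtain U m n V where 1: "clopenin X U" "clopenin X V" "\<gamma> \<in> dr_basic X \<sigma> U m n V" "dr_basic X \<sigma> U m n V \<subseteq> a"
      using Int by blast
    obtain U' m' n' V' where 2: "clopenin X U'" "clopenin X V'" "\<gamma> \<in> dr_basic X \<sigma> U' m' n' V'"
      "dr_basic X \<sigma> U' m' n' V' \<subseteq> b"
      using Int by blast
    then show ?case
      using dr_basic_Int_cases[OF 1(1,2) 2(1,2), of \<sigma> m n m' n'] 1(3,4) by (metis Int_iff Int_mono empty_iff)
  next
    case (UN K)
    then show ?case by (meson UnionE Union_upper subset_trans)
  next
    case (Basis S)
    then obtain U m n V where S: "S = dr_basic X \<sigma> U m n V" "openin X U" "openin X V" by auto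
    obtain x y where xy: "\<gamma> = (x, int m - int n, y)" "x \<in> U" "y \<in> V" "(\<sigma> ^^ m) x = (\<sigma> ^^ n) y"
      using Basis.prems S by (auto simp: dr_basic_def)
    obtain U' where U': "clopenin X U'" "x \<in> U'" "U' \<subseteq> U" using clopen_base[OF S(2) xy(2)] by blast
    obtain V' where V': "clopenin X V'" "y \<in> V'" "V' \<subseteq> V" using clopen_base[OF S(3) xy(3)] by blast
    have "\<gamma> \<in> dr_basic X \<sigma> U' m n V'" "dr_basic X \<sigma> U' m n V' \<subseteq> S"
      using S U' V' xy by (auto simp: dr_basic_def)
    then show ?case using U'(1) V'(1) by blast
  qed simp
qed

text \<open>Arrows of another degree have a basic neighbourhood of their own degree, and if \<open>\<sigma>\<^sup>m x \<noteq> \<sigma>\<^sup>n y\<close>, then disjoint neighbourhoods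
  of these two points keep nearby arrows outside the set.\<close>

lemma dr_basic_whole_closed: "closedin (gtop G) (dr_basic X \<sigma> (topspace X) m n (topspace X))"
proof -
  let ?Z = "dr_basic X \<sigma> (topspace X) m n (topspace X)"
  have "openin (gtop G) (arrows X \<sigma> - ?Z)"
  proof (subst openin_subopen, intro ballI)
    fix \<gamma> assume \<gamma>: "\<gamma> \<in> arrows X \<sigma> - ?Z"
    obtain x k y where [simp]: "\<gamma> = (x, k, y)" by (cases \<gamma>)
    obtain m' n' where a: "x \<in> topspace X" "y \<in> topspace X" "k = int m' - int n'" "(\<sigma> ^^ m') x = (\<sigma> ^^ n') y"
      using \<gamma> by (auto simp: arrows_iff)
    show "\<exists>T. openin (gtop G) T \<and> \<gamma> \<in> T \<and> T \<subseteq> arrows X \<sigma> - ?Z"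
    proof (cases "k = int m - int n")
      case False
      have "openin (gtop G) (dr_basic X \<sigma> (topspace X) m' n' (topspace X))" by (rule openin_dr_basic) auto
      moreover have "dr_basic X \<sigma> (topspace X) m' n' (topspace X) \<subseteq> arrows X \<sigma> - ?Z"
        using False a(3) dr_basic_subset_arrows[OF subset_refl subset_refl, of X \<sigma> m' n'] by (auto simp: dr_basic_def)
      moreover have "\<gamma> \<in> dr_basic X \<sigma> (topspace X) m' n' (topspace X)" using a by (simp add: dr_basic_iff)
      ultimately show ?thesis by blast
    next
      case True
      then have "(\<sigma> ^^ m) x \<noteq> (\<sigma> ^^ n) y" using \<gamma> a by (auto simp: dr_basic_iff)
      then obtain S T where ST: "openin X S" "openin X T" "(\<sigma> ^^ m) x \<in> S" "(\<sigma> ^^ n) y \<in> T" "disjnt S T"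
        using hausdorff a(1,2) unfolding Hausdorff_space_def by (metis iterate_closed)
      let ?U = "{u \<in> topspace X. (\<sigma> ^^ m) u \<in> S}" and ?V = "{u \<in> topspace X. (\<sigma> ^^ n) u \<in> T}"
      have "openin (gtop G) (dr_basic X \<sigma> ?U m' n' ?V)"
        using ST by (intro openin_dr_basic openin_continuous_map_preimage[OF iterate_continuous]) auto
      moreover have "dr_basic X \<sigma> ?U m' n' ?V \<subseteq> arrows X \<sigma> - ?Z"
        using ST(5) dr_basic_subset_arrows[of ?U X ?V \<sigma> m' n'] by (auto simp: dr_basic_iff disjnt_iff)
      moreover have "\<gamma> \<in> dr_basic X \<sigma> ?U m' n' ?V" using a ST by (simp add: dr_basic_iff)
      ultimately show ?thesis by blast
    qed
  qed
  moreover have "?Z \<subseteq> arrows X \<sigma>" by (auto simp: arrows_def)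
  ultimately show ?thesis by (simp add: closedin_def topspace_dr)
qed

text \<open>The set is the image of the closed relation \<open>\<sigma>\<^sup>m x = \<sigma>\<^sup>n y\<close> in the compact space \<open>X \<times> X\<close>. The parametrisation is continuous
  because on that relation each relation \<open>\<sigma>\<^sup>p x = \<sigma>\<^sup>q y\<close> with \<open>p - q = m - n\<close> is relatively open, by local injectivity.\<close>

lemma dr_basic_whole_compact: "compactin (gtop G) (dr_basic X \<sigma> (topspace X) m n (topspace X))"
proof -
  let ?XX = "prod_topology X X"
  let ?E = "{z \<in> topspace ?XX. (\<sigma> ^^ m) (fst z) = (\<sigma> ^^ n) (snd z)}"
  let ?h = "\<lambda>z. (fst z, int m - int n, snd z)"
  have c: "continuous_map ?XX X (\<lambda>z. (\<sigma> ^^ p) (fst z))" "continuous_map ?XX X (\<lambda>z. (\<sigma> ^^ p) (snd z))" for p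
    using continuous_map_compose[OF continuous_map_fst iterate_continuous[of p], of X]
      continuous_map_compose[OF continuous_map_snd iterate_continuous[of p], of X] by (simp_all add: comp_def)
  have "closedin ?XX ?E" by (rule closedin_continuous_maps_eq[OF hausdorff c])
  then have cE: "compactin ?XX ?E"
    using compact by (intro closedin_compact_space) (simp_all add: compact_space_prod_topology)
  have "continuous_map (subtopology ?XX ?E) (gtop G) ?h"
    unfolding dr_groupoid_def top_groupoid.simps
  proof (rule continuous_on_generated_topo)
    fix S assume "S \<in> {dr_basic X \<sigma> U m n V | U m n V. openin X U \<and> openin X V}"
    then obtain U m' n' V where S: "S = dr_basic X \<sigma> U m' n' V" "openin X U" "openin X V" by auto
    show "openin (subtopology ?XX ?E) (?h -` S \<inter> topspace (subtopology ?XX ?E))"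
    proof (subst openin_subopen, intro ballI)
      fix z assume z: "z \<in> ?h -` S \<inter> topspace (subtopology ?XX ?E)"
      obtain x y where [simp]: "z = (x, y)" by (cases z)
      have xy: "x \<in> topspace X" "y \<in> topspace X" "x \<in> U" "y \<in> V" "(\<sigma> ^^ m) x = (\<sigma> ^^ n) y"
        "(\<sigma> ^^ m') x = (\<sigma> ^^ n') y" and k: "int m - int n = int m' - int n'"
        using z S by (auto simp: dr_basic_iff)
      have "\<exists>W. openin ?XX W \<and> z \<in> W \<and> (\<forall>(u, v)\<in>W. (\<sigma> ^^ m) u = (\<sigma> ^^ n) v \<longrightarrow> (\<sigma> ^^ m') u = (\<sigma> ^^ n') v)"
      proof (cases "m \<le> m'")
        case True
        then obtain l where l: "m' = m + l" using le_iff_add by blast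
        then have "n' = n + l" using k by simp
        then have "(\<sigma> ^^ m') u = (\<sigma> ^^ n') v" if "(\<sigma> ^^ m) u = (\<sigma> ^^ n) v" for u v
          using iterate_eq_later[OF that, of l] l by simp
        then show ?thesis using xy
          by (intro exI[of _ "topspace ?XX"] conjI openin_topspace) auto
      next
        case False
        then obtain l where l: "m = m' + l" using le_iff_add nat_le_linear by metis
        then have l': "n = n' + l" using k by simp
        obtain W where W: "openin X W" "(\<sigma> ^^ m') x \<in> W" "inj_on (\<sigma> ^^ l) W"
          using iterate_locally_inj[OF iterate_closed[OF xy(1)]] by metis
        let ?W = "{w \<in> topspace ?XX. (\<sigma> ^^ m') (fst w) \<in> W} \<inter> {w \<in> topspace ?XX. (\<sigma> ^^ n') (snd w) \<in> W}"
        have "openin ?XX ?W" by (intro openin_Int openin_continuous_map_preimage[OF c(1) W(1)]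
            openin_continuous_map_preimage[OF c(2) W(1)])
        moreover have "z \<in> ?W" using W xy by simp
        moreover have "\<forall>(u, v)\<in>?W. (\<sigma> ^^ m) u = (\<sigma> ^^ n) v \<longrightarrow> (\<sigma> ^^ m') u = (\<sigma> ^^ n') v"
        proof (intro ballI)
          fix w assume w: "w \<in> ?W"
          have "(\<sigma> ^^ m') (fst w) = (\<sigma> ^^ n') (snd w)" if "(\<sigma> ^^ m) (fst w) = (\<sigma> ^^ n) (snd w)"
          proof -
            have "(\<sigma> ^^ l) ((\<sigma> ^^ m') (fst w)) = (\<sigma> ^^ l) ((\<sigma> ^^ n') (snd w))"
              using that unfolding l l' by (simp only: add.commute[of _ l] funpow_add comp_apply)
            then show ?thesis using inj_onD[OF W(3)] w by simp
          qed
          then show "case w of (u, v) \<Rightarrow> (\<sigma> ^^ m) u = (\<sigma> ^^ n) v \<longrightarrow> (\<sigma> ^^ m') u = (\<sigma> ^^ n') v"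
            by (simp add: split_beta)
        qed
        ultimately show ?thesis by blast
      qed
      then obtain W where W: "openin ?XX W" "z \<in> W"
        "\<forall>(u, v)\<in>W. (\<sigma> ^^ m) u = (\<sigma> ^^ n) v \<longrightarrow> (\<sigma> ^^ m') u = (\<sigma> ^^ n') v" by blast
      let ?T = "?E \<inter> (W \<inter> U \<times> V)"
      have "openin ?XX (W \<inter> U \<times> V)" using W(1) S by (auto simp: openin_prod_Times_iff)
      then have "openin (subtopology ?XX ?E) ?T" by (rule openin_subtopology_Int2)
      moreover have "z \<in> ?T" using z W xy by auto
      moreover have "?T \<subseteq> ?h -` S \<inter> topspace (subtopology ?XX ?E)"
        using W(3) k S(1) by (auto simp: dr_basic_iff)
      ultimately show "\<exists>T. openin (subtopology ?XX ?E) T \<and> z \<in> T \<and> T \<subseteq> ?h -` S \<inter> topspace (subtopology ?XX ?E)"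
        by blast
    qed
  next
    show "?h ` topspace (subtopology ?XX ?E) \<subseteq> \<Union>{dr_basic X \<sigma> U m n V | U m n V. openin X U \<and> openin X V}"
    proof (intro subsetI UnionI[of "dr_basic X \<sigma> (topspace X) m n (topspace X)"])
      show "dr_basic X \<sigma> (topspace X) m n (topspace X) \<in> {dr_basic X \<sigma> U m n V | U m n V. openin X U \<and> openin X V}"
        using openin_topspace[of X] by blast
    qed (auto simp: dr_basic_iff)
  qed
  then have "compactin (gtop G) (?h ` topspace (subtopology ?XX ?E))"
    using image_compactin[OF compact_space_subtopology[OF cE, unfolded compact_space_def]] by blast
  moreover have "?h ` topspace (subtopology ?XX ?E) = dr_basic X \<sigma> (topspace X) m n (topspace X)"
  proof (intro equalityI subsetI)
    fix \<gamma> assume "\<gamma> \<in> dr_basic X \<sigma> (topspace X) m n (topspace X)"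
    then obtain x y where "\<gamma> = ?h (x, y)" "(x, y) \<in> ?E" by (auto simp: dr_basic_def)
    then show "\<gamma> \<in> ?h ` topspace (subtopology ?XX ?E)" by (intro image_eqI[of _ _ "(x, y)"]) auto
  qed (auto simp: dr_basic_iff)
  ultimately show ?thesis by simp
qed

lemma dr_basic_clopen:
  assumes "clopenin X U" "clopenin X V"
  shows "clopenin (gtop G) (dr_basic X \<sigma> U m n V)"
proof -
  let ?Z = "dr_basic X \<sigma> (topspace X) m n (topspace X)"
  have U: "U \<subseteq> topspace X" "V \<subseteq> topspace X" using assms clopenin_subset by auto
  have eq: "dr_basic X \<sigma> U m n V =
     ?Z - (dr_basic X \<sigma> (topspace X - U) m n (topspace X) \<union> dr_basic X \<sigma> (topspace X) m n (topspace X - V))"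
    using U by (auto simp: dr_basic_def)
  have "openin (gtop G) (dr_basic X \<sigma> (topspace X - U) m n (topspace X) \<union> dr_basic X \<sigma> (topspace X) m n (topspace X - V))"
    using assms by (intro openin_Un openin_dr_basic) (auto simp: clopenin_def)
  then have "closedin (gtop G) (dr_basic X \<sigma> U m n V)"
    unfolding eq by (intro closedin_diff dr_basic_whole_closed)
  then show ?thesis using assms openin_dr_basic by (auto simp: clopenin_def)
qed

lemma dr_basic_compact:
  assumes "clopenin X U" "clopenin X V"
  shows "compactin (gtop G) (dr_basic X \<sigma> U m n V)"
proof (rule closed_compactin[OF dr_basic_whole_compact[of m n]])
  show "dr_basic X \<sigma> U m n V \<subseteq> dr_basic X \<sigma> (topspace X) m n (topspace X)"
    using assms[THEN clopenin_subset] by (auto simp: dr_basic_def)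
  show "closedin (gtop G) (dr_basic X \<sigma> U m n V)" using dr_basic_clopen[OF assms] by (simp add: clopenin_def)
qed

end

lemma dr_groupoid_ops [simp]:
  "gsource (dr_groupoid X \<sigma>) (x, k, y) = y"
  "gmult (dr_groupoid X \<sigma>) (x, p, y) (y', q, z) = (x, p + q, z)"
  "ginv (dr_groupoid X \<sigma>) (x, k, y) = (y, - k, x)"
  by (simp_all add: dr_groupoid_def)

context ample_system
begin

lemma support_closed:
  assumes "\<forall>\<gamma>\<in>arrows X \<sigma>. \<exists>U. openin (gtop G) U \<and> \<gamma> \<in> U \<and> (\<forall>\<delta>\<in>U. f \<delta> = f \<gamma>)"
  shows "closedin (gtop G) {\<gamma> \<in> arrows X \<sigma>. f \<gamma> \<noteq> 0}"
proof -
  have "openin (gtop G) {\<gamma> \<in> arrows X \<sigma>. f \<gamma> = 0}"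
  proof (subst openin_subopen, intro ballI)
    fix \<gamma> assume \<gamma>: "\<gamma> \<in> {\<gamma> \<in> arrows X \<sigma>. f \<gamma> = 0}"
    then have "\<gamma> \<in> arrows X \<sigma>" by simp
    then obtain U where U: "openin (gtop G) U" "\<gamma> \<in> U" "\<forall>\<delta>\<in>U. f \<delta> = f \<gamma>"
      using assms by blast
    have "f \<delta> = 0" if "\<delta> \<in> U" for \<delta> using bspec[OF U(3) that] \<gamma> by simp
    then have "U \<subseteq> {\<gamma> \<in> arrows X \<sigma>. f \<gamma> = 0}"
      using openin_subset[OF U(1)] by (auto simp: topspace_dr)
    then show "\<exists>T. openin (gtop G) T \<and> \<gamma> \<in> T \<and> T \<subseteq> {\<gamma> \<in> arrows X \<sigma>. f \<gamma> = 0}"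
      using U(1,2) by blast
  qed
  moreover have "arrows X \<sigma> - {\<gamma> \<in> arrows X \<sigma>. f \<gamma> \<noteq> 0} = {\<gamma> \<in> arrows X \<sigma>. f \<gamma> = 0}" by auto
  ultimately show ?thesis by (simp add: closedin_def topspace_dr)
qed

lemma steinberg_carrier_iff:
  "f \<in> steinberg_carrier G \<longleftrightarrow> (\<forall>\<gamma>. \<gamma> \<notin> arrows X \<sigma> \<longrightarrow> f \<gamma> = 0) \<and>
    (\<forall>\<gamma>\<in>arrows X \<sigma>. \<exists>U. openin (gtop G) U \<and> \<gamma> \<in> U \<and> (\<forall>\<delta>\<in>U. f \<delta> = f \<gamma>)) \<and>
    compactin (gtop G) {\<gamma> \<in> arrows X \<sigma>. f \<gamma> \<noteq> 0}"
  unfolding steinberg_carrier_def topspace_dr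
  using closure_of_eq[of "gtop G" "{\<gamma> \<in> arrows X \<sigma>. f \<gamma> \<noteq> 0}"] support_closed[of f] by auto

text \<open>Basic sets of clopen sets are compact and clopen, so their indicators are locally constant with compact support.\<close>

lemma dr_span_in_carrier:
  assumes "f \<in> dr_span X \<sigma>" shows "f \<in> steinberg_carrier G"
  using assms
proof (induction rule: dr_span_induct)
  case zero
  then show ?case unfolding steinberg_carrier_iff
    using openin_topspace[of "gtop G"] unfolding topspace_dr by auto
next
  case (ind c U m n V)
  let ?Z = "dr_basic X \<sigma> U m n V"
  have Z: "openin (gtop G) ?Z" "openin (gtop G) (arrows X \<sigma> - ?Z)" "compactin (gtop G) ?Z"
    using dr_basic_clopen[OF ind] dr_basic_compact[OF ind] by (auto simp: clopenin_def closedin_def topspace_dr)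
  have sub: "?Z \<subseteq> arrows X \<sigma>" using openin_subset[OF Z(1)] by (simp add: topspace_dr)
  have "{\<gamma> \<in> arrows X \<sigma>. dr_ind X \<sigma> c U m n V \<gamma> \<noteq> 0} = (if c = 0 then {} else ?Z)"
    using sub by (auto simp: dr_ind_def)
  moreover have "\<exists>U'. openin (gtop G) U' \<and> \<gamma> \<in> U' \<and> (\<forall>\<delta>\<in>U'. dr_ind X \<sigma> c U m n V \<delta> = dr_ind X \<sigma> c U m n V \<gamma>)"
    if "\<gamma> \<in> arrows X \<sigma>" for \<gamma>
  proof (cases "\<gamma> \<in> ?Z")
    case True
    then show ?thesis using Z by (intro exI[of _ ?Z]) (simp add: dr_ind_def)
  next
    case False
    then show ?thesis using Z that by (intro exI[of _ "arrows X \<sigma> - ?Z"]) (simp add: dr_ind_def)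
  qed
  ultimately show ?case unfolding steinberg_carrier_iff using Z(3) sub by (auto simp: dr_ind_def)
next
  case (add f g)
  note f = add(3)[unfolded steinberg_carrier_iff] and g = add(4)[unfolded steinberg_carrier_iff]
  have lc: "\<forall>\<gamma>\<in>arrows X \<sigma>. \<exists>U. openin (gtop G) U \<and> \<gamma> \<in> U \<and> (\<forall>\<delta>\<in>U. f \<delta> + g \<delta> = f \<gamma> + g \<gamma>)"
  proof
    fix \<gamma> assume "\<gamma> \<in> arrows X \<sigma>"
    then obtain U V where UV: "openin (gtop G) U" "\<gamma> \<in> U" "\<forall>\<delta>\<in>U. f \<delta> = f \<gamma>"
      "openin (gtop G) V" "\<gamma> \<in> V" "\<forall>\<delta>\<in>V. g \<delta> = g \<gamma>" using f g by meson
    show "\<exists>U. openin (gtop G) U \<and> \<gamma> \<in> U \<and> (\<forall>\<delta>\<in>U. f \<delta> + g \<delta> = f \<gamma> + g \<gamma>)"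
    proof (intro exI[of _ "U \<inter> V"] conjI ballI)
      fix \<delta> assume d: "\<delta> \<in> U \<inter> V"
      have "f \<delta> = f \<gamma>" "g \<delta> = g \<gamma>" using d UV(3,6) by blast+
      then show "f \<delta> + g \<delta> = f \<gamma> + g \<gamma>" by simp
    qed (use UV(1,2,4,5) in auto)
  qed
  have "compactin (gtop G) {\<gamma> \<in> arrows X \<sigma>. f \<gamma> + g \<gamma> \<noteq> 0}"
    by (rule closed_compactin[OF compactin_Un[OF conjunct2[OF conjunct2[OF f]] conjunct2[OF conjunct2[OF g]]] _ support_closed[OF lc]])
       auto
  then show ?case unfolding steinberg_carrier_iff using f g lc by auto
qed

text \<open>A locally constant function of compact support is constant on each member of a finite cover of its
  support by basic sets; its restriction to the union of the cover is assembled by inclusion and exclusion.\<close>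

lemma carrier_in_dr_span:
  fixes f :: "'a \<times> int \<times> 'a \<Rightarrow> 'k::field"
  assumes "f \<in> steinberg_carrier G" shows "f \<in> dr_span X \<sigma>"
proof -
  note f = assms[unfolded steinberg_carrier_iff]
  define S where "S = {\<gamma> \<in> arrows X \<sigma>. f \<gamma> \<noteq> 0}"
  define one :: "('a \<times> int \<times> 'a) set \<Rightarrow> 'a \<times> int \<times> 'a \<Rightarrow> 'k" where "one Z = (\<lambda>\<gamma>. if \<gamma> \<in> Z then 1 else 0)" for Z
  define res where "res Z = (\<lambda>\<gamma>. if \<gamma> \<in> Z then f \<gamma> else 0)" for Z
  define good where "good Z \<longleftrightarrow> openin (gtop G) Z \<and> one Z \<in> dr_span X \<sigma> \<and> res Z \<in> dr_span X \<sigma>" for Z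
  have "\<exists>Z. good Z \<and> \<gamma> \<in> Z" if \<gamma>: "\<gamma> \<in> S" for \<gamma>
  proof -
    obtain U where U: "openin (gtop G) U" "\<gamma> \<in> U" "\<forall>\<delta>\<in>U. f \<delta> = f \<gamma>" using f \<gamma> unfolding S_def by blast
    obtain A m n B where Z: "clopenin X A" "clopenin X B" "\<gamma> \<in> dr_basic X \<sigma> A m n B" "dr_basic X \<sigma> A m n B \<subseteq> U"
      using dr_basis[OF U(1,2)] by blast
    have "one (dr_basic X \<sigma> A m n B) = dr_ind X \<sigma> 1 A m n B" by (simp add: one_def dr_ind_def)
    moreover have "res (dr_basic X \<sigma> A m n B) = dr_ind X \<sigma> (f \<gamma>) A m n B"
      unfolding res_def dr_ind_def using Z(4) U(3) by (intro ext if_cong) auto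
    ultimately have "good (dr_basic X \<sigma> A m n B)"
      using Z(1,2) dr_ind_span[OF Z(1,2)] dr_basic_clopen[OF Z(1,2)] by (auto simp: good_def clopenin_def)
    then show ?thesis using Z(3) by blast
  qed
  then have cov: "S \<subseteq> \<Union>(Collect good)" by blast
  have "compactin (gtop G) S" using f by (simp add: S_def)
  then obtain \<F> where \<F>: "finite \<F>" "\<F> \<subseteq> Collect good" "S \<subseteq> \<Union>\<F>"
    using cov unfolding compactin_def by (metis good_def mem_Collect_eq)
  have "one (\<Union>\<F>) \<in> dr_span X \<sigma> \<and> res (\<Union>\<F>) \<in> dr_span X \<sigma>"
    using \<F>(1,2)
  proof (induction \<F> rule: finite_induct)
    case empty
    then show ?case by (simp add: one_def res_def dr_span.zero)
  next
    case (insert Z \<F>)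
    have "one (\<Union>(insert Z \<F>)) = (\<lambda>\<gamma>. one Z \<gamma> + one (\<Union>\<F>) \<gamma> - one Z \<gamma> * one (\<Union>\<F>) \<gamma>)"
      by (auto simp: one_def)
    moreover have "res (\<Union>(insert Z \<F>)) = (\<lambda>\<gamma>. res Z \<gamma> + res (\<Union>\<F>) \<gamma> - one Z \<gamma> * res (\<Union>\<F>) \<gamma>)"
      by (auto simp: one_def res_def)
    moreover have a: "one Z \<in> dr_span X \<sigma>" "res Z \<in> dr_span X \<sigma>" "one (\<Union>\<F>) \<in> dr_span X \<sigma>" "res (\<Union>\<F>) \<in> dr_span X \<sigma>"
      using insert by (auto simp: good_def)
    ultimately show ?case
      using dr_span_diff[OF dr_span_add[OF a(1,3)] dr_span_mult[OF a(1,3)]]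
        dr_span_diff[OF dr_span_add[OF a(2,4)] dr_span_mult[OF a(1,4)]] by simp
  qed
  moreover have "res (\<Union>\<F>) = f"
  proof
    fix \<gamma> show "res (\<Union>\<F>) \<gamma> = f \<gamma>"
      using \<F>(3) conjunct1[OF f, rule_format, of \<gamma>] by (cases "\<gamma> \<in> arrows X \<sigma>") (auto simp: res_def S_def)
  qed
  ultimately show ?thesis by simp
qed

lemma steinberg_carrier_eq: "steinberg_carrier G = dr_span X \<sigma>"
  using carrier_in_dr_span dr_span_in_carrier by blast

lemma dr_span_vanish: "f \<in> dr_span X \<sigma> \<Longrightarrow> \<gamma> \<notin> arrows X \<sigma> \<Longrightarrow> f \<gamma> = 0"
  using dr_span_in_carrier steinberg_carrier_iff by blast

lemma dr_ind_partition:
  assumes "clopenin X U" "clopenin X V"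
  obtains P where "finite P"
    "\<And>U' V'. (U', V') \<in> P \<Longrightarrow> clopenin X U' \<and> clopenin X V' \<and> inj_on (\<sigma> ^^ N) U' \<and> inj_on (\<sigma> ^^ N) V'"
    "\<And>c. dr_ind X \<sigma> c U m n V = (\<lambda>\<gamma>. \<Sum>(U', V')\<in>P. dr_ind X \<sigma> c U' m n V' \<gamma>)"
proof -
  obtain \<U> where U: "finite \<U>" "disjoint \<U>" "\<Union>\<U> = U" "\<And>V. V \<in> \<U> \<Longrightarrow> clopenin X V" "\<And>V. V \<in> \<U> \<Longrightarrow> inj_on (\<sigma> ^^ N) V"
    using clopen_inj_partition[OF assms(1)] by metis
  obtain \<V> where V: "finite \<V>" "disjoint \<V>" "\<Union>\<V> = V" "\<And>U. U \<in> \<V> \<Longrightarrow> clopenin X U" "\<And>U. U \<in> \<V> \<Longrightarrow> inj_on (\<sigma> ^^ N) U"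
    using clopen_inj_partition[OF assms(2)] by metis
  have "dr_ind X \<sigma> c U m n V \<gamma> = (\<Sum>(U', V')\<in>\<U> \<times> \<V>. dr_ind X \<sigma> c U' m n V' \<gamma>)" for c \<gamma>
  proof (cases "\<gamma> \<in> dr_basic X \<sigma> U m n V")
    case True
    then obtain x y where xy: "\<gamma> = (x, int m - int n, y)" "x \<in> U" "y \<in> V" "(\<sigma> ^^ m) x = (\<sigma> ^^ n) y"
      by (auto simp: dr_basic_def)
    obtain U0 where U0: "U0 \<in> \<U>" "x \<in> U0" using xy(2) U(3) by blast
    obtain V0 where V0: "V0 \<in> \<V>" "y \<in> V0" using xy(3) V(3) by blast
    have "dr_ind X \<sigma> c U' m n V' \<gamma> = (if (U', V') = (U0, V0) then c else 0)"
      if UV': "U' \<in> \<U>" "V' \<in> \<V>" for U' V'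
    proof -
      have "x \<in> U' \<longleftrightarrow> U' = U0" using UV'(1) U0 disjointD[OF U(2), of U' U0] by blast
      moreover have "y \<in> V' \<longleftrightarrow> V' = V0" using UV'(2) V0 disjointD[OF V(2), of V' V0] by blast
      ultimately show ?thesis using xy(1,4) by (simp add: dr_ind_def dr_basic_iff)
    qed
    then have "(\<Sum>(U', V')\<in>\<U> \<times> \<V>. dr_ind X \<sigma> c U' m n V' \<gamma>) = (\<Sum>z\<in>\<U> \<times> \<V>. if z = (U0, V0) then c else 0)"
      by (intro sum.cong refl) (clarify, simp)
    also have "\<dots> = c" using U0 V0 U(1) V(1) by simp
    finally show ?thesis using True by (simp add: dr_ind_def)
  next
    case False
    have "(\<Sum>(U', V')\<in>\<U> \<times> \<V>. dr_ind X \<sigma> c U' m n V' \<gamma>) = 0"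
      using False U(3) V(3) by (intro sum.neutral) (auto simp: dr_ind_def dr_basic_def)
    then show ?thesis using False by (simp add: dr_ind_def)
  qed
  then show ?thesis using that[of "\<U> \<times> \<V>"] U V by (auto simp: fun_eq_iff)
qed

subsection \<open>Convolution\<close>

definition fibre_support :: "('a \<times> int \<times> 'a \<Rightarrow> 'k::field) \<Rightarrow> 'a \<Rightarrow> ('a \<times> int) set" where
  "fibre_support g z = {(y, q). g (y, q, z) \<noteq> 0}"

lemma finite_fibre_support: "g \<in> dr_span X \<sigma> \<Longrightarrow> finite (fibre_support g z)"
proof (induction rule: dr_span_induct)
  case (ind c U m n V)
  have "fibre_support (dr_ind X \<sigma> c U m n V) z \<subseteq> {y \<in> topspace X. (\<sigma> ^^ m) y = (\<sigma> ^^ n) z} \<times> {int m - int n}"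
    using clopenin_subset[OF ind(1)] by (auto simp: fibre_support_def dr_ind_def dr_basic_iff split: if_splits)
  then show ?case using finite_fibre finite_subset by blast
next
  case (add f g)
  have "fibre_support (\<lambda>\<gamma>. f \<gamma> + g \<gamma>) z \<subseteq> fibre_support f z \<union> fibre_support g z"
    by (auto simp: fibre_support_def)
  then show ?case using add finite_subset by blast
qed (simp add: fibre_support_def)

text \<open>A sum over one finite set that serves all arrows with the source \<open>z\<close> makes convolution visibly bilinear.\<close>

lemma convolution_sum:
  assumes f: "f \<in> dr_span X \<sigma>" and g: "g \<in> dr_span X \<sigma>" and S: "finite S" "fibre_support g z \<subseteq> S"
  shows "convolution G f g (x, k, z) = (\<Sum>(y, q)\<in>S. f (x, k - q, y) * g (y, q, z))"
proof -
  note van = dr_span_vanish[OF f] dr_span_vanish[OF g]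
  let ?T = "{\<alpha> \<in> arrows X \<sigma>. gsource G \<alpha> = gsource G (x, k, z) \<and> f (gmult G (x, k, z) (ginv G \<alpha>)) * g \<alpha> \<noteq> 0}"
  have "(\<Sum>(y, q)\<in>S. f (x, k - q, y) * g (y, q, z)) =
      (\<Sum>(y, q)\<in>{(y, q). f (x, k - q, y) * g (y, q, z) \<noteq> 0}. f (x, k - q, y) * g (y, q, z))"
    using S by (intro sum.mono_neutral_right) (auto simp: fibre_support_def)
  also have "\<dots> = (\<Sum>\<alpha>\<in>?T. f (gmult G (x, k, z) (ginv G \<alpha>)) * g \<alpha>)"
  proof (rule sum.reindex_bij_witness[of _ "\<lambda>(y, q, z). (y, q)" "\<lambda>(y, q). (y, q, z)"])
    fix a assume "a \<in> {(y, q). f (x, k - q, y) * g (y, q, z) \<noteq> 0}"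
    then show "(case a of (y, q) \<Rightarrow> (y, q, z)) \<in> ?T"
      using van(2) by auto
  qed auto
  also have "\<dots> = convolution G f g (x, k, z)"
  proof (cases "(x, k, z) \<in> arrows X \<sigma>")
    case False
    have "f (x, k - q, y) * g (y, q, z) = 0" for y q
      using False arrow_compose[of x "k - q" y X \<sigma> q z] van by fastforce
    then have "?T = {}" by auto
    then have "(\<Sum>\<alpha>\<in>?T. f (gmult G (x, k, z) (ginv G \<alpha>)) * g \<alpha>) = 0" by (simp only: sum.empty)
    then show ?thesis using False by (simp only: convolution_def topspace_dr if_False)
  qed (simp add: convolution_def topspace_dr)
  finally show ?thesis by simp
qed

lemma convolution_off: "\<gamma> \<notin> arrows X \<sigma> \<Longrightarrow> convolution G f g \<gamma> = 0"
  by (simp add: convolution_def topspace_dr)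

lemma convolution_zero: "convolution G (\<lambda>_. 0) g = (\<lambda>_. 0)" "convolution G f (\<lambda>_. 0) = (\<lambda>_. 0)"
  by (simp_all add: convolution_def fun_eq_iff)

lemma convolution_add_left:
  assumes "f \<in> dr_span X \<sigma>" "f' \<in> dr_span X \<sigma>" "g \<in> dr_span X \<sigma>"
  shows "convolution G (\<lambda>\<gamma>. f \<gamma> + f' \<gamma>) g = (\<lambda>\<gamma>. convolution G f g \<gamma> + convolution G f' g \<gamma>)"
proof
  fix \<gamma> :: "'a \<times> int \<times> 'a" obtain x k z where [simp]: "\<gamma> = (x, k, z)" by (cases \<gamma>)
  note fin = finite_fibre_support[OF assms(3), of z]
  show "convolution G (\<lambda>\<gamma>. f \<gamma> + f' \<gamma>) g \<gamma> = convolution G f g \<gamma> + convolution G f' g \<gamma>"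
    using convolution_sum[OF assms(1,3) fin subset_refl] convolution_sum[OF assms(2,3) fin subset_refl]
      convolution_sum[OF dr_span_add[OF assms(1,2)] assms(3) fin subset_refl]
    by (simp add: distrib_right sum.distrib split_beta)
qed

lemma convolution_add_right:
  assumes "f \<in> dr_span X \<sigma>" "g \<in> dr_span X \<sigma>" "g' \<in> dr_span X \<sigma>"
  shows "convolution G f (\<lambda>\<gamma>. g \<gamma> + g' \<gamma>) = (\<lambda>\<gamma>. convolution G f g \<gamma> + convolution G f g' \<gamma>)"
proof
  fix \<gamma> :: "'a \<times> int \<times> 'a" obtain x k z where [simp]: "\<gamma> = (x, k, z)" by (cases \<gamma>)
  let ?S = "fibre_support g z \<union> fibre_support g' z"
  have S: "finite ?S" "fibre_support g z \<subseteq> ?S" "fibre_support g' z \<subseteq> ?S"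
    "fibre_support (\<lambda>\<gamma>. g \<gamma> + g' \<gamma>) z \<subseteq> ?S"
    using assms finite_fibre_support by (auto simp: fibre_support_def)
  show "convolution G f (\<lambda>\<gamma>. g \<gamma> + g' \<gamma>) \<gamma> = convolution G f g \<gamma> + convolution G f g' \<gamma>"
    using convolution_sum[OF assms(1,2) S(1,2)] convolution_sum[OF assms(1,3) S(1,3)]
      convolution_sum[OF assms(1) dr_span_add[OF assms(2,3)] S(1,4)]
    by (simp add: distrib_left sum.distrib split_beta)
qed

lemma convolution_scale:
  assumes "f \<in> dr_span X \<sigma>" "g \<in> dr_span X \<sigma>"
  shows "convolution G (\<lambda>\<gamma>. c * f \<gamma>) g = (\<lambda>\<gamma>. c * convolution G f g \<gamma>)"
    and "convolution G f (\<lambda>\<gamma>. c * g \<gamma>) = (\<lambda>\<gamma>. c * convolution G f g \<gamma>)"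
proof -
  have eq: "convolution G (\<lambda>\<gamma>. c * f \<gamma>) g (x, k, z) = c * convolution G f g (x, k, z) \<and>
      convolution G f (\<lambda>\<gamma>. c * g \<gamma>) (x, k, z) = c * convolution G f g (x, k, z)" for x k z
  proof -
    have S: "fibre_support (\<lambda>\<gamma>. c * g \<gamma>) z \<subseteq> fibre_support g z" by (auto simp: fibre_support_def)
    note fin = finite_fibre_support[OF assms(2), of z]
    show ?thesis
      using convolution_sum[OF assms fin subset_refl]
        convolution_sum[OF dr_span_scale[OF assms(1)] assms(2) fin subset_refl]
        convolution_sum[OF assms(1) dr_span_scale[OF assms(2)] fin S]
      by (simp add: sum_distrib_left split_beta mult_ac)
  qed
  show "convolution G (\<lambda>\<gamma>. c * f \<gamma>) g = (\<lambda>\<gamma>. c * convolution G f g \<gamma>)"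
    and "convolution G f (\<lambda>\<gamma>. c * g \<gamma>) = (\<lambda>\<gamma>. c * convolution G f g \<gamma>)"
    using eq by (auto simp: fun_eq_iff)
qed

lemma convolution_sum_left:
  assumes "finite I" "\<And>i. i \<in> I \<Longrightarrow> f i \<in> dr_span X \<sigma>" "g \<in> dr_span X \<sigma>"
  shows "convolution G (\<lambda>\<gamma>. \<Sum>i\<in>I. f i \<gamma>) g = (\<lambda>\<gamma>. \<Sum>i\<in>I. convolution G (f i) g \<gamma>)"
  using assms(1,2)
proof (induction I rule: finite_induct)
  case (insert i I)
  then show ?case using convolution_add_left[OF _ dr_span_sum assms(3), of "f i" I f] by simp
qed (simp add: convolution_zero)

text \<open>When the inner range \<open>V\<close> is small enough for \<open>\<sigma>\<^sup>n\<close> and \<open>\<sigma>\<^sup>m'\<close> to be injective on it, at most one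
  intermediate point contributes, and the product of two indicators is again an indicator.\<close>

lemma convolution_ind:
  assumes UV: "clopenin X U" "clopenin X V" "clopenin X U'" "clopenin X V'"
    and inj: "inj_on (\<sigma> ^^ n) (V \<inter> U')" "inj_on (\<sigma> ^^ m') (V \<inter> U')"
  shows "n \<le> m' \<Longrightarrow> convolution G (dr_ind X \<sigma> c U m n V) (dr_ind X \<sigma> d U' m' n' V') =
      dr_ind X \<sigma> (c * d) {x \<in> U. (\<sigma> ^^ m) x \<in> (\<sigma> ^^ n) ` (V \<inter> U')} (m + (m' - n)) n' V'"
    and "m' \<le> n \<Longrightarrow> convolution G (dr_ind X \<sigma> c U m n V) (dr_ind X \<sigma> d U' m' n' V') =
      dr_ind X \<sigma> (c * d) U m (n' + (n - m')) {z \<in> V'. (\<sigma> ^^ n') z \<in> (\<sigma> ^^ m') ` (V \<inter> U')}"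
proof -
  let ?f = "dr_ind X \<sigma> c U m n V" and ?g = "dr_ind X \<sigma> d U' m' n' V'"
  note sp = dr_ind_span[OF UV(1,2), of \<sigma> c m n] dr_ind_span[OF UV(3,4), of \<sigma> d m' n']
  have conv: "convolution G ?f ?g (x, k, z) =
    (if \<exists>y\<in>V \<inter> U'. x \<in> U \<and> z \<in> V' \<and> k = int m - int n + (int m' - int n') \<and>
       (\<sigma> ^^ m) x = (\<sigma> ^^ n) y \<and> (\<sigma> ^^ m') y = (\<sigma> ^^ n') z then c * d else 0)" (is "_ = (if ?C then _ else _)")
    for x k z
  proof -
    note sum = convolution_sum[OF sp finite_fibre_support[OF sp(2)] subset_refl, of x k z]
    show ?thesis
    proof (cases "?C \<and> d \<noteq> 0")
      case True
      then obtain y where y: "y \<in> V \<inter> U'" "x \<in> U" "z \<in> V'" "k = int m - int n + (int m' - int n')"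
        "(\<sigma> ^^ m) x = (\<sigma> ^^ n) y" "(\<sigma> ^^ m') y = (\<sigma> ^^ n') z" and d: "d \<noteq> 0" by auto
      have "(\<Sum>(y, q)\<in>fibre_support ?g z. ?f (x, k - q, y) * ?g (y, q, z)) =
          (\<Sum>w\<in>fibre_support ?g z. if w = (y, int m' - int n') then c * d else 0)"
        using y inj(1) by (intro sum.cong refl) (auto simp: dr_ind_def dr_basic_iff fibre_support_def dest: inj_onD split: if_splits)
      also have "\<dots> = c * d"
        using y d finite_fibre_support[OF sp(2), of z]
        by (subst sum.delta) (auto simp: fibre_support_def dr_ind_def dr_basic_iff)
      finally show ?thesis using sum True by (metis (no_types, lifting))
    next
      case False
      have "(\<Sum>(y, q)\<in>fibre_support ?g z. ?f (x, k - q, y) * ?g (y, q, z)) = 0"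
        using False by (intro sum.neutral) (auto simp: dr_ind_def dr_basic_iff)
      then show ?thesis using sum False by auto
    qed
  qed
  {
    assume le: "n \<le> m'"
    then obtain l where l: "m' = n + l" using le_iff_add by blast
    have shift: "(\<sigma> ^^ m') y = (\<sigma> ^^ (m + (m' - n))) x" if "(\<sigma> ^^ m) x = (\<sigma> ^^ n) y" for x y
      using iterate_eq_later[OF that, of l] l by simp
    show "convolution G ?f ?g = dr_ind X \<sigma> (c * d) {x \<in> U. (\<sigma> ^^ m) x \<in> (\<sigma> ^^ n) ` (V \<inter> U')} (m + (m' - n)) n' V'"
    proof
      fix \<gamma> :: "'a \<times> int \<times> 'a" obtain x k z where \<gamma>: "\<gamma> = (x, k, z)" by (cases \<gamma>)
      show "convolution G ?f ?g \<gamma> = dr_ind X \<sigma> (c * d) {x \<in> U. (\<sigma> ^^ m) x \<in> (\<sigma> ^^ n) ` (V \<inter> U')} (m + (m' - n)) n' V' \<gamma>"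
        unfolding \<gamma> conv unfolding dr_ind_def dr_basic_iff
      proof (intro if_cong[OF _ refl refl] iffI, goal_cases)
        case 1
        then show ?case using shift le by (auto simp: of_nat_diff)
      next
        case 2
        then obtain y where y: "y \<in> V \<inter> U'" "(\<sigma> ^^ m) x = (\<sigma> ^^ n) y" by auto
        show ?case by (rule bexI[OF _ y(1)]) (use 2 y(2) shift[OF y(2)] le in \<open>simp add: of_nat_diff\<close>)
      qed
    qed
  next
    assume le: "m' \<le> n"
    then obtain l where l: "n = m' + l" using le_iff_add by blast
    have shift: "(\<sigma> ^^ n) y = (\<sigma> ^^ (n' + (n - m'))) z" if "(\<sigma> ^^ m') y = (\<sigma> ^^ n') z" for y z
      using iterate_eq_later[OF that, of l] l by simp
    show "convolution G ?f ?g = dr_ind X \<sigma> (c * d) U m (n' + (n - m')) {z \<in> V'. (\<sigma> ^^ n') z \<in> (\<sigma> ^^ m') ` (V \<inter> U')}"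
    proof
      fix \<gamma> :: "'a \<times> int \<times> 'a" obtain x k z where \<gamma>: "\<gamma> = (x, k, z)" by (cases \<gamma>)
      show "convolution G ?f ?g \<gamma> = dr_ind X \<sigma> (c * d) U m (n' + (n - m')) {z \<in> V'. (\<sigma> ^^ n') z \<in> (\<sigma> ^^ m') ` (V \<inter> U')} \<gamma>"
        unfolding \<gamma> conv unfolding dr_ind_def dr_basic_iff
      proof (intro if_cong[OF _ refl refl] iffI, goal_cases)
        case 1
        then show ?case using shift le by (auto simp: of_nat_diff intro: rev_image_eqI)
      next
        case 2
        then obtain y where y: "y \<in> V \<inter> U'" "(\<sigma> ^^ m') y = (\<sigma> ^^ n') z" by force
        show ?case by (rule bexI[OF _ y(1)]) (use 2 y(2) shift[OF y(2)] le in \<open>simp add: of_nat_diff\<close>)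
      qed
    qed
  }
qed

lemma clopen_return:
  assumes "clopenin X U" "clopenin X W"
  shows "clopenin X {x \<in> U. (\<sigma> ^^ m) x \<in> (\<sigma> ^^ n) ` W}"
proof -
  have "{x \<in> U. (\<sigma> ^^ m) x \<in> (\<sigma> ^^ n) ` W} = U \<inter> {x \<in> topspace X. (\<sigma> ^^ m) x \<in> (\<sigma> ^^ n) ` W}"
    using clopenin_subset[OF assms(1)] by auto
  then show ?thesis using clopenin_Int[OF assms(1) clopen_preimage[OF clopen_image[OF assms(2)]]] by simp
qed

lemma inj_on_iterate_le: "inj_on (\<sigma> ^^ N) V \<Longrightarrow> n \<le> N \<Longrightarrow> inj_on (\<sigma> ^^ n) V"
  by (metis funpow_add inj_on_imageI2 le_add_diff_inverse2)

text \<open>By bilinearity it suffices to multiply indicators, and these split into pieces on which the iterates are injective.\<close>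

lemma convolution_closed:
  fixes f g :: "'a \<times> int \<times> 'a \<Rightarrow> 'k::field"
  assumes "f \<in> dr_span X \<sigma>" "g \<in> dr_span X \<sigma>"
  shows "convolution G f g \<in> dr_span X \<sigma>"
  using assms(1)
proof (induction rule: dr_span_induct)
  case zero
  then show ?case by (simp add: convolution_zero dr_span.zero)
next
  case (add f f')
  then show ?case using assms(2) by (simp add: convolution_add_left dr_span_add)
next
  case (ind c U m n V)
  note UV = ind
  show ?case using assms(2)
  proof (induction rule: dr_span_induct)
    case zero
    then show ?case by (simp add: convolution_zero dr_span.zero)
  next
    case (add g g')
    then show ?case by (simp add: convolution_add_right[OF dr_ind_span[OF UV]] dr_span_add)
  next
    case (ind d U' m' n' V')
    obtain P where P: "finite P"
      "\<And>A B. (A, B) \<in> P \<Longrightarrow> clopenin X A \<and> clopenin X B \<and> inj_on (\<sigma> ^^ (n + m')) A \<and> inj_on (\<sigma> ^^ (n + m')) B"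
      "\<And>c::'k. dr_ind X \<sigma> c U m n V = (\<lambda>\<gamma>. \<Sum>(A, B)\<in>P. dr_ind X \<sigma> c A m n B \<gamma>)"
      using dr_ind_partition[OF UV, where N = "n + m'" and m = m and n = n] by blast
    have "convolution G (dr_ind X \<sigma> c A m n B) (dr_ind X \<sigma> d U' m' n' V') \<in> dr_span X \<sigma>"
      if AB: "(A, B) \<in> P" for A B
    proof -
      have cl: "clopenin X A" "clopenin X B" using P(2)[OF AB] by auto
      have "inj_on (\<sigma> ^^ n) (B \<inter> U')" "inj_on (\<sigma> ^^ m') (B \<inter> U')"
        using inj_on_subset[OF inj_on_iterate_le[of "n + m'" B]] P(2)[OF AB] by auto
      note c = convolution_ind[OF cl ind this]
      show ?thesis
      proof (cases "n \<le> m'")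
        case True
        then show ?thesis unfolding c(1)[OF True] by (intro dr_ind_span clopen_return cl ind clopenin_Int)
      next
        case False
        then have "m' \<le> n" by simp
        then show ?thesis unfolding c(2)[OF \<open>m' \<le> n\<close>] by (intro dr_ind_span clopen_return cl ind clopenin_Int)
      qed
    qed
    then have cl: "convolution G (dr_ind X \<sigma> c (fst z) m n (snd z)) (dr_ind X \<sigma> d U' m' n' V') \<in> dr_span X \<sigma>"
      if "z \<in> P" for z using that by (cases z) simp
    have sp: "dr_ind X \<sigma> c (fst z) m n (snd z) \<in> dr_span X \<sigma>" if "z \<in> P" for z
      using P(2)[of "fst z" "snd z"] that by (simp add: dr_ind_span)
    have "dr_ind X \<sigma> c U m n V = (\<lambda>\<gamma>. \<Sum>z\<in>P. dr_ind X \<sigma> c (fst z) m n (snd z) \<gamma>)"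
      by (simp add: P(3) split_beta)
    then show ?case
      using convolution_sum_left[OF P(1) sp dr_ind_span[OF ind]] dr_span_sum[OF cl] by simp
  qed
qed

end

section \<open>Steinberg algebras of zero-dimensional systems\<close>

lemma involution_zero: assumes "field_involution j" shows "j 0 = 0"
proof -
  have "j 0 + j 0 = j 0 + 0" using assms unfolding field_involution_def by (metis add_0_right)
  then show ?thesis by (rule add_left_imp_eq)
qed

lemma cnj_involution: "field_involution cnj"
  by (simp add: field_involution_def)

context ample_system
begin

lemma steinberg_ops [simp]:
  "scarrier (steinberg j G) = dr_span X \<sigma>"
  "szero (steinberg j G) = (\<lambda>_. 0)"
  "sadd (steinberg j G) f g = (\<lambda>\<gamma>. f \<gamma> + g \<gamma>)"
  "sscale (steinberg j G) c f = (\<lambda>\<gamma>. c * f \<gamma>)"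
  "smul (steinberg j G) f g = convolution G f g"
  by (simp_all add: steinberg_def steinberg_carrier_eq)

lemma steinberg_star: "sstar (steinberg j G) f = (\<lambda>(x, k, y). if (x, k, y) \<in> arrows X \<sigma> then j (f (y, - k, x)) else 0)"
  by (simp add: steinberg_def topspace_dr fun_eq_iff)

lemma star_ind:
  assumes "field_involution j" "clopenin X U" "clopenin X V"
  shows "sstar (steinberg j G) (dr_ind X \<sigma> c U m n V) = dr_ind X \<sigma> (j c) V n m U"
proof -
  have "(x, k, y) \<in> arrows X \<sigma>" if "(x, k, y) \<in> dr_basic X \<sigma> V n m U" for x k y
    using that assms(2,3)[THEN clopenin_subset] by (auto simp: dr_basic_iff arrows_iff)
  moreover have "(y, - k, x) \<in> dr_basic X \<sigma> U m n V \<longleftrightarrow> (x, k, y) \<in> dr_basic X \<sigma> V n m U" for x k y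
    by (auto simp: dr_basic_iff)
  ultimately show ?thesis
    using involution_zero[OF assms(1)] by (auto simp: steinberg_star fun_eq_iff dr_ind_def)
qed

lemma star_add:
  "field_involution j \<Longrightarrow> sstar (steinberg j G) (\<lambda>\<gamma>. f \<gamma> + g \<gamma>) =
    (\<lambda>\<gamma>. sstar (steinberg j G) f \<gamma> + sstar (steinberg j G) g \<gamma>)"
  by (auto simp: steinberg_star fun_eq_iff field_involution_def)

lemma star_in_span:
  assumes "field_involution j" "f \<in> dr_span X \<sigma>" shows "sstar (steinberg j G) f \<in> dr_span X \<sigma>"
  using assms(2)
proof (induction rule: dr_span_induct)
  case zero
  have "sstar (steinberg j G) (\<lambda>_. 0) = (\<lambda>_. 0)"
    using involution_zero[OF assms(1)] by (auto simp: steinberg_star)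
  then show ?case by (simp add: dr_span.zero)
next
  case (ind c U m n V)
  then show ?case by (simp add: star_ind[OF assms(1)] dr_ind_span)
next
  case (add f g)
  then show ?case by (simp add: star_add[OF assms(1)] dr_span_add)
qed

lemma steinberg_closed: "field_involution j \<Longrightarrow> star_closed (steinberg j G)"
  unfolding star_closed_def by (simp add: dr_span_add dr_span_scale convolution_closed star_in_span)

lemma steinberg_complex: "complex_star_algebra (steinberg cnj G)"
proof
  show "star_closed (steinberg cnj G)" by (rule steinberg_closed[OF cnj_involution])
  show "sstar (steinberg cnj G) (sstar (steinberg cnj G) a) = a" if "a \<in> scarrier (steinberg cnj G)" for a
    using that dr_span_vanish[of a] by (auto simp: steinberg_star fun_eq_iff dest: arrow_inverse)
qed (auto simp: dr_span.zero algebra_simps convolution_add_left convolution_add_right convolution_scale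
       star_add[OF cnj_involution] steinberg_star)

text \<open>A C*-seminorm is at most \<open>1\<close> on projections, and bounded on \<open>f\<close> once it is bounded on \<open>f\<^sup>* f\<close>.
  If \<open>\<sigma>\<^sup>m\<close> and \<open>\<sigma>\<^sup>n\<close> are injective on \<open>U\<close> and \<open>V\<close>, then the indicator \<open>f\<close> of \<open>Z(U, m, n, V)\<close> is a
  partial isometry: \<open>f\<^sup>* f\<close> is the indicator of a clopen set of units.\<close>

lemma steinberg_bounded: "env_bounded (steinberg cnj G)"
proof -
  let ?A = "steinberg cnj G"
  interpret A: complex_star_algebra ?A by (rule steinberg_complex)
  define bd where "bd f \<longleftrightarrow> (\<exists>M. \<forall>p. cstar_seminorm ?A p \<longrightarrow> p f \<le> M)" for f
  have p: "p (\<lambda>\<gamma>. f \<gamma> + g \<gamma>) \<le> p f + p g" "p (\<lambda>\<gamma>. c * f \<gamma>) = cmod c * p f"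
    "p (convolution G (sstar ?A f) f) = (p f)\<^sup>2" "0 \<le> p f"
    if "cstar_seminorm ?A p" "f \<in> dr_span X \<sigma>" "g \<in> dr_span X \<sigma>" for p f g c
    using that unfolding cstar_seminorm_def by simp_all
  have bd_add: "bd (\<lambda>\<gamma>. f \<gamma> + g \<gamma>)" if fg: "f \<in> dr_span X \<sigma>" "g \<in> dr_span X \<sigma>" "bd f" "bd g" for f g
  proof -
    obtain M N where "\<forall>p. cstar_seminorm ?A p \<longrightarrow> p f \<le> M" "\<forall>p. cstar_seminorm ?A p \<longrightarrow> p g \<le> N"
      using fg(3,4) unfolding bd_def by blast
    then have "\<forall>p. cstar_seminorm ?A p \<longrightarrow> p (\<lambda>\<gamma>. f \<gamma> + g \<gamma>) \<le> M + N"
      using p(1)[OF _ fg(1,2)] by (meson add_mono order_trans)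
    then show ?thesis unfolding bd_def by blast
  qed
  have bd_zero: "bd (\<lambda>_. 0)"
    unfolding bd_def
  proof (intro exI[of _ 0] allI impI)
    fix pp assume "cstar_seminorm ?A pp"
    then show "pp (\<lambda>_. 0) \<le> 0" using p(2)[OF _ dr_span.zero dr_span.zero, of pp 0] by simp
  qed
  have bd_square: "bd f" if f: "f \<in> dr_span X \<sigma>" and b: "bd (convolution G (sstar ?A f) f)" for f
  proof -
    obtain M where "\<forall>p. cstar_seminorm ?A p \<longrightarrow> p (convolution G (sstar ?A f) f) \<le> M"
      using b unfolding bd_def by blast
    then have "\<forall>p. cstar_seminorm ?A p \<longrightarrow> p f \<le> sqrt M"
      using p(3)[OF _ f f] by (metis real_le_rsqrt)
    then show ?thesis unfolding bd_def by blast
  qed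
  have bd_unit: "bd (dr_ind X \<sigma> d W 0 0 W)" if W: "clopenin X W" for d W
  proof -
    let ?e = "dr_ind X \<sigma> 1 W 0 0 W :: _ \<Rightarrow> complex"
    note e = dr_ind_span[OF W W, of \<sigma> "1 :: complex" 0 0]
    have "convolution G (sstar ?A ?e) ?e = ?e"
      using convolution_ind(1)[OF W W W W, of 0 0 1 0 1 0] star_ind[OF cnj_involution W W, of 1 0 0] by simp
    then have "p ?e \<le> 1" if "cstar_seminorm ?A p" for p
      using p(3,4)[OF that e e] by (simp add: power2_eq_square) (metis mult_cancel_left1 order_refl zero_le_one)
    then have "cmod d * p ?e \<le> cmod d" if "cstar_seminorm ?A p" for p
      using that by (simp add: mult_left_le)
    moreover have "dr_ind X \<sigma> d W 0 0 W = (\<lambda>\<gamma>. d * ?e \<gamma>)" by (auto simp: dr_ind_def)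
    ultimately show ?thesis unfolding bd_def using p(2)[OF _ e e] by auto
  qed
  have bd_piece: "bd (dr_ind X \<sigma> c U m n V)"
    if UV: "clopenin X U" "clopenin X V" and inj: "inj_on (\<sigma> ^^ m) U" "inj_on (\<sigma> ^^ n) V" for c U m n V
  proof (rule bd_square[OF dr_ind_span[OF UV]])
    let ?W = "{x \<in> V. (\<sigma> ^^ n) x \<in> (\<sigma> ^^ m) ` U}"
    have "convolution G (sstar ?A (dr_ind X \<sigma> c U m n V)) (dr_ind X \<sigma> c U m n V) =
        dr_ind X \<sigma> (cnj c * c) ?W n n V"
      using convolution_ind(1)[OF UV(2,1,1,2), of m m "cnj c" n c n] inj(1) star_ind[OF cnj_involution UV] by simp
    also have "\<dots> = dr_ind X \<sigma> (cnj c * c) ?W 0 0 ?W"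
    proof -
      have "dr_basic X \<sigma> ?W n n V = dr_basic X \<sigma> ?W 0 0 ?W"
        using inj(2) by (auto simp: dr_basic_def dest: inj_onD)
      then show ?thesis by (simp add: dr_ind_def)
    qed
    finally show "bd (convolution G (sstar ?A (dr_ind X \<sigma> c U m n V)) (dr_ind X \<sigma> c U m n V))"
      using bd_unit[OF clopen_return[OF UV(2,1)]] by simp
  qed
  have bd_sum: "bd (\<lambda>\<gamma>. \<Sum>i\<in>I. f i \<gamma>)" if "finite I" "\<And>i. i \<in> I \<Longrightarrow> bd (f i) \<and> f i \<in> dr_span X \<sigma>"
    for I :: "('a set \<times> 'a set) set" and f
    using that by (induction I rule: finite_induct) (auto intro!: bd_zero bd_add dr_span_sum)
  have "bd f" if "f \<in> dr_span X \<sigma>" for f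
    using that
  proof (induction rule: dr_span_induct)
    case (ind c U m n V)
    obtain P where P: "finite P"
      "\<And>A B. (A, B) \<in> P \<Longrightarrow> clopenin X A \<and> clopenin X B \<and> inj_on (\<sigma> ^^ (m + n)) A \<and> inj_on (\<sigma> ^^ (m + n)) B"
      "\<And>c::complex. dr_ind X \<sigma> c U m n V = (\<lambda>\<gamma>. \<Sum>(A, B)\<in>P. dr_ind X \<sigma> c A m n B \<gamma>)"
      using dr_ind_partition[OF ind, where N = "m + n" and m = m and n = n] by blast
    have "bd (\<lambda>\<gamma>. \<Sum>z\<in>P. dr_ind X \<sigma> c (fst z) m n (snd z) \<gamma>)"
    proof (rule bd_sum[OF P(1)])
      fix z assume "z \<in> P"
      then have z: "clopenin X (fst z)" "clopenin X (snd z)" "inj_on (\<sigma> ^^ (m + n)) (fst z)" "inj_on (\<sigma> ^^ (m + n)) (snd z)"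
        using P(2)[of "fst z" "snd z"] by auto
      then show "bd (dr_ind X \<sigma> c (fst z) m n (snd z)) \<and> dr_ind X \<sigma> c (fst z) m n (snd z) \<in> dr_span X \<sigma>"
        using inj_on_iterate_le[of "m + n"] by (intro conjI bd_piece dr_ind_span) auto
    qed
    then show ?case unfolding P(3) by (simp add: split_beta)
  qed (use bd_zero bd_add in auto)
  then have "\<exists>M. \<forall>p. cstar_seminorm ?A p \<longrightarrow> p f \<le> M" if "f \<in> dr_span X \<sigma>" for f
    using that unfolding bd_def by blast
  then show ?thesis unfolding env_bounded_def bdd_above_def by simp
qed

end

section \<open>Fibrewise bijective maps\<close>

text \<open>For an equivariant map which restricts to bijections between the fibres of the two maps, arrows of the
  target groupoid lift uniquely once a lift of the source is chosen. This makes pullback of functions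
  multiplicative for convolution.\<close>

locale fibre_map = S: ample_system X \<sigma> + T: ample_system Y \<rho>
  for X :: "'a topology" and \<sigma> and Y :: "'b topology" and \<rho> +
  fixes \<psi> :: "'a \<Rightarrow> 'b"
  assumes map_continuous: "continuous_map X Y \<psi>"
    and equivariant: "x \<in> topspace X \<Longrightarrow> \<psi> (\<sigma> x) = \<rho> (\<psi> x)"
    and lift: "\<lbrakk>x \<in> topspace X; y \<in> topspace Y; \<rho> y = \<psi> x\<rbrakk> \<Longrightarrow> \<exists>!x'. x' \<in> topspace X \<and> \<sigma> x' = x \<and> \<psi> x' = y"
begin

lemma map_closed [simp]: "x \<in> topspace X \<Longrightarrow> \<psi> x \<in> topspace Y"
  using map_continuous by (simp add: continuous_map_def Pi_iff)

lemma equivariant_iterate: "x \<in> topspace X \<Longrightarrow> \<psi> ((\<sigma> ^^ n) x) = (\<rho> ^^ n) (\<psi> x)"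
  by (induction n) (simp_all add: equivariant)

lemma lift_iterate:
  "\<lbrakk>x \<in> topspace X; y \<in> topspace Y; (\<rho> ^^ n) y = \<psi> x\<rbrakk> \<Longrightarrow> \<exists>!x'. x' \<in> topspace X \<and> (\<sigma> ^^ n) x' = x \<and> \<psi> x' = y"
proof (induction n arbitrary: y)
  case 0
  then show ?case by auto
next
  case (Suc n)
  have "(\<rho> ^^ n) (\<rho> y) = \<psi> x" using Suc.prems(3) by (simp add: funpow_swap1)
  moreover have "\<rho> y \<in> topspace Y" using Suc.prems(2) T.iterate_closed[of y 1] by simp
  ultimately obtain u where u: "u \<in> topspace X" "(\<sigma> ^^ n) u = x" "\<psi> u = \<rho> y"
    and uu: "\<And>u'. u' \<in> topspace X \<Longrightarrow> (\<sigma> ^^ n) u' = x \<Longrightarrow> \<psi> u' = \<rho> y \<Longrightarrow> u' = u"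
    using Suc.IH[OF Suc.prems(1), of "\<rho> y"] by blast
  obtain x' where x': "x' \<in> topspace X" "\<sigma> x' = u" "\<psi> x' = y"
    and xx: "\<And>x''. x'' \<in> topspace X \<Longrightarrow> \<sigma> x'' = u \<Longrightarrow> \<psi> x'' = y \<Longrightarrow> x'' = x'"
    using lift[OF u(1) Suc.prems(2)] u(3) by metis
  show ?case
  proof (rule ex1I[of _ x'])
    show "x' \<in> topspace X \<and> (\<sigma> ^^ Suc n) x' = x \<and> \<psi> x' = y" using x' u by (simp add: funpow_swap1)
    fix x'' assume x'': "x'' \<in> topspace X \<and> (\<sigma> ^^ Suc n) x'' = x \<and> \<psi> x'' = y"
    have "\<sigma> x'' = u"
      using x'' uu[of "\<sigma> x''"] equivariant[of x''] S.iterate_closed[of x'' 1] by (simp add: funpow_swap1)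
    then show "x'' = x'" using xx x'' by blast
  qed
qed

lemma iterate_inj:
  assumes "u \<in> topspace X" "v \<in> topspace X" "(\<sigma> ^^ n) u = (\<sigma> ^^ n) v" "\<psi> u = \<psi> v" shows "u = v"
  using lift_iterate[of "(\<sigma> ^^ n) v" "\<psi> v" n] assms by (auto simp: equivariant_iterate)

lemma arrow_map: "(x, k, y) \<in> arrows X \<sigma> \<Longrightarrow> (\<psi> x, k, \<psi> y) \<in> arrows Y \<rho>"
  unfolding arrows_iff by (metis equivariant_iterate map_closed)

lemma arrow_basic_iff:
  assumes a: "(x, k, y) \<in> arrows X \<sigma>"
  shows "(\<psi> x, k, \<psi> y) \<in> dr_basic Y \<rho> U m n V \<longleftrightarrow>
    (x, k, y) \<in> dr_basic X \<sigma> {x \<in> topspace X. \<psi> x \<in> U} m n {x \<in> topspace X. \<psi> x \<in> V}"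
proof -
  have xy: "x \<in> topspace X" "y \<in> topspace X" using a by (auto simp: arrows_iff)
  have "(\<sigma> ^^ m) x = (\<sigma> ^^ n) y" if k: "k = int m - int n" and eq: "(\<rho> ^^ m) (\<psi> x) = (\<rho> ^^ n) (\<psi> y)"
  proof -
    obtain p q where pq: "p \<ge> m" "k = int p - int q" "(\<sigma> ^^ p) x = (\<sigma> ^^ q) y" using arrow_late[OF a] by metis
    obtain l where l: "p = m + l" using pq(1) le_iff_add by blast
    have l': "q = n + l" using l pq(2) k by simp
    show ?thesis
      by (rule iterate_inj[of _ _ l]) (use pq(3) l l' eq xy in \<open>simp_all add: equivariant_iterate funpow_add add.commute[of _ l]\<close>)
  qed
  then show ?thesis using xy by (auto simp: dr_basic_iff equivariant_iterate[symmetric])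
qed

text \<open>With \<open>\<sigma>\<^sup>m x = \<sigma>\<^sup>n z\<close> the point \<open>\<sigma>\<^sup>n z\<close> is prescribed, and \<open>x\<close> is its unique \<open>m\<close>-fold preimage over \<open>y\<close>.\<close>

lemma arrow_lift:
  assumes "(y, k, \<psi> z) \<in> arrows Y \<rho>" "z \<in> topspace X"
  shows "\<exists>!x. (x, k, z) \<in> arrows X \<sigma> \<and> \<psi> x = y"
proof -
  obtain m n where mn: "k = int m - int n" "(\<rho> ^^ m) y = (\<rho> ^^ n) (\<psi> z)" and y: "y \<in> topspace Y"
    using assms(1) by (auto simp: arrows_iff)
  obtain x where x: "x \<in> topspace X" "(\<sigma> ^^ m) x = (\<sigma> ^^ n) z" "\<psi> x = y"
    using lift_iterate[of "(\<sigma> ^^ n) z" y m] mn(2) y assms(2) by (auto simp: equivariant_iterate)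
  show ?thesis
  proof (rule ex1I[of _ x])
    show "(x, k, z) \<in> arrows X \<sigma> \<and> \<psi> x = y" using x mn assms(2) by (auto simp: arrows_iff)
    fix x' assume x': "(x', k, z) \<in> arrows X \<sigma> \<and> \<psi> x' = y"
    then obtain p q where pq: "p \<ge> m" "k = int p - int q" "(\<sigma> ^^ p) x' = (\<sigma> ^^ q) z"
      using arrow_late[of x' k z X \<sigma> m] by metis
    obtain l where l: "p = m + l" using pq(1) le_iff_add by blast
    have l': "q = n + l" using l pq(2) mn(1) by simp
    have "(\<sigma> ^^ p) x = (\<sigma> ^^ p) x'" using iterate_eq_later[OF x(2), of l] l l' pq(3) by simp
    then show "x' = x" using iterate_inj[of x' x p] x x' by (auto simp: arrows_iff)
  qed
qed

definition pullback :: "('b \<times> int \<times> 'b \<Rightarrow> 'k::field) \<Rightarrow> 'a \<times> int \<times> 'a \<Rightarrow> 'k" where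
  "pullback f = (\<lambda>(x, k, y). if (x, k, y) \<in> arrows X \<sigma> then f (\<psi> x, k, \<psi> y) else 0)"

lemma pullback_ind:
  assumes "clopenin Y U" "clopenin Y V"
  shows "pullback (dr_ind Y \<rho> c U m n V) =
    dr_ind X \<sigma> c {x \<in> topspace X. \<psi> x \<in> U} m n {x \<in> topspace X. \<psi> x \<in> V}"
proof -
  have "(x, k, y) \<in> arrows X \<sigma>"
    if "(x, k, y) \<in> dr_basic X \<sigma> {x \<in> topspace X. \<psi> x \<in> U} m n {x \<in> topspace X. \<psi> x \<in> V}" for x k y
    using that by (auto simp: dr_basic_iff arrows_iff)
  then show ?thesis using arrow_basic_iff by (auto simp: pullback_def dr_ind_def fun_eq_iff)
qed

lemma pullback_add: "pullback (\<lambda>\<gamma>. f \<gamma> + g \<gamma>) = (\<lambda>\<gamma>. pullback f \<gamma> + pullback g \<gamma>)"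
  by (auto simp: pullback_def)

lemma pullback_zero: "pullback (\<lambda>_. 0) = (\<lambda>_. 0)"
  by (auto simp: pullback_def)

lemma pullback_span: "f \<in> dr_span Y \<rho> \<Longrightarrow> pullback f \<in> dr_span X \<sigma>"
proof (induction rule: dr_span_induct)
  case (ind c U m n V)
  then show ?case by (simp add: pullback_ind dr_ind_span clopenin_preimage[OF map_continuous])
qed (simp_all add: pullback_zero pullback_add dr_span.zero dr_span_add)

text \<open>For fixed source, the intermediate points of the two convolution sums correspond to each other by unique lifting of arrows.\<close>

lemma pullback_convolution: "pullback (convolution T.G f g) = convolution S.G (pullback f) (pullback g)"
proof
  fix \<gamma> :: "'a \<times> int \<times> 'a" obtain x k z where \<gamma>: "\<gamma> = (x, k, z)" by (cases \<gamma>)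
  show "pullback (convolution T.G f g) \<gamma> = convolution S.G (pullback f) (pullback g) \<gamma>"
  proof (cases "(x, k, z) \<in> arrows X \<sigma>")
    case False
    then show ?thesis unfolding \<gamma> by (simp add: S.convolution_off) (simp add: pullback_def)
  next
    case True
    let ?t = "\<lambda>(y, q, w). (\<psi> y, q, \<psi> w)"
    let ?S = "{\<alpha> \<in> arrows X \<sigma>. gsource S.G \<alpha> = gsource S.G (x, k, z) \<and>
        pullback f (gmult S.G (x, k, z) (ginv S.G \<alpha>)) * pullback g \<alpha> \<noteq> 0}"
    let ?T = "{\<alpha> \<in> arrows Y \<rho>. gsource T.G \<alpha> = gsource T.G (\<psi> x, k, \<psi> z) \<and>
        f (gmult T.G (\<psi> x, k, \<psi> z) (ginv T.G \<alpha>)) * g \<alpha> \<noteq> 0}"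
    have term_eq: "pullback f (gmult S.G (x, k, z) (ginv S.G \<alpha>)) * pullback g \<alpha> =
        f (gmult T.G (\<psi> x, k, \<psi> z) (ginv T.G (?t \<alpha>))) * g (?t \<alpha>)"
      if a: "\<alpha> \<in> arrows X \<sigma>" and z: "gsource S.G \<alpha> = z" for \<alpha>
    proof -
      obtain y q where \<alpha>: "\<alpha> = (y, q, z)" using z by (cases \<alpha>) auto
      have "(x, k - q, y) \<in> arrows X \<sigma>"
        using arrow_compose[OF True arrow_inverse[of y q z]] a \<alpha> by simp
      then show ?thesis using a unfolding \<alpha> by (simp add: pullback_def)
    qed
    have "bij_betw ?t ?S ?T"
    proof (rule bij_betw_imageI)
      show "inj_on ?t ?S"
      proof (rule inj_onI)
        fix \<alpha> \<beta> assume ab: "\<alpha> \<in> ?S" "\<beta> \<in> ?S" "?t \<alpha> = ?t \<beta>"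
        obtain y q y' q' where e: "\<alpha> = (y, q, z)" "\<beta> = (y', q', z)"
          using ab(1,2) by (cases \<alpha>; cases \<beta>) auto
        then show "\<alpha> = \<beta>" using ab arrow_lift[OF arrow_map[of y q z]] by (auto simp: arrows_iff)
      qed
      show "?t ` ?S = ?T"
      proof (intro equalityI subsetI)
        fix \<beta> assume "\<beta> \<in> ?t ` ?S"
        then obtain \<alpha> where \<alpha>: "\<alpha> \<in> ?S" "\<beta> = ?t \<alpha>" by blast
        obtain y q where e: "\<alpha> = (y, q, z)" using \<alpha> by (cases \<alpha>) auto
        have "pullback f (gmult S.G (x, k, z) (ginv S.G \<alpha>)) * pullback g \<alpha> \<noteq> 0" using \<alpha>(1) by simp
        then have "f (gmult T.G (\<psi> x, k, \<psi> z) (ginv T.G \<beta>)) * g \<beta> \<noteq> 0"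
          using term_eq[of \<alpha>] \<alpha> e by (metis (no_types, lifting) mem_Collect_eq dr_groupoid_ops(1))
        then show "\<beta> \<in> ?T" using \<alpha> arrow_map[of y q z] e by simp
      next
        fix \<beta> assume b: "\<beta> \<in> ?T"
        then obtain y q where e: "\<beta> = (y, q, \<psi> z)" by (cases \<beta>) auto
        obtain x' where x': "(x', q, z) \<in> arrows X \<sigma>" "\<psi> x' = y"
          using arrow_lift[of y q z] b e True by (auto simp: arrows_iff[of x])
        have "f (gmult T.G (\<psi> x, k, \<psi> z) (ginv T.G \<beta>)) * g \<beta> \<noteq> 0" using b by simp
        then have "pullback f (gmult S.G (x, k, z) (ginv S.G (x', q, z))) * pullback g (x', q, z) \<noteq> 0"
          using term_eq[of "(x', q, z)"] x' e by simp
        then have "(x', q, z) \<in> ?S" using x'(1) by simp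
        then show "\<beta> \<in> ?t ` ?S" using e x'(2) by force
      qed
    qed
    then have "(\<Sum>\<alpha>\<in>?S. f (gmult T.G (\<psi> x, k, \<psi> z) (ginv T.G (?t \<alpha>))) * g (?t \<alpha>)) =
        (\<Sum>\<beta>\<in>?T. f (gmult T.G (\<psi> x, k, \<psi> z) (ginv T.G \<beta>)) * g \<beta>)"
      by (rule sum.reindex_bij_betw)
    moreover have "(\<Sum>\<alpha>\<in>?S. pullback f (gmult S.G (x, k, z) (ginv S.G \<alpha>)) * pullback g \<alpha>) =
        (\<Sum>\<alpha>\<in>?S. f (gmult T.G (\<psi> x, k, \<psi> z) (ginv T.G (?t \<alpha>))) * g (?t \<alpha>))"
      by (rule sum.cong[OF refl], rule term_eq) auto
    ultimately have "convolution S.G (pullback f) (pullback g) (x, k, z) = convolution T.G f g (\<psi> x, k, \<psi> z)"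
      unfolding convolution_def topspace_dr using True arrow_map[OF True] by (simp only: if_True)
    then show ?thesis unfolding \<gamma> using True by (simp add: pullback_def)
  qed
qed

lemma pullback_hom: "field_involution j \<Longrightarrow> star_hom (steinberg j T.G) (steinberg j S.G) pullback"
  unfolding star_hom_def
  by (auto simp: pullback_span pullback_add pullback_convolution)
     (auto simp: pullback_def S.steinberg_star T.steinberg_star involution_zero fun_eq_iff dest: arrow_map arrow_inverse)

end

lemma fibre_map_cong:
  assumes "fibre_map X \<sigma> Y \<rho> \<phi>" and eq: "\<And>x. x \<in> topspace X \<Longrightarrow> \<psi> x = \<phi> x"
  shows "fibre_map X \<sigma> Y \<rho> \<psi>"
proof -
  interpret fibre_map X \<sigma> Y \<rho> \<phi> by fact
  have cl: "\<sigma> x \<in> topspace X" if "x \<in> topspace X" for x using S.iterate_closed[OF that, of 1] by simp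
  show ?thesis
  proof
    show "continuous_map X Y \<psi>" by (rule continuous_map_eq[OF map_continuous]) (simp add: eq)
    show "\<psi> (\<sigma> x) = \<rho> (\<psi> x)" if "x \<in> topspace X" for x using equivariant[OF that] eq[OF that] eq[OF cl[OF that]] by simp
    show "\<exists>!x'. x' \<in> topspace X \<and> \<sigma> x' = x \<and> \<psi> x' = y" if "x \<in> topspace X" "y \<in> topspace Y" "\<rho> y = \<psi> x" for x y
    proof -
      have "\<rho> y = \<phi> x" using that(3) eq[OF that(1)] by simp
      from lift[OF that(1,2) this] show ?thesis by (simp add: eq cong: conj_cong)
    qed
  qed
qed

lemma ample_system_homeomorphic:
  assumes "ample_system X \<sigma>" and hg: "homeomorphic_maps X Z h g" and eq: "\<And>x. x \<in> topspace X \<Longrightarrow> h (\<sigma> x) = \<kappa> (h x)"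
  shows "ample_system Z \<kappa>"
proof -
  interpret ample_system X \<sigma> by fact
  have h: "homeomorphic_map X Z h" and g: "homeomorphic_map Z X g" using hg homeomorphic_maps_map by blast+
  have ch: "continuous_map X Z h" and cg: "continuous_map Z X g" and hg': "\<And>z. z \<in> topspace Z \<Longrightarrow> h (g z) = z"
    and gh: "\<And>x. x \<in> topspace X \<Longrightarrow> g (h x) = x"
    using hg unfolding homeomorphic_maps_def by auto
  have gz: "g z \<in> topspace X" if "z \<in> topspace Z" for z using cg that by (simp add: continuous_map_def Pi_iff)
  have \<kappa>: "\<kappa> z = (h \<circ> (\<sigma> \<circ> g)) z" if "z \<in> topspace Z" for z using eq[OF gz[OF that]] hg'[OF that] by simp
  show ?thesis
  proof
    show "compact_space Z" "Hausdorff_space Z"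
      using homeomorphic_compact_space homeomorphic_Hausdorff_space compact hausdorff h
      by (meson homeomorphic_map_imp_homeomorphic_space)+
    show "\<exists>V. clopenin Z V \<and> z \<in> V \<and> V \<subseteq> U" if U: "openin Z U" "z \<in> U" for U z
    proof -
      have z: "z \<in> topspace Z" using openin_subset[OF U(1)] U(2) by blast
      have "openin X {x \<in> topspace X. h x \<in> U}" by (rule openin_continuous_map_preimage[OF ch U(1)])
      moreover have "g z \<in> {x \<in> topspace X. h x \<in> U}" using gz[OF z] hg'[OF z] U(2) by simp
      ultimately obtain V where V: "clopenin X V" "g z \<in> V" "V \<subseteq> {x \<in> topspace X. h x \<in> U}" using clopen_base by blast
      have "clopenin Z {z \<in> topspace Z. g z \<in> V}" by (rule clopenin_preimage[OF cg V(1)])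
      moreover have "{z \<in> topspace Z. g z \<in> V} \<subseteq> U"
      proof clarify
        fix z' assume "z' \<in> topspace Z" "g z' \<in> V"
        then show "z' \<in> U" using V(3) hg'[of z'] by auto
      qed
      ultimately show ?thesis using V(2) z by blast
    qed
    have c: "continuous_map Z Z (h \<circ> (\<sigma> \<circ> g))"
      by (rule continuous_map_compose[OF continuous_map_compose[OF cg continuous] ch])
    show "continuous_map Z Z \<kappa>" by (rule continuous_map_eq[OF c]) (simp add: \<kappa>)
    have "open_map Z Z (h \<circ> (\<sigma> \<circ> g))"
      using open_map_compose[OF open_map_compose[OF _ open_map] homeomorphic_imp_open_map[OF h]]
        homeomorphic_imp_open_map[OF g] by blast
    moreover have "\<kappa> ` U = (h \<circ> (\<sigma> \<circ> g)) ` U" if "openin Z U" for U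
      by (rule image_cong) (use openin_subset[OF that] \<kappa> in auto)
    ultimately show "open_map Z Z \<kappa>" unfolding open_map_def by metis
    show "\<exists>U. openin Z U \<and> z \<in> U \<and> inj_on \<kappa> U" if z: "z \<in> topspace Z" for z
    proof -
      obtain U where U: "openin X U" "g z \<in> U" "inj_on \<sigma> U" using locally_inj[OF gz[OF z]] by blast
      let ?V = "{z \<in> topspace Z. g z \<in> U}"
      have "inj_on \<kappa> ?V"
      proof (rule inj_onI)
        fix a b assume ab: "a \<in> ?V" "b \<in> ?V" "\<kappa> a = \<kappa> b"
        have \<sigma>: "\<sigma> (g y) \<in> topspace X" if "y \<in> topspace Z" for y using iterate_closed[OF gz[OF that], of 1] by simp
        have "h (\<sigma> (g a)) = h (\<sigma> (g b))" using ab \<kappa> by simp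
        then have "g (h (\<sigma> (g a))) = g (h (\<sigma> (g b)))" by simp
        then have "\<sigma> (g a) = \<sigma> (g b)" using gh[OF \<sigma>] ab(1,2) by simp
        then have "g a = g b" using inj_onD[OF U(3)] ab(1,2) by blast
        then have "h (g a) = h (g b)" by simp
        then show "a = b" using hg'[of a] hg'[of b] ab(1,2) by simp
      qed
      then show ?thesis using openin_continuous_map_preimage[OF cg U(1)] U(2) z by (intro exI[of _ ?V]) simp
    qed
  qed
qed

section \<open>Inverse limits of systems and colimits of Steinberg algebras\<close>

text \<open>\<open>X\<close> is an inverse limit of the systems \<open>Y n\<close>: its topology is induced by the projections, and every thread comes
  from a point. The last two conditions describe the limit without mentioning the product space.\<close>

locale fibred_limit =
  fixes Y :: "nat \<Rightarrow> 'b topology" and \<rho> :: "nat \<Rightarrow> 'b \<Rightarrow> 'b" and \<psi> :: "nat \<Rightarrow> 'b \<Rightarrow> 'b"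
    and X :: "'a topology" and \<sigma> :: "'a \<Rightarrow> 'a" and \<pi> :: "nat \<Rightarrow> 'a \<Rightarrow> 'b"
  assumes step: "fibre_map (Y (Suc n)) (\<rho> (Suc n)) (Y n) (\<rho> n) (\<psi> n)"
    and proj: "fibre_map X \<sigma> (Y n) (\<rho> n) (\<pi> n)"
    and proj_compat: "x \<in> topspace X \<Longrightarrow> \<psi> n (\<pi> (Suc n) x) = \<pi> n x"
    and proj_base: "openin X U \<Longrightarrow> x \<in> U \<Longrightarrow> \<exists>n V. clopenin (Y n) V \<and> \<pi> n x \<in> V \<and> {x \<in> topspace X. \<pi> n x \<in> V} \<subseteq> U"
    and threads: "(\<And>n. t n \<in> topspace (Y n)) \<Longrightarrow> (\<And>n. \<psi> n (t (Suc n)) = t n) \<Longrightarrow> \<exists>x\<in>topspace X. \<forall>n. \<pi> n x = t n"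
begin

lemma ample_limit: "ample_system X \<sigma>" and ample_stage: "ample_system (Y n) (\<rho> n)"
  using proj[of n] by (simp_all add: fibre_map_def)

abbreviation "GX \<equiv> dr_groupoid X \<sigma>"
abbreviation "GY n \<equiv> dr_groupoid (Y n) (\<rho> n)"

definition step_pullback :: "nat \<Rightarrow> ('b \<times> int \<times> 'b \<Rightarrow> 'k::field) \<Rightarrow> 'b \<times> int \<times> 'b \<Rightarrow> 'k" where
  "step_pullback n f = (\<lambda>(x, k, y). if (x, k, y) \<in> arrows (Y (Suc n)) (\<rho> (Suc n)) then f (\<psi> n x, k, \<psi> n y) else 0)"

definition proj_pullback :: "nat \<Rightarrow> ('b \<times> int \<times> 'b \<Rightarrow> 'k::field) \<Rightarrow> 'a \<times> int \<times> 'a \<Rightarrow> 'k" where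
  "proj_pullback n f = (\<lambda>(x, k, y). if (x, k, y) \<in> arrows X \<sigma> then f (\<pi> n x, k, \<pi> n y) else 0)"

lemma step_pullback_eq: "step_pullback n = fibre_map.pullback (Y (Suc n)) (\<rho> (Suc n)) (\<psi> n)"
  by (simp add: fun_eq_iff step_pullback_def fibre_map.pullback_def[OF step])

lemma proj_pullback_eq: "proj_pullback n = fibre_map.pullback X \<sigma> (\<pi> n)"
  by (simp add: fun_eq_iff proj_pullback_def fibre_map.pullback_def[OF proj])

lemma step_hom: "field_involution j \<Longrightarrow> star_hom (steinberg j (GY n)) (steinberg j (GY (Suc n))) (step_pullback n)"
  unfolding step_pullback_eq by (rule fibre_map.pullback_hom[OF step])

lemma proj_hom: "field_involution j \<Longrightarrow> star_hom (steinberg j (GY n)) (steinberg j GX) (proj_pullback n)"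
  unfolding proj_pullback_eq by (rule fibre_map.pullback_hom[OF proj])

lemma proj_pullback_step: "proj_pullback (Suc n) (step_pullback n f) = proj_pullback n f"
  using fibre_map.arrow_map[OF proj, of _ _ _ "Suc n"] proj_compat
  by (auto simp: fun_eq_iff proj_pullback_def step_pullback_def arrows_iff[of _ _ _ X])

lemma clopen_raise:
  assumes "clopenin (Y n) V" "n \<le> m"
  shows "\<exists>W. clopenin (Y m) W \<and> {x \<in> topspace X. \<pi> n x \<in> V} = {x \<in> topspace X. \<pi> m x \<in> W}"
  using assms(2)
proof (induction rule: dec_induct)
  case base
  then show ?case using assms(1) by blast
next
  case (step m)
  then obtain W where W: "clopenin (Y m) W" "{x \<in> topspace X. \<pi> n x \<in> V} = {x \<in> topspace X. \<pi> m x \<in> W}" by blast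
  let ?W = "{y \<in> topspace (Y (Suc m)). \<psi> m y \<in> W}"
  have "clopenin (Y (Suc m)) ?W"
    by (rule clopenin_preimage[OF fibre_map.map_continuous[OF fibred_limit.step[OF fibred_limit_axioms]] W(1)])
  moreover have "{x \<in> topspace X. \<pi> m x \<in> W} = {x \<in> topspace X. \<pi> (Suc m) x \<in> ?W}"
    using proj_compat fibre_map.map_closed[OF proj] by auto
  ultimately show ?case using W(2) by auto
qed

text \<open>Projections of clopen sets form a base which is closed under finite unions, as stages can be raised; compactness gives the rest.\<close>

lemma clopen_from_stage:
  assumes "clopenin X U"
  shows "\<exists>n V. clopenin (Y n) V \<and> U = {x \<in> topspace X. \<pi> n x \<in> V}"
proof -
  define cyl where "cyl W \<longleftrightarrow> (\<exists>n V. clopenin (Y n) V \<and> W = {x \<in> topspace X. \<pi> n x \<in> V})" for W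
  have op: "openin X W" if "cyl W" for W
    using that clopenin_preimage[OF fibre_map.map_continuous[OF proj]] unfolding cyl_def clopenin_def by blast
  have "\<exists>W. cyl W \<and> x \<in> W \<and> W \<subseteq> U" if x: "x \<in> U" for x
  proof -
    have U: "openin X U" using assms by (simp add: clopenin_def)
    obtain n V where "clopenin (Y n) V" "\<pi> n x \<in> V" "{x \<in> topspace X. \<pi> n x \<in> V} \<subseteq> U"
      using proj_base[OF U x] by blast
    moreover have "x \<in> topspace X" using openin_subset[OF U] x by blast
    ultimately show ?thesis unfolding cyl_def by blast
  qed
  then have cov: "U \<subseteq> \<Union>{W. cyl W \<and> W \<subseteq> U}" by blast
  have "compactin X U"
    using closedin_compact_space[OF ample_system.compact[OF ample_limit]] assms by (simp add: clopenin_def)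
  then obtain \<F> where \<F>: "finite \<F>" "\<F> \<subseteq> {W. cyl W \<and> W \<subseteq> U}" "U \<subseteq> \<Union>\<F>"
    using compactinD[of X U "{W. cyl W \<and> W \<subseteq> U}"] cov op by blast
  have "cyl (\<Union>\<F>)" using \<F>(1,2)
  proof (induction \<F> rule: finite_induct)
    case empty
    have "clopenin (Y 0) {}" by (simp add: clopenin_def)
    then show ?case unfolding cyl_def by (intro exI[of _ 0] exI[of _ "{}"]) simp
  next
    case (insert W \<F>)
    then have "cyl W" "cyl (\<Union>\<F>)" by auto
    then obtain n V m V' where 1: "clopenin (Y n) V" "W = {x \<in> topspace X. \<pi> n x \<in> V}"
      "clopenin (Y m) V'" "\<Union>\<F> = {x \<in> topspace X. \<pi> m x \<in> V'}" unfolding cyl_def by blast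
    obtain A where A: "clopenin (Y (max n m)) A" "W = {x \<in> topspace X. \<pi> (max n m) x \<in> A}"
      using clopen_raise[OF 1(1), of "max n m"] 1(2) by auto
    obtain B where B: "clopenin (Y (max n m)) B" "\<Union>\<F> = {x \<in> topspace X. \<pi> (max n m) x \<in> B}"
      using clopen_raise[OF 1(3), of "max n m"] 1(4) by auto
    have "clopenin (Y (max n m)) (A \<union> B)" using A(1) B(1) by (auto simp: clopenin_def)
    moreover have "\<Union>(insert W \<F>) = {x \<in> topspace X. \<pi> (max n m) x \<in> A \<union> B}" using A(2) B(2) by auto
    ultimately show ?case unfolding cyl_def by blast
  qed
  moreover have "\<Union>\<F> = U" using \<F> by blast
  ultimately show ?thesis unfolding cyl_def by simp
qed

lemma raise_function:
  assumes "a \<in> dr_span (Y n) (\<rho> n)" "n \<le> m"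
  shows "\<exists>b\<in>dr_span (Y m) (\<rho> m). proj_pullback m b = proj_pullback n a"
  using assms(2)
proof (induction rule: dec_induct)
  case base
  then show ?case using assms(1) by blast
next
  case (step m)
  then obtain b where "b \<in> dr_span (Y m) (\<rho> m)" "proj_pullback m b = proj_pullback n a" by blast
  then show ?case
    using fibre_map.pullback_span[OF fibred_limit.step[OF fibred_limit_axioms], of b m] proj_pullback_step[of m b]
    by (intro bexI[of _ "step_pullback m b"]) (simp_all add: step_pullback_eq)
qed

lemma functions_from_stage:
  fixes f :: "'a \<times> int \<times> 'a \<Rightarrow> 'k::field"
  shows "f \<in> dr_span X \<sigma> \<Longrightarrow> \<exists>n. \<exists>a\<in>dr_span (Y n) (\<rho> n). proj_pullback n a = f"
proof (induction rule: dr_span_induct)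
  case zero
  show ?case by (intro exI[of _ 0] bexI[OF _ dr_span.zero]) (auto simp: proj_pullback_def)
next
  case (ind c U m n V)
  obtain i A where A: "clopenin (Y i) A" "U = {x \<in> topspace X. \<pi> i x \<in> A}" using clopen_from_stage[OF ind(1)] by blast
  obtain j B where B: "clopenin (Y j) B" "V = {x \<in> topspace X. \<pi> j x \<in> B}" using clopen_from_stage[OF ind(2)] by blast
  let ?N = "max i j"
  obtain A' where A': "clopenin (Y ?N) A'" "U = {x \<in> topspace X. \<pi> ?N x \<in> A'}"
    using clopen_raise[OF A(1), of ?N] A(2) by auto
  obtain B' where B': "clopenin (Y ?N) B'" "V = {x \<in> topspace X. \<pi> ?N x \<in> B'}"
    using clopen_raise[OF B(1), of ?N] B(2) by auto
  have "proj_pullback ?N (dr_ind (Y ?N) (\<rho> ?N) c A' m n B') = dr_ind X \<sigma> c U m n V"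
    unfolding proj_pullback_eq A'(2) B'(2) by (rule fibre_map.pullback_ind[OF proj A'(1) B'(1)])
  then show ?case using dr_ind_span[OF A'(1) B'(1)] by blast
next
  case (add f g)
  then obtain n a m b where "a \<in> dr_span (Y n) (\<rho> n)" "proj_pullback n a = f"
    "b \<in> dr_span (Y m) (\<rho> m)" "proj_pullback m b = g" by blast
  then obtain a' b' where "a' \<in> dr_span (Y (max n m)) (\<rho> (max n m))" "proj_pullback (max n m) a' = f"
    "b' \<in> dr_span (Y (max n m)) (\<rho> (max n m))" "proj_pullback (max n m) b' = g"
    using raise_function[of a n "max n m"] raise_function[of b m "max n m"] by auto
  moreover have "proj_pullback (max n m) (\<lambda>\<gamma>. a' \<gamma> + b' \<gamma>) =
      (\<lambda>\<gamma>. proj_pullback (max n m) a' \<gamma> + proj_pullback (max n m) b' \<gamma>)"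
    by (auto simp: proj_pullback_def)
  ultimately show ?case using dr_span_add by metis
qed

primrec down :: "nat \<Rightarrow> nat \<Rightarrow> 'b \<Rightarrow> 'b" where
  "down n 0 y = y"
| "down n (Suc k) y = down n k (\<psi> (n + k) y)"

lemma step_closed: "y \<in> topspace (Y (Suc n)) \<Longrightarrow> \<psi> n y \<in> topspace (Y n)"
  by (rule fibre_map.map_closed[OF step])

lemma down_closed: "y \<in> topspace (Y (n + k)) \<Longrightarrow> down n k y \<in> topspace (Y n)"
  by (induction k arbitrary: y) (auto intro: step_closed)

lemma step_down: "\<psi> n (down (Suc n) k y) = down n (Suc k) y"
  by (induction k arbitrary: y) simp_all

text \<open>If the closed set met the image of every later stage, then the partial threads through it would form a decreasing sequence of nonempty closed subsets of the product of all stages, and a common point of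
  these is a thread through the set.\<close>

lemma closed_missed:
  assumes U: "closedin (Y n) U" and miss: "\<And>x. x \<in> topspace X \<Longrightarrow> \<pi> n x \<notin> U"
  shows "\<exists>k. \<forall>y\<in>topspace (Y (n + k)). down n k y \<notin> U"
proof (rule ccontr)
  assume "\<not> ?thesis"
  then have ex: "\<exists>y\<in>topspace (Y (n + k)). down n k y \<in> U" for k by blast
  have ne: "topspace (Y i) \<noteq> {}" for i
  proof -
    obtain y where "y \<in> topspace (Y (n + i))" using ex by blast
    then show ?thesis using down_closed[of y i n] by (auto simp: add.commute)
  qed
  \<comment> \<open>Arbitrary points that fill up a partial thread beyond its last prescribed entry.\<close>
  define p where "p i = (SOME y. y \<in> topspace (Y i))" for i
  have p: "p i \<in> topspace (Y i)" for i unfolding p_def using ne[of i] by (simp add: some_in_eq)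
  let ?P = "product_topology Y UNIV"
  have proj_cont: "continuous_map ?P (Y i) (\<lambda>t. t i)" for i by (rule continuous_map_product_projection) simp
  define T where "T k = {t \<in> topspace ?P. t n \<in> U} \<inter> (\<Inter>i\<in>{..<n + k}. {t \<in> topspace ?P. \<psi> i (t (Suc i)) = t i})
    \<inter> topspace ?P" for k
  have "compact_space ?P" using ample_system.compact[OF ample_stage] by (simp add: compact_space_product_topology)
  moreover have "closedin ?P (T k)" for k
  proof -
    have "closedin ?P {t \<in> topspace ?P. t n \<in> U}" by (rule closedin_continuous_map_preimage[OF proj_cont U])
    moreover have "closedin ?P {t \<in> topspace ?P. \<psi> i (t (Suc i)) = t i}" for i
    proof -
      have "continuous_map ?P (Y i) (\<lambda>t. \<psi> i (t (Suc i)))"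
        using continuous_map_compose[OF proj_cont fibre_map.map_continuous[OF step]] by (simp add: comp_def)
      then show ?thesis by (rule closedin_continuous_maps_eq[OF ample_system.hausdorff[OF ample_stage] _ proj_cont])
    qed
    moreover have "n + k = 0 \<or> {..<n + k} \<noteq> {}" by auto
    ultimately show ?thesis
      unfolding T_def by (cases "n + k = 0") (auto intro!: closedin_Int closedin_INT simp del: topspace_product_topology)
  qed
  moreover have "T k \<noteq> {}" for k
  proof -
    obtain y where y: "y \<in> topspace (Y (n + k))" "down n k y \<in> U" using ex by blast
    define t where "t i = (if i \<le> n + k then down i (n + k - i) y else p i)" for i
    have ti: "t i \<in> topspace (Y i)" for i
      using p down_closed[of y i "n + k - i"] y(1) by (simp add: t_def)
    have "\<psi> i (t (Suc i)) = t i" if "i < n + k" for i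
    proof -
      have "n + k - i = Suc (n + k - Suc i)" using that by simp
      then show ?thesis using that step_down[of i "n + k - Suc i" y] by (simp add: t_def)
    qed
    moreover have "t n \<in> U" using y(2) by (simp add: t_def)
    ultimately have "t \<in> T k" using ti unfolding T_def by (simp add: PiE_iff)
    then show ?thesis by blast
  qed
  moreover have "decseq T" unfolding T_def by (rule decseq_SucI) auto
  ultimately have "(\<Inter>k. T k) \<noteq> {}" by (rule compact_space_imp_nest)
  then obtain t where t: "\<And>k. t \<in> T k" by blast
  have "t i \<in> topspace (Y i)" for i using t[of 0] unfolding T_def by auto
  moreover have "\<psi> i (t (Suc i)) = t i" for i using t[of "Suc i"] unfolding T_def by simp
  ultimately obtain x where "x \<in> topspace X" "\<pi> n x = t n" using threads by metis
  moreover have "t n \<in> U" using t[of 0] unfolding T_def by simp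
  ultimately show False using miss by metis
qed

lemma range_continuous:
  assumes "ample_system Z \<tau>"
  shows "continuous_map (gtop (dr_groupoid Z \<tau>)) Z fst"
proof -
  interpret ample_system Z \<tau> by fact
  show ?thesis
    unfolding continuous_map topspace_dr
  proof (intro conjI allI impI)
    show "fst ` arrows Z \<tau> \<subseteq> topspace Z" by (auto simp: arrows_iff)
    fix U assume U: "openin Z U"
    have "{\<gamma> \<in> arrows Z \<tau>. fst \<gamma> \<in> U} = (\<Union>m n. dr_basic Z \<tau> U m n (topspace Z))"
    proof (intro equalityI subsetI)
      fix \<gamma> assume "\<gamma> \<in> (\<Union>m n. dr_basic Z \<tau> U m n (topspace Z))"
      then obtain m n where \<gamma>: "\<gamma> \<in> dr_basic Z \<tau> U m n (topspace Z)" by blast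
      then have "\<gamma> \<in> arrows Z \<tau>" using dr_basic_subset_arrows[OF openin_subset[OF U] subset_refl] by blast
      then show "\<gamma> \<in> {\<gamma> \<in> arrows Z \<tau>. fst \<gamma> \<in> U}" using \<gamma> by (auto simp: dr_basic_def)
    qed (auto simp: arrows_iff dr_basic_iff)
    moreover have "openin (gtop G) (\<Union>m n. dr_basic Z \<tau> U m n (topspace Z))"
      using openin_dr_basic[OF U openin_topspace] by (auto intro!: openin_Union)
    ultimately show "openin (gtop G) {\<gamma> \<in> arrows Z \<tau>. fst \<gamma> \<in> U}" by simp
  qed
qed

lemma stage_map_support:
  "stage_map step_pullback n k f (x, l, y) \<noteq> 0 \<Longrightarrow> x \<in> topspace (Y (n + k)) \<or> k = 0"
  "stage_map step_pullback n k f (x, l, y) \<noteq> 0 \<Longrightarrow> f (down n k x, l, down n k y) \<noteq> 0"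
  by (induction k arbitrary: x y) (auto simp: step_pullback_def arrows_iff split: if_splits)

lemma stage_map_diff:
  "stage_map step_pullback n k (\<lambda>\<gamma>. f \<gamma> - g \<gamma>) =
    (\<lambda>\<gamma>. stage_map step_pullback n k f \<gamma> - stage_map step_pullback n k g \<gamma>)"
  by (induction k) (auto simp: step_pullback_def fun_eq_iff)

text \<open>If the pullback of \<open>f\<close> to the limit vanishes, then the ranges of the arrows in the support of \<open>f\<close> form a compact
  set which is missed by the limit, since an arrow of the support whose range lifts would lift itself.\<close>

lemma pullback_eventually_zero:
  assumes f: "f \<in> dr_span (Y n) (\<rho> n)" and z: "proj_pullback n f = (\<lambda>_. 0)"
  shows "\<exists>k. stage_map step_pullback n k f = (\<lambda>_. 0)"
proof -
  interpret P: fibre_map X \<sigma> "Y n" "\<rho> n" "\<pi> n" by (rule proj)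
  let ?S = "{\<gamma> \<in> arrows (Y n) (\<rho> n). f \<gamma> \<noteq> 0}"
  let ?U = "fst ` ?S"
  have "compactin (gtop (GY n)) ?S"
    using P.T.dr_span_in_carrier[OF f] P.T.steinberg_carrier_iff by blast
  then have "compactin (Y n) ?U" by (rule image_compactin[OF _ range_continuous[OF ample_stage]])
  then have cl: "closedin (Y n) ?U" by (rule compactin_imp_closedin[OF P.T.hausdorff])
  have miss: "\<pi> n x \<notin> ?U" if x: "x \<in> topspace X" for x
  proof
    assume "\<pi> n x \<in> ?U"
    then obtain k y where a: "(\<pi> n x, k, y) \<in> arrows (Y n) (\<rho> n)" "f (\<pi> n x, k, y) \<noteq> 0" by auto
    obtain x' where x': "(x', - k, x) \<in> arrows X \<sigma>" "\<pi> n x' = y"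
      using P.arrow_lift[OF arrow_inverse[OF a(1)] x] by blast
    have "proj_pullback n f (x, k, x') = f (\<pi> n x, k, y)"
      using arrow_inverse[OF x'(1)] x'(2) by (simp add: proj_pullback_def)
    then show False using z a(2) by simp
  qed
  obtain k where k: "\<forall>y\<in>topspace (Y (n + k)). down n k y \<notin> ?U" using closed_missed[OF cl miss] by blast
  have "stage_map step_pullback n k f (x, l, y) = 0" for x l y
  proof (rule ccontr)
    assume nz: "stage_map step_pullback n k f (x, l, y) \<noteq> 0"
    then have f0: "f (down n k x, l, down n k y) \<noteq> 0" by (rule stage_map_support(2))
    then have ar: "(down n k x, l, down n k y) \<in> arrows (Y n) (\<rho> n)" using P.T.dr_span_vanish[OF f] by blast
    then have "down n k x \<in> ?U" using f0 by force
    moreover have "x \<in> topspace (Y (n + k))"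
      using stage_map_support(1)[OF nz] ar by (auto simp: arrows_iff)
    ultimately show False using k by blast
  qed
  then show ?thesis by (auto simp: fun_eq_iff)
qed

lemma steinberg_cocone:
  assumes "field_involution (j :: 'k::field \<Rightarrow> 'k)"
  shows "star_cocone (\<lambda>n. steinberg j (GY n)) step_pullback (steinberg j GX) proj_pullback"
proof (intro star_cocone.intro star_sequence.intro star_cocone_axioms.intro)
  note [simp] = ample_system.steinberg_ops[OF ample_stage] ample_system.steinberg_ops[OF ample_limit]
  fix n
  show "star_closed (steinberg j (GY n))" by (rule ample_system.steinberg_closed[OF ample_stage assms])
  show "star_hom (steinberg j (GY n)) (steinberg j (GY (Suc n))) (step_pullback n)" by (rule step_hom[OF assms])
  show "star_hom (steinberg j (GY n)) (steinberg j GX) (proj_pullback n)" by (rule proj_hom[OF assms])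
  show "proj_pullback (Suc n) (step_pullback n a) = proj_pullback n a" for a :: "'b \<times> int \<times> 'b \<Rightarrow> 'k" by (rule proj_pullback_step)
  show "\<exists>k. stage_map step_pullback n k a = stage_map step_pullback n k a'"
    if "a \<in> scarrier (steinberg j (GY n))" "a' \<in> scarrier (steinberg j (GY n))" "proj_pullback n a = proj_pullback n a'"
    for a a'
  proof -
    have "(\<lambda>\<gamma>. a \<gamma> - a' \<gamma>) \<in> dr_span (Y n) (\<rho> n)" using that(1,2) by (simp add: dr_span_diff)
    moreover have "proj_pullback n (\<lambda>\<gamma>. a \<gamma> - a' \<gamma>) = (\<lambda>_. 0)"
      using that(3) by (auto simp: proj_pullback_def fun_eq_iff split: if_splits)
    ultimately obtain k where "stage_map step_pullback n k (\<lambda>\<gamma>. a \<gamma> - a' \<gamma>) = (\<lambda>_. 0)"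
      using pullback_eventually_zero by blast
    then have "stage_map step_pullback n k a \<gamma> - stage_map step_pullback n k a' \<gamma> = 0" for \<gamma>
      unfolding stage_map_diff by (rule fun_cong)
    then show ?thesis by (intro exI[of _ k] ext) simp
  qed
next
  fix b assume "b \<in> scarrier (steinberg j GX)"
  then show "\<exists>n. \<exists>a\<in>scarrier (steinberg j (GY n)). proj_pullback n a = b"
    using functions_from_stage[of b]
    by (simp add: ample_system.steinberg_ops[OF ample_stage] ample_system.steinberg_ops[OF ample_limit])
qed

theorem steinberg_colimit:
  "field_involution j \<Longrightarrow> star_isomorphic (steinberg j GX) (star_colimit (\<lambda>n. steinberg j (GY n)) step_pullback)"
  by (rule star_cocone.star_isomorphic_colimit[OF steinberg_cocone])

theorem groupoid_cstar_colimit: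
  "cstar_isomorphic (groupoid_cstar GX)
    (cstar_colimit (\<lambda>n. groupoid_cstar (GY n)) (\<lambda>n. env_map (steinberg cnj (GY (Suc n))) (step_pullback n)))"
  unfolding groupoid_cstar_def
  by (rule env_cocone.cstar_isomorphic_colimit[where \<mu> = proj_pullback])
     (intro env_cocone.intro env_cocone_axioms.intro steinberg_cocone cnj_involution
       ample_system.steinberg_complex ample_system.steinberg_bounded ample_stage ample_limit)

subsection \<open>Limits up to conjugacy\<close>

lemma homeomorphic_transport:
  assumes hg: "homeomorphic_maps X Z h g" and eq: "\<And>x. x \<in> topspace X \<Longrightarrow> h (\<sigma> x) = \<kappa> (h x)"
  shows "fibred_limit Y \<rho> \<psi> Z \<kappa> (\<lambda>n z. \<pi> n (g z))"
proof (rule fibred_limit.intro)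
  have ch: "continuous_map X Z h" and cg: "continuous_map Z X g" and hg': "\<And>z. z \<in> topspace Z \<Longrightarrow> h (g z) = z"
    and gh: "\<And>x. x \<in> topspace X \<Longrightarrow> g (h x) = x"
    using hg unfolding homeomorphic_maps_def by auto
  have gz: "g z \<in> topspace X" if "z \<in> topspace Z" for z using cg that by (simp add: continuous_map_def Pi_iff)
  have hx: "h x \<in> topspace Z" if "x \<in> topspace X" for x using ch that by (simp add: continuous_map_def Pi_iff)
  have \<sigma>x: "\<sigma> x \<in> topspace X" if "x \<in> topspace X" for x
    using ample_system.iterate_closed[OF ample_limit that, of 1] by simp
  have geq: "g (\<kappa> z) = \<sigma> (g z)" if z: "z \<in> topspace Z" for z
    using eq[OF gz[OF z]] hg'[OF z] gh[OF \<sigma>x[OF gz[OF z]]] by simp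
  show "fibre_map (Y (Suc n)) (\<rho> (Suc n)) (Y n) (\<rho> n) (\<psi> n)" for n by (rule step)
  interpret Z: ample_system Z \<kappa> by (rule ample_system_homeomorphic[OF ample_limit hg eq])
  have \<kappa>z: "\<kappa> z \<in> topspace Z" if "z \<in> topspace Z" for z using Z.iterate_closed[OF that, of 1] by simp
  show "fibre_map Z \<kappa> (Y n) (\<rho> n) (\<lambda>z. \<pi> n (g z))" for n
  proof -
    interpret P: fibre_map X \<sigma> "Y n" "\<rho> n" "\<pi> n" by (rule proj)
    show ?thesis
    proof
      show "continuous_map Z (Y n) (\<lambda>z. \<pi> n (g z))"
        using continuous_map_compose[OF cg P.map_continuous] by (simp add: comp_def)
      show "\<pi> n (g (\<kappa> z)) = \<rho> n (\<pi> n (g z))" if "z \<in> topspace Z" for z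
        using geq[OF that] P.equivariant[OF gz[OF that]] by simp
      fix z y assume z: "z \<in> topspace Z" and y: "y \<in> topspace (Y n)" "\<rho> n y = \<pi> n (g z)"
      from P.lift[OF gz[OF z] y] obtain x where x: "x \<in> topspace X" "\<sigma> x = g z" "\<pi> n x = y"
        and un: "\<And>x'. x' \<in> topspace X \<Longrightarrow> \<sigma> x' = g z \<Longrightarrow> \<pi> n x' = y \<Longrightarrow> x' = x" by blast
      show "\<exists>!z'. z' \<in> topspace Z \<and> \<kappa> z' = z \<and> \<pi> n (g z') = y"
      proof (rule ex1I[of _ "h x"])
        show "h x \<in> topspace Z \<and> \<kappa> (h x) = z \<and> \<pi> n (g (h x)) = y"
          using hx[OF x(1)] eq[OF x(1)] x(2,3) hg'[OF z] gh[OF x(1)] by simp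
        fix z' assume z': "z' \<in> topspace Z \<and> \<kappa> z' = z \<and> \<pi> n (g z') = y"
        then have "g z' = x" using un[of "g z'"] gz[of z'] geq[of z'] by simp
        then show "z' = h x" using hg'[of z'] z' by simp
      qed
    qed
  qed
  show "\<psi> n (\<pi> (Suc n) (g z)) = \<pi> n (g z)" if "z \<in> topspace Z" for n z by (rule proj_compat[OF gz[OF that]])
  show "\<exists>z\<in>topspace Z. \<forall>n. \<pi> n (g z) = t n"
    if t: "\<And>n. t n \<in> topspace (Y n)" "\<And>n. \<psi> n (t (Suc n)) = t n" for t
  proof -
    obtain x where "x \<in> topspace X" "\<forall>n. \<pi> n x = t n" using threads[OF t] by blast
    then show ?thesis using hx gh by (intro bexI[of _ "h x"]) simp_all
  qed
  fix U z assume U: "openin Z U" and z: "z \<in> U"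
  have zZ: "z \<in> topspace Z" using openin_subset[OF U] z by blast
  have "openin X {x \<in> topspace X. h x \<in> U}" by (rule openin_continuous_map_preimage[OF ch U])
  moreover have "g z \<in> {x \<in> topspace X. h x \<in> U}" using gz[OF zZ] hg'[OF zZ] z by simp
  ultimately obtain n V where V: "clopenin (Y n) V" "\<pi> n (g z) \<in> V"
    "{x \<in> topspace X. \<pi> n x \<in> V} \<subseteq> {x \<in> topspace X. h x \<in> U}" using proj_base by blast
  have "{z \<in> topspace Z. \<pi> n (g z) \<in> V} \<subseteq> U"
  proof clarify
    fix z' assume "z' \<in> topspace Z" "\<pi> n (g z') \<in> V"
    then show "z' \<in> U" using V(3) hg'[of z'] gz[of z'] by auto
  qed
  then show "\<exists>n V. clopenin (Y n) V \<and> \<pi> n (g z) \<in> V \<and> {z \<in> topspace Z. \<pi> n (g z) \<in> V} \<subseteq> U" using V(1,2) by blast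
qed

text \<open>The map \<open>x \<mapsto> (\<lambda>n. \<pi> n x)\<close> is a continuous bijection from a compact space onto a Hausdorff space.\<close>

lemma conjugate_inverse_limit:
  "conjugate X \<sigma> (subtopology (product_topology Y UNIV) {t. \<forall>n. \<psi> n (t (Suc n)) = t n}) (\<lambda>t n. \<rho> n (t n))"
proof -
  let ?L = "subtopology (product_topology Y UNIV) {t. \<forall>n. \<psi> n (t (Suc n)) = t n}"
  let ?h = "\<lambda>x n. \<pi> n x"
  have cl: "\<pi> n x \<in> topspace (Y n)" if "x \<in> topspace X" for n x by (rule fibre_map.map_closed[OF proj that])
  have top: "topspace ?L = {t. \<forall>n. t n \<in> topspace (Y n) \<and> \<psi> n (t (Suc n)) = t n}" by auto
  have "homeomorphic_map X ?L ?h"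
  proof (rule continuous_imp_homeomorphic_map)
    show "compact_space X" by (rule ample_system.compact[OF ample_limit])
    show "Hausdorff_space ?L"
      by (intro Hausdorff_space_subtopology)
         (simp add: Hausdorff_space_product_topology ample_system.hausdorff[OF ample_stage])
    have "continuous_map X (product_topology Y UNIV) ?h"
      unfolding continuous_map_componentwise_UNIV using fibre_map.map_continuous[OF proj] by blast
    then show "continuous_map X ?L ?h" by (auto simp: continuous_map_in_subtopology proj_compat)
    show "?h ` topspace X = topspace ?L"
    proof (intro equalityI subsetI)
      fix t assume "t \<in> topspace ?L"
      then obtain x where "x \<in> topspace X" "\<forall>n. \<pi> n x = t n" using threads[of t] unfolding top by blast
      then show "t \<in> ?h ` topspace X" by (intro image_eqI[of _ _ x]) auto
    qed (auto simp: cl proj_compat)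
    show "inj_on ?h (topspace X)"
    proof (rule inj_onI, rule ccontr)
      fix x y assume xy: "x \<in> topspace X" "y \<in> topspace X" "?h x = ?h y" "x \<noteq> y"
      obtain U where U: "openin X U" "x \<in> U" "y \<notin> U"
        using ample_system.hausdorff[OF ample_limit] xy(1,2,4) unfolding Hausdorff_space_def disjnt_def by blast
      obtain n V where "\<pi> n x \<in> V" "{x \<in> topspace X. \<pi> n x \<in> V} \<subseteq> U" using proj_base[OF U(1,2)] by blast
      then show False using U(3) xy(2) fun_cong[OF xy(3), of n] by auto
    qed
  qed
  then show ?thesis
    unfolding conjugate_def using fibre_map.equivariant[OF proj] by (intro exI[of _ ?h]) auto
qed

end

section \<open>The dynamics of an l-diagram\<close>

locale l_diag =
  fixes F :: "('v, 'e) diagram"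
  assumes l_diagram: "l_diagram F"
begin

lemma bratteli: "separated_bratteli F" and cond_a: "l_cond_a F" and cond_b: "l_cond_b F" and cond_c: "l_cond_c F"
  and cond_d: "l_cond_d F" and cond_e: "l_cond_e F" and cond_f: "l_cond_f F" and cond_g: "l_cond_g F"
  using l_diagram unfolding l_diagram_def by auto

lemma vert_level_unique: "v \<in> dvert F i \<Longrightarrow> v \<in> dvert F j \<Longrightarrow> i = j"
  using bratteli unfolding separated_bratteli_def disjoint_family_on_def by blast

lemma edge_rng: "e \<in> dedge F i \<Longrightarrow> drng F e \<in> dvert F i"
  and edge_src: "e \<in> dedge F i \<Longrightarrow> dsrc F e \<in> dvert F (Suc i)"
  using bratteli unfolding separated_bratteli_def by blast+

lemma edge_in [simp]: "e \<in> dedge F i \<Longrightarrow> e \<in> dedges F"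
  unfolding dedges_def by auto

lemma edge_of_rng: "e \<in> dedges F \<Longrightarrow> drng F e \<in> dvert F i \<Longrightarrow> e \<in> dedge F i"
  unfolding dedges_def using edge_rng vert_level_unique by blast

lemma edge_of_src: "e \<in> dedges F \<Longrightarrow> dsrc F e \<in> dvert F (Suc i) \<Longrightarrow> e \<in> dedge F i"
  unfolding dedges_def using edge_src vert_level_unique by blast

lemma B_at_iff: "e \<in> B_at F v \<longleftrightarrow> e \<in> dedges F \<and> drng F e = v \<and> e \<in> dblue F"
  and R_at_iff: "e \<in> R_at F v \<longleftrightarrow> e \<in> dedges F \<and> drng F e = v \<and> e \<notin> dblue F"
  unfolding B_at_def R_at_def by auto

lemmas cond_c_at =
  spec[OF cond_c[unfolded l_cond_c_def], THEN conjunct1]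
  spec[OF cond_c[unfolded l_cond_c_def], THEN conjunct2, THEN conjunct1]
  spec[OF cond_c[unfolded l_cond_c_def], THEN conjunct2, THEN conjunct2, THEN conjunct1]
  spec[OF cond_c[unfolded l_cond_c_def], THEN conjunct2, THEN conjunct2, THEN conjunct2, THEN conjunct1]
  spec[OF cond_c[unfolded l_cond_c_def], THEN conjunct2, THEN conjunct2, THEN conjunct2, THEN conjunct2]

lemmas cond_d_at =
  cond_d[unfolded l_cond_d_def, THEN conjunct2, THEN conjunct1]
  cond_d[unfolded l_cond_d_def, THEN conjunct2, THEN conjunct2, THEN conjunct1]
  spec[OF cond_d[unfolded l_cond_d_def, THEN conjunct2, THEN conjunct2, THEN conjunct2]]

lemmas cond_e_at =
  bspec[OF spec[OF cond_e[unfolded l_cond_e_def]], THEN conjunct2, THEN conjunct1]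
  bspec[OF spec[OF cond_e[unfolded l_cond_e_def]], THEN conjunct2, THEN conjunct2]

lemma cond_b_at:
  assumes "v \<in> dvert F (2*j+1)"
  shows "R_at F v = \<Union> (dR F ` {f \<in> dedge F (2*j) - dblue F. dsrc F f = v})"
  using bspec[OF spec[OF cond_b[unfolded l_cond_b_def], of j] assms] by blast

lemma even_blue_source: assumes "u \<in> dvert F (Suc (Suc (2*i)))"
  obtains e where "e \<in> dedge F (Suc (2*i))" "e \<in> dblue F" "dsrc F e = u"
proof -
  have "dvert F (2*i+2) = (\<Union>v\<in>dvert F (2*i+1). dsrc F ` B_at F v)"
    by (rule cond_c_at)
  then obtain v e where "v \<in> dvert F (Suc (2*i))" and e: "e \<in> B_at F v" "dsrc F e = u" using assms by auto
  then have "e \<in> dedge F (Suc (2*i))" using edge_of_rng[of e] by (simp add: B_at_iff)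
  then show ?thesis using that[of e] e by (simp add: B_at_iff)
qed

lemma even_red_source: assumes "u \<in> dvert F (Suc (Suc (2*i)))"
  obtains e where "e \<in> dedge F (Suc (2*i))" "e \<notin> dblue F" "dsrc F e = u"
proof -
  have "dvert F (2*i+2) = (\<Union>v\<in>dvert F (2*i+1). dsrc F ` R_at F v)"
    by (rule cond_c_at)
  then obtain v e where "v \<in> dvert F (Suc (2*i))" and e: "e \<in> R_at F v" "dsrc F e = u" using assms by auto
  then have "e \<in> dedge F (Suc (2*i))" using edge_of_rng[of e] by (simp add: R_at_iff)
  then show ?thesis using that[of e] e by (simp add: R_at_iff)
qed

lemma red_pair_completes:
  assumes "f0 \<in> dedge F (Suc (2*i))" "f0 \<notin> dblue F" "f1 \<in> dedges F" "f1 \<notin> dblue F" "drng F f1 = dsrc F f0"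
  obtains e0 e1 where "e0 \<in> dedges F" "e0 \<in> dblue F" "drng F e0 = drng F f0"
    "e1 \<in> dedges F" "e1 \<in> dblue F" "drng F e1 = dsrc F e0" "dsrc F e1 = dsrc F f1"
    "\<And>e0' e1'. \<lbrakk>e0' \<in> B_at F (drng F f0); e1' \<in> B_at F (dsrc F e0'); dsrc F e1' = dsrc F f1\<rbrakk> \<Longrightarrow> e0' = e0 \<and> e1' = e1"
proof -
  have "drng F f0 \<in> dvert F (2*i+1)" using edge_rng[OF assms(1)] by simp
  then have "\<exists>!(e0, e1). e0 \<in> B_at F (drng F f0) \<and> e1 \<in> B_at F (dsrc F e0) \<and> dsrc F e1 = dsrc F f1"
    by (rule bspec[OF bspec[OF bspec[OF spec[OF cond_f[unfolded l_cond_f_def], of i]]]]) (use assms in \<open>simp_all add: R_at_iff\<close>)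
  then obtain e where "case e of (e0, e1) \<Rightarrow> e0 \<in> B_at F (drng F f0) \<and> e1 \<in> B_at F (dsrc F e0) \<and> dsrc F e1 = dsrc F f1"
    and un': "\<forall>e'. (case e' of (e0, e1) \<Rightarrow> e0 \<in> B_at F (drng F f0) \<and> e1 \<in> B_at F (dsrc F e0) \<and> dsrc F e1 = dsrc F f1) \<longrightarrow> e' = e"
    by (rule ex1E)
  then have e: "fst e \<in> B_at F (drng F f0)" "snd e \<in> B_at F (dsrc F (fst e))" "dsrc F (snd e) = dsrc F f1"
    by (simp_all add: split_beta)
  have un: "e0' = fst e \<and> e1' = snd e"
    if "e0' \<in> B_at F (drng F f0)" "e1' \<in> B_at F (dsrc F e0')" "dsrc F e1' = dsrc F f1" for e0' e1'
    using un'[rule_format, of "(e0', e1')"] that by auto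
  show ?thesis
    by (rule that[of "fst e" "snd e", OF _ _ _ _ _ _ _ un]) (use e in \<open>simp_all add: B_at_iff\<close>)
qed

lemma blue_pair_completes:
  assumes "g \<in> dedge F (2*i)" "g \<notin> dblue F" "e0 \<in> dedges F" "e0 \<in> dblue F" "drng F e0 = dsrc F g"
    "e1 \<in> dedges F" "e1 \<in> dblue F" "drng F e1 = dsrc F e0"
  obtains f0 f1 where "f0 \<in> dR F g" "f0 \<in> dedges F" "f0 \<notin> dblue F" "drng F f0 = dsrc F g"
    "f1 \<in> dedges F" "f1 \<notin> dblue F" "drng F f1 = dsrc F f0" "dsrc F f1 = dsrc F e1"
    "\<And>f0' f1'. \<lbrakk>f0' \<in> dR F g; f0' \<in> R_at F (dsrc F g); f1' \<in> R_at F (dsrc F f0'); dsrc F f1' = dsrc F e1\<rbrakk> \<Longrightarrow>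
      f0' = f0 \<and> f1' = f1"
proof -
  have "dsrc F g \<in> dvert F (2*i+1)" using edge_src[OF assms(1)] by simp
  then have "\<exists>!(f0, f1). f0 \<in> dR F g \<and> f0 \<in> R_at F (dsrc F g) \<and> f1 \<in> R_at F (dsrc F f0) \<and> dsrc F f1 = dsrc F e1"
    by (rule bspec[OF bspec[OF mp[OF bspec[OF bspec[OF spec[OF cond_g[unfolded l_cond_g_def], of i]]]]]])
       (use assms in \<open>simp_all add: B_at_iff\<close>)
  then obtain f where "case f of (f0, f1) \<Rightarrow> f0 \<in> dR F g \<and> f0 \<in> R_at F (dsrc F g) \<and> f1 \<in> R_at F (dsrc F f0) \<and> dsrc F f1 = dsrc F e1"
    and un': "\<forall>f'. (case f' of (f0, f1) \<Rightarrow> f0 \<in> dR F g \<and> f0 \<in> R_at F (dsrc F g) \<and> f1 \<in> R_at F (dsrc F f0) \<and> dsrc F f1 = dsrc F e1) \<longrightarrow> f' = f"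
    by (rule ex1E)
  then have f: "fst f \<in> dR F g" "fst f \<in> R_at F (dsrc F g)" "snd f \<in> R_at F (dsrc F (fst f))" "dsrc F (snd f) = dsrc F e1"
    by (simp_all add: split_beta)
  have un: "f0' = fst f \<and> f1' = snd f"
    if "f0' \<in> dR F g" "f0' \<in> R_at F (dsrc F g)" "f1' \<in> R_at F (dsrc F f0')" "dsrc F f1' = dsrc F e1" for f0' f1'
    using un'[rule_format, of "(f0', f1')"] that by auto
  show ?thesis
    by (rule that[of "fst f" "snd f", OF _ _ _ _ _ _ _ _ un]) (use f in \<open>simp_all add: R_at_iff\<close>)
qed

text \<open>At level 1 this is condition (d). To the higher odd levels it propagates through the completion of red pairs to blue
  ones by condition (f), and of blue pairs to red ones by condition (g).\<close>

lemma odd_sources: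
  "w \<in> dvert F (Suc (2*i)) \<Longrightarrow> (\<exists>e\<in>dedges F. e \<in> dblue F \<and> dsrc F e = w) \<and> (\<exists>f\<in>dedges F. f \<notin> dblue F \<and> dsrc F f = w)"
proof (induction i arbitrary: w)
  case 0
  have "w \<in> (\<Union>v\<in>dvert F 0. dsrc F ` B_at F v)" "w \<in> (\<Union>v\<in>dvert F 0. dsrc F ` R_at F v)"
    using 0 cond_d_at(1,2) by simp_all
  then show ?case by (auto simp: B_at_iff R_at_iff)
next
  case (Suc i)
  have w: "w \<in> dvert F (Suc (Suc (Suc (2*i))))" using Suc.prems by simp
  have "dsrc F ` dedge F (Suc (Suc (2*i))) = dvert F (Suc (Suc (Suc (2*i))))"
    using bratteli unfolding separated_bratteli_def by blast
  then obtain e where e: "e \<in> dedge F (Suc (Suc (2*i)))" "dsrc F e = w" using w by (metis imageE)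
  have blue: "\<exists>e\<in>dedges F. e \<in> dblue F \<and> dsrc F e = w"
  proof (cases "e \<in> dblue F")
    case False
    obtain f0 where f0: "f0 \<in> dedge F (Suc (2*i))" "f0 \<notin> dblue F" "dsrc F f0 = drng F e"
      using even_red_source[OF edge_rng[OF e(1)]] .
    show ?thesis using red_pair_completes[OF f0(1,2) edge_in[OF e(1)] False] f0(3) e(2) by metis
  qed (use e in auto)
  then obtain e1 where e1: "e1 \<in> dedges F" "e1 \<in> dblue F" "dsrc F e1 = w" by blast
  have e1l: "e1 \<in> dedge F (Suc (Suc (2*i)))" using edge_of_src[OF e1(1)] e1(3) w by simp
  obtain e0 where e0: "e0 \<in> dedge F (Suc (2*i))" "e0 \<in> dblue F" "dsrc F e0 = drng F e1"
    using even_blue_source[OF edge_rng[OF e1l]] .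
  obtain g where g: "g \<in> dedges F" "g \<notin> dblue F" "dsrc F g = drng F e0"
    using Suc.IH[OF edge_rng[OF e0(1)]] by auto
  have gl: "g \<in> dedge F (2*i)" using edge_of_src[OF g(1)] g(3) edge_rng[OF e0(1)] by simp
  have "\<exists>f\<in>dedges F. f \<notin> dblue F \<and> dsrc F f = w"
    using blue_pair_completes[OF gl g(2) edge_in[OF e0(1)] e0(2) g(3)[symmetric] e1(1,2)] e0(3) e1(3) by metis
  then show ?case using blue by blast
qed

lemma blue_source_unique:
  assumes "e \<in> dedges F" "e \<in> dblue F" "e' \<in> dedges F" "e' \<in> dblue F" "dsrc F e = dsrc F e'"
  shows "e = e'"
proof -
  obtain i where i: "e \<in> dedge F i" using assms(1) by (auto simp: dedges_def)
  then have i': "e' \<in> dedge F i" using edge_of_src[OF assms(3)] edge_src[OF i] assms(5) by simp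
  show ?thesis
  proof (cases "even i")
    case True
    then obtain j where "i = 2*j" by blast
    moreover have "inj_on (dsrc F) (dedge F (2*j) \<inter> dblue F)" by (rule cond_d_at)
    ultimately show ?thesis using i i' assms by (auto dest: inj_onD)
  next
    case False
    then obtain j where j: "i = 2*j+1" by (metis oddE)
    have c: "disjoint_family_on (\<lambda>v. dsrc F ` B_at F v) (dvert F (2*j+1))"
      "\<forall>v\<in>dvert F (2*j+1). inj_on (dsrc F) (B_at F v)"
      using cond_c_at(1,5)[of j] by auto
    have B: "e \<in> B_at F (drng F e)" "e' \<in> B_at F (drng F e')" using assms by (auto simp: B_at_iff)
    have v: "drng F e \<in> dvert F (2*j+1)" "drng F e' \<in> dvert F (2*j+1)" using edge_rng i i' j by auto
    have "drng F e = drng F e'"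
    proof (rule ccontr)
      assume "drng F e \<noteq> drng F e'"
      then have "dsrc F ` B_at F (drng F e) \<inter> dsrc F ` B_at F (drng F e') = {}"
        using c(1) v unfolding disjoint_family_on_def by blast
      then show False using B assms(5) by blast
    qed
    then show ?thesis using c(2) v(1) B assms(5) by (auto dest: inj_onD)
  qed
qed

lemma red_source_unique:
  assumes "e \<in> dedge F (Suc (2*j))" "e \<notin> dblue F" "e' \<in> dedges F" "e' \<notin> dblue F" "dsrc F e = dsrc F e'"
  shows "e = e'"
proof -
  have i': "e' \<in> dedge F (Suc (2*j))" using edge_of_src[OF assms(3)] edge_src[OF assms(1)] assms(5) by simp
  have c: "disjoint_family_on (\<lambda>v. dsrc F ` R_at F v) (dvert F (2*j+1))"
    "\<forall>v\<in>dvert F (2*j+1). inj_on (dsrc F) (R_at F v)"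
    using cond_c_at(3,5)[of j] by auto
  have R: "e \<in> R_at F (drng F e)" "e' \<in> R_at F (drng F e')" using assms by (auto simp: R_at_iff)
  have v: "drng F e \<in> dvert F (2*j+1)" "drng F e' \<in> dvert F (2*j+1)" using edge_rng assms(1) i' by auto
  have "drng F e = drng F e'"
  proof (rule ccontr)
    assume "drng F e \<noteq> drng F e'"
    then have "dsrc F ` R_at F (drng F e) \<inter> dsrc F ` R_at F (drng F e') = {}"
      using c(1) v unfolding disjoint_family_on_def by blast
    then show False using R assms(5) by blast
  qed
  then show ?thesis using c(2) v(1) R assms(5) by (auto dest: inj_onD)
qed

text \<open>Every vertex of positive level is the source of exactly one blue edge, so a path is determined backwards from the source of
  any of its edges. The vertices of positive even level also emit exactly one red edge.\<close>

definition blue_from :: "'v \<Rightarrow> 'e" where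
  "blue_from w = (THE e. e \<in> dedges F \<and> e \<in> dblue F \<and> dsrc F e = w)"

definition red_from :: "'v \<Rightarrow> 'e" where
  "red_from u = (THE e. e \<in> dedges F \<and> e \<notin> dblue F \<and> dsrc F e = u)"

lemma blue_from_eq: "e \<in> dedges F \<Longrightarrow> e \<in> dblue F \<Longrightarrow> dsrc F e = w \<Longrightarrow> blue_from w = e"
  unfolding blue_from_def by (rule the_equality) (auto intro: blue_source_unique)

lemma red_from_eq: "e \<in> dedge F (Suc (2*i)) \<Longrightarrow> e \<notin> dblue F \<Longrightarrow> dsrc F e = u \<Longrightarrow> red_from u = e"
  unfolding red_from_def by (rule the_equality) (auto intro: red_source_unique[symmetric])

lemma blue_from:
  assumes "w \<in> dvert F (Suc i)"
  shows "blue_from w \<in> dedge F i" "blue_from w \<in> dblue F" "dsrc F (blue_from w) = w"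
proof -
  have "\<exists>e\<in>dedges F. e \<in> dblue F \<and> dsrc F e = w"
  proof (cases "even i")
    case True
    then show ?thesis using odd_sources assms by auto
  next
    case False
    then obtain j where "i = Suc (2*j)" by (metis oddE Suc_eq_plus1)
    then show ?thesis using even_blue_source assms edge_in by metis
  qed
  then obtain e where e: "e \<in> dedges F" "e \<in> dblue F" "dsrc F e = w" by blast
  then show "blue_from w \<in> dedge F i" "blue_from w \<in> dblue F" "dsrc F (blue_from w) = w"
    using blue_from_eq[OF e] edge_of_src assms by auto
qed

lemma red_from:
  assumes "u \<in> dvert F (Suc (Suc (2*i)))"
  shows "red_from u \<in> dedge F (Suc (2*i))" "red_from u \<notin> dblue F" "dsrc F (red_from u) = u"
  using even_red_source[OF assms] red_from_eq by metis+

definition grandparent :: "'v \<Rightarrow> 'v" where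
  "grandparent w = drng F (blue_from (drng F (blue_from w)))"

text \<open>A red edge of an odd layer lies in exactly one of the sets \<open>R(g)\<close>: condition (b) says that these sets cover, and condition (e) that
  they are disjoint for edges \<open>g\<close> with a common range.\<close>

definition red_anc :: "'e \<Rightarrow> 'e" where
  "red_anc f = (THE g. g \<in> dedges F \<and> g \<notin> dblue F \<and> dsrc F g = drng F f \<and> f \<in> dR F g)"

lemma dR_props:
  assumes "g \<in> dedge F (2*i)" "g \<notin> dblue F" "f \<in> dR F g"
  shows "f \<in> dedge F (Suc (2*i))" "f \<notin> dblue F" "drng F f = dsrc F g"
proof -
  have v: "dsrc F g \<in> dvert F (2*i+1)" using edge_src[OF assms(1)] by simp
  then have "R_at F (dsrc F g) = \<Union> (dR F ` {f \<in> dedge F (2*i) - dblue F. dsrc F f = dsrc F g})"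
    by (rule cond_b_at)
  then have "f \<in> R_at F (dsrc F g)" using assms by auto
  then show "f \<in> dedge F (Suc (2*i))" "f \<notin> dblue F" "drng F f = dsrc F g"
    using edge_of_rng v by (auto simp: R_at_iff)
qed

text \<open>By condition (e) the source of an edge of \<open>R(g)\<close> is also reached from the range of \<open>g\<close> along a blue pair.\<close>

lemma dR_grandparent:
  assumes "g \<in> dedge F (2*i)" "g \<notin> dblue F" "f \<in> dR F g"
  shows "grandparent (dsrc F f) = drng F g"
proof -
  have "(\<Union>e\<in>B_at F (drng F g). dsrc F ` B_at F (dsrc F e)) = (\<Union>f\<in>R_at F (drng F g). dsrc F ` dR F f)"
    by (rule cond_e_at(2)[OF edge_rng[OF assms(1)]])
  moreover have "dsrc F f \<in> (\<Union>f\<in>R_at F (drng F g). dsrc F ` dR F f)"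
    by (rule UN_I[of g]) (use assms in \<open>auto simp: R_at_iff\<close>)
  ultimately have "dsrc F f \<in> (\<Union>e\<in>B_at F (drng F g). dsrc F ` B_at F (dsrc F e))" by simp
  then obtain e e1 where e: "e \<in> B_at F (drng F g)" "e1 \<in> B_at F (dsrc F e)" "dsrc F e1 = dsrc F f" by force
  then have "blue_from (dsrc F f) = e1" "blue_from (drng F e1) = e" using blue_from_eq by (auto simp: B_at_iff)
  then show ?thesis using e by (simp add: grandparent_def B_at_iff)
qed

lemma red_anc_eq:
  assumes "g \<in> dedge F (2*i)" "g \<notin> dblue F" "f \<in> dR F g"
  shows "red_anc f = g"
  unfolding red_anc_def
proof (rule the_equality)
  show "g \<in> dedges F \<and> g \<notin> dblue F \<and> dsrc F g = drng F f \<and> f \<in> dR F g" using assms dR_props[OF assms] by auto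
  fix g' assume g': "g' \<in> dedges F \<and> g' \<notin> dblue F \<and> dsrc F g' = drng F f \<and> f \<in> dR F g'"
  then have "dsrc F g' = dsrc F g" using dR_props[OF assms] by simp
  then have l: "g' \<in> dedge F (2*i)" using edge_of_src[of g' "2*i"] g' edge_src[OF assms(1)] by auto
  then have r: "drng F g' = drng F g" using dR_grandparent[OF l, of f] dR_grandparent[OF assms] g' by simp
  have "disjoint_family_on (\<lambda>f. dsrc F ` dR F f) (R_at F (drng F g))"
    by (rule cond_e_at(1)[OF edge_rng[OF assms(1)]])
  then have "dsrc F ` dR F g' \<inter> dsrc F ` dR F g = {}" if "g' \<noteq> g"
    using g' assms(1,2) r that unfolding disjoint_family_on_def by (simp add: R_at_iff)
  then show "g' = g" using g' assms(3) by blast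
qed

lemma red_anc:
  assumes "f \<in> dedge F (Suc (2*i))" "f \<notin> dblue F"
  shows "red_anc f \<in> dedge F (2*i)" "red_anc f \<notin> dblue F" "f \<in> dR F (red_anc f)" "dsrc F (red_anc f) = drng F f"
    "drng F (red_anc f) = grandparent (dsrc F f)"
proof -
  have v: "drng F f \<in> dvert F (2*i+1)" using edge_rng[OF assms(1)] by simp
  then have "R_at F (drng F f) = \<Union> (dR F ` {g \<in> dedge F (2*i) - dblue F. dsrc F g = drng F f})"
    by (rule cond_b_at)
  moreover have "f \<in> R_at F (drng F f)" using assms by (simp add: R_at_iff)
  ultimately obtain g where g: "g \<in> dedge F (2*i)" "g \<notin> dblue F" "dsrc F g = drng F f" "f \<in> dR F g" by auto
  have "red_anc f = g" by (rule red_anc_eq[OF g(1,2,4)])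
  then show "red_anc f \<in> dedge F (2*i)" "red_anc f \<notin> dblue F" "f \<in> dR F (red_anc f)" "dsrc F (red_anc f) = drng F f"
    "drng F (red_anc f) = grandparent (dsrc F f)"
    using g dR_grandparent[OF g(1,2,4)] by auto
qed

text \<open>The red edges of the even layers form an inverse sequence compatible with the one of the vertices;
  condition (g) says that lifting a red edge amounts to lifting its source.\<close>

definition red_parent :: "'e \<Rightarrow> 'e" where
  "red_parent f = red_anc (red_from (drng F f))"

lemma red_parent:
  assumes "f \<in> dedge F (Suc (Suc (2*i)))" "f \<notin> dblue F"
  shows "red_parent f \<in> dedge F (2*i)" "red_parent f \<notin> dblue F" "dsrc F (red_parent f) = grandparent (dsrc F f)"
    "drng F (red_parent f) = grandparent (drng F f)"
proof -
  note r = red_from[OF edge_rng[OF assms(1)]]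
  note a = red_anc[OF r(1,2)]
  show "red_parent f \<in> dedge F (2*i)" "red_parent f \<notin> dblue F" using a by (auto simp: red_parent_def)
  show "drng F (red_parent f) = grandparent (drng F f)" using a(5) r(3) by (simp add: red_parent_def)
  obtain e0 e1 where e: "e0 \<in> dedges F" "e0 \<in> dblue F" "drng F e0 = drng F (red_from (drng F f))"
    "e1 \<in> dedges F" "e1 \<in> dblue F" "drng F e1 = dsrc F e0" "dsrc F e1 = dsrc F f"
    using red_pair_completes[OF r(1,2) edge_in[OF assms(1)] assms(2)] r(3) by metis
  have "blue_from (dsrc F f) = e1" "blue_from (drng F e1) = e0" using blue_from_eq e by auto
  then show "dsrc F (red_parent f) = grandparent (dsrc F f)"
    using a(4) e(3) by (simp add: red_parent_def grandparent_def)
qed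

lemma red_lift:
  assumes w: "w \<in> dvert F (Suc (Suc (Suc (2*i))))" and g: "g \<in> dedge F (2*i)" "g \<notin> dblue F" "dsrc F g = grandparent w"
  shows "\<exists>!f. f \<in> dedge F (Suc (Suc (2*i))) \<and> f \<notin> dblue F \<and> dsrc F f = w \<and> red_parent f = g"
proof -
  note e1 = blue_from[OF w]
  note e0 = blue_from[OF edge_rng[OF e1(1)]]
  have gs: "drng F (blue_from (drng F (blue_from w))) = dsrc F g" using g(3) by (simp add: grandparent_def)
  obtain f0 f1 where f: "f0 \<in> dR F g" "f0 \<in> dedges F" "f0 \<notin> dblue F" "drng F f0 = dsrc F g"
    "f1 \<in> dedges F" "f1 \<notin> dblue F" "drng F f1 = dsrc F f0" "dsrc F f1 = w"
    and un: "\<And>f0' f1'. \<lbrakk>f0' \<in> dR F g; f0' \<in> R_at F (dsrc F g); f1' \<in> R_at F (dsrc F f0'); dsrc F f1' = w\<rbrakk> \<Longrightarrow>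
      f0' = f0 \<and> f1' = f1"
    using blue_pair_completes[OF g(1,2) edge_in[OF e0(1)] e0(2) gs edge_in[OF e1(1)] e1(2) e0(3)[symmetric], unfolded e1(3)]
    by blast
  have f1l: "f1 \<in> dedge F (Suc (Suc (2*i)))" using edge_of_src[OF f(5)] f(8) w by simp
  have f0l: "f0 \<in> dedge F (Suc (2*i))" using dR_props[OF g(1,2) f(1)] by simp
  show ?thesis
  proof (rule ex1I[of _ f1])
    have "red_from (drng F f1) = f0" using red_from_eq[OF f0l f(3)] f(7) by simp
    then show "f1 \<in> dedge F (Suc (Suc (2*i))) \<and> f1 \<notin> dblue F \<and> dsrc F f1 = w \<and> red_parent f1 = g"
      using f1l f red_anc_eq[OF g(1,2) f(1)] by (simp add: red_parent_def)
    fix f assume f': "f \<in> dedge F (Suc (Suc (2*i))) \<and> f \<notin> dblue F \<and> dsrc F f = w \<and> red_parent f = g"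
    note r = red_from[OF edge_rng[of f "Suc (Suc (2*i))"]]
    have "red_from (drng F f) \<in> dR F g" "drng F (red_from (drng F f)) = dsrc F g"
      using red_anc(3,4)[OF r(1,2)] f' by (auto simp: red_parent_def)
    then show "f = f1" using un[of "red_from (drng F f)" f] r f' by (auto simp: R_at_iff)
  qed
qed

lemma red_pair_eq:
  assumes "e0 \<in> dedge F (2*i)" "e0 \<in> dblue F" "e1 \<in> dedges F" "e1 \<in> dblue F" "drng F e1 = dsrc F e0"
  shows "red_pair F e0 e1 = (red_anc (red_from (dsrc F e1)), red_from (dsrc F e1))"
proof -
  have e1: "e1 \<in> dedge F (Suc (2*i))" using edge_of_rng[OF assms(3)] edge_src[OF assms(1)] assms(5) by simp
  note r = red_from[OF edge_src[OF e1]]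
  note a = red_anc[OF r(1,2)]
  have gp: "grandparent (dsrc F e1) = drng F e0"
    using blue_from_eq[OF assms(3,4)] blue_from_eq[OF edge_in[OF assms(1)] assms(2)] assms(5)
    by (simp add: grandparent_def)
  show ?thesis unfolding red_pair_def
  proof (rule the_equality, goal_cases)
    case 1
    then show ?case using a r gp by (simp add: R_at_iff)
  next
    case (2 p)
    obtain f0 f1 where p: "p = (f0, f1)" by (cases p)
    have f: "f0 \<in> R_at F (drng F e0)" "f1 \<in> R_at F (dsrc F f0)" "dsrc F f1 = dsrc F e1" "f1 \<in> dR F f0"
      using 2 p by auto
    have "f0 \<in> dedge F (2*i)" using f(1) edge_of_rng edge_rng[OF assms(1)] by (auto simp: R_at_iff)
    then have "red_anc f1 = f0" using red_anc_eq f by (auto simp: R_at_iff)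
    moreover have "red_from (dsrc F e1) = f1"
      using red_source_unique[OF r(1,2), of f1] f r(3) by (auto simp: R_at_iff)
    ultimately show ?case using p by simp
  qed
qed

lemma blue_pair_eq:
  assumes "f0 \<in> dedge F (Suc (2*i))" "f0 \<notin> dblue F" "f1 \<in> dedges F" "f1 \<notin> dblue F" "drng F f1 = dsrc F f0"
  shows "blue_pair F f0 f1 = (blue_from (drng F (blue_from (dsrc F f1))), blue_from (dsrc F f1))"
proof -
  obtain e0 e1 where e: "e0 \<in> dedges F" "e0 \<in> dblue F" "drng F e0 = drng F f0"
    "e1 \<in> dedges F" "e1 \<in> dblue F" "drng F e1 = dsrc F e0" "dsrc F e1 = dsrc F f1"
    and un: "\<And>e0' e1'. \<lbrakk>e0' \<in> B_at F (drng F f0); e1' \<in> B_at F (dsrc F e0'); dsrc F e1' = dsrc F f1\<rbrakk> \<Longrightarrow> e0' = e0 \<and> e1' = e1"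
    using red_pair_completes[OF assms] by blast
  have "blue_pair F f0 f1 = (e0, e1)"
    unfolding blue_pair_def
  proof (rule the_equality, goal_cases)
    case 1
    then show ?case using e by (simp add: B_at_iff)
  next
    case (2 p)
    then show ?case using un[of "fst p" "snd p"] by (simp add: split_beta prod_eq_iff)
  qed
  moreover have "blue_from (dsrc F f1) = e1" "blue_from (drng F e1) = e0" using blue_from_eq e by auto
  ultimately show ?thesis by simp
qed

end

context l_diag
begin

lemma path_edge: assumes "x \<in> paths F"
  shows "x i \<in> dedge F i" "x i \<in> dblue F" "drng F (x (Suc i)) = dsrc F (x i)" "x i \<in> dedges F"
  using assms unfolding paths_def dedges_def by auto

lemma path_from: "x \<in> paths F \<Longrightarrow> blue_from (dsrc F (x i)) = x i"
  by (rule blue_from_eq) (auto simp: path_edge)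

lemma path_agree_below:
  assumes "x \<in> paths F" "y \<in> paths F" "x j = y j" "i \<le> j" shows "x i = y i"
  using assms(4)
proof (induction rule: inc_induct)
  case (step n)
  then have "dsrc F (x n) = dsrc F (y n)"
    using path_edge(3)[OF assms(1), of n] path_edge(3)[OF assms(2), of n] by metis
  then show ?case using path_from[OF assms(1), of n] path_from[OF assms(2), of n] by metis
qed (rule assms(3))

lemma path_source_agree:
  assumes "x \<in> paths F" "y \<in> paths F" "dsrc F (x j) = dsrc F (y j)" "i \<le> j" shows "x i = y i"
  using path_agree_below[OF assms(1,2) _ assms(4)] path_from[OF assms(1), of j] path_from[OF assms(2), of j] assms(3)
  by metis

lemma path_eqI:
  assumes "x \<in> paths F" "y \<in> paths F" "\<And>i. dsrc F (x (2*i)) = dsrc F (y (2*i))" shows "x = y"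
proof
  fix i show "x i = y i" by (rule path_source_agree[OF assms(1,2), of "2*i"]) (simp_all add: assms(3))
qed

lemma red_seq_eq:
  assumes "x \<in> paths F"
  shows "red_seq F x (Suc (2*i)) = red_from (dsrc F (x (Suc (2*i))))"
    and "red_seq F x (2*i) = red_anc (red_from (dsrc F (x (Suc (2*i)))))"
  using red_pair_eq[OF path_edge(1)[OF assms, of "2*i"] path_edge(2)[OF assms] path_edge(4)[OF assms, of "Suc (2*i)"]
      path_edge(2)[OF assms] path_edge(3)[OF assms]]
  by (auto simp: red_seq_def)

lemma red_seq_odd:
  assumes "x \<in> paths F"
  shows "red_seq F x (Suc (2*i)) \<in> dedge F (Suc (2*i))" "red_seq F x (Suc (2*i)) \<notin> dblue F"
    "dsrc F (red_seq F x (Suc (2*i))) = dsrc F (x (Suc (2*i)))"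
    "red_seq F x (Suc (2*i)) \<in> dR F (red_seq F x (2*i))"
    "drng F (red_seq F x (Suc (2*i))) = dsrc F (red_seq F x (2*i))"
proof -
  note r = red_from[OF edge_src[OF path_edge(1)[OF assms, of "Suc (2*i)"]]]
  note a = red_anc[OF r(1,2)]
  show "red_seq F x (Suc (2*i)) \<in> dedge F (Suc (2*i))" "red_seq F x (Suc (2*i)) \<notin> dblue F"
    "dsrc F (red_seq F x (Suc (2*i))) = dsrc F (x (Suc (2*i)))"
    "red_seq F x (Suc (2*i)) \<in> dR F (red_seq F x (2*i))"
    "drng F (red_seq F x (Suc (2*i))) = dsrc F (red_seq F x (2*i))"
    unfolding red_seq_eq[OF assms] using r a by simp_all
qed

lemma path_grandparent:
  assumes "x \<in> paths F" shows "grandparent (dsrc F (x (Suc i))) = drng F (x i)"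
  using path_edge(3)[OF assms, of i] path_from[OF assms] by (simp add: grandparent_def)

lemma red_seq_even:
  assumes "x \<in> paths F"
  shows "red_seq F x (2*i) \<in> dedge F (2*i)" "red_seq F x (2*i) \<notin> dblue F"
    "drng F (red_seq F x (2*i)) = drng F (x (2*i))"
proof -
  note r = red_from[OF edge_src[OF path_edge(1)[OF assms, of "Suc (2*i)"]]]
  note a = red_anc[OF r(1,2)]
  show "red_seq F x (2*i) \<in> dedge F (2*i)" "red_seq F x (2*i) \<notin> dblue F"
    "drng F (red_seq F x (2*i)) = drng F (x (2*i))"
    unfolding red_seq_eq[OF assms] using r a path_grandparent[OF assms, of "2*i"] by simp_all
qed

lemma red_seq_characterization:
  assumes "x \<in> paths F" "f0 \<in> dedge F (2*i)" "f0 \<notin> dblue F" "f1 \<in> dR F f0" "dsrc F f1 = dsrc F (x (Suc (2*i)))"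
  shows "red_seq F x (2*i) = f0" "red_seq F x (Suc (2*i)) = f1"
proof -
  have "red_from (dsrc F (x (Suc (2*i)))) = f1"
    using red_from_eq[OF dR_props(1,2)[OF assms(2-4)]] assms(5) by simp
  then show "red_seq F x (2*i) = f0" "red_seq F x (Suc (2*i)) = f1"
    unfolding red_seq_eq[OF assms(1)] using red_anc_eq[OF assms(2-4)] by simp_all
qed

lemma red_seq_parent:
  assumes "x \<in> paths F" shows "red_parent (red_seq F x (Suc (Suc (2*i)))) = red_seq F x (2*i)"
  using red_seq_even(3)[OF assms, of "Suc i"] path_edge(3)[OF assms, of "Suc (2*i)"]
  by (simp add: red_parent_def red_seq_eq[OF assms])

text \<open>The path whose edge of layer \<open>2i\<close> has the source \<open>w i\<close>; the edges of odd layers are forced.\<close>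

definition path_of_sources :: "(nat \<Rightarrow> 'v) \<Rightarrow> nat \<Rightarrow> 'e" where
  "path_of_sources w i = (if even i then blue_from (w (i div 2)) else blue_from (drng F (blue_from (w (Suc i div 2)))))"

lemma path_of_sources_eqs:
  "path_of_sources w (2*i) = blue_from (w i)"
  "path_of_sources w (Suc (2*i)) = blue_from (drng F (blue_from (w (Suc i))))"
  by (simp_all add: path_of_sources_def)

lemma path_of_sources:
  assumes w: "\<And>i. w i \<in> dvert F (Suc (2*i))" and gp: "\<And>i. grandparent (w (Suc i)) = w i"
  shows "path_of_sources w \<in> paths F" "dsrc F (path_of_sources w (2*i)) = w i"
proof -
  note e = blue_from[OF w]
  have w3: "w (Suc i) \<in> dvert F (Suc (Suc (Suc (2*i))))" for i using w[of "Suc i"] by simp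
  note e' = blue_from[OF w3]
  note o = blue_from[OF edge_rng[OF e'(1)]]
  show "dsrc F (path_of_sources w (2*i)) = w i" using e by (simp add: path_of_sources_eqs)
  have "path_of_sources w k \<in> dedge F k \<and> path_of_sources w k \<in> dblue F \<and>
      drng F (path_of_sources w (Suc k)) = dsrc F (path_of_sources w k)" for k
  proof (cases "even k")
    case True
    then obtain i where k: "k = 2*i" by blast
    show ?thesis unfolding k path_of_sources_eqs using e[of i] gp[of i] by (simp add: grandparent_def)
  next
    case False
    then obtain i where k: "k = Suc (2*i)" by (metis oddE Suc_eq_plus1)
    have "path_of_sources w (Suc k) = blue_from (w (Suc i))" using path_of_sources_eqs(1)[of w "Suc i"] k by simp
    then show ?thesis unfolding k path_of_sources_eqs using o[of i] by (simp add: k)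
  qed
  then show "path_of_sources w \<in> paths F" unfolding paths_def by blast
qed

text \<open>The blue pair that completes two consecutive red edges ends at the source of the second one, so the shift of a path runs
  through the sources of the red edges of the even layers.\<close>

lemma path_shift_characterization:
  assumes x: "x \<in> paths F"
  shows "path_shift F x \<in> paths F" "dsrc F (path_shift F x (2*i)) = dsrc F (red_seq F x (2*i))"
proof -
  define w where "w i = dsrc F (red_seq F x (2*i))" for i
  have w: "w i \<in> dvert F (Suc (2*i))" for i unfolding w_def by (rule edge_src[OF red_seq_even(1)[OF x]])
  have gp: "grandparent (w (Suc i)) = w i" for i
    using red_parent(3)[of "red_seq F x (Suc (Suc (2*i)))" i] red_seq_even(1,2)[OF x, of "Suc i"] red_seq_parent[OF x, of i]
    by (simp add: w_def)
  have bp: "blue_pair F (red_seq F x (Suc (2*i))) (red_seq F x (Suc (Suc (2*i)))) =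
      (blue_from (drng F (blue_from (w (Suc i)))), blue_from (w (Suc i)))" for i
    using blue_pair_eq[OF red_seq_odd(1,2)[OF x, of i], of "red_seq F x (Suc (Suc (2*i)))"]
      red_seq_even[OF x, of "Suc i"] red_seq_odd(3)[OF x, of i] path_edge(3)[OF x, of "Suc (2*i)"]
    by (simp add: w_def)
  have "path_shift F x k = path_of_sources w k" for k
  proof -
    consider "k = 0" | i where "k = Suc (2*i)" | i where "k = Suc (Suc (2*i))"
      by (metis oddE evenE Suc_eq_plus1 mult_Suc_right add_2_eq_Suc not0_implies_Suc mult_0_right)
    then show ?thesis
    proof cases
      case 1
      have "drng F (blue_from (drng F (blue_from (w (Suc 0))))) = w 0" using gp[of 0] by (simp add: grandparent_def)
      moreover have "(THE e. e \<in> dedge F 0 \<and> e \<in> dblue F \<and> dsrc F e = w 0) = blue_from (w 0)"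
        using blue_from[of "w 0" 0] w[of 0] by (intro the_equality) (auto intro: blue_from_eq[symmetric])
      ultimately show ?thesis using bp[of 0] 1 by (simp add: path_shift_def path_of_sources_def numeral_2_eq_2)
    next
      case (2 i)
      then show ?thesis using bp[of i] path_of_sources_eqs(2)[of w i] by (simp add: path_shift_def)
    next
      case (3 i)
      then show ?thesis using bp[of i] path_of_sources_eqs(1)[of w "Suc i"] by (simp add: path_shift_def)
    qed
  qed
  then have eq: "path_shift F x = path_of_sources w" by blast
  show "path_shift F x \<in> paths F" "dsrc F (path_shift F x (2*i)) = dsrc F (red_seq F x (2*i))"
    unfolding eq using path_of_sources[of w, OF w gp] by (simp_all add: w_def)
qed

lemma path_shift_eqI:
  assumes "x \<in> paths F" "y \<in> paths F" "\<And>i. dsrc F (y (2*i)) = dsrc F (red_seq F x (2*i))"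
  shows "path_shift F x = y"
  using path_eqI[OF path_shift_characterization(1)[OF assms(1)] assms(2)] path_shift_characterization(2)[OF assms(1)]
    assms(3) by simp

text \<open>The preimages of a path \<open>x\<close> correspond to the red edges whose source is that of a given even-layer edge of \<open>x\<close>:
  such a red edge lifts uniquely to all later even layers along \<open>x\<close>.\<close>

lemma lift_seq:
  assumes x: "x \<in> paths F" and g: "g \<in> dedge F 0" "g \<notin> dblue F" "dsrc F g = dsrc F (x 0)"
  shows "\<exists>h. h 0 = g \<and> (\<forall>k. h k \<in> dedge F (2*k) \<and> h k \<notin> dblue F \<and> dsrc F (h k) = dsrc F (x (2*k)) \<and>
    red_parent (h (Suc k)) = h k)"
proof -
  define P where "P k f \<longleftrightarrow> f \<in> dedge F (2*k) \<and> f \<notin> dblue F \<and> dsrc F f = dsrc F (x (2*k))" for k f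
  have "\<exists>h. \<forall>k. (P k (h k) \<and> (k = 0 \<longrightarrow> h k = g)) \<and> red_parent (h (Suc k)) = h k"
  proof (rule dependent_nat_choice)
    show "\<exists>f. P 0 f \<and> (0 = (0::nat) \<longrightarrow> f = g)" using g by (simp add: P_def)
    fix f k assume "P k f \<and> (k = 0 \<longrightarrow> f = g)"
    then have f: "f \<in> dedge F (2*k)" "f \<notin> dblue F" "dsrc F f = dsrc F (x (2*k))" by (auto simp: P_def)
    have "dsrc F f = grandparent (dsrc F (x (Suc (Suc (2*k)))))"
      using path_grandparent[OF x, of "Suc (2*k)"] path_edge(3)[OF x, of "2*k"] f(3) by simp
    from red_lift[OF edge_src[OF path_edge(1)[OF x]] f(1,2) this]
    show "\<exists>f'. (P (Suc k) f' \<and> (Suc k = 0 \<longrightarrow> f' = g)) \<and> red_parent f' = f" by (auto simp: P_def)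
  qed
  then obtain h where "\<forall>k. (P k (h k) \<and> (k = 0 \<longrightarrow> h k = g)) \<and> red_parent (h (Suc k)) = h k" by blast
  then show ?thesis unfolding P_def by (intro exI[of _ h]) simp
qed

lemma red_seq_eq_below:
  assumes "x \<in> paths F" "y \<in> paths F" "red_seq F x (2*j) = red_seq F y (2*j)" "i \<le> j"
  shows "red_seq F x (2*i) = red_seq F y (2*i)"
  using assms(4)
proof (induction rule: inc_induct)
  case (step n)
  then show ?case using red_seq_parent[OF assms(1), of n] red_seq_parent[OF assms(2), of n] by simp
qed (rule assms(3))

lemma red_seq_eq_above:
  assumes x: "x \<in> paths F" and y: "y \<in> paths F" and s: "path_shift F x = path_shift F y"
    and z: "red_seq F x (2*j) = red_seq F y (2*j)" and le: "j \<le> i"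
  shows "red_seq F x (2*i) = red_seq F y (2*i)"
  using le
proof (induction i rule: dec_induct)
  case (step n)
  have src: "dsrc F (red_seq F x (2*k)) = dsrc F (red_seq F y (2*k))" for k
    using path_shift_characterization(2)[OF x, of k] path_shift_characterization(2)[OF y, of k] s by simp
  let ?u = "red_seq F x (Suc (Suc (2*n)))" and ?v = "red_seq F y (Suc (Suc (2*n)))"
  have u: "?u \<in> dedge F (Suc (Suc (2*n)))" "?u \<notin> dblue F" and v: "?v \<in> dedge F (Suc (Suc (2*n)))" "?v \<notin> dblue F"
    using red_seq_even(1,2)[OF x, of "Suc n"] red_seq_even(1,2)[OF y, of "Suc n"] by simp_all
  have p: "red_parent ?u = red_seq F x (2*n)" "red_parent ?v = red_seq F x (2*n)"
    using red_seq_parent[OF x, of n] red_seq_parent[OF y, of n] step.IH by simp_all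
  have "dsrc F (red_seq F x (2*n)) = grandparent (dsrc F ?u)"
    using red_parent(3)[OF u] p by simp
  from red_lift[OF edge_src[OF u(1)] red_seq_even(1,2)[OF x] this]
  have "?u = ?v" using u v p src[of "Suc n"] by auto
  then show ?case by simp
qed (rule z)

lemma red_seq_determines:
  assumes x: "x \<in> paths F" and y: "y \<in> paths F" and eq: "\<And>i. red_seq F x (2*i) = red_seq F y (2*i)"
  shows "x = y"
proof
  fix i
  have "drng F (x (2*(Suc i))) = drng F (y (2*(Suc i)))"
    using red_seq_even(3)[OF x, of "Suc i"] red_seq_even(3)[OF y, of "Suc i"] eq[of "Suc i"] by simp
  then have "dsrc F (x (Suc (2*i))) = dsrc F (y (Suc (2*i)))"
    using path_edge(3)[OF x, of "Suc (2*i)"] path_edge(3)[OF y, of "Suc (2*i)"] by simp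
  then show "x i = y i" by (rule path_source_agree[OF x y]) simp
qed

lemma shift_inj:
  assumes "x \<in> paths F" "y \<in> paths F" "path_shift F x = path_shift F y" "red_seq F x (2*j) = red_seq F y (2*j)"
  shows "x = y"
proof (rule red_seq_determines[OF assms(1,2)])
  fix i show "red_seq F x (2*i) = red_seq F y (2*i)"
    using red_seq_eq_below[OF assms(1,2,4)] red_seq_eq_above[OF assms] by (cases "i \<le> j") auto
qed

lemma lift_path0:
  assumes x: "x \<in> paths F" and g: "g \<in> dedge F 0" "g \<notin> dblue F" "dsrc F g = dsrc F (x 0)"
  shows "\<exists>x'\<in>paths F. path_shift F x' = x \<and> red_seq F x' 0 = g"
proof -
  obtain h where h0: "h 0 = g"
    and h: "\<And>k. h k \<in> dedge F (2*k)" "\<And>k. h k \<notin> dblue F" "\<And>k. dsrc F (h k) = dsrc F (x (2*k))"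
      "\<And>k. red_parent (h (Suc k)) = h k" using lift_seq[OF assms] by blast
  have hl: "h (Suc k) \<in> dedge F (Suc (Suc (2*k)))" for k using h(1)[of "Suc k"] by simp
  define w where "w k = drng F (blue_from (drng F (h (Suc k))))" for k
  have rw: "drng F (h (Suc k)) \<in> dvert F (Suc (Suc (2*k)))" for k by (rule edge_rng[OF hl])
  have w: "w k \<in> dvert F (Suc (2*k))" for k
    unfolding w_def by (rule edge_rng[OF blue_from(1)[OF rw]])
  have gph: "grandparent (drng F (h (Suc k))) = drng F (h k)" for k
    using red_parent(4)[OF hl h(2), of k] h(4)[of k] by simp
  have gp: "grandparent (w (Suc k)) = w k" for k
  proof -
    have "drng F (blue_from (w (Suc k))) = drng F (h (Suc k))"
      using gph[of "Suc k"] by (simp add: w_def grandparent_def)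
    then show ?thesis by (simp add: grandparent_def w_def)
  qed
  let ?y = "path_of_sources w"
  note y = path_of_sources[of w, OF w gp]
  have src: "dsrc F (?y (Suc (2*k))) = drng F (h (Suc k))" for k
  proof -
    have "drng F (blue_from (w (Suc k))) = drng F (h (Suc k))"
      using gph[of "Suc k"] by (simp add: w_def grandparent_def)
    then show ?thesis unfolding path_of_sources_eqs using blue_from(3)[OF rw] by simp
  qed
  have r: "red_seq F ?y (2*k) = h k" for k
  proof (rule red_seq_characterization(1)[OF y(1) h(1,2)])
    note r = red_from[OF rw[of k]]
    show "red_from (drng F (h (Suc k))) \<in> dR F (h k)"
      using red_anc(3)[OF r(1,2)] h(4)[of k] by (simp add: red_parent_def)
    show "dsrc F (red_from (drng F (h (Suc k)))) = dsrc F (?y (Suc (2*k)))" using r(3) src by simp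
  qed
  have "path_shift F ?y = x" by (rule path_shift_eqI[OF y(1) x]) (simp add: r h(3))
  then show ?thesis using y(1) r[of 0] h0 by auto
qed

lemma lift_path:
  assumes x: "x \<in> paths F" and g: "g \<in> dedge F (2*i)" "g \<notin> dblue F" "dsrc F g = dsrc F (x (2*i))"
  shows "\<exists>x'\<in>paths F. path_shift F x' = x \<and> red_seq F x' (2*i) = g"
  using g
proof (induction i arbitrary: g)
  case 0
  then show ?case using lift_path0[OF x, of g] by simp
next
  case (Suc i)
  have gl: "g \<in> dedge F (Suc (Suc (2*i)))" using Suc.prems by simp
  note p = red_parent[OF gl Suc.prems(2)]
  have ps: "dsrc F (red_parent g) = dsrc F (x (2*i))"
    using p(3) Suc.prems(3) path_grandparent[OF x, of "Suc (2*i)"] path_edge(3)[OF x, of "2*i"] by simp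
  obtain x' where x': "x' \<in> paths F" "path_shift F x' = x" "red_seq F x' (2*i) = red_parent g"
    using Suc.IH[OF p(1,2) ps] by blast
  let ?u = "red_seq F x' (Suc (Suc (2*i)))"
  have u: "?u \<in> dedge F (Suc (Suc (2*i)))" "?u \<notin> dblue F" using red_seq_even(1,2)[OF x'(1), of "Suc i"] by simp_all
  have "dsrc F ?u = dsrc F g" using path_shift_characterization(2)[OF x'(1), of "Suc i"] x'(2) Suc.prems(3) by simp
  moreover have "red_parent ?u = red_parent g" using red_seq_parent[OF x'(1), of i] x'(3) by simp
  ultimately have "?u = g"
    using red_lift[OF edge_src[OF gl] p(1,2,3)] u gl Suc.prems(2) by auto
  then show ?case using x' by auto
qed

subsection \<open>The topology of the path space\<close>

definition cylinder :: "(nat \<Rightarrow> 'e) \<Rightarrow> nat \<Rightarrow> (nat \<Rightarrow> 'e) set" where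
  "cylinder x n = {y \<in> paths F. \<forall>i\<le>n. y i = x i}"

lemma cylinder_mono: "m \<le> n \<Longrightarrow> cylinder x n \<subseteq> cylinder x m"
  unfolding cylinder_def by auto

lemma topspace_path_space [simp]: "topspace (path_space F) = paths F"
  unfolding path_space_def topology_generated_by_topspace by auto

lemma openin_cylinder: "openin (path_space F) (cylinder x n)"
  unfolding path_space_def cylinder_def by (rule topology_generated_by_Basis) blast

lemma openin_path_space_iff:
  "openin (path_space F) U \<longleftrightarrow> U \<subseteq> paths F \<and> (\<forall>x\<in>U. \<exists>n. cylinder x n \<subseteq> U)"
proof
  assume U: "openin (path_space F) U"
  then have "generate_topology_on {{x \<in> paths F. \<forall>i\<le>n. x i = e i} | e n. True} U"
    unfolding path_space_def by (simp add: openin_topology_generated_by_iff)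
  then have "\<exists>n. cylinder x n \<subseteq> U" if "x \<in> U" for x
    using that
  proof (induction U)
    case (Int a b)
    then obtain m n where "cylinder x m \<subseteq> a" "cylinder x n \<subseteq> b" by blast
    then show ?case using cylinder_mono[of m "max m n" x] cylinder_mono[of n "max m n" x]
      by (intro exI[of _ "max m n"]) auto
  next
    case (UN K)
    then show ?case by (meson UnionE Union_upper subset_trans)
  next
    case (Basis s)
    then obtain e n where s: "s = {x \<in> paths F. \<forall>i\<le>n. x i = e i}" by blast
    then show ?case using Basis.prems by (intro exI[of _ n]) (auto simp: cylinder_def)
  qed simp
  then show "U \<subseteq> paths F \<and> (\<forall>x\<in>U. \<exists>n. cylinder x n \<subseteq> U)"
    using openin_subset[OF U] by simp
next
  assume U: "U \<subseteq> paths F \<and> (\<forall>x\<in>U. \<exists>n. cylinder x n \<subseteq> U)"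
  show "openin (path_space F) U"
  proof (subst openin_subopen, intro ballI)
    fix x assume x: "x \<in> U"
    then obtain n where "cylinder x n \<subseteq> U" using U by blast
    moreover have "x \<in> cylinder x n" using x U by (auto simp: cylinder_def)
    ultimately show "\<exists>T. openin (path_space F) T \<and> x \<in> T \<and> T \<subseteq> U" using openin_cylinder by blast
  qed
qed

lemma openin_path_spaceI:
  assumes "U \<subseteq> paths F" "\<And>x y. x \<in> U \<Longrightarrow> y \<in> paths F \<Longrightarrow> \<forall>i\<le>n. y i = x i \<Longrightarrow> y \<in> U"
  shows "openin (path_space F) U"
  unfolding openin_path_space_iff
proof (intro conjI ballI exI)
  fix x assume "x \<in> U"
  then show "cylinder x n \<subseteq> U" using assms by (auto simp: cylinder_def)
qed (rule assms(1))

lemma clopen_path_spaceI: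
  assumes "\<And>x y. x \<in> paths F \<Longrightarrow> y \<in> paths F \<Longrightarrow> \<forall>i\<le>n. y i = x i \<Longrightarrow> P x \<Longrightarrow> P y"
  shows "clopenin (path_space F) {x \<in> paths F. P x}"
proof -
  have "openin (path_space F) {x \<in> paths F. P x}" by (rule openin_path_spaceI[of _ n]) (use assms in auto)
  moreover have "openin (path_space F) (paths F - {x \<in> paths F. P x})"
  proof (rule openin_path_spaceI[of _ n])
    fix x y assume "x \<in> paths F - {x \<in> paths F. P x}" "y \<in> paths F" "\<forall>i\<le>n. y i = x i"
    then show "y \<in> paths F - {x \<in> paths F. P x}" using assms[of y x] by auto
  qed auto
  ultimately show ?thesis by (auto simp: clopenin_def closedin_def)
qed

text \<open>Paths form a closed subset of a product of finite discrete spaces, which carries the topology of the path space.\<close>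

lemma compact_path_space: "compact_space (path_space F)"
proof -
  let ?P = "product_topology (\<lambda>i. discrete_topology (dedge F i)) (UNIV :: nat set)"
  have "compact_space ?P"
    using bratteli unfolding separated_bratteli_def
    by (simp add: compact_space_product_topology compact_space_discrete_topology)
  have proj: "openin ?P {x \<in> topspace ?P. x i = e}" for i e
  proof -
    have "continuous_map ?P (discrete_topology (dedge F i)) (\<lambda>x. x i)"
      by (rule continuous_map_product_projection) simp
    from openin_continuous_map_preimage[OF this, of "dedge F i \<inter> {e}"]
    have "openin ?P {x \<in> topspace ?P. x i \<in> dedge F i \<inter> {e}}" by simp
    moreover have "{x \<in> topspace ?P. x i \<in> dedge F i \<inter> {e}} = {x \<in> topspace ?P. x i = e}"
      by (auto simp: PiE_iff)
    ultimately show ?thesis by simp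
  qed
  have sub: "paths F \<subseteq> topspace ?P" by (auto simp: path_edge PiE_iff)
  have "openin ?P (topspace ?P - paths F)"
  proof (subst openin_subopen, intro ballI)
    fix x assume x: "x \<in> topspace ?P - paths F"
    then obtain i where i: "\<not> (x i \<in> dedge F i \<and> x i \<in> dblue F \<and> drng F (x (Suc i)) = dsrc F (x i))"
      unfolding paths_def by blast
    let ?T = "{y \<in> topspace ?P. y i = x i} \<inter> {y \<in> topspace ?P. y (Suc i) = x (Suc i)}"
    have "openin ?P ?T" by (intro openin_Int proj)
    moreover have "x \<in> ?T" using x by simp
    moreover have "?T \<subseteq> topspace ?P - paths F"
    proof
      fix y assume y: "y \<in> ?T"
      then have "y \<notin> paths F" using i path_edge[of y i] by auto
      then show "y \<in> topspace ?P - paths F" using y by simp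
    qed
    ultimately show "\<exists>T. openin ?P T \<and> x \<in> T \<and> T \<subseteq> topspace ?P - paths F" by blast
  qed
  then have "closedin ?P (paths F)" using sub by (simp add: closedin_def)
  then have c: "compactin ?P (paths F)" using \<open>compact_space ?P\<close> closedin_compact_space by blast
  have "continuous_map (subtopology ?P (paths F)) (path_space F) (\<lambda>x. x)"
    unfolding path_space_def
  proof (rule continuous_on_generated_topo)
    fix S assume "S \<in> {{x \<in> paths F. \<forall>i\<le>n. x i = e i} | e n. True}"
    then obtain e n where S: "S = {x \<in> paths F. \<forall>i\<le>n. x i = e i}" by blast
    have "openin ?P (\<Inter>i\<in>{..n}. {x \<in> topspace ?P. x i = e i})" by (rule openin_Inter) (auto simp del: topspace_product_topology intro: proj)
    then have "openin (subtopology ?P (paths F)) (paths F \<inter> (\<Inter>i\<in>{..n}. {x \<in> topspace ?P. x i = e i}))"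
      by (rule openin_subtopology_Int2)
    moreover have "paths F \<inter> (\<Inter>i\<in>{..n}. {x \<in> topspace ?P. x i = e i}) = (\<lambda>x. x) -` S \<inter> topspace (subtopology ?P (paths F))"
      unfolding S using sub by auto
    ultimately show "openin (subtopology ?P (paths F)) ((\<lambda>x. x) -` S \<inter> topspace (subtopology ?P (paths F)))" by simp
  next
    show "(\<lambda>x. x) ` topspace (subtopology ?P (paths F)) \<subseteq> \<Union>{{x \<in> paths F. \<forall>i\<le>n. x i = e i} | e n. True}"
      using sub by auto
  qed
  then have "compactin (path_space F) ((\<lambda>x. x) ` paths F)"
    by (rule image_compactin[rotated]) (simp add: compactin_subtopology c)
  then show ?thesis by (simp add: compact_space_def)
qed

lemma red_seq_local:
  assumes "x \<in> paths F" "y \<in> paths F" "x (Suc (2*i)) = y (Suc (2*i))"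
  shows "red_seq F x (2*i) = red_seq F y (2*i)"
  using assms(3) by (simp add: red_seq_eq[OF assms(1)] red_seq_eq[OF assms(2)])

text \<open>The red edge of layer \<open>2i\<close> of a path depends only on its first edges, which gives continuity and, by \<open>shift_inj\<close>, local injectivity.
  The shift is open since a path that agrees with the shift of \<open>x\<close> for long has a preimage, obtained by lifting a late red edge of
  \<open>x\<close>, that agrees with \<open>x\<close> for long.\<close>

lemma ample_path_system: "ample_system (path_space F) (path_shift F)"
proof
  show "compact_space (path_space F)" by (rule compact_path_space)
  have cyl: "clopenin (path_space F) (cylinder x n)" for x n
    unfolding cylinder_def by (rule clopen_path_spaceI[of n]) auto
  have self: "x \<in> cylinder x n" if "x \<in> paths F" for x n using that by (simp add: cylinder_def)
  show "Hausdorff_space (path_space F)"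
    unfolding Hausdorff_space_def
  proof (intro allI impI, elim conjE)
    fix x y assume xy: "x \<in> topspace (path_space F)" "y \<in> topspace (path_space F)" "x \<noteq> y"
    then obtain i where "x i \<noteq> y i" by auto
    then have "disjnt (cylinder x i) (cylinder y i)" by (auto simp: disjnt_def cylinder_def)
    then show "\<exists>U V. openin (path_space F) U \<and> openin (path_space F) V \<and> x \<in> U \<and> y \<in> V \<and> disjnt U V"
      using openin_cylinder self xy by (intro exI[of _ "cylinder x i"] exI[of _ "cylinder y i"]) auto
  qed
  show "\<exists>V. clopenin (path_space F) V \<and> x \<in> V \<and> V \<subseteq> U" if "openin (path_space F) U" "x \<in> U" for U x
    using that cyl self unfolding openin_path_space_iff by blast
  show "continuous_map (path_space F) (path_space F) (path_shift F)"
    unfolding continuous_map topspace_path_space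
  proof (intro conjI allI impI)
    fix U assume U: "openin (path_space F) U"
    show "openin (path_space F) {x \<in> paths F. path_shift F x \<in> U}"
      unfolding openin_path_space_iff
    proof (intro conjI ballI)
      fix x assume "x \<in> {x \<in> paths F. path_shift F x \<in> U}"
      then have x: "x \<in> paths F" and "path_shift F x \<in> U" by auto
      then obtain n where n: "cylinder (path_shift F x) n \<subseteq> U" using U unfolding openin_path_space_iff by blast
      have "path_shift F y \<in> U" if y: "y \<in> cylinder x (Suc (2*n))" for y
      proof -
        have yp: "y \<in> paths F" and "y (Suc (2*n)) = x (Suc (2*n))" using y by (auto simp: cylinder_def)
        then have "dsrc F (path_shift F y (2*n)) = dsrc F (path_shift F x (2*n))"
          using path_shift_characterization(2)[OF x] path_shift_characterization(2)[OF yp] red_seq_local[OF yp x] by simp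
        then have "path_shift F y i = path_shift F x i" if "i \<le> n" for i
          using path_source_agree[OF path_shift_characterization(1)[OF yp] path_shift_characterization(1)[OF x]] that by simp
        then show ?thesis using n path_shift_characterization(1)[OF yp] by (auto simp: cylinder_def)
      qed
      then show "\<exists>n. cylinder x n \<subseteq> {x \<in> paths F. path_shift F x \<in> U}"
        by (intro exI[of _ "Suc (2*n)"]) (auto simp: cylinder_def)
    qed auto
  qed (auto simp: path_shift_characterization)
  show "open_map (path_space F) (path_space F) (path_shift F)"
    unfolding open_map_def
  proof (intro allI impI)
    fix U assume U: "openin (path_space F) U"
    show "openin (path_space F) (path_shift F ` U)"
      unfolding openin_path_space_iff
    proof (intro conjI ballI)
      show "path_shift F ` U \<subseteq> paths F" using openin_subset[OF U] path_shift_characterization(1) by auto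
      fix z assume "z \<in> path_shift F ` U"
      then obtain x where xU: "x \<in> U" and z: "z = path_shift F x" by blast
      have x: "x \<in> paths F" using openin_subset[OF U] xU by auto
      obtain n where n: "cylinder x n \<subseteq> U" using U xU unfolding openin_path_space_iff by blast
      have "y \<in> path_shift F ` U" if y: "y \<in> cylinder z (2*(Suc n))" for y
      proof -
        have yp: "y \<in> paths F" and ys: "y (2*(Suc n)) = z (2*(Suc n))" using y by (auto simp: cylinder_def)
        have "dsrc F (red_seq F x (2*(Suc n))) = dsrc F (y (2*(Suc n)))"
          using path_shift_characterization(2)[OF x, of "Suc n"] ys z by simp
        then obtain x' where x': "x' \<in> paths F" "path_shift F x' = y" "red_seq F x' (2*(Suc n)) = red_seq F x (2*(Suc n))"
          using lift_path[OF yp red_seq_even(1,2)[OF x]] by blast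
        have "drng F (x' (2*(Suc n))) = drng F (x (2*(Suc n)))"
          using red_seq_even(3)[OF x'(1), of "Suc n"] red_seq_even(3)[OF x, of "Suc n"] x'(3) by simp
        then have "dsrc F (x' (Suc (2*n))) = dsrc F (x (Suc (2*n)))"
          using path_edge(3)[OF x'(1), of "Suc (2*n)"] path_edge(3)[OF x, of "Suc (2*n)"] by simp
        then have "x' i = x i" if "i \<le> n" for i using path_source_agree[OF x'(1) x] that by simp
        then have "x' \<in> U" using n x'(1) by (auto simp: cylinder_def)
        then show ?thesis using x'(2) by blast
      qed
      then show "\<exists>n. cylinder z n \<subseteq> path_shift F ` U" by blast
    qed
  qed
  show "\<exists>U. openin (path_space F) U \<and> x \<in> U \<and> inj_on (path_shift F) U" if "x \<in> topspace (path_space F)" for x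
  proof -
    have x: "x \<in> paths F" using that by simp
    have "red_seq F y 0 = red_seq F x 0" if "y \<in> cylinder x 1" for y
      using red_seq_local[of y x 0] that x by (auto simp: cylinder_def)
    then have "inj_on (path_shift F) (cylinder x 1)"
      using shift_inj[of _ _ 0] by (intro inj_onI) (auto simp: cylinder_def)
    then show ?thesis using openin_cylinder self[OF x] by blast
  qed
qed

end

section \<open>Canonical resolutions are l-diagrams\<close>

definition well_formed :: "('v, 'e) res_graph \<Rightarrow> bool" where
  "well_formed G \<longleftrightarrow> finite (bvert0 G) \<and> finite (bvert1 G) \<and> finite (bedge G) \<and> bvert0 G \<noteq> {} \<and>
     brng G ` bedge G = bvert0 G \<and> bsrc G ` bedge G = bvert1 G \<and>
     (\<forall>u\<in>bvert0 G. partition_on {x \<in> bedge G. brng G x = u} (bsep G u))"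

lemma well_formedD:
  assumes "well_formed G"
  shows "x \<in> bedge G \<Longrightarrow> brng G x \<in> bvert0 G" "x \<in> bedge G \<Longrightarrow> bsrc G x \<in> bvert1 G"
    "u \<in> bvert0 G \<Longrightarrow> \<exists>x\<in>bedge G. u = brng G x" "w \<in> bvert1 G \<Longrightarrow> \<exists>x\<in>bedge G. w = bsrc G x"
    "u \<in> bvert0 G \<Longrightarrow> partition_on {x \<in> bedge G. brng G x = u} (bsep G u)" "finite (bedge G)"
proof -
  have e: "brng G ` bedge G = bvert0 G" "bsrc G ` bedge G = bvert1 G"
    using assms unfolding well_formed_def by blast+
  show "x \<in> bedge G \<Longrightarrow> brng G x \<in> bvert0 G" "x \<in> bedge G \<Longrightarrow> bsrc G x \<in> bvert1 G"
    "u \<in> bvert0 G \<Longrightarrow> \<exists>x\<in>bedge G. u = brng G x" "w \<in> bvert1 G \<Longrightarrow> \<exists>x\<in>bedge G. w = bsrc G x"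
    using e by auto
  show "u \<in> bvert0 G \<Longrightarrow> partition_on {x \<in> bedge G. brng G x = u} (bsep G u)" "finite (bedge G)"
    using assms unfolding well_formed_def by auto
qed

definition blue_at :: "('v, 'e) res_graph \<Rightarrow> ('v, 'e) rvert \<Rightarrow> 'e redge set" where
  "blue_at G u = {x \<in> bedge G. brng G x = u \<and> x \<in> bblue G}"

definition red_at :: "('v, 'e) res_graph \<Rightarrow> ('v, 'e) rvert \<Rightarrow> 'e redge set" where
  "red_at G u = {x \<in> bedge G. brng G x = u \<and> x \<notin> bblue G}"

definition unique_blue_source :: "('v, 'e) res_graph \<Rightarrow> bool" where
  "unique_blue_source G \<longleftrightarrow> (\<forall>w\<in>bvert1 G. \<exists>!x. x \<in> bedge G \<and> x \<in> bblue G \<and> bsrc G x = w)"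

definition unique_red_source :: "('v, 'e) res_graph \<Rightarrow> bool" where
  "unique_red_source G \<longleftrightarrow> (\<forall>w\<in>bvert1 G. \<exists>!x. x \<in> bedge G \<and> x \<notin> bblue G \<and> bsrc G x = w)"

text \<open>The shapes of the even and of the odd layers of an l-diagram; resolving turns one into the other.\<close>

definition even_shape :: "('v, 'e) res_graph \<Rightarrow> bool" where
  "even_shape G \<longleftrightarrow> well_formed G \<and> unique_blue_source G \<and>
     (\<forall>u\<in>bvert0 G. bsep G u = {blue_at G u, red_at G u}) \<and>
     (\<forall>w\<in>bvert1 G. \<exists>x\<in>bedge G. x \<notin> bblue G \<and> bsrc G x = w)"

definition odd_shape :: "('v, 'e) res_graph \<Rightarrow> bool" where
  "odd_shape G \<longleftrightarrow> well_formed G \<and> unique_blue_source G \<and> unique_red_source G \<and>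
     (\<forall>u\<in>bvert0 G. blue_at G u \<in> bsep G u \<and> red_at G u \<noteq> {})"

lemma resolve_simps [simp]:
  "bvert0 (resolve G) = bvert1 G"
  "bvert1 (resolve G) = Fam ` {S. family G S}"
  "bedge (resolve G) = (\<Union>x\<in>bedge G. block G x)"
  "bsrc (resolve G) (Alpha x S) = Fam S"
  "brng (resolve G) (Alpha x S) = bsrc G x"
  "bsep (resolve G) v = block G ` {x \<in> bedge G. bsrc G x = v}"
  "bblue (resolve G) = (\<Union>x\<in>bedge G \<inter> bblue G. block G x)"
  by (auto simp: resolve_def)

lemma block_iff: "a \<in> block G x \<longleftrightarrow> (\<exists>S. a = Alpha x S \<and> family G S \<and> x |\<in>| S)"
  unfolding block_def by auto

lemma family_at:
  assumes "family G S" "x |\<in>| S"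
  shows "x \<in> bedge G" "brng G x \<in> bvert0 G" "\<And>y. y |\<in>| S \<Longrightarrow> y \<in> bedge G \<and> brng G y = brng G x"
    "\<And>Y. Y \<in> bsep G (brng G x) \<Longrightarrow> \<exists>!y. y \<in> Y \<and> y |\<in>| S"
  using assms unfolding family_def by auto

lemma resolve_edge_iff:
  "a \<in> bedge (resolve G) \<longleftrightarrow> (\<exists>x S. a = Alpha x S \<and> family G S \<and> x |\<in>| S)"
  "Alpha x S \<in> bblue (resolve G) \<longleftrightarrow> family G S \<and> x |\<in>| S \<and> x \<in> bblue G"
  by (auto simp: block_iff family_at(1))

text \<open>Choose an edge from each block, and \<open>x\<close> itself from its own.\<close>

lemma family_exists:
  assumes G: "well_formed G" and x: "x \<in> bedge G"
  shows "\<exists>S. family G S \<and> x |\<in>| S"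
proof -
  let ?u = "brng G x"
  have u: "?u \<in> bvert0 G" using G x unfolding well_formed_def by auto
  then have p: "partition_on {y \<in> bedge G. brng G y = ?u} (bsep G ?u)" using G unfolding well_formed_def by blast
  define c where "c Y = (if x \<in> Y then x else (SOME y. y \<in> Y))" for Y
  have c: "c Y \<in> Y" if "Y \<in> bsep G ?u" for Y
    using that partition_onD3[OF p] unfolding c_def by (metis some_in_eq)
  have fin: "finite (bsep G ?u)"
    using finite_elements[OF _ p] G unfolding well_formed_def by simp
  define S where "S = Abs_fset (c ` bsep G ?u)"
  have S: "fset S = c ` bsep G ?u" unfolding S_def using fin by (simp add: Abs_fset_inverse)
  have sub: "fset S \<subseteq> {y \<in> bedge G. brng G y = ?u}"
    unfolding S using c partition_onD1[OF p] by blast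
  have un: "\<exists>!y. y \<in> Y \<and> y |\<in>| S" if Y: "Y \<in> bsep G ?u" for Y
  proof (rule ex1I[of _ "c Y"])
    show "c Y \<in> Y \<and> c Y |\<in>| S" using c[OF Y] Y S by auto
    fix y assume y: "y \<in> Y \<and> y |\<in>| S"
    then obtain Y' where Y': "Y' \<in> bsep G ?u" "y = c Y'" using S by auto
    then have "Y' = Y" using partition_onD2[OF p] y Y c[OF Y'(1)] unfolding disjoint_def by blast
    then show "y = c Y" using Y'(2) by simp
  qed
  obtain Y where "Y \<in> bsep G ?u" "x \<in> Y" using partition_onD1[OF p] x by blast
  then have "x |\<in>| S" unfolding S c_def by force
  moreover have "family G S" unfolding family_def by (intro bexI[OF _ u] conjI ballI sub un)
  ultimately show ?thesis by blast
qed

lemma family_nonempty: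
  assumes "well_formed G" "family G S" obtains x where "x |\<in>| S"
proof -
  obtain u where u: "u \<in> bvert0 G" "\<forall>Y\<in>bsep G u. \<exists>!x. x \<in> Y \<and> x |\<in>| S"
    using assms(2) unfolding family_def by blast
  obtain x where x: "x \<in> bedge G" "brng G x = u" using well_formedD(3)[OF assms(1) u(1)] by auto
  have "partition_on {x \<in> bedge G. brng G x = u} (bsep G u)" by (rule well_formedD(5)[OF assms(1) u(1)])
  then obtain Y where "Y \<in> bsep G u" using x partition_onD1 by blast
  then show ?thesis using u(2) that by blast
qed

lemma finite_families: assumes "well_formed G" shows "finite {S. family G S}"
proof (rule finite_imageD)
  show "finite (fset ` {S. family G S})"
    by (rule finite_subset[of _ "Pow (bedge G)"]) (use assms in \<open>auto simp: family_def well_formed_def\<close>)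
  show "inj_on fset {S. family G S}" by (auto intro: inj_onI simp: fset_inject)
qed

lemma resolve_well_formed:
  assumes G: "well_formed G" shows "well_formed (resolve G)"
  unfolding well_formed_def
proof (intro conjI ballI)
  show "finite (bvert0 (resolve G))" using G by (simp add: well_formed_def)
  show "finite (bvert1 (resolve G))" using finite_families[OF G] by simp
  have "bedge (resolve G) \<subseteq> (\<lambda>(x, S). Alpha x S) ` (bedge G \<times> {S. family G S})"
    by (force simp: block_iff)
  then show "finite (bedge (resolve G))"
    using finite_families[OF G] G unfolding well_formed_def by (meson finite_SigmaI finite_imageI finite_subset)
  have "bedge G \<noteq> {}" using G unfolding well_formed_def by auto
  then show "bvert0 (resolve G) \<noteq> {}" using G unfolding well_formed_def by auto
  show "brng (resolve G) ` bedge (resolve G) = bvert0 (resolve G)"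
  proof (intro equalityI subsetI)
    fix v assume "v \<in> brng (resolve G) ` bedge (resolve G)"
    then obtain x S where "x \<in> bedge G" "v = bsrc G x" by (auto simp: block_iff)
    then show "v \<in> bvert0 (resolve G)" using G unfolding well_formed_def by auto
  next
    fix v assume "v \<in> bvert0 (resolve G)"
    then obtain x where x: "x \<in> bedge G" "v = bsrc G x" using well_formedD(4)[OF G] by auto
    obtain S where "family G S" "x |\<in>| S" using family_exists[OF G x(1)] by blast
    then have "Alpha x S \<in> bedge (resolve G)" unfolding resolve_edge_iff by blast
    then show "v \<in> brng (resolve G) ` bedge (resolve G)" using x(2) by (intro image_eqI[of _ _ "Alpha x S"]) simp_all
  qed
  show "bsrc (resolve G) ` bedge (resolve G) = bvert1 (resolve G)"
  proof (intro equalityI subsetI)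
    fix v assume "v \<in> bsrc (resolve G) ` bedge (resolve G)"
    then show "v \<in> bvert1 (resolve G)" by (auto simp: block_iff)
  next
    fix v assume "v \<in> bvert1 (resolve G)"
    then obtain S where S: "family G S" "v = Fam S" by auto
    obtain x where "x |\<in>| S" using family_nonempty[OF G S(1)] .
    then have "Alpha x S \<in> bedge (resolve G)" using S(1) unfolding resolve_edge_iff by blast
    then show "v \<in> bsrc (resolve G) ` bedge (resolve G)" using S(2) by (intro image_eqI[of _ _ "Alpha x S"]) simp_all
  qed
  fix v assume "v \<in> bvert0 (resolve G)"
  show "partition_on {a \<in> bedge (resolve G). brng (resolve G) a = v} (bsep (resolve G) v)"
  proof (rule partition_onI)
    show "\<Union>(bsep (resolve G) v) = {a \<in> bedge (resolve G). brng (resolve G) a = v}"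
      by (auto simp: block_iff)
    show "disjnt p q" if "p \<in> bsep (resolve G) v" "q \<in> bsep (resolve G) v" "p \<noteq> q" for p q
      using that by (auto simp: disjnt_def block_iff)
    show "{} \<notin> bsep (resolve G) v"
      using family_exists[OF G] by (auto simp: block_def)
  qed
qed

lemma blue_at_resolve:
  assumes "unique_blue_source G" "x \<in> bedge G" "x \<in> bblue G" "bsrc G x \<in> bvert1 G"
  shows "blue_at (resolve G) (bsrc G x) = block G x"
proof -
  have un: "y = x" if "y \<in> bedge G" "y \<in> bblue G" "bsrc G y = bsrc G x" for y
    using assms that unfolding unique_blue_source_def by blast
  show ?thesis unfolding blue_at_def
  proof (intro equalityI subsetI)
    fix a assume "a \<in> {a \<in> bedge (resolve G). brng (resolve G) a = bsrc G x \<and> a \<in> bblue (resolve G)}"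
    then obtain y S where "a = Alpha y S" "family G S" "y |\<in>| S" "y \<in> bedge G" "y \<in> bblue G" "bsrc G y = bsrc G x"
      by (auto simp: block_iff)
    then show "a \<in> block G x" using un[of y] by (simp add: block_iff)
  qed (use assms(2,3) in \<open>auto simp: block_iff\<close>)
qed

lemma red_at_resolve:
  "red_at (resolve G) v = \<Union> (block G ` {x \<in> bedge G - bblue G. bsrc G x = v})"
  unfolding red_at_def by (auto simp: block_iff)

lemma unique_resolved_source:
  assumes S: "family G S" and ex: "\<exists>!x. x |\<in>| S \<and> (x \<in> bblue G \<longleftrightarrow> c)"
  shows "\<exists>!a. a \<in> bedge (resolve G) \<and> (a \<in> bblue (resolve G) \<longleftrightarrow> c) \<and> bsrc (resolve G) a = Fam S"
proof -
  obtain x where x: "x |\<in>| S" "x \<in> bblue G \<longleftrightarrow> c" and un: "\<forall>y. y |\<in>| S \<and> (y \<in> bblue G \<longleftrightarrow> c) \<longrightarrow> y = x"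
    using ex by (elim ex1E conjE)
  show ?thesis
  proof (rule ex1I[of _ "Alpha x S"])
    show "Alpha x S \<in> bedge (resolve G) \<and> (Alpha x S \<in> bblue (resolve G) \<longleftrightarrow> c) \<and> bsrc (resolve G) (Alpha x S) = Fam S"
      using S x unfolding resolve_edge_iff by simp
    fix a assume a: "a \<in> bedge (resolve G) \<and> (a \<in> bblue (resolve G) \<longleftrightarrow> c) \<and> bsrc (resolve G) a = Fam S"
    then obtain y T where y: "a = Alpha y T" "family G T" "y |\<in>| T" using resolve_edge_iff(1)[of a G] by blast
    then have "T = S" "y \<in> bblue G \<longleftrightarrow> c" using a resolve_edge_iff(2)[of y T G] by auto
    then show "a = Alpha x S" using un y by simp
  qed
qed

lemma even_resolve:
  assumes G: "even_shape G" shows "odd_shape (resolve G)"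
proof -
  have wf: "well_formed G" and ub: "unique_blue_source G"
    and sep: "\<And>u. u \<in> bvert0 G \<Longrightarrow> bsep G u = {blue_at G u, red_at G u}"
    and red: "\<And>w. w \<in> bvert1 G \<Longrightarrow> \<exists>x\<in>bedge G. x \<notin> bblue G \<and> bsrc G x = w"
    using G unfolding even_shape_def by auto
  have one: "(\<exists>!x. x |\<in>| S \<and> x \<in> bblue G) \<and> (\<exists>!x. x |\<in>| S \<and> x \<notin> bblue G)" if S: "family G S" for S
  proof -
    obtain x where x: "x |\<in>| S" using family_nonempty[OF wf S] .
    note f = family_at[OF S x]
    have "\<exists>!y. y \<in> blue_at G (brng G x) \<and> y |\<in>| S" "\<exists>!y. y \<in> red_at G (brng G x) \<and> y |\<in>| S"
      using f(4) sep[OF f(2)] by simp_all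
    moreover have "y \<in> blue_at G (brng G x) \<and> y |\<in>| S \<longleftrightarrow> y |\<in>| S \<and> y \<in> bblue G"
      "y \<in> red_at G (brng G x) \<and> y |\<in>| S \<longleftrightarrow> y |\<in>| S \<and> y \<notin> bblue G" for y
      using f(3) by (auto simp: blue_at_def red_at_def)
    ultimately show ?thesis by simp
  qed
  have "unique_blue_source (resolve G)"
    unfolding unique_blue_source_def
  proof
    fix w assume "w \<in> bvert1 (resolve G)"
    then obtain S where S: "family G S" "w = Fam S" by auto
    show "\<exists>!a. a \<in> bedge (resolve G) \<and> a \<in> bblue (resolve G) \<and> bsrc (resolve G) a = w"
      using unique_resolved_source[OF S(1), of True] one[OF S(1)] S(2) by (simp del: resolve_simps)
  qed
  moreover have "unique_red_source (resolve G)"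
    unfolding unique_red_source_def
  proof
    fix w assume "w \<in> bvert1 (resolve G)"
    then obtain S where S: "family G S" "w = Fam S" by auto
    show "\<exists>!a. a \<in> bedge (resolve G) \<and> a \<notin> bblue (resolve G) \<and> bsrc (resolve G) a = w"
      using unique_resolved_source[OF S(1), of False] one[OF S(1)] S(2) by (simp del: resolve_simps)
  qed
  moreover have "blue_at (resolve G) w \<in> bsep (resolve G) w \<and> red_at (resolve G) w \<noteq> {}"
    if "w \<in> bvert0 (resolve G)" for w
  proof -
    have w: "w \<in> bvert1 G" using that by simp
    then obtain x where x: "x \<in> bedge G" "x \<in> bblue G" "bsrc G x = w" using ub unfolding unique_blue_source_def by blast
    obtain y where y: "y \<in> bedge G" "y \<notin> bblue G" "bsrc G y = w" using red[OF w] by blast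
    have "blue_at (resolve G) w = block G x" using blue_at_resolve[OF ub x(1,2)] x(3) w by simp
    moreover obtain S where "Alpha y S \<in> block G y" using family_exists[OF wf y(1)] by (auto simp: block_iff)
    ultimately show ?thesis using x y by (auto simp: red_at_resolve)
  qed
  ultimately show ?thesis unfolding odd_shape_def using resolve_well_formed[OF wf] by blast
qed

lemma odd_resolve:
  assumes G: "odd_shape G" shows "even_shape (resolve G)"
proof -
  have wf: "well_formed G" and ub: "unique_blue_source G" and ur: "unique_red_source G"
    and sep: "\<And>u. u \<in> bvert0 G \<Longrightarrow> blue_at G u \<in> bsep G u \<and> red_at G u \<noteq> {}"
    using G unfolding odd_shape_def by auto
  have "unique_blue_source (resolve G)"
    unfolding unique_blue_source_def
  proof
    fix w assume "w \<in> bvert1 (resolve G)"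
    then obtain S where S: "family G S" "w = Fam S" by auto
    obtain z where z: "z |\<in>| S" using family_nonempty[OF wf S(1)] .
    note f = family_at[OF S(1) z]
    have "\<exists>!x. x \<in> blue_at G (brng G z) \<and> x |\<in>| S" by (rule f(4)) (use sep[OF f(2)] in simp)
    moreover have "x \<in> blue_at G (brng G z) \<and> x |\<in>| S \<longleftrightarrow> x |\<in>| S \<and> x \<in> bblue G" for x
      using f(3) by (auto simp: blue_at_def)
    ultimately show "\<exists>!a. a \<in> bedge (resolve G) \<and> a \<in> bblue (resolve G) \<and> bsrc (resolve G) a = w"
      using unique_resolved_source[OF S(1), of True] S(2) by (simp del: resolve_simps)
  qed
  moreover have "bsep (resolve G) w = {blue_at (resolve G) w, red_at (resolve G) w}" if "w \<in> bvert0 (resolve G)" for w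
  proof -
    have w: "w \<in> bvert1 G" using that by simp
    obtain x where x: "x \<in> bedge G" "x \<in> bblue G" "bsrc G x = w"
      and xu: "\<And>y. y \<in> bedge G \<Longrightarrow> y \<in> bblue G \<Longrightarrow> bsrc G y = w \<Longrightarrow> y = x"
      using ub w unfolding unique_blue_source_def by blast
    obtain y where y: "y \<in> bedge G" "y \<notin> bblue G" "bsrc G y = w"
      and yu: "\<And>z. z \<in> bedge G \<Longrightarrow> z \<notin> bblue G \<Longrightarrow> bsrc G z = w \<Longrightarrow> z = y"
      using ur w unfolding unique_red_source_def by blast
    have "{z \<in> bedge G. bsrc G z = w} = {x, y}" using x y xu yu by blast
    moreover have "{z \<in> bedge G - bblue G. bsrc G z = w} = {y}" using y yu by blast
    moreover have "blue_at (resolve G) w = block G x" using blue_at_resolve[OF ub x(1,2)] x(3) w by simp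
    ultimately show ?thesis by (simp add: red_at_resolve)
  qed
  moreover have "\<exists>a\<in>bedge (resolve G). a \<notin> bblue (resolve G) \<and> bsrc (resolve G) a = w"
    if "w \<in> bvert1 (resolve G)" for w
  proof -
    obtain S where S: "family G S" "w = Fam S" using \<open>w \<in> bvert1 (resolve G)\<close> by auto
    obtain z where z: "z |\<in>| S" using family_nonempty[OF wf S(1)] .
    note f = family_at[OF S(1) z]
    obtain y where y: "y \<in> red_at G (brng G z)" using sep[OF f(2)] by blast
    have p: "partition_on {x \<in> bedge G. brng G x = brng G z} (bsep G (brng G z))"
      using wf f(2) unfolding well_formed_def by blast
    obtain Y where Y: "Y \<in> bsep G (brng G z)" "y \<in> Y" using partition_onD1[OF p] y unfolding red_at_def by blast
    obtain x where x: "x \<in> Y" "x |\<in>| S" using f(4)[OF Y(1)] by blast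
    have "x \<notin> bblue G"
    proof
      assume "x \<in> bblue G"
      then have "x \<in> blue_at G (brng G z)" using f(3)[OF x(2)] by (simp add: blue_at_def)
      then have "Y = blue_at G (brng G z)"
        using partition_onD2[OF p] Y(1) sep[OF f(2)] x(1) unfolding disjoint_def by blast
      then show False using Y(2) y by (simp add: blue_at_def red_at_def)
    qed
    then show ?thesis
      using S x(2) by (intro bexI[of _ "Alpha x S"]) (auto simp: block_iff family_at(1))
  qed
  ultimately show ?thesis unfolding even_shape_def using resolve_well_formed[OF wf] by blast
qed

text \<open>Layers are told apart by the nesting depth of edges.\<close>

primrec depth :: "'e redge \<Rightarrow> nat" where
  "depth (Init e) = 0"
| "depth (Alpha x S) = Suc (depth x)"

locale resolvable =
  fixes G0 :: "('v, 'e) res_graph"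
  assumes shape0: "even_shape G0" and edges0: "x \<in> bedge G0 \<Longrightarrow> depth x = 0"
    and verts0: "bvert0 G0 \<subseteq> range Base" "bvert1 G0 \<subseteq> range Base" "bvert0 G0 \<inter> bvert1 G0 = {}"
begin

definition level :: "nat \<Rightarrow> ('v, 'e) res_graph" where
  "level k = (resolve ^^ k) G0"

lemma level_0 [simp]: "level 0 = G0" and level_Suc: "level (Suc k) = resolve (level k)"
  by (simp_all add: level_def)

lemma level_shape: "even_shape (level (2*i)) \<and> odd_shape (level (Suc (2*i)))"
proof (induction i)
  case 0
  then show ?case using shape0 even_resolve[OF shape0] by (simp add: level_Suc)
next
  case (Suc i)
  then have "even_shape (level (Suc (Suc (2*i))))" by (subst level_Suc) (blast intro: odd_resolve)
  moreover from this have "odd_shape (level (Suc (Suc (Suc (2*i)))))" by (subst level_Suc) (rule even_resolve)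
  ultimately show ?case by simp
qed

lemma level_well_formed: "well_formed (level k)"
proof (cases "even k")
  case True
  then obtain i where "k = 2*i" by blast
  then show ?thesis using level_shape[of i] by (simp add: even_shape_def)
next
  case False
  then obtain i where "k = Suc (2*i)" by (metis oddE Suc_eq_plus1)
  then show ?thesis using level_shape[of i] by (simp add: odd_shape_def)
qed

lemma level_unique_blue: "unique_blue_source (level k)"
proof (cases "even k")
  case True
  then obtain i where "k = 2*i" by blast
  then show ?thesis using level_shape[of i] by (simp add: even_shape_def)
next
  case False
  then obtain i where "k = Suc (2*i)" by (metis oddE Suc_eq_plus1)
  then show ?thesis using level_shape[of i] by (simp add: odd_shape_def)
qed

lemma edge_depth: "x \<in> bedge (level k) \<Longrightarrow> depth x = k"
proof (induction k arbitrary: x)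
  case 0
  then show ?case using edges0 by simp
next
  case (Suc k)
  then show ?case by (auto simp: level_Suc block_iff)
qed

lemma vert0_Suc: "bvert0 (level (Suc k)) = bvert1 (level k)"
  by (simp add: level_Suc)

lemma vert_level_unique:
  assumes "v \<in> bvert0 (level i)" "v \<in> bvert0 (level j)" shows "i = j"
proof -
  \<comment> \<open>The level of \<open>Fam S\<close> is two more than that of the ranges of the members of \<open>S\<close>.\<close>
  define rank where "rank v = (case v of Base w \<Rightarrow> if v \<in> bvert0 G0 then 0 else 1
    | Fam S \<Rightarrow> Suc (Suc (depth (SOME x. x |\<in>| S))))" for v :: "('v, 'e) rvert"
  have "rank v = k" if v: "v \<in> bvert0 (level k)" for k
  proof -
    consider "k = 0" | "k = 1" | l where "k = Suc (Suc l)" by (metis One_nat_def old.nat.exhaust)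
    then show ?thesis
    proof cases
      case 1
      then show ?thesis using v verts0 by (auto simp: rank_def split: rvert.splits)
    next
      case 2
      then have "v \<in> bvert1 G0" using v vert0_Suc[of 0] by simp
      then show ?thesis using 2 verts0 by (auto simp: rank_def split: rvert.splits)
    next
      case (3 l)
      then obtain S where S: "family (level l) S" "v = Fam S"
        using v vert0_Suc[of "Suc l"] by (auto simp: level_Suc)
      obtain x where "x |\<in>| S" using family_nonempty[OF level_well_formed S(1)] .
      then have "(SOME x. x |\<in>| S) |\<in>| S" by (rule someI)
      then have "depth (SOME x. x |\<in>| S) = l" using edge_depth family_at(1)[OF S(1)] by blast
      then show ?thesis using S(2) 3 by (simp add: rank_def)
    qed
  qed
  then show ?thesis using assms by metis
qed

abbreviation "H \<equiv> resolution G0"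

lemma edge_level_eq: "a \<in> bedge (level k) \<Longrightarrow> edge_level G0 a = k"
  unfolding edge_level_def level_def[symmetric] using edge_depth by (intro the_equality) auto

lemma vert_level_eq: "v \<in> bvert0 (level k) \<Longrightarrow> vert_level G0 v = k"
  unfolding vert_level_def level_def[symmetric] using vert_level_unique by (intro the_equality) auto

lemma H_vert: "dvert H k = bvert0 (level k)" and H_edge: "dedge H k = bedge (level k)"
  by (simp_all add: resolution_def level_def)

lemma H_src: "a \<in> bedge (level k) \<Longrightarrow> dsrc H a = bsrc (level k) a"
  and H_rng: "a \<in> bedge (level k) \<Longrightarrow> drng H a = brng (level k) a"
  and H_R: "a \<in> bedge (level k) \<Longrightarrow> dR H a = block (level k) a"
  using edge_level_eq[of a k] by (simp_all add: resolution_def level_def)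

lemma H_sep: "v \<in> bvert0 (level k) \<Longrightarrow> dsep H v = bsep (level k) v"
  using vert_level_eq[of v k] by (simp add: resolution_def level_def)

lemma H_blue: "a \<in> bedge (level k) \<Longrightarrow> a \<in> dblue H \<longleftrightarrow> a \<in> bblue (level k)"
  using edge_depth by (auto simp: resolution_def level_def[symmetric])

lemma level_rng: "a \<in> bedge (level k) \<Longrightarrow> brng (level k) a \<in> bvert0 (level k)"
  and level_src: "a \<in> bedge (level k) \<Longrightarrow> bsrc (level k) a \<in> bvert1 (level k)"
  using level_well_formed[of k] unfolding well_formed_def by auto

lemma H_edges_at:
  assumes "v \<in> bvert0 (level k)"
  shows "{e \<in> dedges H. drng H e = v} = {e \<in> bedge (level k). brng (level k) e = v}"
proof (intro equalityI subsetI)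
  fix e assume "e \<in> {e \<in> dedges H. drng H e = v}"
  then obtain i where i: "e \<in> bedge (level i)" "drng H e = v" by (auto simp: dedges_def H_edge)
  then have "i = k" using vert_level_unique[OF _ assms] level_rng[OF i(1)] H_rng[OF i(1)] by simp
  then show "e \<in> {e \<in> bedge (level k). brng (level k) e = v}" using i H_rng[OF i(1)] by simp
next
  fix e assume "e \<in> {e \<in> bedge (level k). brng (level k) e = v}"
  then show "e \<in> {e \<in> dedges H. drng H e = v}" using H_rng[of e k] by (auto simp: dedges_def H_edge)
qed

lemma H_B: "v \<in> bvert0 (level k) \<Longrightarrow> B_at H v = blue_at (level k) v"
  and H_Rat: "v \<in> bvert0 (level k) \<Longrightarrow> R_at H v = red_at (level k) v"
  using H_edges_at[of v k] H_blue[of _ k] unfolding B_at_def R_at_def blue_at_def red_at_def by blast+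

lemma unique_blue:
  "\<lbrakk>x \<in> bedge (level k); x \<in> bblue (level k); y \<in> bedge (level k); y \<in> bblue (level k);
    bsrc (level k) x = bsrc (level k) y\<rbrakk> \<Longrightarrow> x = y"
  using level_unique_blue[of k] level_src[of y k] unfolding unique_blue_source_def by blast

lemma unique_red:
  "\<lbrakk>x \<in> bedge (level (Suc (2*i))); x \<notin> bblue (level (Suc (2*i))); y \<in> bedge (level (Suc (2*i)));
    y \<notin> bblue (level (Suc (2*i))); bsrc (level (Suc (2*i))) x = bsrc (level (Suc (2*i))) y\<rbrakk> \<Longrightarrow> x = y"
  using conjunct2[OF level_shape[of i]] level_src[of y "Suc (2*i)"] unfolding odd_shape_def unique_red_source_def by blast

text \<open>An edge \<open>x\<close> that is the only one of its colour with its source has as its block all edges of that colour that end there.\<close>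

lemma blue_after:
  assumes "x \<in> bedge (level k)" "x \<in> bblue (level k)"
  shows "B_at H (dsrc H x) = block (level k) x"
  using blue_at_resolve[OF level_unique_blue assms level_src[OF assms(1)]] level_src[OF assms(1)]
    H_B[of "bsrc (level k) x" "Suc k"] H_src[OF assms(1)] by (simp add: level_Suc)

lemma red_after:
  assumes "x \<in> bedge (level (Suc (2*i)))" "x \<notin> bblue (level (Suc (2*i)))"
  shows "R_at H (dsrc H x) = block (level (Suc (2*i))) x"
proof -
  let ?G = "level (Suc (2*i))"
  have "{y \<in> bedge ?G - bblue ?G. bsrc ?G y = bsrc ?G x} = {x}" using assms unique_red by blast
  then have "red_at (resolve ?G) (bsrc ?G x) = block ?G x" by (simp add: red_at_resolve)
  then show ?thesis
    using H_Rat[of "bsrc ?G x" "Suc (Suc (2*i))"] level_src[OF assms(1)] H_src[OF assms(1)]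
    by (simp add: level_Suc[of "Suc (2*i)"])
qed

lemma src_block: "a \<in> block (level k) x \<Longrightarrow> x \<in> bedge (level k) \<Longrightarrow> \<exists>S. a = Alpha x S \<and> family (level k) S \<and> x |\<in>| S \<and> dsrc H a = Fam S"
proof -
  assume a: "a \<in> block (level k) x" "x \<in> bedge (level k)"
  then obtain S where S: "a = Alpha x S" "family (level k) S" "x |\<in>| S" by (auto simp: block_iff)
  have "a \<in> bedge (level (Suc k))" using a by (auto simp: level_Suc)
  then have "dsrc H a = Fam S" using H_src[of a "Suc k"] S(1) by (simp add: level_Suc)
  then show ?thesis using S by blast
qed

lemma src_block_image:
  assumes "x \<in> bedge (level k)"
  shows "dsrc H ` block (level k) x = Fam ` {S. family (level k) S \<and> x |\<in>| S}"
proof (intro equalityI subsetI)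
  fix w :: "('v, 'e) rvert" assume "w \<in> Fam ` {S. family (level k) S \<and> x |\<in>| S}"
  then obtain S where S: "family (level k) S" "x |\<in>| S" "w = Fam S" by blast
  then have a: "Alpha x S \<in> block (level k) x" by (auto simp: block_iff)
  then have "dsrc H (Alpha x S) = w" using src_block[OF a assms] S(3) by auto
  then show "w \<in> dsrc H ` block (level k) x" using a by blast
qed (use src_block[OF _ assms] in blast)

lemma H_bratteli: "separated_bratteli H"
  unfolding separated_bratteli_def
proof (intro conjI allI ballI)
  show "disjoint_family (dvert H)"
    using vert_level_unique by (auto simp: disjoint_family_on_def H_vert)
  show "disjoint_family (dedge H)"
    using edge_depth by (auto simp: disjoint_family_on_def H_edge)
  fix j
  note wf = level_well_formed[of j]
  show "finite (dvert H j)" "dvert H j \<noteq> {}" "finite (dedge H j)" "dedge H j \<noteq> {}"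
    using wf by (auto simp: well_formed_def H_vert H_edge)
  have "drng H ` dedge H j = brng (level j) ` bedge (level j)"
    using H_rng[of _ j] by (auto simp: H_edge)
  then show "drng H ` dedge H j = dvert H j" using wf by (simp add: well_formed_def H_vert)
  have "dsrc H ` dedge H j = bsrc (level j) ` bedge (level j)"
    using H_src[of _ j] by (auto simp: H_edge)
  then show "dsrc H ` dedge H j = dvert H (Suc j)" using wf by (simp add: well_formed_def H_vert vert0_Suc)
  fix v assume "v \<in> dvert H j"
  then have v: "v \<in> bvert0 (level j)" by (simp add: H_vert)
  then show "partition_on {e \<in> dedges H. drng H e = v} (dsep H v)"
    using wf H_edges_at[OF v] H_sep[OF v] by (simp add: well_formed_def)
qed

lemma H_cond_a: "l_cond_a H"
  unfolding l_cond_a_def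
proof (intro allI ballI)
  fix j v assume "v \<in> dvert H (2*j)"
  then have v: "v \<in> bvert0 (level (2*j))" by (simp add: H_vert)
  then show "dsep H v = {B_at H v, R_at H v}"
    using conjunct1[OF level_shape[of j]] unfolding H_sep[OF v] H_B[OF v] H_Rat[OF v] even_shape_def by blast
qed

lemma H_cond_b: "l_cond_b H"
  unfolding l_cond_b_def
proof (intro allI ballI)
  fix j v assume "v \<in> dvert H (2*j+1)"
  then have v: "v \<in> bvert0 (level (Suc (2*j)))" and v': "v \<in> bvert1 (level (2*j))" by (simp_all add: H_vert vert0_Suc)
  let ?G = "level (2*j)"
  obtain x where x: "x \<in> bedge ?G" "x \<in> bblue ?G" "bsrc ?G x = v"
    using level_unique_blue[of "2*j"] v' unfolding unique_blue_source_def by blast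
  have B: "B_at H v = block ?G x" using blue_after[OF x(1,2)] H_src[OF x(1)] x(3) by simp
  have red: "{f \<in> dedge H (2*j) - dblue H. dsrc H f = v} = {f \<in> bedge ?G - bblue ?G. bsrc ?G f = v}"
    using H_blue[of _ "2*j"] H_src[of _ "2*j"] by (auto simp: H_edge)
  have "dR H ` {f \<in> bedge ?G - bblue ?G. bsrc ?G f = v} = block ?G ` {f \<in> bedge ?G - bblue ?G. bsrc ?G f = v}"
    using H_R[of _ "2*j"] by (intro image_cong) auto
  moreover have "{f \<in> bedge ?G. bsrc ?G f = v} = insert x {f \<in> bedge ?G - bblue ?G. bsrc ?G f = v}"
    using x unique_blue by blast
  moreover have "dsep H v = block ?G ` {f \<in> bedge ?G. bsrc ?G f = v}"
    using H_sep[OF v] by (simp add: level_Suc)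
  moreover have "R_at H v = \<Union> (block ?G ` {f \<in> bedge ?G - bblue ?G. bsrc ?G f = v})"
    using H_Rat[OF v] by (simp add: level_Suc red_at_resolve)
  ultimately show "dsep H v = {B_at H v} \<union> dR H ` {f \<in> dedge H (2*j) - dblue H. dsrc H f = v} \<and>
      R_at H v = \<Union> (dR H ` {f \<in> dedge H (2*j) - dblue H. dsrc H f = v})"
    unfolding red B by simp
qed

lemma blue_sources_cover:
  "disjoint_family_on (\<lambda>v. dsrc H ` B_at H v) (dvert H k)"
  "dvert H (Suc k) = (\<Union>v\<in>dvert H k. dsrc H ` B_at H v)"
  "v \<in> dvert H k \<Longrightarrow> inj_on (dsrc H) (B_at H v)"
proof -
  have B: "x \<in> B_at H v \<longleftrightarrow> x \<in> bedge (level k) \<and> x \<in> bblue (level k) \<and> brng (level k) x = v"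
    if "v \<in> dvert H k" for x v using that H_B[of v k] by (auto simp: H_vert blue_at_def)
  have inj: "x = y" if "x \<in> bedge (level k)" "x \<in> bblue (level k)" "y \<in> bedge (level k)" "y \<in> bblue (level k)"
    "dsrc H x = dsrc H y" for x y using unique_blue[of x k y] that H_src[of x k] H_src[of y k] by simp
  show "disjoint_family_on (\<lambda>v. dsrc H ` B_at H v) (dvert H k)"
    unfolding disjoint_family_on_def
  proof (intro ballI impI, rule ccontr)
    fix u v assume uv: "u \<in> dvert H k" "v \<in> dvert H k" "u \<noteq> v" "dsrc H ` B_at H u \<inter> dsrc H ` B_at H v \<noteq> {}"
    then obtain x y where "x \<in> B_at H u" "y \<in> B_at H v" "dsrc H x = dsrc H y" by blast
    then show False using inj[of x y] B[OF uv(1)] B[OF uv(2)] uv(3) by auto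
  qed
  show "inj_on (dsrc H) (B_at H v)" if "v \<in> dvert H k"
    using inj B[OF that] by (intro inj_onI) blast
  show "dvert H (Suc k) = (\<Union>v\<in>dvert H k. dsrc H ` B_at H v)"
  proof (intro equalityI subsetI)
    fix w assume "w \<in> dvert H (Suc k)"
    then have "w \<in> bvert1 (level k)" by (simp add: H_vert vert0_Suc)
    then obtain x where x: "x \<in> bedge (level k)" "x \<in> bblue (level k)" "bsrc (level k) x = w"
      using level_unique_blue[of k] unfolding unique_blue_source_def by blast
    have v: "brng (level k) x \<in> dvert H k" using level_rng[OF x(1)] by (simp add: H_vert)
    then have "x \<in> B_at H (brng (level k) x)" using B[OF v] x by simp
    moreover have "w = dsrc H x" using H_src[OF x(1)] x(3) by simp
    ultimately show "w \<in> (\<Union>v\<in>dvert H k. dsrc H ` B_at H v)" using v by blast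
  next
    fix w assume "w \<in> (\<Union>v\<in>dvert H k. dsrc H ` B_at H v)"
    then obtain v x where "v \<in> dvert H k" "x \<in> B_at H v" "w = dsrc H x" by blast
    then show "w \<in> dvert H (Suc k)"
      using B[of v x] level_src[of x k] H_src[of x k] by (simp add: H_vert vert0_Suc)
  qed
qed

lemma red_at_H: "v \<in> dvert H k \<Longrightarrow> x \<in> R_at H v \<longleftrightarrow> x \<in> bedge (level k) \<and> x \<notin> bblue (level k) \<and> brng (level k) x = v"
  using H_Rat[of v k] by (auto simp: H_vert red_at_def)

lemma blue_at_H: "v \<in> dvert H k \<Longrightarrow> x \<in> B_at H v \<longleftrightarrow> x \<in> bedge (level k) \<and> x \<in> bblue (level k) \<and> brng (level k) x = v"
  using H_B[of v k] by (auto simp: H_vert blue_at_def)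

lemma red_sources_cover:
  assumes ex: "\<And>w. w \<in> bvert1 (level k) \<Longrightarrow> \<exists>x\<in>bedge (level k). x \<notin> bblue (level k) \<and> bsrc (level k) x = w"
  shows "dvert H (Suc k) = (\<Union>v\<in>dvert H k. dsrc H ` R_at H v)"
proof (intro equalityI subsetI)
  fix w assume "w \<in> dvert H (Suc k)"
  then have "w \<in> bvert1 (level k)" by (simp add: H_vert vert0_Suc)
  then obtain x where x: "x \<in> bedge (level k)" "x \<notin> bblue (level k)" "bsrc (level k) x = w" using ex by blast
  have v: "brng (level k) x \<in> dvert H k" using level_rng[OF x(1)] by (simp add: H_vert)
  then have "x \<in> R_at H (brng (level k) x)" using red_at_H[OF v, of x] x by simp
  moreover have "w = dsrc H x" using H_src[OF x(1)] x(3) by simp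
  ultimately show "w \<in> (\<Union>v\<in>dvert H k. dsrc H ` R_at H v)" using v by blast
next
  fix w assume "w \<in> (\<Union>v\<in>dvert H k. dsrc H ` R_at H v)"
  then obtain v x where "v \<in> dvert H k" "x \<in> R_at H v" "w = dsrc H x" by blast
  then show "w \<in> dvert H (Suc k)"
    using red_at_H[of v k] level_src[of x k] H_src[of x k] by (simp add: H_vert vert0_Suc)
qed

lemma H_cond_c: "l_cond_c H"
  unfolding l_cond_c_def
proof (intro allI conjI ballI)
  fix j
  let ?k = "Suc (2*j)"
  have inj: "x = y" if "x \<in> bedge (level ?k)" "x \<notin> bblue (level ?k)" "y \<in> bedge (level ?k)" "y \<notin> bblue (level ?k)"
    "dsrc H x = dsrc H y" for x y using unique_red[of x j y] that H_src[of x ?k] H_src[of y ?k] by simp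
  show "disjoint_family_on (\<lambda>v. dsrc H ` B_at H v) (dvert H (2*j+1))"
    "dvert H (2*j+2) = (\<Union>v\<in>dvert H (2*j+1). dsrc H ` B_at H v)"
    using blue_sources_cover(1,2)[where k = ?k] by simp_all
  show "disjoint_family_on (\<lambda>v. dsrc H ` R_at H v) (dvert H (2*j+1))"
    unfolding disjoint_family_on_def
  proof (intro ballI impI, rule ccontr)
    fix u v assume uv: "u \<in> dvert H (2*j+1)" "v \<in> dvert H (2*j+1)" "u \<noteq> v" "dsrc H ` R_at H u \<inter> dsrc H ` R_at H v \<noteq> {}"
    then obtain x y where "x \<in> R_at H u" "y \<in> R_at H v" "dsrc H x = dsrc H y" by blast
    then show False using inj[of x y] red_at_H[of u ?k] red_at_H[of v ?k] uv by auto
  qed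
  have "\<exists>x\<in>bedge (level ?k). x \<notin> bblue (level ?k) \<and> bsrc (level ?k) x = w" if "w \<in> bvert1 (level ?k)" for w
    using conjunct2[OF level_shape[of j]] that unfolding odd_shape_def unique_red_source_def by blast
  then show "dvert H (2*j+2) = (\<Union>v\<in>dvert H (2*j+1). dsrc H ` R_at H v)"
    using red_sources_cover[of ?k] by simp
  fix v assume v: "v \<in> dvert H (2*j+1)"
  then show "inj_on (dsrc H) (B_at H v)" using blue_sources_cover(3)[of v ?k] by simp
  show "inj_on (dsrc H) (R_at H v)"
    using inj red_at_H[of v ?k] v by (intro inj_onI) simp
qed

lemma H_cond_d: "l_cond_d H"
  unfolding l_cond_d_def
proof (intro conjI allI)
  show "disjoint_family_on (\<lambda>v. dsrc H ` B_at H v) (dvert H 0)"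
    "dvert H 1 = (\<Union>v\<in>dvert H 0. dsrc H ` B_at H v)" using blue_sources_cover(1,2)[where k = 0] by simp_all
  show "dvert H 1 = (\<Union>v\<in>dvert H 0. dsrc H ` R_at H v)"
    using red_sources_cover[of 0] shape0 by (simp add: even_shape_def)
  show "inj_on (dsrc H) (dedge H (2*j) \<inter> dblue H)" for j
  proof (rule inj_onI)
    fix x y assume xy: "x \<in> dedge H (2*j) \<inter> dblue H" "y \<in> dedge H (2*j) \<inter> dblue H" "dsrc H x = dsrc H y"
    then show "x = y"
      using unique_blue[of x "2*j" y] H_blue[of x "2*j"] H_blue[of y "2*j"] H_src[of x "2*j"] H_src[of y "2*j"] by (simp add: H_edge)
  qed
qed

lemma even_family:
  assumes "family (level (2*j)) S" "x |\<in>| S"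
  shows "\<exists>!y. y \<in> blue_at (level (2*j)) (brng (level (2*j)) x) \<and> y |\<in>| S"
    "\<exists>!y. y \<in> red_at (level (2*j)) (brng (level (2*j)) x) \<and> y |\<in>| S"
proof -
  note f = family_at[OF assms]
  have "bsep (level (2*j)) (brng (level (2*j)) x) =
      {blue_at (level (2*j)) (brng (level (2*j)) x), red_at (level (2*j)) (brng (level (2*j)) x)}"
    using conjunct1[OF level_shape[of j]] f(2) unfolding even_shape_def by blast
  then show "\<exists>!y. y \<in> blue_at (level (2*j)) (brng (level (2*j)) x) \<and> y |\<in>| S"
    "\<exists>!y. y \<in> red_at (level (2*j)) (brng (level (2*j)) x) \<and> y |\<in>| S" using f(4) by simp_all
qed

text \<open>Both unions consist of the vertices \<open>Fam S\<close> for the families \<open>S\<close> at \<open>v\<close>, as each family has one blue and one red member.\<close>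

lemma H_cond_e: "l_cond_e H"
  unfolding l_cond_e_def
proof (intro allI ballI conjI)
  fix j v assume v: "v \<in> dvert H (2*j)"
  let ?G = "level (2*j)"
  have B: "dsrc H ` B_at H (dsrc H e) = Fam ` {S. family ?G S \<and> e |\<in>| S}" if "e \<in> B_at H v" for e
    using that blue_at_H[OF v] blue_after[of e "2*j"] src_block_image[of e "2*j"] by simp
  have R: "dsrc H ` dR H f = Fam ` {S. family ?G S \<and> f |\<in>| S}" if "f \<in> R_at H v" for f
    using that red_at_H[OF v] H_R[of f "2*j"] src_block_image[of f "2*j"] by simp
  have vG: "v \<in> bvert0 ?G" using v by (simp add: H_vert)
  have sub: "Fam ` {S. family ?G S \<and> x |\<in>| S} \<inter> Fam ` {S. family ?G S \<and> y |\<in>| S} = {}"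
    if "x \<noteq> y" "(x \<in> B_at H v \<and> y \<in> B_at H v) \<or> (x \<in> R_at H v \<and> y \<in> R_at H v)" for x y
  proof (rule ccontr)
    assume "\<not> ?thesis"
    then obtain S where S: "family ?G S" "x |\<in>| S" "y |\<in>| S" by auto
    have "brng ?G x = v" using that(2) blue_at_H[OF v] red_at_H[OF v] by auto
    then have "\<exists>!y. y \<in> B_at H v \<and> y |\<in>| S" "\<exists>!y. y \<in> R_at H v \<and> y |\<in>| S"
      using even_family[OF S(1,2)] H_B[OF vG] H_Rat[OF vG] by simp_all
    then show False using that S(2,3) by blast
  qed
  show "disjoint_family_on (\<lambda>e. dsrc H ` B_at H (dsrc H e)) (B_at H v)"
    unfolding disjoint_family_on_def
  proof (intro ballI impI)
    fix x y assume "x \<in> B_at H v" "y \<in> B_at H v" "x \<noteq> y"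
    then show "dsrc H ` B_at H (dsrc H x) \<inter> dsrc H ` B_at H (dsrc H y) = {}" using sub[of x y] by (simp add: B)
  qed
  show "disjoint_family_on (\<lambda>f. dsrc H ` dR H f) (R_at H v)"
    unfolding disjoint_family_on_def
  proof (intro ballI impI)
    fix x y assume "x \<in> R_at H v" "y \<in> R_at H v" "x \<noteq> y"
    then show "dsrc H ` dR H x \<inter> dsrc H ` dR H y = {}" using sub[of x y] by (simp add: R)
  qed
  have "(\<Union>e\<in>B_at H v. Fam ` {S. family ?G S \<and> e |\<in>| S}) = (\<Union>f\<in>R_at H v. Fam ` {S. family ?G S \<and> f |\<in>| S})"
  proof (intro equalityI subsetI)
    fix w assume "w \<in> (\<Union>e\<in>B_at H v. Fam ` {S. family ?G S \<and> e |\<in>| S})"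
    then obtain e S where e: "e \<in> B_at H v" "family ?G S" "e |\<in>| S" "w = Fam S" by blast
    then have "brng ?G e = v" using blue_at_H[OF v] by auto
    then obtain f where "f \<in> R_at H v" "f |\<in>| S" using even_family(2)[OF e(2,3)] H_Rat[OF vG] by auto
    then show "w \<in> (\<Union>f\<in>R_at H v. Fam ` {S. family ?G S \<and> f |\<in>| S})" using e by blast
  next
    fix w assume "w \<in> (\<Union>f\<in>R_at H v. Fam ` {S. family ?G S \<and> f |\<in>| S})"
    then obtain e S where e: "e \<in> R_at H v" "family ?G S" "e |\<in>| S" "w = Fam S" by blast
    then have "brng ?G e = v" using red_at_H[OF v] by auto
    then obtain f where "f \<in> B_at H v" "f |\<in>| S" using even_family(1)[OF e(2,3)] H_B[OF vG] by auto
    then show "w \<in> (\<Union>e\<in>B_at H v. Fam ` {S. family ?G S \<and> e |\<in>| S})" using e by blast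
  qed
  then show "(\<Union>e\<in>B_at H v. dsrc H ` B_at H (dsrc H e)) = (\<Union>f\<in>R_at H v. dsrc H ` dR H f)"
    using B R by simp
qed

text \<open>A pair of edges ending at an odd vertex is a family \<open>S\<close> at that vertex together with a member of \<open>S\<close>: the member is the
  first edge, and the source of the second edge is \<open>Fam S\<close>. Conditions (f) and (g) therefore say that a family has
  exactly one member in the block of blue edges and in the block \<open>R(g)\<close>.\<close>

lemma H_cond_f: "l_cond_f H"
  unfolding l_cond_f_def
proof (intro allI ballI)
  fix j v f0 f1 assume v: "v \<in> dvert H (2*j+1)" and f0: "f0 \<in> R_at H v" and f1: "f1 \<in> R_at H (dsrc H f0)"
  let ?G = "level (Suc (2*j))"
  have v': "v \<in> dvert H (Suc (2*j))" and vG: "v \<in> bvert0 ?G" using v by (simp_all add: H_vert)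
  note f0' = red_at_H[OF v', THEN iffD1, OF f0]
  have "f1 \<in> block ?G f0" using f1 red_after[of f0 j] f0' by simp
  then obtain S where S: "family ?G S" "f0 |\<in>| S" "dsrc H f1 = Fam S" using src_block f0' by blast
  have "blue_at ?G v \<in> bsep ?G v" using conjunct2[OF level_shape[of j]] vG unfolding odd_shape_def by blast
  then have "\<exists>!y. y \<in> blue_at ?G v \<and> y |\<in>| S" using family_at(4)[OF S(1,2)] f0' by simp
  then obtain e0 where e0: "e0 \<in> B_at H v" "e0 |\<in>| S" and un: "\<And>y. y \<in> B_at H v \<Longrightarrow> y |\<in>| S \<Longrightarrow> y = e0"
    using H_B[OF vG] by auto
  note e0' = blue_at_H[OF v', THEN iffD1, OF e0(1)]
  have a: "Alpha e0 S \<in> block ?G e0" using S(1) e0(2) by (auto simp: block_iff)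
  show "\<exists>!(e0, e1). e0 \<in> B_at H v \<and> e1 \<in> B_at H (dsrc H e0) \<and> dsrc H e1 = dsrc H f1"
  proof (rule ex1I[of _ "(e0, Alpha e0 S)"])
    have "dsrc H (Alpha e0 S) = Fam S" using src_block[OF a] e0' by auto
    then show "case (e0, Alpha e0 S) of (e0, e1) \<Rightarrow> e0 \<in> B_at H v \<and> e1 \<in> B_at H (dsrc H e0) \<and> dsrc H e1 = dsrc H f1"
      using e0 a e0' blue_after[of e0 "Suc (2*j)"] S(3) by simp
    fix p assume p: "case p of (e0, e1) \<Rightarrow> e0 \<in> B_at H v \<and> e1 \<in> B_at H (dsrc H e0) \<and> dsrc H e1 = dsrc H f1"
    obtain d0 d1 where pd: "p = (d0, d1)" by (cases p)
    have d: "d0 \<in> B_at H v" "d1 \<in> B_at H (dsrc H d0)" "dsrc H d1 = Fam S" using p pd S(3) by auto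
    note d0 = blue_at_H[OF v', THEN iffD1, OF d(1)]
    have "d1 \<in> block ?G d0" using d(2) blue_after[of d0 "Suc (2*j)"] d0 by simp
    then obtain T where "d1 = Alpha d0 T" "d0 |\<in>| T" "dsrc H d1 = Fam T" using src_block d0 by blast
    then show "p = (e0, Alpha e0 S)" using d un[of d0] pd by simp
  qed
qed

lemma H_cond_g: "l_cond_g H"
  unfolding l_cond_g_def
proof (intro allI ballI impI)
  fix j v g e0 e1 assume v: "v \<in> dvert H (2*j+1)" and g: "g \<in> dedge H (2*j) - dblue H" "dsrc H g = v"
    and e0: "e0 \<in> B_at H v" and e1: "e1 \<in> B_at H (dsrc H e0)"
  let ?G = "level (Suc (2*j))"
  have v': "v \<in> dvert H (Suc (2*j))" and vG: "v \<in> bvert0 ?G" using v by (simp_all add: H_vert)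
  note e0' = blue_at_H[OF v', THEN iffD1, OF e0]
  have "e1 \<in> block ?G e0" using e1 blue_after[of e0 "Suc (2*j)"] e0' by simp
  then obtain S where S: "family ?G S" "e0 |\<in>| S" "dsrc H e1 = Fam S" using src_block e0' by blast
  have g': "g \<in> bedge (level (2*j))" "g \<notin> bblue (level (2*j))" "bsrc (level (2*j)) g = v"
    using g H_blue[of g "2*j"] H_src[of g "2*j"] by (auto simp: H_edge)
  have dRg: "dR H g = block (level (2*j)) g" by (rule H_R[OF g'(1)])
  have "dR H g \<in> bsep ?G v" unfolding dRg level_Suc using g' by simp
  then have "\<exists>!y. y \<in> dR H g \<and> y |\<in>| S" using family_at(4)[OF S(1,2)] e0' by simp
  then obtain f0 where f0: "f0 \<in> dR H g" "f0 |\<in>| S" and un: "\<And>y. y \<in> dR H g \<Longrightarrow> y |\<in>| S \<Longrightarrow> y = f0" by auto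
  have f0R: "f0 \<in> R_at H v"
    using f0(1) g' unfolding dRg H_Rat[OF vG] level_Suc red_at_resolve by blast
  note f0' = red_at_H[OF v', THEN iffD1, OF f0R]
  have a: "Alpha f0 S \<in> block ?G f0" using S(1) f0(2) by (auto simp: block_iff)
  show "\<exists>!(f0, f1). f0 \<in> dR H g \<and> f0 \<in> R_at H v \<and> f1 \<in> R_at H (dsrc H f0) \<and> dsrc H f1 = dsrc H e1"
  proof (rule ex1I[of _ "(f0, Alpha f0 S)"])
    have "dsrc H (Alpha f0 S) = Fam S" using src_block[OF a] f0' by auto
    then show "case (f0, Alpha f0 S) of (f0, f1) \<Rightarrow> f0 \<in> dR H g \<and> f0 \<in> R_at H v \<and> f1 \<in> R_at H (dsrc H f0) \<and> dsrc H f1 = dsrc H e1"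
      using f0 f0R a f0' red_after[of f0 j] S(3) by simp
    fix p assume p: "case p of (f0, f1) \<Rightarrow> f0 \<in> dR H g \<and> f0 \<in> R_at H v \<and> f1 \<in> R_at H (dsrc H f0) \<and> dsrc H f1 = dsrc H e1"
    obtain d0 d1 where pd: "p = (d0, d1)" by (cases p)
    have d: "d0 \<in> dR H g" "d0 \<in> R_at H v" "d1 \<in> R_at H (dsrc H d0)" "dsrc H d1 = Fam S" using p pd S(3) by auto
    note d0 = red_at_H[OF v', THEN iffD1, OF d(2)]
    have "d1 \<in> block ?G d0" using d(3) red_after[of d0 j] d0 by simp
    then obtain T where "d1 = Alpha d0 T" "d0 |\<in>| T" "dsrc H d1 = Fam T" using src_block d0 by blast
    then show "p = (f0, Alpha f0 S)" using d un[of d0] pd by simp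
  qed
qed

theorem resolution_l_diagram: "l_diagram H"
  unfolding l_diagram_def
  using H_bratteli H_cond_a H_cond_b H_cond_c H_cond_d H_cond_e H_cond_f H_cond_g by blast

end

section \<open>The universal property of generalized finite shifts\<close>

sublocale resolvable \<subseteq> R: l_diag "resolution G0"
  by unfold_locales (rule resolution_l_diagram)

text \<open>A system marked by the edges of a graph: \<open>\<beta>\<close> and \<open>\<tau>\<close> send a point to the blue edge \<open>e\<close> with \<open>y \<in> Z_e\<close> and to
  the red edge \<open>f\<close> with \<open>y \<in> W_f\<close>. The last condition is the bijectivity of \<open>\<rho> : W_f \<rightarrow> Z_e\<close>.\<close>

locale marked_system = resolvable G0 for G0 :: "('v, 'e) res_graph" +
  fixes Y :: "'y set" and \<rho> :: "'y \<Rightarrow> 'y" and \<beta> \<tau> :: "'y \<Rightarrow> 'e redge"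
  assumes closed: "y \<in> Y \<Longrightarrow> \<rho> y \<in> Y"
    and blue_mark: "y \<in> Y \<Longrightarrow> \<beta> y \<in> bedge G0 \<and> \<beta> y \<in> bblue G0"
    and red_mark: "y \<in> Y \<Longrightarrow> \<tau> y \<in> bedge G0 \<and> \<tau> y \<notin> bblue G0"
    and same_range: "y \<in> Y \<Longrightarrow> brng G0 (\<beta> y) = brng G0 (\<tau> y)"
    and shift_source: "y \<in> Y \<Longrightarrow> bsrc G0 (\<tau> y) = bsrc G0 (\<beta> (\<rho> y))"
    and branch: "\<lbrakk>y \<in> Y; g \<in> bedge G0; g \<notin> bblue G0; bsrc G0 g = bsrc G0 (\<beta> y)\<rbrakk> \<Longrightarrow>
      \<exists>!y'. y' \<in> Y \<and> \<rho> y' = y \<and> \<tau> y' = g"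
begin

definition preimages :: "'y \<Rightarrow> 'y set" where
  "preimages y = {y' \<in> Y. \<rho> y' = y}"

lemma finite_preimages: assumes "y \<in> Y" shows "finite (preimages y)"
proof (rule finite_imageD)
  show "finite (\<tau> ` preimages y)"
    by (rule finite_subset[of _ "bedge G0"])
       (use red_mark well_formedD(6)[OF level_well_formed[of 0]] in \<open>auto simp: preimages_def\<close>)
  show "inj_on \<tau> (preimages y)"
  proof (rule inj_onI)
    fix a b assume ab: "a \<in> preimages y" "b \<in> preimages y" "\<tau> a = \<tau> b"
    then have "a \<in> Y" "\<rho> a = y" "b \<in> Y" "\<rho> b = y" by (auto simp: preimages_def)
    moreover from this have "\<exists>!y'. y' \<in> Y \<and> \<rho> y' = y \<and> \<tau> y' = \<tau> a"
      using branch[OF assms, of "\<tau> a"] red_mark[of a] shift_source[of a] by simp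
    ultimately show "a = b" using ab(3) by auto
  qed
qed

text \<open>The marks on all layers of the resolution. On an odd layer the family at \<open>y\<close> collects the blue mark of \<open>y\<close>
  and the red marks of all its preimages: one edge for each edge of the previous layer that has the same source.\<close>

definition family_of :: "bool \<Rightarrow> ('y \<Rightarrow> 'e redge \<times> 'e redge) \<Rightarrow> 'y \<Rightarrow> 'e redge fset" where
  "family_of b L y = (if b then {|fst (L y), snd (L y)|} else Abs_fset (insert (fst (L y)) ((\<lambda>y'. snd (L y')) ` preimages y)))"

primrec marks :: "nat \<Rightarrow> 'y \<Rightarrow> 'e redge \<times> 'e redge" where
  "marks 0 = (\<lambda>y. (\<beta> y, \<tau> y))"
| "marks (Suc k) = (\<lambda>y. (Alpha (fst (marks k y)) (family_of (even k) (marks k) y),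
     Alpha (snd (marks k y)) (family_of (even k) (marks k) (if even k then y else \<rho> y))))"

abbreviation "blue k y \<equiv> fst (marks k y)"
abbreviation "red k y \<equiv> snd (marks k y)"
abbreviation "fam k y \<equiv> family_of (even k) (marks k) y"

lemma fset_fam_odd: "y \<in> Y \<Longrightarrow> odd k \<Longrightarrow> fset (fam k y) = insert (blue k y) (red k ` preimages y)"
  using finite_preimages by (simp add: family_of_def Abs_fset_inverse)

definition consistent :: "nat \<Rightarrow> bool" where
  "consistent k \<longleftrightarrow> (\<forall>y\<in>Y. blue k y \<in> bedge (level k) \<and> blue k y \<in> bblue (level k) \<and>
     red k y \<in> bedge (level k) \<and> red k y \<notin> bblue (level k) \<and>
     brng (level k) (blue k y) = brng (level k) (red k y) \<and>
     bsrc (level k) (red k y) = bsrc (level k) (blue k (\<rho> y)) \<and>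
     (\<forall>g\<in>bedge (level k). g \<notin> bblue (level k) \<longrightarrow> bsrc (level k) g = bsrc (level k) (blue k y) \<longrightarrow>
       (\<exists>!y'. y' \<in> Y \<and> \<rho> y' = y \<and> red k y' = g)))"

lemma consistentD:
  assumes "consistent k" "y \<in> Y"
  shows "blue k y \<in> bedge (level k)" "blue k y \<in> bblue (level k)" "red k y \<in> bedge (level k)" "red k y \<notin> bblue (level k)"
    "brng (level k) (blue k y) = brng (level k) (red k y)"
    "bsrc (level k) (red k y) = bsrc (level k) (blue k (\<rho> y))"
    "\<And>g. \<lbrakk>g \<in> bedge (level k); g \<notin> bblue (level k); bsrc (level k) g = bsrc (level k) (blue k y)\<rbrakk> \<Longrightarrow>
       \<exists>!y'. y' \<in> Y \<and> \<rho> y' = y \<and> red k y' = g"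
  using assms unfolding consistent_def by simp_all

text \<open>On an even layer there are two blocks at each vertex, one for each colour, and the two marks of \<open>y\<close> meet one each.\<close>

lemma family_even:
  assumes c: "consistent (2*i)" and y: "y \<in> Y"
  shows "family (level (2*i)) (fam (2*i) y)" "blue (2*i) y |\<in>| fam (2*i) y" "red (2*i) y |\<in>| fam (2*i) y"
proof -
  let ?G = "level (2*i)" and ?u = "brng (level (2*i)) (blue (2*i) y)"
  note d = consistentD[OF c y]
  have sep: "bsep ?G ?u = {blue_at ?G ?u, red_at ?G ?u}"
    using conjunct1[OF level_shape[of i]] level_rng[OF d(1)] unfolding even_shape_def by blast
  have "\<exists>!x. x \<in> blue_at ?G ?u \<and> x |\<in>| fam (2*i) y"
    by (rule ex1I[of _ "blue (2*i) y"]) (use d in \<open>auto simp: family_of_def blue_at_def\<close>)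
  moreover have "\<exists>!x. x \<in> red_at ?G ?u \<and> x |\<in>| fam (2*i) y"
    by (rule ex1I[of _ "red (2*i) y"]) (use d in \<open>auto simp: family_of_def red_at_def\<close>)
  ultimately show "family ?G (fam (2*i) y)"
    unfolding family_def using level_rng[OF d(1)] d(1,3,5) sep by (intro bexI[of _ ?u]) (auto simp: family_of_def)
  show "blue (2*i) y |\<in>| fam (2*i) y" "red (2*i) y |\<in>| fam (2*i) y" by (simp_all add: family_of_def)
qed

lemma odd_marks:
  assumes c: "consistent (2*i)" and y: "y \<in> Y"
  shows "blue (Suc (2*i)) y = Alpha (blue (2*i) y) (fam (2*i) y)" "red (Suc (2*i)) y = Alpha (red (2*i) y) (fam (2*i) y)"
    "blue (Suc (2*i)) y \<in> bedge (level (Suc (2*i)))" "blue (Suc (2*i)) y \<in> bblue (level (Suc (2*i)))"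
    "red (Suc (2*i)) y \<in> bedge (level (Suc (2*i)))" "red (Suc (2*i)) y \<notin> bblue (level (Suc (2*i)))"
proof -
  show e: "blue (Suc (2*i)) y = Alpha (blue (2*i) y) (fam (2*i) y)" "red (Suc (2*i)) y = Alpha (red (2*i) y) (fam (2*i) y)"
    by simp_all
  note f = family_even[OF c y]
  show "blue (Suc (2*i)) y \<in> bedge (level (Suc (2*i)))" "red (Suc (2*i)) y \<in> bedge (level (Suc (2*i)))"
    unfolding e level_Suc resolve_edge_iff using f by blast+
  show "blue (Suc (2*i)) y \<in> bblue (level (Suc (2*i)))" "red (Suc (2*i)) y \<notin> bblue (level (Suc (2*i)))"
    unfolding e level_Suc resolve_edge_iff(2) using f consistentD(2,4)[OF c y] by simp_all
qed

text \<open>The blocks at a vertex of odd level are indexed by the edges \<open>g\<close> of the previous layer with that source. The blue mark of \<open>y\<close> meets the block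
  of the blue \<open>g\<close>; the block of a red \<open>g\<close> is met by the mark of the one preimage of \<open>y\<close> with red mark \<open>g\<close>.\<close>

lemma family_odd:
  assumes c: "consistent (2*i)" and y: "y \<in> Y"
  shows "family (level (Suc (2*i))) (fam (Suc (2*i)) y)"
proof -
  let ?G = "level (2*i)" and ?k = "Suc (2*i)"
  let ?u = "bsrc ?G (blue (2*i) y)"
  note d = consistentD[OF c y] and o = odd_marks[OF c]
  have u: "?u \<in> bvert0 (level ?k)" using level_src[OF d(1)] by (simp add: vert0_Suc)
  have mem: "x |\<in>| fam ?k y \<longleftrightarrow> x = blue ?k y \<or> (\<exists>y'\<in>preimages y. x = red ?k y')" for x
    using fset_fam_odd[OF y, of ?k] by auto
  have pre: "y' \<in> Y" "bsrc ?G (red (2*i) y') = ?u" if "y' \<in> preimages y" for y'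
    using that consistentD(6)[OF c, of y'] by (auto simp: preimages_def)
  have sub: "fset (fam ?k y) \<subseteq> {x \<in> bedge (level ?k). brng (level ?k) x = ?u}"
  proof
    fix x assume "x \<in> fset (fam ?k y)"
    then consider "x = blue ?k y" | y' where "y' \<in> preimages y" "x = red ?k y'" using mem by blast
    then show "x \<in> {x \<in> bedge (level ?k). brng (level ?k) x = ?u}"
    proof cases
      case 1
      then show ?thesis using o(1,3)[OF y] by (simp add: level_Suc del: resolve_simps(3))
    next
      case (2 y')
      then show ?thesis using o(2,5)[OF pre(1)[OF 2(1)]] pre(2)[OF 2(1)] by (simp add: level_Suc del: resolve_simps(3))
    qed
  qed
  have "\<exists>!x. x \<in> X \<and> x |\<in>| fam ?k y" if X: "X \<in> bsep (level ?k) ?u" for X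
  proof -
    obtain g where g: "X = block ?G g" "g \<in> bedge ?G" "bsrc ?G g = ?u" using X by (auto simp: level_Suc)
    have inX: "Alpha a S \<in> X \<longleftrightarrow> a = g \<and> family ?G S \<and> a |\<in>| S" for a S using g(1) by (auto simp: block_iff)
    show ?thesis
    proof (cases "g \<in> bblue ?G")
      case True
      then have gy: "g = blue (2*i) y" using unique_blue[OF g(2) True d(1,2)] g(3) by simp
      show ?thesis
      proof (rule ex1I[of _ "blue ?k y"])
        show "blue ?k y \<in> X \<and> blue ?k y |\<in>| fam ?k y" unfolding mem o(1)[OF y] inX using gy family_even[OF c y] by simp
        fix x assume x: "x \<in> X \<and> x |\<in>| fam ?k y"
        have "x \<noteq> red ?k y'" if "y' \<in> preimages y" for y'
          using x True consistentD(4)[OF c pre(1)[OF that]] unfolding o(2)[OF pre(1)[OF that]] by (auto simp: inX)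
        then show "x = blue ?k y" using x mem by blast
      qed
    next
      case False
      obtain y' where y': "y' \<in> Y" "\<rho> y' = y" "red (2*i) y' = g"
        and un: "\<And>z. z \<in> Y \<Longrightarrow> \<rho> z = y \<Longrightarrow> red (2*i) z = g \<Longrightarrow> z = y'"
        using d(7)[OF g(2) False g(3)] by blast
      have py: "y' \<in> preimages y" using y' by (simp add: preimages_def)
      show ?thesis
      proof (rule ex1I[of _ "red ?k y'"])
        have "red ?k y' \<in> X" unfolding o(2)[OF y'(1)] inX using y'(3) family_even[OF c y'(1)] by simp
        then show "red ?k y' \<in> X \<and> red ?k y' |\<in>| fam ?k y" using mem py by blast
        fix x assume x: "x \<in> X \<and> x |\<in>| fam ?k y"
        have "x \<noteq> blue ?k y" using x False d(2) unfolding o(1)[OF y] by (auto simp: inX)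
        then obtain z where z: "z \<in> preimages y" "x = red ?k z" using x mem by blast
        then have "red (2*i) z = g" using x unfolding o(2)[OF pre(1)[OF z(1)]] by (simp add: inX)
        then have "z = y'" using un z(1) by (simp add: preimages_def)
        then show "x = red ?k y'" using z(2) by simp
      qed
    qed
  qed
  then show ?thesis unfolding family_def by (intro bexI[OF _ u] conjI ballI sub)
qed

lemma consistent_step:
  assumes c: "consistent (2*i)" shows "consistent (Suc (Suc (2*i)))"
proof -
  let ?k = "Suc (2*i)" and ?G = "level (2*i)"
  note o = odd_marks[OF c]
  have mem: "x |\<in>| fam ?k y \<longleftrightarrow> x = blue ?k y \<or> (\<exists>y'\<in>preimages y. x = red ?k y')" if "y \<in> Y" for x y
    using fset_fam_odd[OF that, of ?k] by auto
  have e: "blue (Suc ?k) y = Alpha (blue ?k y) (fam ?k y)" "red (Suc ?k) y = Alpha (red ?k y) (fam ?k (\<rho> y))" for y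
    unfolding marks.simps(2)[of ?k] by simp_all
  have mb: "blue ?k y |\<in>| fam ?k y" if "y \<in> Y" for y using mem[OF that] by blast
  have mr: "red ?k y |\<in>| fam ?k (\<rho> y)" if "y \<in> Y" for y
    using mem[OF closed[OF that]] that by (auto simp: preimages_def)
  show ?thesis
    unfolding consistent_def
  proof (intro ballI conjI impI)
    fix y assume y: "y \<in> Y"
    note f = family_odd[OF c y] family_odd[OF c closed[OF y]]
    show "blue (Suc ?k) y \<in> bedge (level (Suc ?k))" "red (Suc ?k) y \<in> bedge (level (Suc ?k))"
      unfolding e level_Suc[of ?k] resolve_edge_iff using f mb[OF y] mr[OF y] by blast+
    show "blue (Suc ?k) y \<in> bblue (level (Suc ?k))" "red (Suc ?k) y \<notin> bblue (level (Suc ?k))"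
      unfolding e level_Suc[of ?k] resolve_edge_iff(2) using f mb[OF y] mr[OF y] o[OF y] by simp_all
    show "brng (level (Suc ?k)) (blue (Suc ?k) y) = brng (level (Suc ?k)) (red (Suc ?k) y)"
      unfolding e level_Suc[of ?k] resolve_simps o(1,2)[OF y] by (simp add: level_Suc)
    show "bsrc (level (Suc ?k)) (red (Suc ?k) y) = bsrc (level (Suc ?k)) (blue (Suc ?k) (\<rho> y))"
      unfolding e level_Suc[of ?k] resolve_simps ..
    fix g assume g: "g \<in> bedge (level (Suc ?k))" "g \<notin> bblue (level (Suc ?k))"
      "bsrc (level (Suc ?k)) g = bsrc (level (Suc ?k)) (blue (Suc ?k) y)"
    obtain x S where x: "g = Alpha x S" "family (level ?k) S" "x |\<in>| S"
      using g(1) unfolding level_Suc[of ?k] resolve_edge_iff(1) by blast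
    have S: "S = fam ?k y" using g(3) unfolding x(1) e level_Suc[of ?k] resolve_simps by simp
    have "x \<notin> bblue (level ?k)" using g(2) x unfolding level_Suc[of ?k] x(1) resolve_edge_iff(2) by simp
    then have "x \<noteq> blue ?k y" using o(4)[OF y] by auto
    then obtain y' where y': "y' \<in> preimages y" "x = red ?k y'" using x(3) S mem[OF y] by blast
    then have y'Y: "y' \<in> Y" "\<rho> y' = y" by (auto simp: preimages_def)
    show "\<exists>!y'. y' \<in> Y \<and> \<rho> y' = y \<and> red (Suc ?k) y' = g"
    proof (rule ex1I[of _ y'])
      show "y' \<in> Y \<and> \<rho> y' = y \<and> red (Suc ?k) y' = g" unfolding e x(1) using y'Y y'(2) S by simp
      fix z assume z: "z \<in> Y \<and> \<rho> z = y \<and> red (Suc ?k) z = g"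
      then have "red ?k z = red ?k y'" using x(1) y'(2) unfolding e by simp
      then have "red (2*i) z = red (2*i) y'" using z y'Y o(2) by simp
      moreover have "bsrc ?G (red (2*i) y') = bsrc ?G (blue (2*i) y)" using consistentD(6)[OF c y'Y(1)] y'Y(2) by simp
      ultimately show "z = y'"
        using consistentD(7)[OF c y consistentD(3,4)[OF c y'Y(1)]] z y'Y by blast
    qed
  qed
qed

lemma consistent_even: "consistent (2*i)"
proof (induction i)
  case 0
  show ?case
    unfolding consistent_def using blue_mark red_mark same_range shift_source branch by simp
next
  case (Suc i)
  then show ?case using consistent_step[of i] by simp
qed

lemmas even_marks = consistentD[OF consistent_even]
lemmas odd_marks' = odd_marks[OF consistent_even]

lemma mark_levels:
  assumes "y \<in> Y"
  shows "blue k y \<in> bedge (level k)" "blue k y \<in> bblue (level k)" "red k y \<in> bedge (level k)" "red k y \<notin> bblue (level k)"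
proof -
  have "blue k y \<in> bedge (level k) \<and> blue k y \<in> bblue (level k) \<and> red k y \<in> bedge (level k) \<and> red k y \<notin> bblue (level k)"
  proof (cases "even k")
    case True
    then obtain i where "k = 2*i" by blast
    then show ?thesis using even_marks(1-4)[OF assms, of i] by blast
  next
    case False
    then obtain i where "k = Suc (2*i)" by (metis oddE Suc_eq_plus1)
    then show ?thesis using odd_marks'[OF assms, of i] by blast
  qed
  then show "blue k y \<in> bedge (level k)" "blue k y \<in> bblue (level k)" "red k y \<in> bedge (level k)" "red k y \<notin> bblue (level k)"
    by auto
qed

definition itinerary :: "'y \<Rightarrow> nat \<Rightarrow> 'e redge" where
  "itinerary y = (\<lambda>k. blue k y)"

lemma itinerary_path: assumes y: "y \<in> Y" shows "itinerary y \<in> paths H"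
  unfolding paths_def itinerary_def
proof (intro CollectI allI conjI)
  fix k
  note m = mark_levels[OF y]
  show "blue k y \<in> dedge H k" using m(1) by (simp add: H_edge)
  show "blue k y \<in> dblue H" using m(1,2) H_blue by blast
  have "brng (level (Suc k)) (blue (Suc k) y) = bsrc (level k) (blue k y)" by (simp add: level_Suc)
  then show "drng H (blue (Suc k) y) = dsrc H (blue k y)"
    unfolding H_rng[OF m(1)] H_src[OF m(1)] .
qed

lemma red_seq_itinerary: assumes y: "y \<in> Y" shows "red_seq H (itinerary y) (2*i) = red (2*i) y"
    "red_seq H (itinerary y) (Suc (2*i)) = red (Suc (2*i)) y"
proof -
  note m = mark_levels[OF y] and o = odd_marks'[OF y, of i] and f = family_even[OF consistent_even y, of i]
  have 1: "red (2*i) y \<in> dedge H (2*i)" "red (2*i) y \<notin> dblue H" using m(3,4)[of "2*i"] H_blue by (auto simp: H_edge)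
  have 2: "red (Suc (2*i)) y \<in> dR H (red (2*i) y)"
    unfolding H_R[OF m(3)] o(2) block_iff using f by blast
  have "bsrc (level (Suc (2*i))) (red (Suc (2*i)) y) = bsrc (level (Suc (2*i))) (blue (Suc (2*i)) y)"
    unfolding o(1,2) level_Suc by simp
  then have 3: "dsrc H (red (Suc (2*i)) y) = dsrc H (itinerary y (Suc (2*i)))"
    unfolding itinerary_def H_src[OF m(1)] H_src[OF m(3)] .
  show "red_seq H (itinerary y) (2*i) = red (2*i) y" "red_seq H (itinerary y) (Suc (2*i)) = red (Suc (2*i)) y"
    using R.red_seq_characterization[OF itinerary_path[OF y] 1 2 3] by simp_all
qed

lemma itinerary_shift: assumes y: "y \<in> Y" shows "path_shift H (itinerary y) = itinerary (\<rho> y)"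
proof (rule R.path_shift_eqI[OF itinerary_path[OF y] itinerary_path[OF closed[OF y]]])
  fix i
  show "dsrc H (itinerary (\<rho> y) (2*i)) = dsrc H (red_seq H (itinerary y) (2*i))"
    unfolding red_seq_itinerary[OF y] unfolding itinerary_def
    using even_marks(6)[OF y, of i] H_src[OF mark_levels(1)[OF closed[OF y]]] H_src[OF mark_levels(3)[OF y]] by simp
qed

lemma itinerary_0: "itinerary y 0 = \<beta> y" and red_seq_itinerary_0: "y \<in> Y \<Longrightarrow> red_seq H (itinerary y) 0 = \<tau> y"
  using red_seq_itinerary(1)[of y 0] by (simp_all add: itinerary_def)

text \<open>A preimage in the shift is determined by its first red edge, and the marking provides the preimage in \<open>Y\<close> with that red mark.\<close>

lemma itinerary_lift:
  assumes y: "y \<in> Y" and p: "p \<in> paths H" "path_shift H p = itinerary y"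
  shows "\<exists>!y'. y' \<in> Y \<and> \<rho> y' = y \<and> itinerary y' = p"
proof -
  let ?g = "red_seq H p 0"
  have g: "?g \<in> bedge G0" "?g \<notin> bblue G0"
    using R.red_seq_even(1,2)[OF p(1), of 0] H_blue[of ?g 0] by (auto simp: H_edge)
  have "dsrc H (itinerary y 0) = dsrc H ?g"
    using R.path_shift_characterization(2)[OF p(1), of 0] p(2) by simp
  then have "bsrc G0 ?g = bsrc G0 (\<beta> y)"
    using H_src[of ?g 0] H_src[of "\<beta> y" 0] g(1) blue_mark[OF y] by (simp add: itinerary_0)
  then obtain y' where y': "y' \<in> Y" "\<rho> y' = y" "\<tau> y' = ?g"
    and un: "\<And>z. z \<in> Y \<Longrightarrow> \<rho> z = y \<Longrightarrow> \<tau> z = ?g \<Longrightarrow> z = y'" using branch[OF y g] by blast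
  show ?thesis
  proof (rule ex1I[of _ y'])
    have "itinerary y' = p"
      using R.shift_inj[OF itinerary_path[OF y'(1)] p(1), of 0] itinerary_shift[OF y'(1)] p(2) y' red_seq_itinerary_0[OF y'(1)]
      by simp
    then show "y' \<in> Y \<and> \<rho> y' = y \<and> itinerary y' = p" using y' by simp
    fix z assume "z \<in> Y \<and> \<rho> z = y \<and> itinerary z = p"
    then show "z = y'" using un red_seq_itinerary_0[of z] by auto
  qed
qed

end

text \<open>Equivariant maps that preserve the marks of the first layer preserve the marks of all layers, because
  the preimages of a point and of its image correspond to each other through their red marks.\<close>

lemma marks_natural:
  assumes S: "marked_system G0 Y \<rho> \<beta> \<tau>" and T: "marked_system G0 Z \<kappa> \<beta>' \<tau>'"
    and maps: "\<And>y. y \<in> Y \<Longrightarrow> \<phi> y \<in> Z" and eq: "\<And>y. y \<in> Y \<Longrightarrow> \<phi> (\<rho> y) = \<kappa> (\<phi> y)"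
    and b: "\<And>y. y \<in> Y \<Longrightarrow> \<beta>' (\<phi> y) = \<beta> y" and t: "\<And>y. y \<in> Y \<Longrightarrow> \<tau>' (\<phi> y) = \<tau> y"
    and y: "y \<in> Y"
  shows "marked_system.marks Z \<kappa> \<beta>' \<tau>' k (\<phi> y) = marked_system.marks Y \<rho> \<beta> \<tau> k y"
proof -
  interpret S: marked_system G0 Y \<rho> \<beta> \<tau> by fact
  interpret T: marked_system G0 Z \<kappa> \<beta>' \<tau>' by fact
  have pre: "T.preimages (\<phi> y) = \<phi> ` S.preimages y" if y: "y \<in> Y" for y
  proof (intro equalityI subsetI)
    fix z assume "z \<in> T.preimages (\<phi> y)"
    then have z: "z \<in> Z" "\<kappa> z = \<phi> y" by (auto simp: T.preimages_def)
    have "bsrc G0 (\<tau>' z) = bsrc G0 (\<beta> y)" using T.shift_source[OF z(1)] z(2) b[OF y] by simp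
    then obtain y' where y': "y' \<in> Y" "\<rho> y' = y" "\<tau> y' = \<tau>' z" using S.branch[OF y] T.red_mark[OF z(1)] by metis
    have "bsrc G0 (\<tau>' z) = bsrc G0 (\<beta>' (\<phi> y))" using T.shift_source[OF z(1)] z(2) by simp
    from T.branch[OF maps[OF y] _ _ this] have "\<phi> y' = z"
      using T.red_mark[OF z(1)] z maps[OF y'(1)] eq[OF y'(1)] t[OF y'(1)] y'(2,3) by auto
    then show "z \<in> \<phi> ` S.preimages y" using y' by (auto simp: S.preimages_def)
  next
    fix z assume "z \<in> \<phi> ` S.preimages y"
    then show "z \<in> T.preimages (\<phi> y)" using maps eq by (auto simp: S.preimages_def T.preimages_def)
  qed
  have sub: "S.preimages y \<subseteq> Y" for y by (auto simp: S.preimages_def)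
  show ?thesis using y
  proof (induction k arbitrary: y)
    case 0
    then show ?case using b t by simp
  next
    case (Suc k)
    have fam: "T.family_of (even k) (T.marks k) (\<phi> y) = S.family_of (even k) (S.marks k) y" if y: "y \<in> Y" for y
    proof -
      have "(\<lambda>z. snd (T.marks k z)) ` T.preimages (\<phi> y) = (\<lambda>z. snd (S.marks k z)) ` S.preimages y"
        unfolding pre[OF y] image_image using Suc.IH subsetD[OF sub] by (intro image_cong) auto
      then show ?thesis using Suc.IH[OF y] by (simp add: S.family_of_def T.family_of_def)
    qed
    show ?case
      using Suc.IH[OF Suc.prems] fam[OF Suc.prems] fam[OF S.closed[OF Suc.prems]] eq[OF Suc.prems] by (cases "even k") simp_all
  qed
qed

context resolvable
begin

text \<open>With this marking the generalized finite shift can be compared with any other marked system.\<close>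

lemma self_marked: "marked_system G0 (paths H) (path_shift H) (\<lambda>x. x 0) (\<lambda>x. red_seq H x 0)"
proof (unfold_locales)
  fix x assume x: "x \<in> paths H"
  show "path_shift H x \<in> paths H" by (rule R.path_shift_characterization(1)[OF x])
  have b: "x 0 \<in> bedge G0" using R.path_edge(1)[OF x, of 0] by (simp add: H_edge)
  then show "x 0 \<in> bedge G0 \<and> x 0 \<in> bblue G0" using R.path_edge(2)[OF x, of 0] H_blue[of "x 0" 0] by simp
  have r: "red_seq H x 0 \<in> bedge G0" using R.red_seq_even(1)[OF x, of 0] by (simp add: H_edge)
  then show "red_seq H x 0 \<in> bedge G0 \<and> red_seq H x 0 \<notin> bblue G0"
    using R.red_seq_even(2)[OF x, of 0] H_blue[of "red_seq H x 0" 0] by simp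
  show "brng G0 (x 0) = brng G0 (red_seq H x 0)"
    using R.red_seq_even(3)[OF x, of 0] H_rng[of "x 0" 0] H_rng[of "red_seq H x 0" 0] b r by simp
  have "path_shift H x 0 \<in> bedge G0"
    using R.path_edge(1)[OF R.path_shift_characterization(1)[OF x], of 0] by (simp add: H_edge)
  then show "bsrc G0 (red_seq H x 0) = bsrc G0 (path_shift H x 0)"
    using R.path_shift_characterization(2)[OF x, of 0] H_src[of "path_shift H x 0" 0] H_src[of "red_seq H x 0" 0] r by simp
  fix g assume g: "g \<in> bedge G0" "g \<notin> bblue G0" "bsrc G0 g = bsrc G0 (x 0)"
  have "g \<in> dedge H (2*0)" "g \<notin> dblue H" "dsrc H g = dsrc H (x (2*0))"
    using g H_blue[of g 0] H_src[of g 0] H_src[of "x 0" 0] b by (simp_all add: H_edge)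
  from R.lift_path[OF x this] obtain x' where x': "x' \<in> paths H" "path_shift H x' = x" "red_seq H x' 0 = g" by auto
  show "\<exists>!x'. x' \<in> paths H \<and> path_shift H x' = x \<and> red_seq H x' 0 = g"
  proof (rule ex1I[of _ x'])
    show "x' \<in> paths H \<and> path_shift H x' = x \<and> red_seq H x' 0 = g" using x' by blast
    fix z assume "z \<in> paths H \<and> path_shift H z = x \<and> red_seq H z 0 = g"
    then show "z = x'" using R.shift_inj[of z x' 0] x' by simp
  qed
qed

lemma path_step:
  assumes x: "x \<in> paths H"
  obtains S where "x (Suc k) = Alpha (x k) S" "family (level k) S" "x k |\<in>| S" "dsrc H (x (Suc k)) = Fam S"
proof -
  have k: "x (Suc k) \<in> bedge (level (Suc k))" "x (Suc k) \<in> bblue (level (Suc k))"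
    using R.path_edge(1,2)[OF x, of "Suc k"] H_blue[of "x (Suc k)" "Suc k"] by (auto simp: H_edge)
  have b: "x k \<in> bedge (level k)" "x k \<in> bblue (level k)"
    using R.path_edge(1,2)[OF x, of k] H_blue[of "x k" k] by (auto simp: H_edge)
  obtain z S where z: "x (Suc k) = Alpha z S" "family (level k) S" "z |\<in>| S"
    using k(1) unfolding level_Suc resolve_edge_iff(1) by blast
  have "z \<in> bblue (level k)" using k(2) z unfolding level_Suc z(1) resolve_edge_iff(2) by simp
  moreover have "bsrc (level k) z = bsrc (level k) (x k)"
    using R.path_edge(3)[OF x, of k] H_rng[OF k(1)] H_src[OF b(1)] z(1) by (simp add: level_Suc)
  ultimately have "z = x k" using unique_blue[OF family_at(1)[OF z(2,3)] _ b] by simp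
  moreover have "dsrc H (x (Suc k)) = Fam S" using H_src[OF k(1)] z(1) by (simp add: level_Suc)
  ultimately show ?thesis using that z by blast
qed

lemma self_even_step:
  assumes x: "x \<in> paths H"
  shows "x (Suc (2*i)) = Alpha (x (2*i)) {|x (2*i), red_seq H x (2*i)|}"
    "red_seq H x (Suc (2*i)) = Alpha (red_seq H x (2*i)) {|x (2*i), red_seq H x (2*i)|}"
proof -
  let ?r = "red_seq H x (2*i)" and ?G = "level (2*i)"
  obtain S where S: "x (Suc (2*i)) = Alpha (x (2*i)) S" "family ?G S" "x (2*i) |\<in>| S" "dsrc H (x (Suc (2*i))) = Fam S"
    using path_step[OF x] .
  have r: "?r \<in> bedge ?G" "?r \<notin> bblue ?G"
    using R.red_seq_even(1,2)[OF x, of i] H_blue[of ?r "2*i"] by (auto simp: H_edge)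
  have b: "x (2*i) \<in> bblue ?G"
    using R.path_edge(1,2)[OF x, of "2*i"] H_blue[of "x (2*i)" "2*i"] by (auto simp: H_edge)
  have "red_seq H x (Suc (2*i)) \<in> block ?G ?r"
    using R.red_seq_odd(4)[OF x, of i] H_R[OF r(1)] by simp
  then obtain T where T: "red_seq H x (Suc (2*i)) = Alpha ?r T" "?r |\<in>| T" "dsrc H (red_seq H x (Suc (2*i))) = Fam T"
    using src_block[OF _ r(1)] by blast
  then have TS: "T = S" using R.red_seq_odd(3)[OF x, of i] S(4) by simp
  note un = even_family[OF S(2,3)]
  have "y = x (2*i) \<or> y = ?r" if y: "y |\<in>| S" for y
  proof (cases "y \<in> bblue ?G")
    case True
    then have "y \<in> blue_at ?G (brng ?G (x (2*i)))" "x (2*i) \<in> blue_at ?G (brng ?G (x (2*i)))"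
      using family_at(3)[OF S(2,3) y] family_at(1)[OF S(2,3)] b by (auto simp: blue_at_def)
    then show ?thesis using un(1) y S(3) by blast
  next
    case False
    then have "y \<in> red_at ?G (brng ?G (x (2*i)))" "?r \<in> red_at ?G (brng ?G (x (2*i)))"
      using family_at(3)[OF S(2,3) y] family_at(3)[OF S(2,3), of ?r] T(2) TS r by (auto simp: red_at_def)
    then show ?thesis using un(2) y T(2) TS by blast
  qed
  then have "S = {|x (2*i), ?r|}" using S(3) T(2) TS by (intro fset_eqI) auto
  then show "x (Suc (2*i)) = Alpha (x (2*i)) {|x (2*i), ?r|}" "red_seq H x (Suc (2*i)) = Alpha ?r {|x (2*i), ?r|}"
    using S(1) T(1) TS by simp_all
qed

lemma self_odd_red:
  assumes x: "x \<in> paths H" and S: "path_shift H x (Suc (Suc (2*i))) = Alpha (path_shift H x (Suc (2*i))) S"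
    "dsrc H (path_shift H x (Suc (Suc (2*i)))) = Fam S"
  shows "red_seq H x (Suc (Suc (2*i))) = Alpha (red_seq H x (Suc (2*i))) S" "red_seq H x (Suc (2*i)) |\<in>| S"
proof -
  let ?f = "red_seq H x (Suc (2*i))" and ?g = "red_seq H x (Suc (Suc (2*i)))" and ?k = "Suc (2*i)"
  have g: "?g \<in> bedge (level (Suc ?k))" "?g \<notin> bblue (level (Suc ?k))"
    using R.red_seq_even(1,2)[OF x, of "Suc i"] H_blue[of ?g "Suc ?k"] by (auto simp: H_edge)
  have f: "?f \<in> bedge (level ?k)" "?f \<notin> bblue (level ?k)"
    using R.red_seq_odd(1,2)[OF x, of i] H_blue[of ?f ?k] by (auto simp: H_edge)
  obtain z T where z: "?g = Alpha z T" "family (level ?k) T" "z |\<in>| T"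
    using g(1) unfolding level_Suc[of ?k] resolve_edge_iff(1) by blast
  have zr: "z \<notin> bblue (level ?k)" using g(2) z unfolding level_Suc[of ?k] z(1) resolve_edge_iff(2) by simp
  have "drng H ?g = dsrc H ?f"
    using R.red_seq_even(3)[OF x, of "Suc i"] R.path_edge(3)[OF x, of ?k] R.red_seq_odd(3)[OF x, of i] by simp
  then have "bsrc (level ?k) z = bsrc (level ?k) ?f"
    using H_rng[OF g(1)] H_src[OF f(1)] z(1) by (simp add: level_Suc[of ?k])
  then have "z = ?f" using unique_red[OF family_at(1)[OF z(2,3)] zr f] by simp
  moreover have "T = S"
    using R.path_shift_characterization(2)[OF x, of "Suc i"] H_src[OF g(1)] z(1) S(2) by (simp add: level_Suc[of ?k])
  ultimately show "?g = Alpha ?f S" "?f |\<in>| S" using z by simp_all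
qed

text \<open>On an odd layer the family that extends the path \<open>x\<close> contains one edge from the block of each edge \<open>g\<close> of the previous layer with the
  same source. For red \<open>g\<close> there is a preimage of \<open>x\<close> whose red edge is \<open>g\<close>, by \<open>lift_path\<close>, and the member of the family is the
  next red edge of this preimage.\<close>

lemma self_marks:
  assumes "x \<in> paths H"
  shows "marked_system.marks (paths H) (path_shift H) (\<lambda>x. x 0) (\<lambda>x. red_seq H x 0) k x = (x k, red_seq H x k)"
proof -
  interpret M: marked_system G0 "paths H" "path_shift H" "\<lambda>x. x 0" "\<lambda>x. red_seq H x 0" by (rule self_marked)
  show ?thesis using assms
  proof (induction k arbitrary: x)
    case (Suc k)
    note x = Suc.prems and IH = Suc.IH
    show ?case
    proof (cases "even k")
      case True
      then obtain i where "k = 2*i" by blast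
      then show ?thesis using self_even_step[OF x, of i] IH[OF x] by (simp add: M.family_of_def)
    next
      case False
      then obtain i where k: "k = Suc (2*i)" by (metis oddE Suc_eq_plus1)
      let ?G = "level k"
      have fam: "M.family_of False (M.marks k) w = S"
        if w: "w \<in> paths H" and S: "w (Suc k) = Alpha (w k) S" "family ?G S" "w k |\<in>| S" "dsrc H (w (Suc k)) = Fam S" for w S
      proof -
        have pre: "z \<in> paths H" "path_shift H z = w" if "z \<in> M.preimages w" for z using that by (auto simp: M.preimages_def)
        have inS: "red_seq H z k |\<in>| S" if "z \<in> M.preimages w" for z
          using self_odd_red(2)[OF pre(1)[OF that], of i S] pre(2)[OF that] S(1,4) k by simp
        have wk: "w k \<in> bedge ?G" "w k \<in> bblue ?G"
          using R.path_edge(1,2)[OF w, of k] H_blue[of "w k" k] by (auto simp: H_edge)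
        note f = family_at[OF S(2,3)]
        have "fset S = insert (w k) ((\<lambda>z. red_seq H z k) ` M.preimages w)"
        proof (intro equalityI subsetI)
          fix y assume "y \<in> fset S"
          then have y: "y |\<in>| S" by simp
          show "y \<in> insert (w k) ((\<lambda>z. red_seq H z k) ` M.preimages w)"
          proof (cases "y \<in> bblue ?G")
            case True
            have "blue_at ?G (brng ?G (w k)) \<in> bsep ?G (brng ?G (w k))"
              using conjunct2[OF level_shape[of i]] f(2) unfolding k odd_shape_def by blast
            moreover have "y \<in> blue_at ?G (brng ?G (w k))" "w k \<in> blue_at ?G (brng ?G (w k))"
              using True wk f(3)[OF y] by (auto simp: blue_at_def)
            ultimately have "y = w k" using f(4) y S(3) by blast
            then show ?thesis by simp
          next
            case False
            obtain g T where g: "y = Alpha g T" "family (level (2*i)) T" "g |\<in>| T"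
              using f(3)[OF y] unfolding k level_Suc resolve_edge_iff(1) by blast
            have gr: "g \<in> bedge (level (2*i))" "g \<notin> bblue (level (2*i))"
              using family_at(1)[OF g(2,3)] False g unfolding k level_Suc g(1) resolve_edge_iff(2) by simp_all
            have "brng ?G (w k) = bsrc (level (2*i)) g" using f(3)[OF y] g(1) unfolding k level_Suc by simp
            then have src: "dsrc H g = dsrc H (w (2*i))"
              using R.path_edge(3)[OF w, of "2*i"] H_rng[OF wk(1)] H_src[OF gr(1)] k by simp
            have "g \<in> dedge H (2*i)" "g \<notin> dblue H" using gr H_blue[OF gr(1)] by (simp_all add: H_edge)
            then obtain z where z: "z \<in> paths H" "path_shift H z = w" "red_seq H z (2*i) = g"
              using R.lift_path[OF w _ _ src] by blast
            then have zp: "z \<in> M.preimages w" by (simp add: M.preimages_def)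
            have "red_seq H z k \<in> block (level (2*i)) g"
              using R.red_seq_odd(4)[OF z(1), of i] z(3) H_R[OF gr(1)] k by simp
            moreover have "y \<in> block (level (2*i)) g" using g by (auto simp: block_iff)
            moreover have "block (level (2*i)) g \<in> bsep ?G (brng ?G (w k))"
              using \<open>brng ?G (w k) = bsrc (level (2*i)) g\<close> gr(1) unfolding k level_Suc by simp
            ultimately have "y = red_seq H z k" using f(4) y inS[OF zp] by blast
            then show ?thesis using zp by simp
          qed
        next
          fix y assume "y \<in> insert (w k) ((\<lambda>z. red_seq H z k) ` M.preimages w)"
          then show "y \<in> fset S" using S(3) inS by auto
        qed
        also have "\<dots> = fset (M.family_of False (M.marks k) w)"
        proof -
          have "(\<lambda>z. red_seq H z k) ` M.preimages w = (\<lambda>z. snd (M.marks k z)) ` M.preimages w"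
            using IH pre(1) by (intro image_cong) auto
          then show ?thesis using M.fset_fam_odd[OF w False] IH[OF w] False by simp
        qed
        finally show ?thesis by (simp add: fset_inject)
      qed
      obtain S where S: "x (Suc k) = Alpha (x k) S" "family ?G S" "x k |\<in>| S" "dsrc H (x (Suc k)) = Fam S"
        using path_step[OF x] .
      note sx = R.path_shift_characterization(1)[OF x]
      obtain T where T: "path_shift H x (Suc k) = Alpha (path_shift H x k) T" "family ?G T" "path_shift H x k |\<in>| T"
        "dsrc H (path_shift H x (Suc k)) = Fam T"
        using path_step[OF sx] .
      show ?thesis
        using fam[OF x S] fam[OF sx T] IH[OF x] S(1) False self_odd_red(1)[OF x, of i T] T k by simp
    qed
  qed simp
qed

text \<open>By naturality a point has the same marks as its image in the shift, and these marks spell out the image.\<close>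

lemma itinerary_unique:
  assumes S: "marked_system G0 Y \<rho> \<beta> \<tau>" and maps: "\<And>y. y \<in> Y \<Longrightarrow> \<phi> y \<in> paths H"
    and eq: "\<And>y. y \<in> Y \<Longrightarrow> \<phi> (\<rho> y) = path_shift H (\<phi> y)"
    and b: "\<And>y. y \<in> Y \<Longrightarrow> \<phi> y 0 = \<beta> y" and t: "\<And>y. y \<in> Y \<Longrightarrow> red_seq H (\<phi> y) 0 = \<tau> y"
    and y: "y \<in> Y"
  shows "\<phi> y = marked_system.itinerary Y \<rho> \<beta> \<tau> y"
proof
  fix k
  have "marked_system.marks Y \<rho> \<beta> \<tau> k y = (\<phi> y k, red_seq H (\<phi> y) k)"
    unfolding self_marks[OF maps[OF y], symmetric]
    by (rule marks_natural[OF S self_marked, where \<phi> = \<phi>, symmetric]) (use maps eq b t y in blast)+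
  then show "\<phi> y k = marked_system.itinerary Y \<rho> \<beta> \<tau> y k"
    using marked_system.itinerary_def[OF S] by simp
qed

end

subsection \<open>Continuity of the itinerary\<close>

definition locally_constant :: "'a topology \<Rightarrow> ('a \<Rightarrow> 'b) \<Rightarrow> bool" where
  "locally_constant X f \<longleftrightarrow> (\<forall>A. openin X {x \<in> topspace X. f x \<in> A})"

lemma locally_constantI:
  assumes "\<And>c. openin X {x \<in> topspace X. f x = c}" shows "locally_constant X f"
  unfolding locally_constant_def
proof
  fix A
  have "{x \<in> topspace X. f x \<in> A} = (\<Union>c\<in>A. {x \<in> topspace X. f x = c})" by blast
  then show "openin X {x \<in> topspace X. f x \<in> A}" using assms by auto
qed

lemma locally_constant_open: "locally_constant X f \<Longrightarrow> openin X {x \<in> topspace X. f x = c}"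
  unfolding locally_constant_def by (elim allE[of _ "{c}"]) simp

lemma locally_constant_clopen: assumes "locally_constant X f" shows "clopenin X {x \<in> topspace X. f x = c}"
proof -
  have "topspace X - {x \<in> topspace X. f x = c} = {x \<in> topspace X. f x \<in> - {c}}" by auto
  then have "openin X (topspace X - {x \<in> topspace X. f x = c})" using assms unfolding locally_constant_def by metis
  then show ?thesis using locally_constant_open[OF assms] unfolding clopenin_def closedin_def by auto
qed

lemma locally_constant_comp: "locally_constant X f \<Longrightarrow> locally_constant X (\<lambda>x. h (f x))"
  unfolding locally_constant_def by (intro allI, drule_tac x = "h -` A" in spec) simp

lemma locally_constant_pair:
  assumes "locally_constant X f" "locally_constant X g" shows "locally_constant X (\<lambda>x. (f x, g x))"
proof (rule locally_constantI)
  fix c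
  have "{x \<in> topspace X. (f x, g x) = c} = {x \<in> topspace X. f x = fst c} \<inter> {x \<in> topspace X. g x = snd c}" by auto
  then show "openin X {x \<in> topspace X. (f x, g x) = c}"
    using openin_Int[OF locally_constant_open[OF assms(1)] locally_constant_open[OF assms(2)], of "fst c" "snd c"]
    by (simp only:)
qed

lemma locally_constant_precomp:
  assumes "continuous_map X Y \<rho>" "locally_constant Y f" shows "locally_constant X (\<lambda>x. f (\<rho> x))"
proof (rule locally_constantI)
  fix c
  have "{x \<in> topspace X. f (\<rho> x) = c} = {x \<in> topspace X. \<rho> x \<in> {y \<in> topspace Y. f y = c}}"
    using assms(1) by (auto simp: continuous_map_def Pi_iff)
  then show "openin X {x \<in> topspace X. f (\<rho> x) = c}"
    using openin_continuous_map_preimage[OF assms(1) locally_constant_open[OF assms(2)]] by simp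
qed

text \<open>The shift maps clopen sets to clopen sets, so the values of a locally constant function on the fibre over a point
  depend only locally on the point.\<close>

lemma (in ample_system) locally_constant_fibre_image:
  assumes f: "locally_constant X f" and fin: "finite (f ` topspace X)"
  shows "locally_constant X (\<lambda>y. f ` {x \<in> topspace X. \<sigma> x = y})"
proof (rule locally_constantI)
  fix S
  let ?A = "\<lambda>c. \<sigma> ` {x \<in> topspace X. f x = c}"
  have A: "clopenin X (?A c)" for c using clopen_image[OF locally_constant_clopen[OF f, of c], of 1] by simp
  let ?T = "\<lambda>c. if c \<in> S then ?A c else topspace X - ?A c"
  have T: "openin X (?T c)" for c using A[of c] by (auto simp: clopenin_def)
  show "openin X {y \<in> topspace X. f ` {x \<in> topspace X. \<sigma> x = y} = S}"
  proof (cases "S \<subseteq> f ` topspace X")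
    case True
    have "openin X (topspace X \<inter> \<Inter> (?T ` f ` topspace X))"
    proof (cases "topspace X = {}")
      case False
      then have ne: "?T ` f ` topspace X \<noteq> {}" by blast
      have "openin X (\<Inter> (?T ` f ` topspace X))"
        by (rule openin_Inter[OF finite_imageI[OF fin] ne]) (use T in blast)
      then show ?thesis by blast
    qed simp
    moreover have "{y \<in> topspace X. f ` {x \<in> topspace X. \<sigma> x = y} = S} = topspace X \<inter> \<Inter> (?T ` f ` topspace X)"
    proof (intro equalityI subsetI)
      fix y assume "y \<in> {y \<in> topspace X. f ` {x \<in> topspace X. \<sigma> x = y} = S}"
      then have y: "y \<in> topspace X" and S: "S = f ` {x \<in> topspace X. \<sigma> x = y}" by auto
      have "y \<in> ?T c" for c
      proof (cases "c \<in> S")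
        case True
        then show ?thesis unfolding S by auto
      next
        case False
        then have "y \<notin> ?A c" unfolding S by auto
        then show ?thesis using False y by simp
      qed
      then show "y \<in> topspace X \<inter> \<Inter> (?T ` f ` topspace X)" using y by blast
    next
      fix y assume y: "y \<in> topspace X \<inter> \<Inter> (?T ` f ` topspace X)"
      have "c \<in> S \<longleftrightarrow> c \<in> f ` {x \<in> topspace X. \<sigma> x = y}" for c
      proof (cases "c \<in> f ` topspace X")
        case c: True
        have yT: "y \<in> ?T c" using y c by blast
        have "y \<in> ?A c \<longleftrightarrow> c \<in> f ` {x \<in> topspace X. \<sigma> x = y}" by auto
        then show ?thesis using yT by (cases "c \<in> S") auto
      next
        case False
        then show ?thesis using True by auto
      qed
      then show "y \<in> {y \<in> topspace X. f ` {x \<in> topspace X. \<sigma> x = y} = S}" using y by blast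
    qed
    ultimately show ?thesis by simp
  next
    case False
    then have "{y \<in> topspace X. f ` {x \<in> topspace X. \<sigma> x = y} = S} = {}" by auto
    then show ?thesis by (simp only: openin_empty)
  qed
qed

text \<open>Each mark is computed from the marks of the previous layer at \<open>y\<close>, at \<open>\<rho> y\<close> and on the fibre over \<open>y\<close> or \<open>\<rho> y\<close>.\<close>

lemma (in marked_system) marks_locally_constant:
  assumes "ample_system X \<rho>" and Y: "topspace X = Y" and b: "locally_constant X \<beta>" and t: "locally_constant X \<tau>"
  shows "locally_constant X (marks k)"
proof -
  interpret ample_system X \<rho> by fact
  show ?thesis
  proof (induction k)
    case 0
    show ?case unfolding marks.simps by (rule locally_constant_pair[OF b t])
  next
    case (Suc k)
    note bl = locally_constant_comp[OF Suc, of fst] and re = locally_constant_comp[OF Suc, of snd]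
    have "locally_constant X (family_of (even k) (marks k))"
    proof (cases "even k")
      case True
      have "family_of (even k) (marks k) = (\<lambda>y. {|fst (marks k y), snd (marks k y)|})"
        using True by (auto simp: family_of_def)
      then show ?thesis using locally_constant_comp[OF Suc, of "\<lambda>p. {|fst p, snd p|}"] by simp
    next
      case False
      have "finite ((\<lambda>y. red k y) ` topspace X)"
        by (rule finite_subset[OF _ well_formedD(6)[OF level_well_formed[of k]]]) (use mark_levels(3) Y in auto)
      from locally_constant_pair[OF bl locally_constant_fibre_image[OF re this]]
      have "locally_constant X (\<lambda>y. Abs_fset (insert (blue k y) ((\<lambda>y. red k y) ` {x \<in> topspace X. \<rho> x = y})))"
        using locally_constant_comp[where h = "\<lambda>(b, R). Abs_fset (insert b R)"] by fastforce
      moreover have "family_of (even k) (marks k) = (\<lambda>y. Abs_fset (insert (blue k y) ((\<lambda>y. red k y) ` {x \<in> topspace X. \<rho> x = y})))"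
        using False by (auto simp: family_of_def preimages_def Y)
      ultimately show ?thesis by simp
    qed
    note fa = this and fr = locally_constant_precomp[OF continuous this]
    have "locally_constant X (\<lambda>y. family_of (even k) (marks k) (if even k then y else \<rho> y))"
      using fa fr by (cases "even k") simp_all
    note r = locally_constant_comp[OF locally_constant_pair[OF re this], of "\<lambda>(r, S). Alpha r S"]
    note b' = locally_constant_comp[OF locally_constant_pair[OF bl fa], of "\<lambda>(b, S). Alpha b S"]
    show ?case unfolding marks.simps using locally_constant_pair[OF b' r] by simp
  qed
qed

text \<open>Locally constant marks make the itinerary continuous because an edge of a path determines all earlier ones.\<close>

lemma (in marked_system) itinerary_fibre_map:
  assumes "ample_system X \<rho>" and Y: "topspace X = Y" and b: "locally_constant X \<beta>" and t: "locally_constant X \<tau>"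
  shows "fibre_map X \<rho> (path_space H) (path_shift H) itinerary"
proof -
  interpret ample_system X \<rho> by fact
  interpret P: ample_system "path_space H" "path_shift H" by (rule R.ample_path_system)
  show ?thesis
  proof
    show "continuous_map X (path_space H) itinerary"
      unfolding continuous_map R.topspace_path_space
    proof (intro conjI allI impI)
      show "itinerary ` topspace X \<subseteq> paths H" using itinerary_path Y by auto
      fix U assume U: "openin (path_space H) U"
      show "openin X {y \<in> topspace X. itinerary y \<in> U}"
      proof (subst openin_subopen, intro ballI)
        fix y assume "y \<in> {y \<in> topspace X. itinerary y \<in> U}"
        then have y: "y \<in> topspace X" "itinerary y \<in> U" by auto
        then obtain n where n: "R.cylinder (itinerary y) n \<subseteq> U" using U unfolding R.openin_path_space_iff by blast
        let ?T = "{z \<in> topspace X. blue n z = blue n y}"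
        have "openin X ?T"
          by (rule locally_constant_open[OF locally_constant_comp[OF marks_locally_constant[OF assms], of fst]])
        moreover have "?T \<subseteq> {y \<in> topspace X. itinerary y \<in> U}"
        proof
          fix z assume z: "z \<in> ?T"
          then have "itinerary z n = itinerary y n" by (simp add: itinerary_def)
          then have "itinerary z \<in> R.cylinder (itinerary y) n"
            using R.path_agree_below[OF itinerary_path itinerary_path, of z y n] z y Y
            by (auto simp: R.cylinder_def itinerary_path)
          then show "z \<in> {y \<in> topspace X. itinerary y \<in> U}" using n z by auto
        qed
        ultimately show "\<exists>T. openin X T \<and> y \<in> T \<and> T \<subseteq> {y \<in> topspace X. itinerary y \<in> U}"
          using y by (intro exI[of _ ?T]) auto
      qed
    qed
    show "itinerary (\<rho> x) = path_shift H (itinerary x)" if "x \<in> topspace X" for x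
      using itinerary_shift[of x] that Y by simp
    show "\<exists>!x'. x' \<in> topspace X \<and> \<rho> x' = x \<and> itinerary x' = y"
      if "x \<in> topspace X" "y \<in> topspace (path_space H)" "path_shift H y = itinerary x" for x y
      using itinerary_lift[of x y] that Y by simp
  qed
qed

section \<open>The inverse system of an l-diagram\<close>

primrec base_edge :: "'e redge \<Rightarrow> 'e" where
  "base_edge (Init e) = e"
| "base_edge (Alpha x S) = base_edge x"

lemma Init_image_iff [simp]: "Init e \<in> Init ` A \<longleftrightarrow> e \<in> A"
  by auto

lemma layer_graph_simps [simp]:
  "bvert0 (layer_graph F n) = Base ` dvert F (2*n)"
  "bvert1 (layer_graph F n) = Base ` dvert F (Suc (2*n))"
  "bedge (layer_graph F n) = Init ` dedge F (2*n)"
  "bsrc (layer_graph F n) (Init e) = Base (dsrc F e)"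
  "brng (layer_graph F n) (Init e) = Base (drng F e)"
  "bblue (layer_graph F n) = Init ` (dedge F (2*n) \<inter> dblue F)"
  by (simp_all add: layer_graph_def)

context l_diag
begin

lemma layer_edges_at:
  assumes "w \<in> dvert F (2*n)"
  shows "{x \<in> bedge (layer_graph F n). brng (layer_graph F n) x = Base w} = Init ` {e \<in> dedges F. drng F e = w}"
    "blue_at (layer_graph F n) (Base w) = Init ` B_at F w" "red_at (layer_graph F n) (Base w) = Init ` R_at F w"
proof -
  have "e \<in> dedge F (2*n)" if "e \<in> dedges F" "drng F e = w" for e using edge_of_rng[of e "2*n"] that assms by simp
  then show "{x \<in> bedge (layer_graph F n). brng (layer_graph F n) x = Base w} = Init ` {e \<in> dedges F. drng F e = w}"
    "blue_at (layer_graph F n) (Base w) = Init ` B_at F w" "red_at (layer_graph F n) (Base w) = Init ` R_at F w"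
    by (auto simp: blue_at_def red_at_def B_at_iff R_at_iff)
qed

lemma layer_sep: "w \<in> dvert F (2*n) \<Longrightarrow> bsep (layer_graph F n) (Base w) = (`) Init ` dsep F w"
  by (simp add: layer_graph_def)

lemma layer_even_shape: "even_shape (layer_graph F n)"
proof -
  let ?G = "layer_graph F n"
  have br: "finite (dvert F (2*n))" "finite (dvert F (Suc (2*n)))" "dvert F (2*n) \<noteq> {}" "finite (dedge F (2*n))"
    "drng F ` dedge F (2*n) = dvert F (2*n)" "dsrc F ` dedge F (2*n) = dvert F (Suc (2*n))"
    "\<And>w. w \<in> dvert F (2*n) \<Longrightarrow> partition_on {e \<in> dedges F. drng F e = w} (dsep F w)"
    using bratteli unfolding separated_bratteli_def by blast+
  have "well_formed ?G"
    unfolding well_formed_def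
  proof (intro conjI ballI)
    show "finite (bvert0 ?G)" "finite (bvert1 ?G)" "finite (bedge ?G)" "bvert0 ?G \<noteq> {}" using br by simp_all
    have "brng ?G ` bedge ?G = Base ` drng F ` dedge F (2*n)" "bsrc ?G ` bedge ?G = Base ` dsrc F ` dedge F (2*n)"
      by (auto simp: image_iff)
    then show "brng ?G ` bedge ?G = bvert0 ?G" "bsrc ?G ` bedge ?G = bvert1 ?G" using br(5,6) by simp_all
    fix u assume "u \<in> bvert0 ?G"
    then obtain w where w: "u = Base w" "w \<in> dvert F (2*n)" by auto
    note p = br(7)[OF w(2)]
    have "{} \<notin> dsep F w" by (rule partition_onD3[OF p])
    then have "(`) Init ` dsep F w - {{}} = (`) Init ` dsep F w" by auto
    then show "partition_on {x \<in> bedge ?G. brng ?G x = u} (bsep ?G u)"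
      using partition_on_inj_image[OF p, of Init] unfolding w(1) layer_edges_at(1)[OF w(2)] layer_sep[OF w(2)]
      by (simp add: inj_on_def)
  qed
  moreover have "unique_blue_source ?G"
    unfolding unique_blue_source_def
  proof
    fix u assume "u \<in> bvert1 ?G"
    then obtain w where w: "u = Base w" "w \<in> dvert F (Suc (2*n))" by auto
    show "\<exists>!x. x \<in> bedge ?G \<and> x \<in> bblue ?G \<and> bsrc ?G x = u"
    proof (rule ex1I[of _ "Init (blue_from w)"])
      show "Init (blue_from w) \<in> bedge ?G \<and> Init (blue_from w) \<in> bblue ?G \<and> bsrc ?G (Init (blue_from w)) = u"
        using blue_from[OF w(2)] w(1) by simp
      fix x assume "x \<in> bedge ?G \<and> x \<in> bblue ?G \<and> bsrc ?G x = u"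
      then obtain e where "x = Init e" "e \<in> dedge F (2*n)" "e \<in> dblue F" "dsrc F e = w" using w(1) by auto
      then show "x = Init (blue_from w)" using blue_from_eq[of e w] by simp
    qed
  qed
  moreover have "bsep ?G u = {blue_at ?G u, red_at ?G u}" if "u \<in> bvert0 ?G" for u
  proof -
    obtain w where w: "u = Base w" "w \<in> dvert F (2*n)" using \<open>u \<in> bvert0 ?G\<close> by auto
    have "dsep F w = {B_at F w, R_at F w}" using cond_a w(2) unfolding l_cond_a_def by blast
    then show ?thesis unfolding w(1) layer_edges_at(2,3)[OF w(2)] layer_sep[OF w(2)] by simp
  qed
  moreover have "\<exists>x\<in>bedge ?G. x \<notin> bblue ?G \<and> bsrc ?G x = u" if "u \<in> bvert1 ?G" for u
  proof -
    obtain w where w: "u = Base w" "w \<in> dvert F (Suc (2*n))" using \<open>u \<in> bvert1 ?G\<close> by auto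
    then obtain f where f: "f \<in> dedges F" "f \<notin> dblue F" "dsrc F f = w" using odd_sources by blast
    then have "f \<in> dedge F (2*n)" using edge_of_src[of f "2*n"] w(2) by simp
    then show ?thesis using f w(1) by (intro bexI[of _ "Init f"]) auto
  qed
  ultimately show ?thesis unfolding even_shape_def by blast
qed

lemma layer_resolvable: "resolvable (layer_graph F n)"
proof
  show "even_shape (layer_graph F n)" by (rule layer_even_shape)
  show "depth x = 0" if "x \<in> bedge (layer_graph F n)" for x using that by auto
  show "bvert0 (layer_graph F n) \<subseteq> range Base" "bvert1 (layer_graph F n) \<subseteq> range Base" by auto
  have "dvert F (2*n) \<inter> dvert F (Suc (2*n)) = {}" using vert_level_unique[of _ "2*n" "Suc (2*n)"] by auto
  then show "bvert0 (layer_graph F n) \<inter> bvert1 (layer_graph F n) = {}" by auto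
qed

lemma layer_res_l_diag: "l_diag (layer_res F n)"
  unfolding layer_res_def using resolvable.resolution_l_diagram[OF layer_resolvable] by unfold_locales

subsection \<open>Markings by the edges of an even layer\<close>

lemma layer_marked:
  assumes "\<And>y. y \<in> Y \<Longrightarrow> \<rho> y \<in> Y"
    and "\<And>y. y \<in> Y \<Longrightarrow> b y \<in> dedge F (2*n)" "\<And>y. y \<in> Y \<Longrightarrow> b y \<in> dblue F"
    and "\<And>y. y \<in> Y \<Longrightarrow> r y \<in> dedge F (2*n)" "\<And>y. y \<in> Y \<Longrightarrow> r y \<notin> dblue F"
    and "\<And>y. y \<in> Y \<Longrightarrow> drng F (b y) = drng F (r y)" "\<And>y. y \<in> Y \<Longrightarrow> dsrc F (r y) = dsrc F (b (\<rho> y))"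
    and branch: "\<And>y g. \<lbrakk>y \<in> Y; g \<in> dedge F (2*n); g \<notin> dblue F; dsrc F g = dsrc F (b y)\<rbrakk> \<Longrightarrow>
      \<exists>!y'. y' \<in> Y \<and> \<rho> y' = y \<and> r y' = g"
  shows "marked_system (layer_graph F n) Y \<rho> (\<lambda>y. Init (b y)) (\<lambda>y. Init (r y))"
proof (intro marked_system.intro marked_system_axioms.intro layer_resolvable)
  fix y g assume y: "y \<in> Y" and g: "g \<in> bedge (layer_graph F n)" "g \<notin> bblue (layer_graph F n)"
    "bsrc (layer_graph F n) g = bsrc (layer_graph F n) (Init (b y))"
  then obtain f where "g = Init f" "f \<in> dedge F (2*n)" "f \<notin> dblue F" "dsrc F f = dsrc F (b y)" by auto
  then show "\<exists>!y'. y' \<in> Y \<and> \<rho> y' = y \<and> Init (r y') = g" using branch[OF y, of f] by simp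
qed (use assms(1-7) in auto)

lemma layer_markedD:
  assumes S: "marked_system (layer_graph F n) Y \<rho> \<beta> \<tau>" and y: "y \<in> Y"
  shows "\<beta> y = Init (base_edge (\<beta> y))" "base_edge (\<beta> y) \<in> dedge F (2*n)" "base_edge (\<beta> y) \<in> dblue F"
    "\<tau> y = Init (base_edge (\<tau> y))" "base_edge (\<tau> y) \<in> dedge F (2*n)" "base_edge (\<tau> y) \<notin> dblue F"
    "drng F (base_edge (\<tau> y)) = drng F (base_edge (\<beta> y))"
    "dsrc F (base_edge (\<tau> y)) = dsrc F (base_edge (\<beta> (\<rho> y)))"
    "\<And>g. \<lbrakk>g \<in> dedge F (2*n); g \<notin> dblue F; dsrc F g = dsrc F (base_edge (\<beta> y))\<rbrakk> \<Longrightarrow>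
      \<exists>!y'. y' \<in> Y \<and> \<rho> y' = y \<and> \<tau> y' = Init g"
proof -
  interpret marked_system "layer_graph F n" Y \<rho> \<beta> \<tau> by fact
  obtain e where e: "\<beta> y = Init e" "e \<in> dedge F (2*n)" "e \<in> dblue F" using blue_mark[OF y] by auto
  obtain e' where e': "\<beta> (\<rho> y) = Init e'" using blue_mark[OF closed[OF y]] by auto
  obtain f where f: "\<tau> y = Init f" "f \<in> dedge F (2*n)" "f \<notin> dblue F" using red_mark[OF y] by auto
  show "\<beta> y = Init (base_edge (\<beta> y))" "base_edge (\<beta> y) \<in> dedge F (2*n)" "base_edge (\<beta> y) \<in> dblue F"
    "\<tau> y = Init (base_edge (\<tau> y))" "base_edge (\<tau> y) \<in> dedge F (2*n)" "base_edge (\<tau> y) \<notin> dblue F"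
    using e f by simp_all
  show "drng F (base_edge (\<tau> y)) = drng F (base_edge (\<beta> y))" using same_range[OF y] e f by simp
  show "dsrc F (base_edge (\<tau> y)) = dsrc F (base_edge (\<beta> (\<rho> y)))" using shift_source[OF y] e' f by simp
  show "\<exists>!y'. y' \<in> Y \<and> \<rho> y' = y \<and> \<tau> y' = Init g"
    if "g \<in> dedge F (2*n)" "g \<notin> dblue F" "dsrc F g = dsrc F (base_edge (\<beta> y))" for g
    using branch[OF y, of "Init g"] that e by auto
qed

text \<open>The fibres of the shift are right by \<open>lift_path\<close> and \<open>shift_inj\<close>.\<close>

lemma path_space_marked:
  "marked_system (layer_graph F n) (paths F) (path_shift F) (\<lambda>x. Init (x (2*n))) (\<lambda>x. Init (red_seq F x (2*n)))"
proof (rule layer_marked)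
  fix x g assume x: "x \<in> paths F" and g: "g \<in> dedge F (2*n)" "g \<notin> dblue F" "dsrc F g = dsrc F (x (2*n))"
  obtain x' where x': "x' \<in> paths F" "path_shift F x' = x" "red_seq F x' (2*n) = g" using lift_path[OF x g] by blast
  show "\<exists>!x'. x' \<in> paths F \<and> path_shift F x' = x \<and> red_seq F x' (2*n) = g"
  proof (rule ex1I[of _ x'])
    show "x' \<in> paths F \<and> path_shift F x' = x \<and> red_seq F x' (2*n) = g" using x' by blast
    fix z assume "z \<in> paths F \<and> path_shift F z = x \<and> red_seq F z (2*n) = g"
    then show "z = x'" using shift_inj[of z x' n] x' by simp
  qed
qed (simp_all add: path_shift_characterization path_edge red_seq_even)

text \<open>The blue counterpart of \<^const>\<open>red_parent\<close>. A marking by the edges of an even layer determines a marking by the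
  edges of the preceding even layer; that its fibres are right is the lifting property of red edges.\<close>

definition blue_parent :: "'e \<Rightarrow> 'e" where
  "blue_parent e = blue_from (drng F (blue_from (drng F e)))"

lemma blue_parent:
  assumes "e \<in> dedge F (Suc (Suc (2*n)))" "e \<in> dblue F"
  shows "blue_parent e \<in> dedge F (2*n)" "blue_parent e \<in> dblue F" "drng F (blue_parent e) = grandparent (drng F e)"
    "dsrc F (blue_parent e) = grandparent (dsrc F e)"
proof -
  note e1 = blue_from[OF edge_rng[OF assms(1)]]
  note e0 = blue_from[OF edge_rng[OF e1(1)]]
  show "blue_parent e \<in> dedge F (2*n)" "blue_parent e \<in> dblue F" "drng F (blue_parent e) = grandparent (drng F e)"
    using e0 by (simp_all add: blue_parent_def grandparent_def)
  have "blue_from (dsrc F e) = e" using blue_from_eq[of e] assms by simp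
  then show "dsrc F (blue_parent e) = grandparent (dsrc F e)" using e0(3) by (simp add: blue_parent_def grandparent_def)
qed

lemma path_blue_parent: assumes "x \<in> paths F" shows "blue_parent (x (Suc (Suc (2*n)))) = x (2*n)"
  using path_edge(3)[OF assms, of "Suc (2*n)"] path_edge(3)[OF assms, of "2*n"] path_from[OF assms]
  by (simp add: blue_parent_def)

lemma coarsen_marked:
  assumes S: "marked_system (layer_graph F (Suc n)) Y \<rho> \<beta> \<tau>"
  shows "marked_system (layer_graph F n) Y \<rho> (\<lambda>y. Init (blue_parent (base_edge (\<beta> y))))
    (\<lambda>y. Init (red_parent (base_edge (\<tau> y))))"
proof (rule layer_marked)
  show cl: "\<rho> y \<in> Y" if "y \<in> Y" for y by (rule marked_system.closed[OF S that])
  fix y assume y: "y \<in> Y"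
  note d = layer_markedD[OF S y] and d' = layer_markedD[OF S cl[OF y]]
  have e: "base_edge (\<beta> y) \<in> dedge F (Suc (Suc (2*n)))" "base_edge (\<tau> y) \<in> dedge F (Suc (Suc (2*n)))"
    "base_edge (\<beta> (\<rho> y)) \<in> dedge F (Suc (Suc (2*n)))" using d(2,5) d'(2) by simp_all
  note b = blue_parent[OF e(1) d(3)] and r = red_parent[OF e(2) d(6)]
  show "blue_parent (base_edge (\<beta> y)) \<in> dedge F (2*n)" "blue_parent (base_edge (\<beta> y)) \<in> dblue F"
    "red_parent (base_edge (\<tau> y)) \<in> dedge F (2*n)" "red_parent (base_edge (\<tau> y)) \<notin> dblue F"
    "drng F (blue_parent (base_edge (\<beta> y))) = drng F (red_parent (base_edge (\<tau> y)))"
    using b r d(7) by simp_all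
  show "dsrc F (red_parent (base_edge (\<tau> y))) = dsrc F (blue_parent (base_edge (\<beta> (\<rho> y))))"
    using r(3) blue_parent(4)[OF e(3) d'(3)] d(8) by simp
  fix g assume g: "g \<in> dedge F (2*n)" "g \<notin> dblue F" "dsrc F g = dsrc F (blue_parent (base_edge (\<beta> y)))"
  have "dsrc F g = grandparent (dsrc F (base_edge (\<beta> y)))" using g(3) b(4) by simp
  from red_lift[OF edge_src[OF e(1)] g(1,2) this]
  obtain f where f: "f \<in> dedge F (Suc (Suc (2*n)))" "f \<notin> dblue F" "dsrc F f = dsrc F (base_edge (\<beta> y))" "red_parent f = g"
    and fu: "\<And>f'. f' \<in> dedge F (Suc (Suc (2*n))) \<Longrightarrow> f' \<notin> dblue F \<Longrightarrow> dsrc F f' = dsrc F (base_edge (\<beta> y)) \<Longrightarrow>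
      red_parent f' = g \<Longrightarrow> f' = f" by blast
  have "f \<in> dedge F (2 * Suc n)" using f(1) by simp
  from d(9)[OF this f(2,3)] obtain y' where y': "y' \<in> Y" "\<rho> y' = y" "\<tau> y' = Init f"
    and un: "\<And>z. z \<in> Y \<Longrightarrow> \<rho> z = y \<Longrightarrow> \<tau> z = Init f \<Longrightarrow> z = y'" by blast
  show "\<exists>!y'. y' \<in> Y \<and> \<rho> y' = y \<and> red_parent (base_edge (\<tau> y')) = g"
  proof (rule ex1I[of _ y'])
    show "y' \<in> Y \<and> \<rho> y' = y \<and> red_parent (base_edge (\<tau> y')) = g" using y' f(4) by simp
    fix z assume z: "z \<in> Y \<and> \<rho> z = y \<and> red_parent (base_edge (\<tau> z)) = g"
    then have zY: "z \<in> Y" by blast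
    note dz = layer_markedD[OF S zY]
    have "base_edge (\<tau> z) = f" using fu[of "base_edge (\<tau> z)"] dz(5,6,8) z by simp
    then show "z = y'" using un[of z] z dz(4) by metis
  qed
qed

abbreviation blue0 :: "(nat \<Rightarrow> 'e redge) \<Rightarrow> 'e" where
  "blue0 t \<equiv> base_edge (t 0)"

abbreviation red0 :: "nat \<Rightarrow> (nat \<Rightarrow> 'e redge) \<Rightarrow> 'e" where
  "red0 n t \<equiv> base_edge (red_seq (layer_res F n) t 0)"

lemma stage_marked:
  "marked_system (layer_graph F n) (paths (layer_res F n)) (path_shift (layer_res F n)) (\<lambda>t. t 0)
    (\<lambda>t. red_seq (layer_res F n) t 0)"
  unfolding layer_res_def by (rule resolvable.self_marked[OF layer_resolvable])

lemmas stage = layer_markedD[OF stage_marked]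

subsection \<open>The projections of the path space to the stages\<close>

definition projection :: "nat \<Rightarrow> (nat \<Rightarrow> 'e) \<Rightarrow> nat \<Rightarrow> 'e redge" where
  "projection n = marked_system.itinerary (paths F) (path_shift F) (\<lambda>x. Init (x (2*n))) (\<lambda>x. Init (red_seq F x (2*n)))"

lemma projection:
  assumes x: "x \<in> paths F"
  shows "projection n x \<in> paths (layer_res F n)" "projection n x 0 = Init (x (2*n))"
    "red_seq (layer_res F n) (projection n x) 0 = Init (red_seq F x (2*n))"
    "path_shift (layer_res F n) (projection n x) = projection n (path_shift F x)"
  using marked_system.itinerary_path[OF path_space_marked x] marked_system.itinerary_0[OF path_space_marked, of n x]
    marked_system.red_seq_itinerary_0[OF path_space_marked x] marked_system.itinerary_shift[OF path_space_marked x]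
  by (simp_all add: projection_def layer_res_def)

lemma path_space_locally_constant:
  assumes "\<And>x y. x \<in> paths F \<Longrightarrow> y \<in> paths F \<Longrightarrow> \<forall>i\<le>n. y i = x i \<Longrightarrow> f y = f x"
  shows "locally_constant (path_space F) f"
proof (rule locally_constantI)
  fix c show "openin (path_space F) {x \<in> topspace (path_space F). f x = c}"
  proof (rule openin_path_spaceI[of _ n])
    fix x y assume x: "x \<in> {x \<in> topspace (path_space F). f x = c}" and y: "y \<in> paths F" "\<forall>i\<le>n. y i = x i"
    then have "f y = f x" by (intro assms) simp_all
    then show "y \<in> {x \<in> topspace (path_space F). f x = c}" using x y(1) by simp
  qed simp
qed

lemma projection_fibre_map:
  "fibre_map (path_space F) (path_shift F) (gfs_space F n) (gfs_shift F n) (projection n)"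
  unfolding gfs_space_def gfs_shift_def layer_res_def projection_def
proof (rule marked_system.itinerary_fibre_map[OF path_space_marked ample_path_system topspace_path_space])
  show "locally_constant (path_space F) (\<lambda>x. Init (x (2*n)))"
    by (rule path_space_locally_constant[of "2*n"]) simp
  show "locally_constant (path_space F) (\<lambda>x. Init (red_seq F x (2*n)))"
  proof (rule path_space_locally_constant[of "Suc (2*n)"])
    fix x y assume xy: "x \<in> paths F" "y \<in> paths F" and eq: "\<forall>i\<le>Suc (2*n). y i = x i"
    have "y (Suc (2*n)) = x (Suc (2*n))" by (rule eq[rule_format]) simp
    then show "Init (red_seq F y (2*n)) = Init (red_seq F x (2*n))" by (rule arg_cong[OF red_seq_local[OF xy(2,1)]])
  qed
qed

lemma stage_unique:
  assumes "marked_system (layer_graph F n) Y \<rho> \<beta> \<tau>" "\<And>y. y \<in> Y \<Longrightarrow> \<phi> y \<in> paths (layer_res F n)"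
    "\<And>y. y \<in> Y \<Longrightarrow> \<phi> (\<rho> y) = path_shift (layer_res F n) (\<phi> y)"
    "\<And>y. y \<in> Y \<Longrightarrow> \<phi> y 0 = \<beta> y" "\<And>y. y \<in> Y \<Longrightarrow> red_seq (layer_res F n) (\<phi> y) 0 = \<tau> y" "y \<in> Y"
  shows "\<phi> y = marked_system.itinerary Y \<rho> \<beta> \<tau> y"
  using resolvable.itinerary_unique[OF layer_resolvable, of n Y \<rho> \<beta> \<tau> \<phi> y] assms unfolding layer_res_def by blast

subsection \<open>The connecting maps\<close>

lemma layer_res_0:
  "dedge (layer_res F n) 0 = Init ` dedge F (2*n)"
  "e \<in> dedge F (2*n) \<Longrightarrow> drng (layer_res F n) (Init e) = Base (drng F e)"
  "e \<in> dedge F (2*n) \<Longrightarrow> Init e \<in> dblue (layer_res F n) \<longleftrightarrow> e \<in> dblue F"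
proof -
  interpret L: resolvable "layer_graph F n" by (rule layer_resolvable)
  show "dedge (layer_res F n) 0 = Init ` dedge F (2*n)" by (simp add: layer_res_def L.H_edge)
  show "drng (layer_res F n) (Init e) = Base (drng F e)" "Init e \<in> dblue (layer_res F n) \<longleftrightarrow> e \<in> dblue F"
    if "e \<in> dedge F (2*n)" for e
    using L.H_rng[of "Init e" 0] L.H_blue[of "Init e" 0] that by (simp_all add: layer_res_def)
qed

lemma layer_res_Suc:
  assumes "a \<in> dedge (layer_res F n) (Suc k)"
  shows "\<exists>x S. a = Alpha x S" "drng (layer_res F n) a \<notin> Base ` dvert F i \<or> i = Suc (2*n)"
proof -
  interpret L: resolvable "layer_graph F n" by (rule layer_resolvable)
  have a: "a \<in> bedge (L.level (Suc k))" using assms by (simp add: layer_res_def L.H_edge)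
  then show "\<exists>x S. a = Alpha x S" unfolding L.level_Suc resolve_edge_iff(1) by blast
  have r: "drng (layer_res F n) a \<in> bvert0 (L.level (Suc k))"
    using L.H_rng[OF a] L.level_rng[OF a] by (simp add: layer_res_def)
  show "drng (layer_res F n) a \<notin> Base ` dvert F i \<or> i = Suc (2*n)"
  proof (cases k)
    case 0
    then show ?thesis using r vert_level_unique by (auto simp: L.level_Suc)
  next
    case (Suc l)
    then show ?thesis using r by (auto simp: L.level_Suc)
  qed
qed

context
  fixes n :: nat
begin

abbreviation "Gl \<equiv> glued F n"
abbreviation "Tl \<equiv> layer_res F (Suc n)"

lemma glued_init [simp]:
  "dsrc Gl (Init e) = Base (dsrc F e)" "drng Gl (Init e) = Base (drng F e)"
  "e \<in> dedge F (2*n) \<Longrightarrow> dR Gl (Init e) = Init ` dR F e"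
  by (simp_all add: glued_def Let_def)

lemma glued_edge:
  "dedge Gl 0 = Init ` dedge F (2*n)" "dedge Gl (Suc 0) = Init ` dedge F (Suc (2*n))" "dedge Gl (Suc (Suc k)) = dedge Tl k"
  by (simp_all add: glued_def Let_def)

lemma glued_blue_init:
  assumes "e \<in> dedge F (2*n) \<or> e \<in> dedge F (Suc (2*n))" shows "Init e \<in> dblue Gl \<longleftrightarrow> e \<in> dblue F"
proof -
  have "Init e \<notin> dblue Tl"
  proof
    assume b: "Init e \<in> dblue Tl"
    interpret L: resolvable "layer_graph F (Suc n)" by (rule layer_resolvable)
    obtain k where k: "Init e \<in> bedge (L.level k)" using b by (auto simp: layer_res_def resolution_def L.level_def)
    then have "k = 0" using L.edge_depth by fastforce
    then have "e \<in> dedge F (Suc (Suc (2*n)))" using k by simp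
    then show False
      using assms edge_rng vert_level_unique[of "drng F e" "Suc (Suc (2*n))" "2*n"]
        vert_level_unique[of "drng F e" "Suc (Suc (2*n))" "Suc (2*n)"] by auto
  qed
  then show ?thesis using assms by (auto simp: glued_def Let_def)
qed

lemma glued_tail:
  assumes "a \<in> dedge Tl k" shows "dsrc Gl a = dsrc Tl a" "drng Gl a = drng Tl a" "a \<in> dblue Gl \<longleftrightarrow> a \<in> dblue Tl"
proof -
  interpret L: resolvable "layer_graph F (Suc n)" by (rule layer_resolvable)
  have a: "a \<in> bedge (L.level k)" using assms by (simp add: layer_res_def L.H_edge)
  have "dsrc Gl a = dsrc Tl a \<and> drng Gl a = drng Tl a \<and> (a \<in> dblue Gl \<longleftrightarrow> a \<in> dblue Tl)"
  proof (cases a)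
    case (Init e)
    then have "k = 0" using L.edge_depth[OF a] by simp
    then have e: "Init e \<in> bedge (L.level 0)" "e \<in> dedge F (Suc (Suc (2*n)))" using a Init by auto
    have "e \<notin> dedge F (2*n)" "e \<notin> dedge F (Suc (2*n))"
      using e(2) edge_rng vert_level_unique[of "drng F e" "Suc (Suc (2*n))" "2*n"]
        vert_level_unique[of "drng F e" "Suc (Suc (2*n))" "Suc (2*n)"] by auto
    then show ?thesis
      using L.H_src[OF e(1)] L.H_rng[OF e(1)] unfolding Init by (auto simp: glued_def Let_def layer_res_def)
  qed (auto simp: glued_def Let_def)
  then show "dsrc Gl a = dsrc Tl a" "drng Gl a = drng Tl a" "a \<in> dblue Gl \<longleftrightarrow> a \<in> dblue Tl" by auto
qed

lemma glued_edges_at: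
  assumes v: "v \<in> dvert F (2*n) \<or> v \<in> dvert F (Suc (2*n))"
  shows "a \<in> dedges Gl \<and> drng Gl a = Base v \<longleftrightarrow> (\<exists>e. a = Init e \<and> e \<in> dedges F \<and> drng F e = v)"
proof
  assume a: "a \<in> dedges Gl \<and> drng Gl a = Base v"
  then obtain k where k: "a \<in> dedge Gl k" by (auto simp: dedges_def)
  consider "k = 0" | "k = Suc 0" | "k = Suc (Suc 0)" | j where "k = Suc (Suc (Suc j))" by (metis not0_implies_Suc)
  then show "\<exists>e. a = Init e \<and> e \<in> dedges F \<and> drng F e = v"
  proof cases
    case 3
    then obtain e where e: "a = Init e" "e \<in> dedge F (2 * Suc n)" using k layer_res_0(1) by (auto simp: glued_edge)
    then show ?thesis using a by auto
  next
    case (4 j)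
    then have t: "a \<in> dedge Tl (Suc j)" using k by (simp add: glued_edge)
    then have "drng Tl a = Base v" using a glued_tail(2) by simp
    moreover have "2*n \<noteq> Suc (2 * Suc n)" "Suc (2*n) \<noteq> Suc (2 * Suc n)" by simp_all
    ultimately have False using layer_res_Suc(2)[OF t, of "2*n"] layer_res_Suc(2)[OF t, of "Suc (2*n)"] v by auto
    then show ?thesis ..
  qed (use k a in \<open>auto simp: glued_edge\<close>)
next
  assume "\<exists>e. a = Init e \<and> e \<in> dedges F \<and> drng F e = v"
  then obtain e where e: "a = Init e" "e \<in> dedges F" "drng F e = v" by blast
  then have "e \<in> dedge F (2*n) \<or> e \<in> dedge F (Suc (2*n))" using edge_of_rng v by blast
  then have "a \<in> dedge Gl 0 \<or> a \<in> dedge Gl (Suc 0)" using e(1) by (simp add: glued_edge)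
  then show "a \<in> dedges Gl \<and> drng Gl a = Base v" using e unfolding dedges_def by auto
qed

lemma glued_red_at:
  assumes v: "v \<in> dvert F (2*n) \<or> v \<in> dvert F (Suc (2*n))"
  shows "a \<in> R_at Gl (Base v) \<longleftrightarrow> (\<exists>f. a = Init f \<and> f \<in> R_at F v)"
proof -
  have "Init e \<in> dblue Gl \<longleftrightarrow> e \<in> dblue F" if "e \<in> dedges F" "drng F e = v" for e
    using that v glued_blue_init edge_of_rng by blast
  then show ?thesis using glued_edges_at[OF v, of a] unfolding R_at_def by auto
qed

text \<open>The red pair below a vertex \<open>v\<close> is computed within the first two layers, where the glued diagram agrees with \<open>F\<close>.\<close>

lemma glued_red_pair:
  assumes v: "v \<in> dvert F (Suc (Suc (2*n)))"
  shows "red_pair Gl (Init (blue_from (drng F (blue_from v)))) (Init (blue_from v)) =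
    (Init (red_anc (red_from v)), Init (red_from v))"
proof -
  note b1 = blue_from[OF v] note b0 = blue_from[OF edge_rng[OF b1(1)]]
  note r1 = red_from[OF v] note r0 = red_anc[OF r1(1,2)]
  have gp: "drng F (blue_from (drng F (blue_from v))) = grandparent v" by (simp add: grandparent_def)
  have gv: "grandparent v \<in> dvert F (2*n)" using edge_rng[OF b0(1)] gp by simp
  show ?thesis
    unfolding red_pair_def
  proof (rule the_equality, goal_cases)
    case 1
    have "drng F (red_from v) \<in> dvert F (Suc (2*n))" by (rule edge_rng[OF r1(1)])
    then show ?case using gv gp r0 r1 b1(3) by (auto simp: glued_red_at R_at_iff)
  next
    case (2 p)
    obtain a0 a1 where p: "p = (a0, a1)" by (cases p)
    have a: "a0 \<in> R_at Gl (Base (grandparent v))" "a1 \<in> R_at Gl (dsrc Gl a0)" "dsrc Gl a1 = Base v" "a1 \<in> dR Gl a0"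
      using 2 p gp b1(3) by auto
    obtain f0 where f0: "a0 = Init f0" "f0 \<in> R_at F (grandparent v)" using a(1) glued_red_at[of "grandparent v"] gv by blast
    have f0l: "f0 \<in> dedge F (2*n)" using f0(2) edge_of_rng gv by (auto simp: R_at_iff)
    have "dsrc F f0 \<in> dvert F (Suc (2*n))" by (rule edge_src[OF f0l])
    then obtain f1 where f1: "a1 = Init f1" "f1 \<in> R_at F (dsrc F f0)"
      using a(2) f0(1) glued_red_at[of "dsrc F f0"] by auto
    have "f1 \<in> dR F f0" using a(4) f0(1) f1(1) f0l by simp
    then have "red_anc f1 = f0" using red_anc_eq[OF f0l] f0(2) by (simp add: R_at_iff)
    moreover have "red_from v = f1"
      using red_source_unique[OF r1(1,2), of f1] f1(2) a(3) f1(1) r1(3) by (simp add: R_at_iff)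
    ultimately show ?case using p f0(1) f1(1) by simp
  qed
qed

lemma blue0_range: "y \<in> paths Tl \<Longrightarrow> drng F (blue0 y) \<in> dvert F (Suc (Suc (2*n)))"
  using edge_rng[OF stage(2)[of y "Suc n"]] by simp

lemma glued_paths:
  assumes x: "x \<in> paths Gl"
  shows "delete2 x \<in> paths Tl" "x 0 = Init (blue_parent (blue0 (delete2 x)))"
    "x 1 = Init (blue_from (drng F (blue0 (delete2 x))))"
proof -
  have e: "x k \<in> dedge Gl k" "x k \<in> dblue Gl" "drng Gl (x (Suc k)) = dsrc Gl (x k)" for k
    using x unfolding paths_def by blast+
  have tl: "delete2 x k \<in> dedge Tl k" for k using e(1)[of "Suc (Suc k)"] by (simp add: delete2_def glued_edge)
  show p: "delete2 x \<in> paths Tl"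
    unfolding paths_def
  proof (intro CollectI allI conjI tl)
    fix k
    show "delete2 x k \<in> dblue Tl" using glued_tail(3)[OF tl] e(2)[of "Suc (Suc k)"] by (simp add: delete2_def)
    show "drng Tl (delete2 x (Suc k)) = dsrc Tl (delete2 x k)"
      using glued_tail(1)[OF tl, of k] glued_tail(2)[OF tl, of "Suc k"] e(3)[of "Suc (Suc k)"] by (simp add: delete2_def)
  qed
  obtain e0 where e0: "x 0 = Init e0" "e0 \<in> dedge F (2*n)" using e(1)[of 0] by (auto simp: glued_edge)
  obtain e1 where e1: "x 1 = Init e1" "e1 \<in> dedge F (Suc (2*n))" using e(1)[of 1] by (auto simp: glued_edge)
  have b: "e0 \<in> dblue F" "e1 \<in> dblue F"
    using e(2)[of 0] e(2)[of 1] glued_blue_init[of e0] glued_blue_init[of e1] e0 e1 by auto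
  have e2: "x (Suc (Suc 0)) = Init (blue0 (delete2 x))"
    using stage(1)[OF p] by (simp add: delete2_def numeral_2_eq_2)
  have "drng F (blue0 (delete2 x)) = dsrc F e1" using e(3)[of "Suc 0"] e1(1) by (simp add: e2)
  then have 1: "blue_from (drng F (blue0 (delete2 x))) = e1" using blue_from_eq b(2) e1(2) by auto
  then show "x 1 = Init (blue_from (drng F (blue0 (delete2 x))))" using e1(1) by simp
  have "drng F e1 = dsrc F e0" using e(3)[of 0] e0(1) e1(1) by simp
  then have "blue_from (drng F e1) = e0" using blue_from_eq b(1) e0(2) by auto
  then show "x 0 = Init (blue_parent (blue0 (delete2 x)))" using e0(1) 1 by (simp add: blue_parent_def)
qed

lemma glued_extension:
  assumes y: "y \<in> paths Tl" shows "\<exists>x\<in>paths Gl. delete2 x = y"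
proof -
  let ?v = "drng F (blue0 y)"
  interpret T: l_diag Tl by (rule layer_res_l_diag)
  note b1 = blue_from[OF blue0_range[OF y]] note b0 = blue_from[OF edge_rng[OF b1(1)]]
  let ?x = "\<lambda>k. case k of 0 \<Rightarrow> Init (blue_from (drng F (blue_from ?v))) | Suc 0 \<Rightarrow> Init (blue_from ?v) | Suc (Suc k) \<Rightarrow> y k"
  have y0: "y 0 = Init (blue0 y)" by (rule stage(1)[OF y])
  have "?x \<in> paths Gl"
    unfolding paths_def
  proof (intro CollectI allI)
    fix k
    consider "k = 0" | "k = Suc 0" | j where "k = Suc (Suc j)" by (metis not0_implies_Suc)
    then show "?x k \<in> dedge Gl k \<and> ?x k \<in> dblue Gl \<and> drng Gl (?x (Suc k)) = dsrc Gl (?x k)"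
    proof cases
      case 1
      then show ?thesis using b0 glued_blue_init by (simp add: glued_edge)
    next
      case 2
      have "drng Gl (y 0) = Base ?v" by (subst y0) simp
      then show ?thesis using 2 b1 glued_blue_init by (simp add: glued_edge)
    next
      case (3 j)
      note e = T.path_edge[OF y]
      show ?thesis using 3 e(1)[of j] e(2)[of j] e(3)[of j] glued_tail[OF e(1)[of j]] glued_tail[OF e(1)[of "Suc j"]]
        by (simp add: glued_edge)
    qed
  qed
  moreover have "delete2 ?x = y" by (simp add: fun_eq_iff delete2_def)
  ultimately show ?thesis by blast
qed

text \<open>In terms of the system of its tail, the natural structure of the glued diagram is the coarsening of the natural structure of
  that system.\<close>

lemma glued_natural_Z: "delete2 ` natural_Z Gl g = {y \<in> paths Tl. Init (blue_parent (blue0 y)) = g}"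
  using glued_paths(1,2) glued_extension unfolding natural_Z_def by force

lemma glued_natural_W: "delete2 ` natural_W Gl g = {y \<in> paths Tl. Init (red_parent (red0 (Suc n) y)) = g}"
proof -
  have "fst (red_pair Gl (x 0) (x 1)) = Init (red_parent (red0 (Suc n) (delete2 x)))" if x: "x \<in> paths Gl" for x
  proof -
    note p = glued_paths[OF x]
    show ?thesis
      using glued_red_pair[OF blue0_range[OF p(1)]] stage(7)[OF p(1)] unfolding p(2,3)
      by (simp add: blue_parent_def red_parent_def)
  qed
  then show ?thesis using glued_paths(1) glued_extension unfolding natural_W_def by force
qed

end

definition coarse_blue :: "nat \<Rightarrow> (nat \<Rightarrow> 'e redge) \<Rightarrow> 'e redge" where
  "coarse_blue n y = Init (blue_parent (blue0 y))"

definition coarse_red :: "nat \<Rightarrow> (nat \<Rightarrow> 'e redge) \<Rightarrow> 'e redge" where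
  "coarse_red n y = Init (red_parent (red0 (Suc n) y))"

lemma stage_coarse_marked:
  "marked_system (layer_graph F n) (paths (layer_res F (Suc n))) (path_shift (layer_res F (Suc n)))
    (coarse_blue n) (coarse_red n)"
  using coarsen_marked[OF stage_marked] unfolding coarse_blue_def[abs_def] coarse_red_def[abs_def] .

lemma topspace_gfs: "topspace (gfs_space F n) = paths (layer_res F n)"
  unfolding gfs_space_def by (rule l_diag.topspace_path_space[OF layer_res_l_diag])

lemma coarse_fibre_map:
  "fibre_map (gfs_space F (Suc n)) (gfs_shift F (Suc n)) (gfs_space F n) (gfs_shift F n)
    (marked_system.itinerary (paths (layer_res F (Suc n))) (path_shift (layer_res F (Suc n))) (coarse_blue n) (coarse_red n))"
proof -
  interpret T: l_diag "layer_res F (Suc n)" by (rule layer_res_l_diag)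
  have b: "locally_constant (path_space (layer_res F (Suc n))) (coarse_blue n)"
    by (rule T.path_space_locally_constant[of 0]) (simp add: coarse_blue_def)
  have r: "locally_constant (path_space (layer_res F (Suc n))) (coarse_red n)"
  proof (rule T.path_space_locally_constant[of 1])
    fix x y assume xy: "x \<in> paths (layer_res F (Suc n))" "y \<in> paths (layer_res F (Suc n))" and eq: "\<forall>i\<le>1. y i = x i"
    have "y (Suc (2*0)) = x (Suc (2*0))" by (rule eq[rule_format]) simp
    from T.red_seq_local[OF xy(2,1) this] show "coarse_red n y = coarse_red n x" by (simp add: coarse_red_def)
  qed
  show ?thesis
    using marked_system.itinerary_fibre_map[OF stage_coarse_marked T.ample_path_system T.topspace_path_space b r]
    unfolding gfs_space_def gfs_shift_def layer_res_def .
qed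

text \<open>The conditions that define the connecting map say that it is equivariant and respects the coarsened marking, which characterises
  the itinerary map of this marking.\<close>

lemma connecting_eq:
  "connecting F n = restrict (marked_system.itinerary (paths (layer_res F (Suc n))) (path_shift (layer_res F (Suc n)))
    (coarse_blue n) (coarse_red n)) (paths (layer_res F (Suc n)))"
    (is "_ = restrict ?\<psi> ?P")
proof -
  interpret f: fibre_map "gfs_space F (Suc n)" "gfs_shift F (Suc n)" "gfs_space F n" "gfs_shift F n" "restrict ?\<psi> ?P"
    by (rule fibre_map_cong[OF coarse_fibre_map]) (simp add: topspace_gfs)
  interpret T: l_diag "layer_res F (Suc n)" by (rule layer_res_l_diag)
  note i = marked_system.itinerary_path[OF stage_coarse_marked] marked_system.itinerary_0[OF stage_coarse_marked]
    marked_system.red_seq_itinerary_0[OF stage_coarse_marked]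
  show ?thesis
    unfolding connecting_def
  proof (rule the_equality, intro conjI ballI)
    show "restrict ?\<psi> ?P \<in> extensional (topspace (gfs_space F (Suc n)))" by (simp add: topspace_gfs)
    show "continuous_map (gfs_space F (Suc n)) (gfs_space F n) (restrict ?\<psi> ?P)" by (rule f.map_continuous)
    show "restrict ?\<psi> ?P (gfs_shift F (Suc n) x) = gfs_shift F n (restrict ?\<psi> ?P x)"
      if "x \<in> topspace (gfs_space F (Suc n))" for x by (rule f.equivariant[OF that])
    show "restrict ?\<psi> ?P ` delete2 ` natural_Z (glued F n) e \<subseteq> natural_Z (layer_res F n) e" for e
    proof (clarsimp simp: glued_natural_Z)
      fix y assume y: "y \<in> ?P" "e = Init (blue_parent (blue0 y))"
      then show "?\<psi> y \<in> natural_Z (layer_res F n) (Init (blue_parent (blue0 y)))"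
        using i(1)[OF y(1)] i(2)[of n y] by (simp add: natural_Z_def coarse_blue_def layer_res_def)
    qed
    show "restrict ?\<psi> ?P ` delete2 ` natural_W (glued F n) f \<subseteq> natural_W (layer_res F n) f" for f
    proof (clarsimp simp: glued_natural_W)
      fix y assume y: "y \<in> ?P" "f = Init (red_parent (red0 (Suc n) y))"
      then show "?\<psi> y \<in> natural_W (layer_res F n) (Init (red_parent (red0 (Suc n) y)))"
        using i(1,3)[OF y(1)] by (simp add: natural_W_def red_seq_def coarse_red_def layer_res_def)
    qed
  next
    fix \<psi>
    assume "\<psi> \<in> extensional (topspace (gfs_space F (Suc n))) \<and>
     continuous_map (gfs_space F (Suc n)) (gfs_space F n) \<psi> \<and>
     (\<forall>x\<in>topspace (gfs_space F (Suc n)). \<psi> (gfs_shift F (Suc n) x) = gfs_shift F n (\<psi> x)) \<and>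
     (\<forall>e\<in>Init ` (dedge F (2*n) \<inter> dblue F).
        \<psi> ` delete2 ` natural_Z (glued F n) e \<subseteq> natural_Z (layer_res F n) e) \<and>
     (\<forall>f\<in>Init ` (dedge F (2*n) - dblue F).
        \<psi> ` delete2 ` natural_W (glued F n) f \<subseteq> natural_W (layer_res F n) f)"
    then have ext: "\<psi> \<in> extensional ?P" and c: "continuous_map (gfs_space F (Suc n)) (gfs_space F n) \<psi>"
      and eq: "\<And>x. x \<in> ?P \<Longrightarrow> \<psi> (gfs_shift F (Suc n) x) = gfs_shift F n (\<psi> x)"
      and Z: "\<And>e. e \<in> dedge F (2*n) \<Longrightarrow> e \<in> dblue F \<Longrightarrow>
        \<psi> ` {y \<in> ?P. Init (blue_parent (blue0 y)) = Init e} \<subseteq> natural_Z (layer_res F n) (Init e)"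
      and W: "\<And>f. f \<in> dedge F (2*n) \<Longrightarrow> f \<notin> dblue F \<Longrightarrow>
        \<psi> ` {y \<in> ?P. Init (red_parent (red0 (Suc n) y)) = Init f} \<subseteq> natural_W (layer_res F n) (Init f)"
      unfolding topspace_gfs glued_natural_Z glued_natural_W by auto
    have "\<psi> y = ?\<psi> y" if y: "y \<in> ?P" for y
    proof (rule stage_unique[OF stage_coarse_marked _ _ _ _ y])
      fix y assume y: "y \<in> ?P"
      note d = layer_markedD[OF stage_coarse_marked y]
      show "\<psi> y \<in> paths (layer_res F n)" using c y unfolding continuous_map topspace_gfs by blast
      show "\<psi> (path_shift (layer_res F (Suc n)) y) = path_shift (layer_res F n) (\<psi> y)"
        using eq[OF y] by (simp add: gfs_shift_def)
      show "\<psi> y 0 = coarse_blue n y"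
        using Z[of "blue_parent (blue0 y)"] d(2,3) y by (auto simp: coarse_blue_def natural_Z_def)
      show "red_seq (layer_res F n) (\<psi> y) 0 = coarse_red n y"
        using W[of "red_parent (red0 (Suc n) y)"] d(5,6) y by (auto simp: coarse_red_def natural_W_def red_seq_def)
    qed
    then show "\<psi> = restrict ?\<psi> ?P" by (intro extensionalityI[OF ext restrict_extensional]) simp
  qed
qed

lemma connecting_fibre_map:
  "fibre_map (gfs_space F (Suc n)) (gfs_shift F (Suc n)) (gfs_space F n) (gfs_shift F n) (connecting F n)"
  unfolding connecting_eq by (rule fibre_map_cong[OF coarse_fibre_map]) (simp add: topspace_gfs)

lemma connecting:
  assumes y: "y \<in> paths (layer_res F (Suc n))"
  shows "connecting F n y \<in> paths (layer_res F n)"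
    "blue0 (connecting F n y) = blue_parent (blue0 y)" "red0 n (connecting F n y) = red_parent (red0 (Suc n) y)"
    "connecting F n (path_shift (layer_res F (Suc n)) y) = path_shift (layer_res F n) (connecting F n y)"
proof -
  interpret f: fibre_map "gfs_space F (Suc n)" "gfs_shift F (Suc n)" "gfs_space F n" "gfs_shift F n" "connecting F n"
    by (rule connecting_fibre_map)
  show "connecting F n y \<in> paths (layer_res F n)" using f.map_closed y by (simp add: topspace_gfs)
  show "connecting F n (path_shift (layer_res F (Suc n)) y) = path_shift (layer_res F n) (connecting F n y)"
    using f.equivariant y by (simp add: topspace_gfs gfs_shift_def)
  show "blue0 (connecting F n y) = blue_parent (blue0 y)" "red0 n (connecting F n y) = red_parent (red0 (Suc n) y)"
    using marked_system.itinerary_0[OF stage_coarse_marked, of n y] marked_system.red_seq_itinerary_0[OF stage_coarse_marked y]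
      y unfolding connecting_eq by (simp_all add: coarse_blue_def coarse_red_def layer_res_def)
qed

lemma projection_compat:
  assumes x: "x \<in> paths F" shows "connecting F n (projection (Suc n) x) = projection n x"
  unfolding projection_def[of n]
proof (rule stage_unique[OF path_space_marked _ _ _ _ x])
  fix x assume x: "x \<in> paths F"
  note p = projection[OF x, of "Suc n"]
  note c = connecting[OF p(1)]
  show "connecting F n (projection (Suc n) x) \<in> paths (layer_res F n)" by (rule c(1))
  show "connecting F n (projection (Suc n) (path_shift F x)) = path_shift (layer_res F n) (connecting F n (projection (Suc n) x))"
    using c(4) p(4) by simp
  show "connecting F n (projection (Suc n) x) 0 = Init (x (2*n))"
    using stage(1)[OF c(1)] c(2) p(2) path_blue_parent[OF x, of n] by simp
  show "red_seq (layer_res F n) (connecting F n (projection (Suc n) x)) 0 = Init (red_seq F x (2*n))"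
    using stage(4)[OF c(1)] c(3) p(3) red_seq_parent[OF x, of n] by simp
qed

subsection \<open>Threads come from paths\<close>

definition thread :: "(nat \<Rightarrow> nat \<Rightarrow> 'e redge) \<Rightarrow> bool" where
  "thread t \<longleftrightarrow> (\<forall>n. t n \<in> paths (layer_res F n) \<and> connecting F n (t (Suc n)) = t n)"

lemma threadD: assumes "thread t" shows "t n \<in> paths (layer_res F n)" "connecting F n (t (Suc n)) = t n"
    "blue0 (t n) = blue_parent (blue0 (t (Suc n)))" "red0 n (t n) = red_parent (red0 (Suc n) (t (Suc n)))"
  using assms connecting(2,3)[of "t (Suc n)" n] unfolding thread_def by metis+

definition thread_path :: "(nat \<Rightarrow> nat \<Rightarrow> 'e redge) \<Rightarrow> nat \<Rightarrow> 'e" where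
  "thread_path t = path_of_sources (\<lambda>n. dsrc F (blue0 (t n)))"

lemma thread_path:
  assumes t: "thread t"
  shows "thread_path t \<in> paths F" "thread_path t (2*n) = blue0 (t n)" "red_seq F (thread_path t) (2*n) = red0 n (t n)"
proof -
  note d = threadD[OF t]
  let ?b = "\<lambda>n. blue0 (t n)" and ?r = "\<lambda>n. red0 n (t n)"
  note s = stage[OF d(1)]
  have b: "?b (Suc n) \<in> dedge F (Suc (Suc (2*n)))" and r: "?r (Suc n) \<in> dedge F (Suc (Suc (2*n)))" for n
    using s(2)[of "Suc n"] s(5)[of "Suc n"] by simp_all
  have w: "dsrc F (?b n) \<in> dvert F (Suc (2*n))" for n by (rule edge_src[OF s(2)])
  have gp: "grandparent (dsrc F (?b (Suc n))) = dsrc F (?b n)" for n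
    using blue_parent(4)[OF b s(3)] d(3)[of n] by simp
  show p: "thread_path t \<in> paths F" unfolding thread_path_def by (rule path_of_sources(1)[OF w gp])
  show e: "thread_path t (2*n) = ?b n" for n
    unfolding thread_path_def path_of_sources_eqs(1) by (rule blue_from_eq) (use s(2,3) edge_in in blast)+
  show "red_seq F (thread_path t) (2*n) = ?r n"
  proof (rule red_seq_characterization(1)[OF p s(5,6)])
    note f = red_from[OF edge_rng[OF r[of n]]]
    have "red_anc (red_from (drng F (?r (Suc n)))) = ?r n" using d(4)[of n] by (simp add: red_parent_def)
    then show "red_from (drng F (?r (Suc n))) \<in> dR F (?r n)" using red_anc(3)[OF f(1,2)] by simp
    have "drng F (?b (Suc n)) = dsrc F (thread_path t (Suc (2*n)))"
      using path_edge(3)[OF p, of "Suc (2*n)"] e[of "Suc n"] by simp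
    then show "dsrc F (red_from (drng F (?r (Suc n)))) = dsrc F (thread_path t (Suc (2*n)))"
      using f(3) s(7)[of "Suc n"] by simp
  qed
qed

abbreviation thread_shift :: "(nat \<Rightarrow> nat \<Rightarrow> 'e redge) \<Rightarrow> nat \<Rightarrow> nat \<Rightarrow> 'e redge" where
  "thread_shift t \<equiv> \<lambda>n. path_shift (layer_res F n) (t n)"

lemma stage_closed: "y \<in> paths (layer_res F n) \<Longrightarrow> path_shift (layer_res F n) y \<in> paths (layer_res F n)"
  by (rule marked_system.closed[OF stage_marked])

lemma thread_shift: "thread t \<Longrightarrow> thread (thread_shift t)"
  using connecting(4) stage_closed unfolding thread_def by metis

lemma thread_path_shift:
  assumes t: "thread t" shows "thread_path (thread_shift t) = path_shift F (thread_path t)"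
proof (rule path_shift_eqI[symmetric])
  note p = thread_path[OF t] note q = thread_path[OF thread_shift[OF t]]
  show "thread_path t \<in> paths F" "thread_path (thread_shift t) \<in> paths F" by (rule p q)+
  show "dsrc F (thread_path (thread_shift t) (2*i)) = dsrc F (red_seq F (thread_path t) (2*i))" for i
    unfolding p(3) q(2) using stage(8)[OF threadD(1)[OF t]] by simp
qed

lemma stage_lift_unique:
  assumes "y \<in> paths (layer_res F n)" "z \<in> paths (layer_res F n)"
    "path_shift (layer_res F n) y = path_shift (layer_res F n) z" "red0 n y = red0 n z"
  shows "y = z"
proof (rule l_diag.shift_inj[OF layer_res_l_diag assms(1-3), of 0])
  show "red_seq (layer_res F n) y (2*0) = red_seq (layer_res F n) z (2*0)"
    using stage(4)[OF assms(1)] stage(4)[OF assms(2)] assms(4) by simp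
qed

text \<open>The threads with the componentwise shift form a system marked by each layer. To lift a thread \<open>t\<close> along a red edge, lift the
  path of \<open>t\<close> in the diagram; its red edges on all even layers prescribe the lifts at all stages, and uniqueness of lifts makes them
  compatible.\<close>

lemma threads_marked:
  "marked_system (layer_graph F n) {t. thread t} thread_shift (\<lambda>t. Init (blue0 (t n))) (\<lambda>t. Init (red0 n (t n)))"
proof (rule layer_marked; (elim CollectE)?)
  fix t assume t: "thread t"
  note s = stage[OF threadD(1)[OF t, of n]]
  show "thread_shift t \<in> {t. thread t}" using thread_shift[OF t] by simp
  show "blue0 (t n) \<in> dedge F (2*n)" "blue0 (t n) \<in> dblue F" "red0 n (t n) \<in> dedge F (2*n)" "red0 n (t n) \<notin> dblue F"
    "drng F (blue0 (t n)) = drng F (red0 n (t n))" "dsrc F (red0 n (t n)) = dsrc F (blue0 (thread_shift t n))"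
    using s(2,3,5,6,7,8) by simp_all
  fix g assume g: "g \<in> dedge F (2*n)" "g \<notin> dblue F" "dsrc F g = dsrc F (blue0 (t n))"
  note p = thread_path[OF t]
  have "dsrc F g = dsrc F (thread_path t (2*n))" using g(3) p(2) by simp
  then obtain x where x: "x \<in> paths F" "path_shift F x = thread_path t" "red_seq F x (2*n) = g"
    using lift_path[OF p(1) g(1,2)] by blast
  have "\<exists>z. z \<in> paths (layer_res F m) \<and> path_shift (layer_res F m) z = t m \<and> red0 m z = red_seq F x (2*m)" for m
  proof -
    have "dsrc F (red_seq F x (2*m)) = dsrc F (blue0 (t m))"
      using path_shift_characterization(2)[OF x(1), of m] x(2) p(2) by simp
    from stage(9)[OF threadD(1)[OF t] red_seq_even(1,2)[OF x(1)] this]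
    obtain z where "z \<in> paths (layer_res F m)" "path_shift (layer_res F m) z = t m"
      "red_seq (layer_res F m) z 0 = Init (red_seq F x (2*m))" by blast
    then show ?thesis by (intro exI[of _ z]) simp
  qed
  then obtain t' where t': "\<And>m. t' m \<in> paths (layer_res F m)" "\<And>m. path_shift (layer_res F m) (t' m) = t m"
    "\<And>m. red0 m (t' m) = red_seq F x (2*m)" by metis
  have "connecting F m (t' (Suc m)) = t' m" for m
  proof (rule stage_lift_unique[OF _ t'(1)])
    note c = connecting[OF t'(1)[of "Suc m"]]
    show "connecting F m (t' (Suc m)) \<in> paths (layer_res F m)" by (rule c(1))
    show "path_shift (layer_res F m) (connecting F m (t' (Suc m))) = path_shift (layer_res F m) (t' m)"
      using c(4) t'(2) threadD(2)[OF t] by simp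
    show "red0 m (connecting F m (t' (Suc m))) = red0 m (t' m)"
      using c(3) t'(3)[of m] t'(3)[of "Suc m"] red_seq_parent[OF x(1), of m] by simp
  qed
  then have th: "thread t'" using t'(1) by (simp add: thread_def)
  show "\<exists>!t'. t' \<in> {t. thread t} \<and> thread_shift t' = t \<and> red0 n (t' n) = g"
  proof (rule ex1I[of _ t'])
    show "t' \<in> {t. thread t} \<and> thread_shift t' = t \<and> red0 n (t' n) = g" using th t'(2,3) x(3) by auto
    fix u assume "u \<in> {t. thread t} \<and> thread_shift u = t \<and> red0 n (u n) = g"
    then have u: "thread u" "thread_shift u = t" "red0 n (u n) = g" by auto
    have st: "thread_shift t' = t" using t'(2) by blast
    have "thread_path u = thread_path t'"
      by (rule shift_inj[of _ _ n])
         (use thread_path[OF u(1)] thread_path[OF th] thread_path_shift[OF u(1)] thread_path_shift[OF th] u(2,3) st t'(3) x(3) in simp_all)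
    then have "red0 m (u m) = red0 m (t' m)" for m using thread_path(3)[OF u(1), of m] thread_path(3)[OF th, of m] by simp
    then have "u m = t' m" for m
      using stage_lift_unique[OF threadD(1)[OF u(1)] t'(1), of m] t'(2)[of m] fun_cong[OF u(2), of m] by simp
    then show "u = t'" by blast
  qed
qed

text \<open>Both \<open>t \<mapsto> t n\<close> and \<open>t \<mapsto> projection n (thread_path t)\<close> are equivariant and respect the marks, so they are the same itinerary map.\<close>

lemma projection_thread_path:
  assumes t: "thread t" shows "projection n (thread_path t) = t n"
proof -
  let ?it = "marked_system.itinerary {t. thread t} thread_shift (\<lambda>t. Init (blue0 (t n))) (\<lambda>t. Init (red0 n (t n)))"
  have "t n = ?it t"
  proof (rule stage_unique[OF threads_marked, where \<phi> = "\<lambda>t. t n"]; (elim CollectE)?)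
    fix t assume t: "thread t"
    note s = stage[OF threadD(1)[OF t, of n]]
    show "t n \<in> paths (layer_res F n)" by (rule threadD(1)[OF t])
    show "t n 0 = Init (blue0 (t n))" "red_seq (layer_res F n) (t n) 0 = Init (red0 n (t n))" by (rule s(1,4))+
  qed (use t in simp_all)
  moreover have "projection n (thread_path t) = ?it t"
  proof (rule stage_unique[OF threads_marked, where \<phi> = "\<lambda>t. projection n (thread_path t)"]; (elim CollectE)?)
    fix t assume t: "thread t"
    note p = thread_path[OF t]
    note q = projection[OF p(1), of n]
    show "projection n (thread_path t) \<in> paths (layer_res F n)" by (rule q(1))
    show "projection n (thread_path (thread_shift t)) = path_shift (layer_res F n) (projection n (thread_path t))"
      using q(4) thread_path_shift[OF t] by simp
    show "projection n (thread_path t) 0 = Init (blue0 (t n))" using q(2) p(2) by simp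
    show "red_seq (layer_res F n) (projection n (thread_path t)) 0 = Init (red0 n (t n))" using q(3) p(3) by simp
  qed (use t in simp)
  ultimately show ?thesis by simp
qed

theorem path_space_limit:
  "fibred_limit (gfs_space F) (gfs_shift F) (connecting F) (path_space F) (path_shift F) projection"
proof (rule fibred_limit.intro)
  show "fibre_map (gfs_space F (Suc n)) (gfs_shift F (Suc n)) (gfs_space F n) (gfs_shift F n) (connecting F n)" for n
    by (rule connecting_fibre_map)
  show "fibre_map (path_space F) (path_shift F) (gfs_space F n) (gfs_shift F n) (projection n)" for n
    by (rule projection_fibre_map)
  show "connecting F n (projection (Suc n) x) = projection n x" if "x \<in> topspace (path_space F)" for n x
    using projection_compat that by simp
  show "\<exists>x\<in>topspace (path_space F). \<forall>n. projection n x = t n"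
    if "\<And>n. t n \<in> topspace (gfs_space F n)" "\<And>n. connecting F n (t (Suc n)) = t n" for t
  proof -
    have "thread t" using that by (simp add: thread_def topspace_gfs)
    then show ?thesis using thread_path(1) projection_thread_path by auto
  qed
  fix U x assume U: "openin (path_space F) U" and x: "x \<in> U"
  then obtain n where n: "cylinder x n \<subseteq> U" unfolding openin_path_space_iff by blast
  have xp: "x \<in> paths F" using openin_subset[OF U] x by auto
  let ?V = "{z \<in> paths (layer_res F n). z 0 = Init (x (2*n))}"
  interpret H: l_diag "layer_res F n" by (rule layer_res_l_diag)
  have "clopenin (gfs_space F n) ?V"
    unfolding gfs_space_def by (rule H.clopen_path_spaceI[of 0]) auto
  moreover have "projection n x \<in> ?V" using projection(1,2)[OF xp] by simp
  moreover have "y \<in> U" if y: "y \<in> paths F" "projection n y \<in> ?V" for y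
  proof -
    have "y (2*n) = x (2*n)" using y(2) projection(2)[OF y(1), of n] by simp
    then have "y i = x i" if "i \<le> n" for i using path_agree_below[OF y(1) xp, of "2*n" i] that by simp
    then show ?thesis using n y(1) by (auto simp: cylinder_def)
  qed
  ultimately show "\<exists>n V. clopenin (gfs_space F n) V \<and> projection n x \<in> V \<and> {x \<in> topspace (path_space F). projection n x \<in> V} \<subseteq> U"
    by (intro exI[of _ n] exI[of _ ?V]) auto
qed

end

section \<open>Conclusion\<close>

theorem theorem1p4:
  fixes X :: "'a topology" and \<sigma> :: "'a \<Rightarrow> 'a" and F :: "('v, 'e) diagram"
  assumes "lhomeo X \<sigma>" and "l_diagram_for F X \<sigma>"
  shows "conjugate X \<sigma> (limit_space F) (limit_shift F) \<and>
    (\<forall>j :: 'k::field \<Rightarrow> 'k. field_involution j \<longrightarrow>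
       star_isomorphic (steinberg j (dr_groupoid X \<sigma>))
         (star_colimit (\<lambda>n. steinberg j (gfs_groupoid F n)) (connecting_star F))) \<and>
    cstar_isomorphic (groupoid_cstar (dr_groupoid X \<sigma>))
      (cstar_colimit (\<lambda>n. groupoid_cstar (gfs_groupoid F n)) (connecting_cstar F))"
proof -
  interpret l_diag F using assms(2) by unfold_locales (simp add: l_diagram_for_def)
  obtain h where h: "homeomorphic_map (path_space F) X h"
    and eq: "\<And>x. x \<in> topspace (path_space F) \<Longrightarrow> h (path_shift F x) = \<sigma> (h x)"
    using assms(2) unfolding l_diagram_for_def conjugate_def by auto
  obtain g where g: "homeomorphic_maps (path_space F) X h g" using h unfolding homeomorphic_map_maps by blast
  interpret L: fibred_limit "gfs_space F" "gfs_shift F" "connecting F" X \<sigma> "\<lambda>n z. projection n (g z)"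
    by (rule fibred_limit.homeomorphic_transport[OF path_space_limit g]) (rule eq)
  have gr: "gfs_groupoid F n = dr_groupoid (gfs_space F n) (gfs_shift F n)" for n by (simp add: gfs_groupoid_def)
  have star: "connecting_star F = (L.step_pullback :: nat \<Rightarrow> _ \<Rightarrow> _ \<Rightarrow> 'k::field)"
    by (simp add: fun_eq_iff connecting_star_def L.step_pullback_def gr topspace_dr)
  have star': "connecting_star F = (L.step_pullback :: nat \<Rightarrow> _ \<Rightarrow> _ \<Rightarrow> complex)"
    by (simp add: fun_eq_iff connecting_star_def L.step_pullback_def gr topspace_dr)
  have "connecting_cstar F = (\<lambda>n. env_map (steinberg cnj (dr_groupoid (gfs_space F (Suc n)) (gfs_shift F (Suc n)))) (L.step_pullback n))"
    by (rule ext, rule ext) (simp add: connecting_cstar_def star' gr)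
  moreover have "conjugate X \<sigma> (limit_space F) (limit_shift F)"
    using L.conjugate_inverse_limit unfolding limit_space_def limit_shift_def[abs_def] .
  ultimately show ?thesis
    using L.steinberg_colimit L.groupoid_cstar_colimit by (auto simp: gr star)
qed

end
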